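(* Let $S$ be a non-densely defined closed symmetric operator in $\mathcal H$ such that $\dim(\operatorname{dom}S)^\perp=\infty$, $n'_\pm\neq0$, and $S$ is regular. Then each unitary operator $U\in\mathbf B(\mathfrak N_i,\mathfrak N_{-i})$ such that $(U-V_i)f\neq0$ for all $f\in\mathfrak L_i\setminus\{0\}$ has the block form $$U=\begin{bmatrix}YV_i&D_{Y^*}M\\ GD_YV_i&-GY^*M+D_{G^*}XD_M\end{bmatrix}:\ \mathfrak L_i\oplus\mathfrak N'_i\to\mathfrak L_{-i}\oplus\mathfrak N'_{-i},$$ where - $Y$ is a contraction in $\mathfrak L_{-i}$ with $\ker(I-Y)=\{0\}$, $\dim\mathfrak D_Y\le n'_-$, $\dim\mathfrak D_{Y^*}\le n'_+$; - $M^*\in\mathbf B(\mathfrak D_{Y^*},\mathfrak N'_i)$ and $G\in\mathbf B(\mathfrak D_Y,\mathfrak N'_{-i})$ are isometries and $\dim\mathfrak D_M=\dim\mathfrak D_{G^*}$; - $X\in\mathbf B(\mathfrak D_M,\mathfrak D_{G^*})$ is unitary when $\dim\mathfrak D_M=\dim\mathfrak D_{G^*}\neq0$. Put $\Omega_Y=\operatorname{ran}(I-Y)\cap\operatorname{ran}D_{Y^*}$ and $\Omega_{Y^*}=\operatorname{ran}(I-Y^* )\cap\operatorname{ran}D_Y$. For the selfadjoint extension $\widetilde S$ of $S$ given by $$\operatorname{dom}\widetilde S=\operatorname{dom}S\dot+(I-U)\mathfrak N_i,\quad \widetilde S(f_S+(I-U)\varphi_i)=Sf_S+i(I+U)\varphi_i\quad(f_S\in\operatorname{dom}S,\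 \varphi_i\in\mathfrak N_i)$$ and its compression $\widetilde S_0=P_{\mathcal H_0}\widetilde S\upharpoonright(\operatorname{dom}\widetilde S\cap\mathcal H_0)$ the following hold. (1) The subspaces $\widetilde{\mathfrak N}_i:=\{\varphi\in\mathfrak N_i:(U-I)\varphi\in\mathcal H_0\}$ and $\widetilde{\mathfrak N}_{-i}:=U\widetilde{\mathfrak N}_i=\{\phi\in\mathfrak N_{-i}:(U^{-1}-I)\phi\in\mathcal H_0\}$ have the form $$\widetilde{\mathfrak N}_i=\ker(P_{\mathfrak L_{-i}}U-V_iP_{\mathfrak L_i})=\left\{\begin{bmatrix}V_{-i}(I-Y)^{-1}h\\ \psi'_i+M^*D_{Y^*}^{[-1]}h\end{bmatrix}:h\in\Omega_Y,\ \psi'_i\in\ker M\right\},$$ $$\widetilde{\mathfrak N}_{-i}=\ker(P_{\mathfrak L_i}U^{-1}-V_{-i}P_{\mathfrak L_{-i}})=\left\{\begin{bmatrix}(I-Y^* )^{-1}g\\ \psi'_{-i}+GD_Y^{[-1]}g\end{bmatrix}:g\in\Omega_{Y^*},\ \psi'_{-i}\in\ker G^*\right\}.$$ (2) $\operatorname{dom}\widetilde S_0=\operatorname{dom}S_0\dot+(I-U_0)\operatorname{dom}U_0=\operatorname{dom}S\dot+(I-U_0^{-1})\operatorname{dom}U_0^{-1}$, where $\operatorname{dom}U_0\subseteq\mathfrak N'_i$, $\operatorname{dom}U_0^{-1}\subseteq\mathfrak N'_{-i}$ and the isometry $U_0:P_{\mathfrak N'_i}\varphi\mapsto P_{\mathfrak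 N'_{-i}}U\varphi$, $\varphi\in\ker(P_{\mathfrak L_{-i}}U-V_iP_{\mathfrak L_i})$, and its inverse are $$\operatorname{dom}U_0=\{\varphi'_i\in\mathfrak N'_i:D_{Y^*}M\varphi'_i\in\Omega_Y\},\quad U_0\varphi'_i=\big(G[-Y^*+D_Y(I-Y)^{-1}D_{Y^*}]M+D_{G^*}XD_M\big)\varphi'_i,$$ $$\operatorname{dom}U_0^{-1}=\operatorname{ran}U_0=\{\varphi'_{-i}\in\mathfrak N'_{-i}:D_YG^*\varphi'_{-i}\in\Omega_{Y^*}\},$$ $$U_0^{-1}\varphi'_{-i}=\big(M^*[-Y+D_{Y^*}(I-Y^* )^{-1}D_Y]G^*+D_MX^*D_{G^*}\big)\varphi'_{-i}.$$ (3) The deficiency subspaces of $\widetilde S_0$ are $$\mathfrak N_i(\widetilde S_0)=\mathfrak N'_i\ominus M^{-1}\{D_{Y^*}^{[-1]}\Omega_Y\},\qquad \mathfrak N_{-i}(\widetilde S_0)=\mathfrak N'_{-i}\ominus G^{*-1}\{D_Y^{[-1]}\Omega_{Y^*}\}.$$ Moreover: (I) The following are equivalent: (a) $\widetilde S_0=S_0$; (b) $\ker M=\{0\}$ and $\Omega_Y=\{0\}$; (c) $\ker G^*=\{0\}$ and $\Omega_{Y^*}=\{0\}$. (II) The following are equivalent: (a) $\widetilde S_0$ is maximal symmetric with $n_+(\widetilde S_0)=0$ and $n_-(\widetilde S_0)>0$; (b) $\operatorname{ran}(I-Y)=\operatorname{ran}(I-Y_R)^{1/2}$ and $\operatorname{ran}(I-Y^*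 )\neq\operatorname{ran}(I-Y_R)^{1/2}$. In particular, (a) holds if $Y$ is a non-unitary co-isometry ($D_{Y^*}=0$). (III) The following are equivalent: (a) $\widetilde S_0$ is maximal symmetric with $n_+(\widetilde S_0)>0$ and $n_-(\widetilde S_0)=0$; (b) $\operatorname{ran}(I-Y^* )=\operatorname{ran}(I-Y_R)^{1/2}$ and $\operatorname{ran}(I-Y)\neq\operatorname{ran}(I-Y_R)^{1/2}$. In particular, (a) holds if $Y$ is a non-unitary isometry ($D_Y=0$). (IV) If $n'_+=n'_-$, the following are equivalent: (a) $\widetilde S_0$ is selfadjoint in $\mathcal H_0$; (b) $\operatorname{ran}D_{Y^*}\subseteq\operatorname{ran}(I-Y)$ and $\operatorname{ran}D_Y\subseteq\operatorname{ran}(I-Y^* )$; (c) $\operatorname{ran}(I-Y^* )=\operatorname{ran}(I-Y)=\operatorname{ran}(I-Y_R)^{1/2}$. In particular, the extension $\widetilde S$ is regular if and only if $\operatorname{ran}(I-Y)=\mathfrak L_{-i}$, and in this case $\widetilde S_0$ is selfadjoint; and if $Y$ is unitary, then $\widetilde S_0$ is selfadjoint.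
   Context: $\mathcal H$ is an infinite-dimensional complex separable Hilbert space; "subspace" means closed linear manifold; $P_{\mathfrak K}$ is the orthogonal projection onto $\mathfrak K$; $\dot+$ is the direct sum of linear manifolds; $\mathbf B(H_1,H_2)$ is the space of bounded operators. For a contraction $Z$, $D_Z=(I-Z^*Z)^{1/2}$, $\mathfrak D_Z=\overline{\operatorname{ran}}\,D_Z$. $Y_R=\frac12(Y+Y^* )$. $D_Z^{[-1]}$ is the Moore–Penrose pseudoinverse, i.e. the inverse of $D_Z\upharpoonright\mathfrak D_Z$ defined on $\operatorname{ran}D_Z$. $B^{-1}\{\mathcal L\}=\{h\in\operatorname{dom}B:Bh\in\mathcal L\}$ is the preimage (so $G^{*-1}\{\mathcal L\}$ is the preimage under $G^*$). If $\mathfrak D_Y=\{0\}$ (resp. $\mathfrak D_{Y^*}=\{0\}$), then $G$ (resp. $M$) is the zero operator and $D_{G^*}=I_{\mathfrak N'_{-i}}$ (resp. $D_M=I_{\mathfrak N'_i}$). $S$ is symmetric if $\operatorname{Im}(Sf,f)=0$ on $\operatorname{dom}S$. For a closed non-densely defined symmetric $S$: $\mathcal H_0=\overline{\operatorname{dom}}\,S$, $\mathfrak L=\mathcal H\ominus\mathcal H_0$, $S_0=P_{\mathcal H_0}S$ (an operator in $\mathcal H_0$ with domain $\operatorname{dom}S$); for $\lambda\in\mathbb C\setminus\mathbb R$, $\mathfrak N_\lambda=\mathcal H\ominus\operatorname{ran}(S-\bar\lambda I)$, $\mathfrak L_\lambda=P_{\mathfrak N_\lambda}\mathfrak L$, $\mathfrak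 N'_\lambda=\mathfrak N_\lambda\ominus\mathfrak L_\lambda\subset\mathcal H_0$, $n'_\pm=\dim\mathfrak N'_\lambda$ for $\lambda\in\mathbb C_\pm$; $V_\lambda:\mathfrak L_\lambda\to\mathfrak L_{\bar\lambda}$ is the isometry $V_\lambda P_{\mathfrak N_\lambda}h=P_{\mathfrak N_{\bar\lambda}}h$, $h\in\mathfrak L$ ($V_{-i}=V_i^{-1}$). $S$ is regular if $S_0$ is closed (then all $\mathfrak L_\lambda$ are closed). An extension $\widetilde S$ of $S$ is regular if $P_{\mathcal H_0}\widetilde S$ is closed. For the symmetric operator $\widetilde S_0$ in $\mathcal H_0$: $\mathfrak N_{\pm i}(\widetilde S_0)=\mathcal H_0\ominus\operatorname{ran}(\widetilde S_0\pm iI)$ and $n_\pm(\widetilde S_0)=\dim\mathfrak N_{\pm i}(\widetilde S_0)$; maximal symmetric means having no proper symmetric extension in $\mathcal H_0$. *)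

theory Defs
  imports "HOL-Analysis.Analysis"
begin

section \<open>Complex Hilbert spaces\<close>

text \<open>The inner product \<^term>\<open>cinner\<close> is linear in its first argument. The class extends
  \<^class>\<open>real_inner\<close> so that norm, topology and the real inner product theory of the
  underlying real space are available; completeness comes from \<^class>\<open>complete_space\<close>.\<close>

class complex_hilbert_space = real_inner + complete_space +
  fixes scaleC :: "complex \<Rightarrow> 'a \<Rightarrow> 'a"  (infixr \<open>*\<^sub>C\<close> 75)
    and cinner :: "'a \<Rightarrow> 'a \<Rightarrow> complex"
  assumes scaleC_add_right: "a *\<^sub>C (x + y) = a *\<^sub>C x + a *\<^sub>C y"
    and scaleC_add_left: "(a + b) *\<^sub>C x = a *\<^sub>C x + b *\<^sub>C x"
    and scaleC_scaleC: "a *\<^sub>C (b *\<^sub>C x) = (a * b) *\<^sub>C x"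
    and scaleC_one: "1 *\<^sub>C x = x"
    and scaleR_eq_scaleC: "r *\<^sub>R x = complex_of_real r *\<^sub>C x"
    and cinner_commute: "cinner x y = cnj (cinner y x)"
    and cinner_add_left: "cinner (x + y) z = cinner x z + cinner y z"
    and cinner_scaleC_left: "cinner (a *\<^sub>C x) y = a * cinner x y"
    and inner_eq_Re_cinner: "inner x y = Re (cinner x y)"

interpretation complex_vector: vector_space "scaleC :: complex \<Rightarrow> 'a \<Rightarrow> 'a::complex_hilbert_space"
  by unfold_locales
    (simp_all add: scaleC_add_right scaleC_add_left scaleC_scaleC scaleC_one)

definition orth_diff :: "'a::complex_hilbert_space set \<Rightarrow> 'a set \<Rightarrow> 'a set"  (infixl \<open>\<ominus>\<close> 65)
  where "K \<ominus> A = {x \<in> K. \<forall>y\<in>A. cinner x y = 0}"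

definition proj :: "'a::complex_hilbert_space set \<Rightarrow> 'a \<Rightarrow> 'a"
  where "proj K x = (THE y. y \<in> K \<and> (\<forall>k\<in>K. cinner (x - y) k = 0))"

definition orthonormal_basis :: "'a::complex_hilbert_space set \<Rightarrow> 'a set \<Rightarrow> bool"
  where "orthonormal_basis B K \<longleftrightarrow>
    (\<forall>x\<in>B. \<forall>y\<in>B. cinner x y = (if x = y then 1 else 0)) \<and>
    closure (complex_vector.span B) = K"

text \<open>Hilbert space dimension of a closed subspace. All infinite dimensions are identified, so
  this is the true dimension in separable spaces only, where \<open>\<infinity>\<close> stands for \<open>\<aleph>\<^sub>0\<close>.\<close>

definition hdim :: "'a::complex_hilbert_space set \<Rightarrow> enat"
  where "hdim K = (THE n. \<exists>B. orthonormal_basis B K \<and>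
    n = (if finite B then enat (card B) else \<infinity>))"

definition is_direct_sum :: "'a::complex_hilbert_space set \<Rightarrow> 'a set \<Rightarrow> 'a set \<Rightarrow> bool"
  where "is_direct_sum D A B \<longleftrightarrow> D = {a + b | a b. a \<in> A \<and> b \<in> B} \<and> A \<inter> B = {0}"


section \<open>Bounded operators between subspaces\<close>

text \<open>An operator in \<open>\<^bold>B(H, K)\<close> is a function of which only the values on the subspace \<open>H\<close>
  matter. All notions below depend on these values only.\<close>

definition bounded_op :: "'a::complex_hilbert_space set \<Rightarrow> 'a set \<Rightarrow> ('a \<Rightarrow> 'a) \<Rightarrow> bool"
  where "bounded_op H K T \<longleftrightarrow>
    (\<forall>x\<in>H. T x \<in> K) \<and>
    (\<forall>x\<in>H. \<forall>y\<in>H. T (x + y) = T x + T y) \<and>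
    (\<forall>c. \<forall>x\<in>H. T (c *\<^sub>C x) = c *\<^sub>C T x) \<and>
    (\<exists>b. \<forall>x\<in>H. norm (T x) \<le> b * norm x)"

definition contraction_op :: "'a::complex_hilbert_space set \<Rightarrow> 'a set \<Rightarrow> ('a \<Rightarrow> 'a) \<Rightarrow> bool"
  where "contraction_op H K T \<longleftrightarrow> bounded_op H K T \<and> (\<forall>x\<in>H. norm (T x) \<le> norm x)"

definition isometry_op :: "'a::complex_hilbert_space set \<Rightarrow> 'a set \<Rightarrow> ('a \<Rightarrow> 'a) \<Rightarrow> bool"
  where "isometry_op H K T \<longleftrightarrow> bounded_op H K T \<and> (\<forall>x\<in>H. norm (T x) = norm x)"

definition unitary_op :: "'a::complex_hilbert_space set \<Rightarrow> 'a set \<Rightarrow> ('a \<Rightarrow> 'a) \<Rightarrow> bool"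
  where "unitary_op H K T \<longleftrightarrow> isometry_op H K T \<and> T ` H = K"

definition adj :: "'a::complex_hilbert_space set \<Rightarrow> 'a set \<Rightarrow> ('a \<Rightarrow> 'a) \<Rightarrow> 'a \<Rightarrow> 'a"
  where "adj H K T y = (THE x. x \<in> H \<and> (\<forall>h\<in>H. cinner (T h) y = cinner h x))"

definition positive_op :: "'a::complex_hilbert_space set \<Rightarrow> ('a \<Rightarrow> 'a) \<Rightarrow> bool"
  where "positive_op H T \<longleftrightarrow> bounded_op H H T \<and> (\<forall>x\<in>H. cinner (T x) x \<in> \<real>\<^sub>\<ge>\<^sub>0)"

text \<open>The nonnegative square root of \<open>A\<close> in \<open>H\<close> is unique on \<open>H\<close>, but not as a function on
  the whole type, hence the choice operator.\<close>

definition sqrt_op :: "'a::complex_hilbert_space set \<Rightarrow> ('a \<Rightarrow> 'a) \<Rightarrow> 'a \<Rightarrow> 'a"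
  where "sqrt_op H A = (SOME R. positive_op H R \<and> (\<forall>x\<in>H. R (R x) = A x))"

definition defect_op :: "'a::complex_hilbert_space set \<Rightarrow> 'a set \<Rightarrow> ('a \<Rightarrow> 'a) \<Rightarrow> 'a \<Rightarrow> 'a"
  where "defect_op H K Z = sqrt_op H (\<lambda>x. x - adj H K Z (Z x))"

definition defect_sp :: "'a::complex_hilbert_space set \<Rightarrow> 'a set \<Rightarrow> ('a \<Rightarrow> 'a) \<Rightarrow> 'a set"
  where "defect_sp H K Z = closure (defect_op H K Z ` H)"


section \<open>Unbounded operators\<close>

text \<open>Not everywhere defined operators are represented by their graphs: the domain is
  \<^const>\<open>Domain\<close>, the range \<^const>\<open>Range\<close>, the inverse \<^const>\<open>converse\<close>, and
  inclusion means extension. \<open>T\<close> is a closed operator iff \<^term>\<open>closed T\<close>.\<close>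

definition linear_operator :: "('a::complex_hilbert_space \<times> 'a) set \<Rightarrow> bool"
  where "linear_operator T \<longleftrightarrow>
    (0, 0) \<in> T \<and>
    (\<forall>(f, f')\<in>T. \<forall>(g, g')\<in>T. (f + g, f' + g') \<in> T) \<and>
    (\<forall>c. \<forall>(f, f')\<in>T. (c *\<^sub>C f, c *\<^sub>C f') \<in> T) \<and>
    single_valued T"

definition isometric_operator :: "('a::complex_hilbert_space \<times> 'a) set \<Rightarrow> bool"
  where "isometric_operator T \<longleftrightarrow> linear_operator T \<and> (\<forall>(f, f')\<in>T. norm f' = norm f)"

definition symmetric_operator :: "('a::complex_hilbert_space \<times> 'a) set \<Rightarrow> bool"
  where "symmetric_operator T \<longleftrightarrow> linear_operator T \<and> (\<forall>(f, f')\<in>T. Im (cinner f' f) = 0)"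

definition maximal_symmetric_in ::
    "'a::complex_hilbert_space set \<Rightarrow> ('a \<times> 'a) set \<Rightarrow> bool"
  where "maximal_symmetric_in K T \<longleftrightarrow>
    symmetric_operator T \<and> T \<subseteq> K \<times> K \<and>
    (\<forall>T'. symmetric_operator T' \<and> T' \<subseteq> K \<times> K \<and> T \<subseteq> T' \<longrightarrow> T' = T)"

definition adjoint_in ::
    "'a::complex_hilbert_space set \<Rightarrow> ('a \<times> 'a) set \<Rightarrow> ('a \<times> 'a) set"
  where "adjoint_in K T =
    {(g, g') \<in> K \<times> K. \<forall>(f, f')\<in>T. cinner f' g = cinner f g'}"

definition selfadjoint_in :: "'a::complex_hilbert_space set \<Rightarrow> ('a \<times> 'a) set \<Rightarrow> bool"
  where "selfadjoint_in K T \<longleftrightarrow>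
    linear_operator T \<and> T \<subseteq> K \<times> K \<and> closure (Domain T) = K \<and> adjoint_in K T = T"

text \<open>\<open>K \<ominus> ran (T - cnj z I)\<close>.\<close>

definition deficiency_sp ::
    "'a::complex_hilbert_space set \<Rightarrow> ('a \<times> 'a) set \<Rightarrow> complex \<Rightarrow> 'a set"
  where "deficiency_sp K T z = K \<ominus> {f' - cnj z *\<^sub>C f | f f'. (f, f') \<in> T}"

text \<open>The operators \<open>P\<^sub>K T\<close> and \<open>P\<^sub>K T \<restriction> (dom T \<inter> K)\<close>.\<close>

definition proj_operator ::
    "'a::complex_hilbert_space set \<Rightarrow> ('a \<times> 'a) set \<Rightarrow> ('a \<times> 'a) set"
  where "proj_operator K T = {(f, proj K f') | f f'. (f, f') \<in> T}"

definition compression ::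
    "'a::complex_hilbert_space set \<Rightarrow> ('a \<times> 'a) set \<Rightarrow> ('a \<times> 'a) set"
  where "compression K T = {(f, proj K f') | f f'. (f, f') \<in> T \<and> f \<in> K}"


section \<open>Non-densely defined symmetric operators\<close>

text \<open>For a symmetric operator \<open>S\<close>: \<open>H\<^sub>0\<close>, \<open>\<LL>\<close>, \<open>\<NN>\<^sub>z\<close>, \<open>\<LL>\<^sub>z\<close>, \<open>\<NN>'\<^sub>z\<close>
  and the isometry \<open>V\<^sub>z\<close> from \<open>\<LL>\<^sub>z\<close> onto the space \<open>\<LL>\<close> for the conjugate of \<open>z\<close>.\<close>

definition dom_closure :: "('a::complex_hilbert_space \<times> 'a) set \<Rightarrow> 'a set"
  where "dom_closure S = closure (Domain S)"

definition dom_orth :: "('a::complex_hilbert_space \<times> 'a) set \<Rightarrow> 'a set"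
  where "dom_orth S = UNIV \<ominus> dom_closure S"

definition N_sp :: "('a::complex_hilbert_space \<times> 'a) set \<Rightarrow> complex \<Rightarrow> 'a set"
  where "N_sp S z = deficiency_sp UNIV S z"

definition L_sp :: "('a::complex_hilbert_space \<times> 'a) set \<Rightarrow> complex \<Rightarrow> 'a set"
  where "L_sp S z = proj (N_sp S z) ` dom_orth S"

definition N'_sp :: "('a::complex_hilbert_space \<times> 'a) set \<Rightarrow> complex \<Rightarrow> 'a set"
  where "N'_sp S z = N_sp S z \<ominus> L_sp S z"

definition V_op :: "('a::complex_hilbert_space \<times> 'a) set \<Rightarrow> complex \<Rightarrow> 'a \<Rightarrow> 'a"
  where "V_op S z x = (THE y. \<exists>h \<in> dom_orth S.
    x = proj (N_sp S z) h \<and> y = proj (N_sp S (cnj z)) h)"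

text \<open>\<open>T\<close> is a regular extension of \<open>S\<close> (for \<open>T = S\<close>: \<open>S\<close> is regular) if \<open>P T\<close> is closed,
  where \<open>P\<close> projects onto the closure of the domain of \<open>S\<close>, not of \<open>T\<close>.\<close>

definition regular_extension ::
    "('a::complex_hilbert_space \<times> 'a) set \<Rightarrow> ('a \<times> 'a) set \<Rightarrow> bool"
  where "regular_extension S T \<longleftrightarrow> closed (proj_operator (dom_closure S) T)"

definition vN_extension ::
    "('a::complex_hilbert_space \<times> 'a) set \<Rightarrow> ('a \<Rightarrow> 'a) \<Rightarrow> ('a \<times> 'a) set"
  where "vN_extension S U =
    {(f + (\<phi> - U \<phi>), f' + \<i> *\<^sub>C (\<phi> + U \<phi>)) | f f' \<phi>. (f, f') \<in> S \<and> \<phi> \<in> N_sp S \<i>}"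

text \<open>The block representation of \<open>U\<close> with parameters \<open>Y, M, G, X\<close>. Here \<open>X\<close> acts from
  the defect space of \<open>M\<close> to that of the adjoint of \<open>G\<close>; vectors of \<open>\<LL>\<^sub>z \<oplus> \<NN>'\<^sub>z\<close> are
  written as sums.\<close>

definition block_representation ::
    "('a::complex_hilbert_space \<times> 'a) set \<Rightarrow> ('a \<Rightarrow> 'a) \<Rightarrow>
     ('a \<Rightarrow> 'a) \<Rightarrow> ('a \<Rightarrow> 'a) \<Rightarrow> ('a \<Rightarrow> 'a) \<Rightarrow> ('a \<Rightarrow> 'a) \<Rightarrow> bool"
  where "block_representation S U Y M G X \<longleftrightarrow>
    (let L = L_sp S (-\<i>); Np = N'_sp S \<i>; Nm = N'_sp S (-\<i>); V = V_op S \<i>;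
         Ys = adj L L Y;
         DY = defect_op L L Y;    KY = defect_sp L L Y;
         DYs = defect_op L L Ys;  KYs = defect_sp L L Ys;
         Ms = adj Np KYs M;       Gs = adj KY Nm G;
         DM = defect_op Np KYs M; KM = defect_sp Np KYs M;
         DGs = defect_op Nm KY Gs; KGs = defect_sp Nm KY Gs
     in contraction_op L L Y \<and> {x \<in> L. x - Y x = 0} = {0} \<and>
        hdim KY \<le> hdim Nm \<and> hdim KYs \<le> hdim Np \<and>
        bounded_op Np KYs M \<and> isometry_op KYs Np Ms \<and>
        isometry_op KY Nm G \<and>
        hdim KM = hdim KGs \<and>
        bounded_op KM KGs X \<and> (hdim KM \<noteq> 0 \<longrightarrow> unitary_op KM KGs X) \<and>
        (\<forall>f \<in> L_sp S \<i>. \<forall>\<phi> \<in> Np. U (f + \<phi>) =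
            (Y (V f) + DYs (M \<phi>)) +
            (G (DY (V f)) + (- G (Ys (M \<phi>)) + DGs (X (DM \<phi>))))))"

end

theory Submission
  imports Defs
begin

text \<open>For \<open>h \<in> \<LL>\<close> the orthogonal decompositions of \<open>h\<close> along \<open>ran (S + i I)\<close> and
  \<open>ran (S - i I)\<close> involve the same vector \<open>g \<in> dom S\<close>. Hence \<open>V\<^sub>i\<close> is isometric,
  \<open>\<phi> - V\<^sub>i \<phi> \<in> dom S\<close> on \<open>\<LL>\<^sub>i\<close>, and \<open>U \<phi> - \<phi> \<in> H\<^sub>0\<close> holds iff the components
  of \<open>U \<phi>\<close> and \<open>\<phi>\<close> in \<open>\<LL>\<^sub>-\<^sub>i\<close> and \<open>\<LL>\<^sub>i\<close> correspond under \<open>V\<^sub>i\<close>; in block form this is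
  \<open>(I - Y) x = D\<^sub>Y\<^sub>* M \<phi>'\<close>. So the compression is the von Neumann extension of \<open>S\<^sub>0\<close> with
  the isometry \<open>U\<^sub>0\<close>, and its deficiency spaces are the complements of \<open>dom U\<^sub>0\<close> and
  \<open>ran U\<^sub>0\<close>. Replacing \<open>U\<close> by its inverse exchanges \<open>(Y, M)\<close> with \<open>(Y\<^sup>*, G\<^sup>*)\<close>.
  From \<open>(I - Y) (I - Y\<^sup>*) + D\<^sub>Y\<^sub>*\<^sup>2 = 2 (I - Y\<^sub>R)\<close> Douglas' lemma gives
  \<open>ran (I - Y\<^sub>R)\<^sup>1\<^sup>/\<^sup>2 = ran (I - Y) + ran D\<^sub>Y\<^sub>*\<close>, which turns the conditions
  \<open>ran D\<^sub>Y\<^sub>* \<subseteq> ran (I - Y)\<close> into equalities of ranges.\<close>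

subsection \<open>Inner product calculus\<close>

text \<open>An operator is a function that matters only on a subspace, and this shapes the proof: Y
  equals its second adjoint only there, and a square root is fixed only there. Roots are built from
  the binomial series of (1 - t)^(1/2) and identified with the chosen root by uniqueness. The
  existence of the block form starts from the two components of U V_{-i} on \<LL>_-i. They are Y and
  a map E with |E x| = |D_Y x|, so E = G D_Y for an isometry G. The components of U^{-1} on the same
  space yield the adjoint of Y and, in the same way, the isometry \<open>Ms\<close>. Finally U
  itself maps ker M onto ker \<open>Gs\<close> and serves as X. Regularity of S makes \<LL>_i and
  \<LL>_-i closed, so that projections and adjoints exist there. Regularity of the extension is a
  statement about lower bounds: a closed range and injectivity give one. From a regular extension
  one first gets only that R = (I - Y_R)^(1/2) is onto; the identity |R x|^2 = Re ((I - Y) x, x)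
  then passes surjectivity to I - Y.\<close>

abbreviation (input) csubspace :: "'a::complex_hilbert_space set \<Rightarrow> bool"
  where "csubspace \<equiv> complex_vector.subspace"

definition csub :: "'a::complex_hilbert_space set \<Rightarrow> bool"
  where "csub H \<longleftrightarrow> csubspace H \<and> closed H"

instance complex_hilbert_space \<subseteq> banach ..

lemma cinner_zero_left [simp]: "cinner 0 y = 0"
  using cinner_add_left[of 0 0 y] by simp

lemma cinner_zero_right [simp]: "cinner x 0 = 0"
  by (metis cinner_commute cinner_zero_left complex_cnj_zero)

lemma cinner_minus_left [simp]: "cinner (- x) y = - cinner x y"
  using cinner_add_left[of x "-x" y] by (simp add: eq_neg_iff_add_eq_0 add.commute)

lemma cinner_diff_left: "cinner (x - z) y = cinner x y - cinner z y"
  using cinner_add_left[of x "-z" y] by simp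

lemma cinner_add_right: "cinner x (y + z) = cinner x y + cinner x z"
  by (metis cinner_add_left cinner_commute complex_cnj_add)

lemma cinner_scaleC_right: "cinner x (a *\<^sub>C y) = cnj a * cinner x y"
  by (metis cinner_scaleC_left cinner_commute complex_cnj_mult)

lemma cinner_minus_right [simp]: "cinner x (- y) = - cinner x y"
  by (metis cinner_minus_left cinner_commute complex_cnj_minus)

lemma cinner_diff_right: "cinner x (y - z) = cinner x y - cinner x z"
  using cinner_add_right[of x y "-z"] by simp

lemma cinner_scaleR_left: "cinner (r *\<^sub>R x) y = r *\<^sub>R cinner x y"
  by (simp add: scaleR_eq_scaleC cinner_scaleC_left scaleR_conv_of_real)

lemma cinner_scaleR_right: "cinner x (r *\<^sub>R y) = r *\<^sub>R cinner x y"
  by (simp add: scaleR_eq_scaleC cinner_scaleC_right scaleR_conv_of_real)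

lemmas cinner_lin = cinner_add_left cinner_add_right cinner_diff_left cinner_diff_right
  cinner_scaleC_left cinner_scaleC_right cinner_scaleR_left cinner_scaleR_right

lemma cinner_self: "cinner x x = of_real ((norm x)\<^sup>2)"
proof -
  have "Im (cinner x x) = 0"
    by (metis cinner_commute complex_cnj complex.sel(2) equation_minus_iff neg_equal_iff_equal
        Im_complex_of_real Reals_cnj_iff complex_is_Real_iff)
  moreover have "Re (cinner x x) = (norm x)\<^sup>2"
    by (simp add: inner_eq_Re_cinner[symmetric] power2_norm_eq_inner)
  ultimately show ?thesis by (simp add: complex_eq_iff)
qed

lemma cinner_self_eq_0 [simp]: "cinner x x = 0 \<longleftrightarrow> x = 0"
  by (simp add: cinner_self)

lemma norm_sq_cinner: "(norm x)\<^sup>2 = Re (cinner x x)"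
  by (simp add: cinner_self)

lemma scaleC_zero_right [simp]: "a *\<^sub>C (0::'a::complex_hilbert_space) = 0"
  by (rule complex_vector.scale_zero_right)

lemma scaleC_minus_right: "a *\<^sub>C (- x::'a::complex_hilbert_space) = - (a *\<^sub>C x)"
  by (rule complex_vector.scale_minus_right)

lemma scaleC_minus_left: "(- a) *\<^sub>C (x::'a::complex_hilbert_space) = - (a *\<^sub>C x)"
  by (rule complex_vector.scale_minus_left)

lemma scaleC_diff_right: "a *\<^sub>C (x - y::'a::complex_hilbert_space) = a *\<^sub>C x - a *\<^sub>C y"
  by (rule complex_vector.scale_right_diff_distrib)

lemmas scaleC_simps = scaleC_add_right scaleC_diff_right scaleC_minus_right scaleC_scaleC
  scaleC_minus_left scaleC_one

lemma norm_scaleC: "norm (a *\<^sub>C (x::'a::complex_hilbert_space)) = cmod a * norm x"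
proof -
  have "cinner (a *\<^sub>C x) (a *\<^sub>C x) = (a * cnj a) * cinner x x"
    by (simp add: cinner_lin)
  then have "of_real ((norm (a *\<^sub>C x))\<^sup>2) = (of_real ((cmod a)\<^sup>2 * (norm x)\<^sup>2) :: complex)"
    by (simp only: cinner_self complex_norm_square[symmetric] of_real_mult)
  then have "(norm (a *\<^sub>C x))\<^sup>2 = (cmod a * norm x)\<^sup>2"
    by (simp only: of_real_eq_iff power_mult_distrib)
  then show ?thesis by simp
qed

text \<open>A unimodular factor \<open>a\<close> turns the complex inner product into its modulus,
  so the real Cauchy-Schwarz inequality applies to \<open>a *\<^sub>C x\<close> and y.\<close>

lemma cinner_CS: "cmod (cinner x y) \<le> norm x * norm y"
proof (cases "cinner x y = 0")
  case False
  define c where "c = cinner x y"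
  define a where "a = cnj c / of_real (cmod c)"
  have c: "cmod c \<noteq> 0" using False c_def by simp
  have "cinner (a *\<^sub>C x) y = cnj c * c / of_real (cmod c)"
    by (simp add: a_def cinner_lin c_def)
  also have "\<dots> = of_real ((cmod c)\<^sup>2) / of_real (cmod c)"
    by (simp only: complex_norm_square mult.commute)
  also have "\<dots> = of_real (cmod c)" using c by (simp add: power2_eq_square)
  finally have "cinner (a *\<^sub>C x) y = of_real (cmod c)" .
  then have "cmod c = inner (a *\<^sub>C x) y" by (simp add: inner_eq_Re_cinner)
  also have "\<dots> \<le> norm (a *\<^sub>C x) * norm y" by (rule norm_cauchy_schwarz)
  also have "norm (a *\<^sub>C x) = norm x" using c by (simp add: norm_scaleC a_def norm_divide)
  finally show ?thesis by (simp add: c_def)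
qed simp

lemma bounded_bilinear_cinner: "bounded_bilinear (cinner :: 'a::complex_hilbert_space \<Rightarrow> 'a \<Rightarrow> complex)"
  by standard (auto simp: cinner_lin intro!: exI[of _ 1] cinner_CS)

lemmas tendsto_cinner [tendsto_intros] = bounded_bilinear.tendsto[OF bounded_bilinear_cinner]
lemmas continuous_on_cinner [continuous_intros] =
  bounded_bilinear.continuous_on[OF bounded_bilinear_cinner]

lemma bounded_linear_scaleC: "bounded_linear (\<lambda>x::'a::complex_hilbert_space. a *\<^sub>C x)"
  by (rule bounded_linear_intro[of _ "cmod a"])
    (simp_all add: scaleC_add_right norm_scaleC scaleR_eq_scaleC scaleC_scaleC mult.commute)

lemmas tendsto_scaleC [tendsto_intros] = bounded_linear.tendsto[OF bounded_linear_scaleC]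
lemma norm_add_orth: "cinner x y = 0 \<Longrightarrow> (norm (x + y))\<^sup>2 = (norm x)\<^sup>2 + (norm y)\<^sup>2"
  by (simp add: norm_sq_cinner cinner_lin cinner_commute[of y x])

lemma cinner_eq_sym: "cinner x y = 0 \<longleftrightarrow> cinner y x = 0"
  by (metis cinner_commute complex_cnj_zero)

subsection \<open>Closed subspaces and projections\<close>

lemma csub_subspace: "csub H \<Longrightarrow> subspace H"
  unfolding csub_def subspace_def complex_vector.subspace_def by (auto simp: scaleR_eq_scaleC)

lemma csub_closed: "csub H \<Longrightarrow> closed H"
  by (simp add: csub_def)

lemma csub_csubspace: "csub H \<Longrightarrow> csubspace H"
  by (simp add: csub_def)

lemmas csub_0 = complex_vector.subspace_0[OF csub_csubspace]
lemmas csub_add = complex_vector.subspace_add[OF csub_csubspace]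
lemmas csub_diff = complex_vector.subspace_diff[OF csub_csubspace]
lemmas csub_neg = complex_vector.subspace_neg[OF csub_csubspace]
lemmas csub_scaleC = complex_vector.subspace_scale[OF csub_csubspace]
lemmas csub_scaleR = subspace_scale[OF csub_subspace]

lemma csub_UNIV: "csub (UNIV :: 'a::complex_hilbert_space set)"
  by (simp add: csub_def complex_vector.subspace_UNIV)

lemma csub_orth_diff:
  assumes "csub K" shows "csub (K \<ominus> A)"
proof -
  have "K \<ominus> A = K \<inter> (\<Inter>y\<in>A. {x. cinner x y = 0})" by (auto simp: orth_diff_def)
  moreover have "closed {x::'a. cinner x y = 0}" for y
    by (intro closed_Collect_eq continuous_intros)
  ultimately have "closed (K \<ominus> A)" using assms by (auto simp: csub_def intro!: closed_INT)
  moreover have "csubspace (K \<ominus> A)"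
    using assms unfolding orth_diff_def complex_vector.subspace_def csub_def
    by (auto simp: cinner_lin)
  ultimately show ?thesis by (simp add: csub_def)
qed

lemma csubspace_closure:
  assumes "csubspace (A :: 'a::complex_hilbert_space set)" shows "csub (closure A)"
proof -
  have "x + y \<in> closure A" if "x \<in> closure A" "y \<in> closure A" for x y
  proof -
    from that obtain u v where "\<And>n. u n \<in> A" "u \<longlonglongrightarrow> x" "\<And>n. v n \<in> A" "v \<longlonglongrightarrow> y"
      by (auto simp: closure_sequential)
    then show ?thesis unfolding closure_sequential
      by (intro exI[of _ "\<lambda>n. u n + v n"])
        (auto intro: tendsto_intros complex_vector.subspace_add[OF assms])
  qed
  moreover have "c *\<^sub>C x \<in> closure A" if "x \<in> closure A" for c x
  proof -
    from that obtain u where "\<And>n. u n \<in> A" "u \<longlonglongrightarrow> x"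
      by (auto simp: closure_sequential)
    then show ?thesis unfolding closure_sequential
      by (intro exI[of _ "\<lambda>n. c *\<^sub>C u n"])
        (auto intro: tendsto_intros complex_vector.subspace_scale[OF assms])
  qed
  moreover have "0 \<in> closure A" using complex_vector.subspace_0[OF assms] closure_subset by blast
  ultimately show ?thesis by (simp add: csub_def complex_vector.subspace_def)
qed

text \<open>The representing vector is the limit of \<open>T u\<^sub>n\<close> for a minimizing sequence of
  \<open>\<parallel>T h\<parallel>\<^sup>2 - 2 f h\<close>; the parallelogram identity makes it a Cauchy sequence.\<close>

lemma riesz_general:
  fixes H :: "'b::real_vector set" and T :: "'b \<Rightarrow> 'c::{real_inner,complete_space}"
  assumes H: "subspace H"
    and Tadd: "\<And>x y. x \<in> H \<Longrightarrow> y \<in> H \<Longrightarrow> T (x + y) = T x + T y"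
    and Tsc: "\<And>c x. x \<in> H \<Longrightarrow> T (c *\<^sub>R x) = c *\<^sub>R T x"
    and add: "\<And>x y. x \<in> H \<Longrightarrow> y \<in> H \<Longrightarrow> f (x + y) = f x + f y"
    and sc: "\<And>c x. x \<in> H \<Longrightarrow> f (c *\<^sub>R x) = c * f x"
    and bd: "\<And>x. x \<in> H \<Longrightarrow> \<bar>f x\<bar> \<le> b * norm (T x)"
  shows "\<exists>w\<in>closure (T ` H). \<forall>h\<in>H. f h = inner (T h) w"
proof -
  define q where "q h = (norm (T h))\<^sup>2 - 2 * f h" for h
  have qlow: "- (b\<^sup>2) \<le> q h" if "h \<in> H" for h
  proof -
    have "0 \<le> (norm (T h) - b)\<^sup>2" by simp
    then show ?thesis using bd[OF that] by (simp add: q_def power2_diff algebra_simps abs_le_iff)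
  qed
  define m where "m = Inf (q ` H)"
  have ne: "q ` H \<noteq> {}" using subspace_0[OF H] by auto
  have bb: "bdd_below (q ` H)" using qlow by (auto intro: bdd_belowI[of _ "- (b\<^sup>2)"])
  have mle: "m \<le> q h" if "h \<in> H" for h unfolding m_def using bb that by (auto intro: cInf_lower)
  have "\<exists>u\<in>H. q u < m + 1 / real (Suc n)" for n
  proof -
    have "Inf (q ` H) < m + 1 / real (Suc n)" unfolding m_def by simp
    then show ?thesis using cInf_less_iff[OF ne bb] by auto
  qed
  then obtain u where u: "\<And>n. u n \<in> H" "\<And>n. q (u n) < m + 1 / real (Suc n)" by metis
  have par: "(norm (T x - T y))\<^sup>2 \<le> 2 * (q x - m) + 2 * (q y - m)" if "x \<in> H" "y \<in> H" for x y
  proof -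
    have "(1/2) *\<^sub>R (x + y) \<in> H" using H that by (simp add: subspace_add subspace_scale)
    from mle[OF this] have "m \<le> (norm ((1/2) *\<^sub>R (T x + T y)))\<^sup>2 - (f x + f y)"
      using that H by (simp add: q_def sc add Tsc Tadd subspace_add add_divide_distrib)
    moreover have "(norm ((1/2) *\<^sub>R (T x + T y)))\<^sup>2 = (1/4) * (norm (T x + T y))\<^sup>2"
      by (simp add: power_mult_distrib power_divide)
    moreover have "(norm (T x - T y))\<^sup>2 + (norm (T x + T y))\<^sup>2 = 2 * (norm (T x))\<^sup>2 + 2 * (norm (T y))\<^sup>2"
      by (simp add: power2_norm_eq_inner inner_simps inner_commute)
    ultimately show ?thesis by (simp add: q_def)
  qed
  have "Cauchy (\<lambda>n. T (u n))"
  proof (rule metric_CauchyI)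
    fix e :: real assume e: "e > 0"
    obtain N where N: "1 / real (Suc N) < e\<^sup>2 / 4"
      using nat_approx_posE[of "e\<^sup>2/4"] e by auto
    have "dist (T (u i)) (T (u j)) < e" if "i \<ge> N" "j \<ge> N" for i j
    proof -
      have "1 / real (Suc i) \<le> 1 / real (Suc N)" "1 / real (Suc j) \<le> 1 / real (Suc N)"
        using that by (auto simp: frac_le)
      then have "q (u i) - m < e\<^sup>2 / 4" "q (u j) - m < e\<^sup>2 / 4"
        using u(2)[of i] u(2)[of j] N by linarith+
      then have "(norm (T (u i) - T (u j)))\<^sup>2 < e\<^sup>2"
        using par[OF u(1)[of i] u(1)[of j]] by argo
      then show ?thesis using e by (simp add: dist_norm power2_less_imp_less)
    qed
    then show "\<exists>M. \<forall>i\<ge>M. \<forall>j\<ge>M. dist (T (u i)) (T (u j)) < e" by blast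
  qed
  then obtain w where w: "(\<lambda>n. T (u n)) \<longlonglongrightarrow> w" using Cauchy_convergent_iff convergent_def by blast
  have wH: "w \<in> closure (T ` H)"
    unfolding closure_sequential using u(1) w by (intro exI[of _ "\<lambda>n. T (u n)"]) auto
  have "f h = inner (T h) w" if hH: "h \<in> H" for h
  proof -
    define d where "d = f h - inner (T h) w"
    \<comment> \<open>First variation at the infimum: m is at most the value of q at
      \<open>u n + t *\<^sub>R h\<close>, and n tends to infinity. Nonnegativity for every t will
      force the linear coefficient d to vanish.\<close>
    have low: "0 \<le> t\<^sup>2 * (norm (T h))\<^sup>2 - 2 * t * d" for t
    proof -
      have le: "m \<le> m + 1 / real (Suc n) + t\<^sup>2 * (norm (T h))\<^sup>2 - 2 * t * (f h - inner (T h) (T (u n)))" for n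
      proof -
        have "m \<le> q (u n + t *\<^sub>R h)"
          using mle u(1) hH H by (simp add: subspace_add subspace_scale)
        also have "\<dots> = q (u n) + t\<^sup>2 * (norm (T h))\<^sup>2 - 2 * t * (f h - inner (T h) (T (u n)))"
        proof -
          have "(norm (T (u n) + t *\<^sub>R T h))\<^sup>2
              = (norm (T (u n)))\<^sup>2 + t\<^sup>2 * (norm (T h))\<^sup>2 + 2 * t * inner (T h) (T (u n))"
            unfolding power2_norm_eq_inner
            by (simp add: inner_simps inner_commute algebra_simps power2_eq_square)
          then show ?thesis
            using u(1) hH H by (simp add: q_def add sc Tadd Tsc subspace_scale algebra_simps)
        qed
        finally show ?thesis using u(2)[of n] by linarith
      qed
      have "(\<lambda>n. m + 1 / real (Suc n) + t\<^sup>2 * (norm (T h))\<^sup>2 - 2 * t * (f h - inner (T h) (T (u n))))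
          \<longlonglongrightarrow> m + 0 + t\<^sup>2 * (norm (T h))\<^sup>2 - 2 * t * (f h - inner (T h) w)"
        by (intro tendsto_intros LIMSEQ_Suc[OF lim_1_over_n] w)
      then have "m \<le> m + 0 + t\<^sup>2 * (norm (T h))\<^sup>2 - 2 * t * (f h - inner (T h) w)"
        by (rule LIMSEQ_le_const) (use le in blast)
      then show ?thesis by (simp add: d_def)
    qed
    have "d = 0"
    proof (cases "T h = 0")
      case True
      then show ?thesis using bd[OF hH] by (simp add: d_def)
    next
      case False
      \<comment> \<open>The value of t that minimizes the quadratic polynomial.\<close>
      have "0 \<le> (d / (norm (T h))\<^sup>2)\<^sup>2 * (norm (T h))\<^sup>2 - 2 * (d / (norm (T h))\<^sup>2) * d" by (rule low)
      also have "\<dots> = - (d\<^sup>2 / (norm (T h))\<^sup>2)" using False by (simp add: power2_eq_square)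
      finally have "d\<^sup>2 / (norm (T h))\<^sup>2 \<le> 0" by simp
      then show ?thesis using False by (simp add: divide_le_0_iff)
    qed
    then show ?thesis by (simp add: d_def)
  qed
  then show ?thesis using wH by blast
qed

lemma riesz_real:
  fixes H :: "'b::{real_inner,complete_space} set"
  assumes "subspace H" "closed H"
    and "\<And>x y. x \<in> H \<Longrightarrow> y \<in> H \<Longrightarrow> f (x + y) = f x + f y"
    and "\<And>c x. x \<in> H \<Longrightarrow> f (c *\<^sub>R x) = c * f x"
    and "\<And>x. x \<in> H \<Longrightarrow> \<bar>f x\<bar> \<le> b * norm x"
  shows "\<exists>v\<in>H. \<forall>h\<in>H. f h = inner h v"
  using riesz_general[of H "\<lambda>x. x" f b] assms by simp

text \<open>The real part tested on \<open>\<i> *\<^sub>C h\<close> is, up to sign, the imaginary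
  part tested on h. This carries Riesz representation over from the real to the complex inner
  product.\<close>

lemma cinner_eqI_Re:
  assumes "csubspace H" "\<And>h. h \<in> H \<Longrightarrow> Re (cinner h x) = Re (cinner h y)" "h \<in> H"
  shows "cinner h x = cinner h y"
  using assms(2)[OF assms(3)] assms(2)[OF complex_vector.subspace_scale[OF assms(1,3), of \<i>]]
  by (simp add: complex_eq_iff cinner_lin)

lemma orth_self_eq:
  assumes "csubspace K" "y \<in> K" "z \<in> K" "\<And>k. k \<in> K \<Longrightarrow> cinner k y = cinner k z" shows "y = z"
proof -
  have "y - z \<in> K" using assms by (simp add: complex_vector.subspace_diff)
  from assms(4)[OF this] have "cinner (y - z) (y - z) = 0" by (simp add: cinner_lin)
  then show ?thesis by simp
qed

lemma orth_self_eq':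
  assumes "csubspace K" "y \<in> K" "z \<in> K" "\<And>k. k \<in> K \<Longrightarrow> cinner y k = cinner z k" shows "y = z"
  by (rule orth_self_eq[OF assms(1-3)]) (metis assms(4) cinner_commute)

text \<open>The projection of x is the Riesz vector of the functional h \<mapsto> (h, x) on K; this
  gives the definite description in \<open>proj\<close> a meaning.\<close>

lemma proj_ex1:
  assumes K: "csub K" shows "\<exists>!y. y \<in> K \<and> (\<forall>k\<in>K. cinner (x - y) k = 0)"
proof -
  have "\<exists>v\<in>K. \<forall>h\<in>K. inner h x = inner h v"
    by (rule riesz_real[OF csub_subspace[OF K] csub_closed[OF K], where b="norm x"])
      (simp_all add: inner_simps, metis Cauchy_Schwarz_ineq2 mult.commute)
  then obtain v where v: "v \<in> K" "\<And>h. h \<in> K \<Longrightarrow> Re (cinner h x) = Re (cinner h v)"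
    by (auto simp: inner_eq_Re_cinner)
  have e: "cinner h x = cinner h v" if "h \<in> K" for h
    by (rule cinner_eqI_Re[OF csub_csubspace[OF K] v(2) that])
  then have "\<forall>k\<in>K. cinner (x - v) k = 0"
    by (metis cinner_commute cinner_diff_left right_minus_eq)
  moreover have "y = z" if "y \<in> K" "z \<in> K" "\<forall>k\<in>K. cinner (x - y) k = 0"
      "\<forall>k\<in>K. cinner (x - z) k = 0" for y z
    by (rule orth_self_eq'[OF csub_csubspace[OF K] that(1,2)])
      (metis that(3,4) cinner_diff_left right_minus_eq)
  ultimately show ?thesis using v(1) by blast
qed

lemma proj_mem: "csub K \<Longrightarrow> proj K x \<in> K"
  and proj_orth: "csub K \<Longrightarrow> k \<in> K \<Longrightarrow> cinner (x - proj K x) k = 0"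
  unfolding proj_def using theI'[OF proj_ex1] by blast+

lemma proj_eqI: "csub K \<Longrightarrow> y \<in> K \<Longrightarrow> (\<And>k. k \<in> K \<Longrightarrow> cinner (x - y) k = 0) \<Longrightarrow> proj K x = y"
  unfolding proj_def by (rule the1_equality[OF proj_ex1]) auto

lemma proj_cinner: "csub K \<Longrightarrow> k \<in> K \<Longrightarrow> cinner (proj K x) k = cinner x k"
  using proj_orth[of K k x] by (simp add: cinner_lin)

lemma proj_cinner': "csub K \<Longrightarrow> k \<in> K \<Longrightarrow> cinner k (proj K x) = cinner k x"
  by (metis cinner_commute proj_cinner)

lemma proj_id: "csub K \<Longrightarrow> x \<in> K \<Longrightarrow> proj K x = x"
  by (rule proj_eqI) auto

lemma proj_add: "csub K \<Longrightarrow> proj K (x + y) = proj K x + proj K y"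
  by (rule proj_eqI) (auto simp: csub_add proj_mem proj_cinner cinner_lin)

lemma proj_scaleC: "csub K \<Longrightarrow> proj K (c *\<^sub>C x) = c *\<^sub>C proj K x"
  by (rule proj_eqI) (auto simp: csub_scaleC proj_mem proj_cinner cinner_lin)

lemma proj_0 [simp]: "csub K \<Longrightarrow> proj K 0 = 0"
  by (simp add: csub_0 proj_id)

lemma proj_diff: "csub K \<Longrightarrow> proj K (x - y) = proj K x - proj K y"
  by (rule proj_eqI) (auto simp: csub_diff proj_mem proj_cinner cinner_lin)

lemma proj_eq_0_iff: "csub K \<Longrightarrow> proj K x = 0 \<longleftrightarrow> (\<forall>k\<in>K. cinner x k = 0)"
  by (metis cinner_zero_left csub_0 diff_zero proj_cinner proj_eqI)

lemma proj_norm_sq: "csub K \<Longrightarrow> (norm x)\<^sup>2 = (norm (proj K x))\<^sup>2 + (norm (x - proj K x))\<^sup>2"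
  using norm_add_orth[of "x - proj K x" "proj K x"] proj_orth[of K "proj K x" x] proj_mem[of K x]
  by simp

lemma proj_norm_le: "csub K \<Longrightarrow> norm (proj K x) \<le> norm x"
  by (rule power2_le_imp_le) (simp_all add: proj_norm_sq[of K x])

lemma bounded_linear_proj: "csub K \<Longrightarrow> bounded_linear (proj K)"
  by (rule bounded_linear_intro[of _ 1])
    (simp_all add: proj_add scaleR_eq_scaleC proj_scaleC proj_norm_le)

text \<open>The residual \<open>x - proj K x\<close> is orthogonal to K, so by hypothesis also to x.
  Being orthogonal to both x and its projection, it is orthogonal to itself.\<close>

lemma orth_orth:
  assumes K: "csub K" and x: "\<And>y. (\<And>k. k \<in> K \<Longrightarrow> cinner y k = 0) \<Longrightarrow> cinner x y = 0"
  shows "x \<in> K"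
proof -
  have o: "cinner (x - proj K x) k = 0" if "k \<in> K" for k using proj_orth[OF K that] .
  have "cinner (proj K x) (x - proj K x) = 0"
    using o[OF proj_mem[OF K, of x]] cinner_eq_sym by blast
  then have "cinner (x - proj K x) (x - proj K x) = 0"
    using x[OF o] by (simp add: cinner_diff_left)
  then have "x = proj K x" by simp
  then show ?thesis using proj_mem[OF K, of x] by simp
qed

lemma dense_orth_0:
  assumes "csubspace A" "K = closure A" "x \<in> K" "\<And>a. a \<in> A \<Longrightarrow> cinner x a = 0" shows "x = 0"
proof -
  have "closed {a. cinner x a = 0}" by (intro closed_Collect_eq continuous_intros)
  then have "closure A \<subseteq> {a. cinner x a = 0}" using assms(4) by (intro closure_minimal) auto
  then show ?thesis using assms(2,3) by auto
qed

text \<open>The residual of a vector of K after projection onto \<open>closure A\<close> stays in K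
  and is orthogonal to A.\<close>

lemma dense_if_orth_0:
  assumes "csubspace A" "csub K" "A \<subseteq> K" "\<And>x. x \<in> K \<Longrightarrow> (\<And>a. a \<in> A \<Longrightarrow> cinner x a = 0) \<Longrightarrow> x = 0"
  shows "closure A = K"
proof
  show "closure A \<subseteq> K" using assms by (simp add: closure_minimal csub_closed)
  have c: "csub (closure A)" by (rule csubspace_closure[OF assms(1)])
  show "K \<subseteq> closure A"
  proof
    fix x assume x: "x \<in> K"
    have p: "proj (closure A) x \<in> closure A" by (rule proj_mem[OF c])
    have "x - proj (closure A) x \<in> K"
      using x p \<open>closure A \<subseteq> K\<close> assms(2) by (auto intro: csub_diff)
    then have "x - proj (closure A) x = 0"
      using assms(4) proj_orth[OF c] closure_subset by blast
    then show "x \<in> closure A" using p by simp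
  qed
qed

subsection \<open>Bounded operators and adjoints\<close>

lemma bop_mem: "bounded_op H K T \<Longrightarrow> x \<in> H \<Longrightarrow> T x \<in> K"
  and bop_add: "bounded_op H K T \<Longrightarrow> x \<in> H \<Longrightarrow> y \<in> H \<Longrightarrow> T (x + y) = T x + T y"
  and bop_scaleC: "bounded_op H K T \<Longrightarrow> x \<in> H \<Longrightarrow> T (c *\<^sub>C x) = c *\<^sub>C T x"
  by (simp_all add: bounded_op_def)

lemma bop_0: "csub H \<Longrightarrow> bounded_op H K T \<Longrightarrow> T 0 = 0"
  using bop_scaleC[of H K T 0 0] csub_0 by fastforce

lemma bop_minus: "bounded_op H K T \<Longrightarrow> x \<in> H \<Longrightarrow> T (- x) = - T x"
  using bop_scaleC[of H K T x "-1"] by (simp add: scaleC_simps)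

lemma bop_diff: "csub H \<Longrightarrow> bounded_op H K T \<Longrightarrow> x \<in> H \<Longrightarrow> y \<in> H \<Longrightarrow> T (x - y) = T x - T y"
  using bop_add[of H K T x "-y"] bop_minus[of H K T y] csub_neg by fastforce

lemma bop_scaleR: "bounded_op H K T \<Longrightarrow> x \<in> H \<Longrightarrow> T (c *\<^sub>R x) = c *\<^sub>R T x"
  by (simp add: scaleR_eq_scaleC bop_scaleC)

lemma bop_bound:
  assumes "bounded_op H K T" obtains b where "b > 0" "\<And>x. x \<in> H \<Longrightarrow> norm (T x) \<le> b * norm x"
proof -
  from assms obtain b where b: "\<forall>x\<in>H. norm (T x) \<le> b * norm x" by (auto simp: bounded_op_def)
  have "norm (T x) \<le> (\<bar>b\<bar> + 1) * norm x" if "x \<in> H" for x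
  proof -
    have "b * norm x \<le> (\<bar>b\<bar> + 1) * norm x" by (intro mult_right_mono) auto
    then show ?thesis using b that by force
  qed
  then show ?thesis by (intro that[of "\<bar>b\<bar> + 1"]) auto
qed

lemma bopI:
  assumes "\<And>x. x \<in> H \<Longrightarrow> T x \<in> K" "\<And>x y. x \<in> H \<Longrightarrow> y \<in> H \<Longrightarrow> T (x + y) = T x + T y"
    "\<And>c x. x \<in> H \<Longrightarrow> T (c *\<^sub>C x) = c *\<^sub>C T x" "\<And>x. x \<in> H \<Longrightarrow> norm (T x) \<le> b * norm x"
  shows "bounded_op H K T"
  unfolding bounded_op_def using assms by (intro conjI exI[of _ b]) simp_all

text \<open>Composition with the projection onto H turns an operator that matters only on H into a
  bounded linear map of the whole space, to which the library's limit and summation theorems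
  apply.\<close>

lemma bounded_linear_bop_proj:
  assumes "csub H" "bounded_op H K T" shows "bounded_linear (\<lambda>x. T (proj H x))"
proof -
  obtain b where b: "b > 0" "\<And>x. x \<in> H \<Longrightarrow> norm (T x) \<le> b * norm x" using bop_bound[OF assms(2)] by metis
  show ?thesis
  proof (rule bounded_linear_intro[of _ b])
    fix x
    have "norm (T (proj H x)) \<le> b * norm (proj H x)" using b proj_mem assms by blast
    also have "\<dots> \<le> b * norm x" using proj_norm_le[OF assms(1)] b(1) by (simp add: mult_left_mono)
    finally show "norm (T (proj H x)) \<le> norm x * b" by (simp add: mult.commute)
  qed (use assms in \<open>simp_all add: proj_add scaleR_eq_scaleC proj_scaleC bop_add[OF assms(2)]
      bop_scaleC[OF assms(2)] proj_mem\<close>)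
qed

lemma bop_tendsto:
  assumes "csub H" "bounded_op H K T" "\<And>n. u n \<in> H" "u \<longlonglongrightarrow> x"
  shows "(\<lambda>n. T (u n)) \<longlonglongrightarrow> T x"
proof -
  have "x \<in> H" using assms csub_closed closed_sequentially by blast
  then show ?thesis
    using bounded_linear.tendsto[OF bounded_linear_bop_proj[OF assms(1,2)] assms(4)] assms(1,3)
    by (simp add: proj_id)
qed

lemma bop_image_csubspace:
  assumes "csub H" "bounded_op H K T" shows "csubspace (T ` H)"
  unfolding complex_vector.subspace_def
proof (intro conjI ballI allI)
  show "0 \<in> T ` H" using bop_0[OF assms] csub_0[OF assms(1)] by (metis image_eqI)
  fix x y assume "x \<in> T ` H" "y \<in> T ` H"
  then show "x + y \<in> T ` H" using bop_add[OF assms(2)] csub_add[OF assms(1)]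
    by (smt (verit, best) imageE imageI)
next
  fix c x assume "x \<in> T ` H"
  then show "c *\<^sub>C x \<in> T ` H" using bop_scaleC[OF assms(2)] csub_scaleC[OF assms(1)]
    by (smt (verit, best) imageE imageI)
qed

lemma bop_subset: "bounded_op H K T \<Longrightarrow> H' \<subseteq> H \<Longrightarrow> bounded_op H' K T"
  unfolding bounded_op_def by (meson subset_iff)

lemma bop_compose:
  assumes "bounded_op H K S" "bounded_op K J T" shows "bounded_op H J (\<lambda>x. T (S x))"
proof -
  obtain a where a: "a > 0" "\<And>x. x \<in> H \<Longrightarrow> norm (S x) \<le> a * norm x" using bop_bound[OF assms(1)] by metis
  obtain b where b: "b > 0" "\<And>x. x \<in> K \<Longrightarrow> norm (T x) \<le> b * norm x" using bop_bound[OF assms(2)] by metis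
  show ?thesis
  proof (rule bopI[where b="b * a"])
    fix x assume x: "x \<in> H"
    have "norm (T (S x)) \<le> b * norm (S x)" by (rule b(2)[OF bop_mem[OF assms(1) x]])
    also have "\<dots> \<le> b * (a * norm x)" using a(2)[OF x] b(1) by (simp add: mult_left_mono)
    finally show "norm (T (S x)) \<le> b * a * norm x" by (simp add: mult.assoc)
  qed (simp_all add: bop_mem[OF assms(2) bop_mem[OF assms(1)]] bop_add[OF assms(1)] bop_scaleC[OF assms(1)]
      bop_add[OF assms(2)] bop_scaleC[OF assms(2)] bop_mem[OF assms(1)])
qed

lemma bop_minus_op:
  assumes "bounded_op H K S" "bounded_op H K' T" shows "bounded_op H UNIV (\<lambda>x. S x - T x)"
proof -
  obtain a where a: "a > 0" "\<And>x. x \<in> H \<Longrightarrow> norm (S x) \<le> a * norm x" using bop_bound[OF assms(1)] by metis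
  obtain b where b: "b > 0" "\<And>x. x \<in> H \<Longrightarrow> norm (T x) \<le> b * norm x" using bop_bound[OF assms(2)] by metis
  show ?thesis
  proof (rule bopI[where b="a + b"])
    fix x assume x: "x \<in> H"
    have "norm (S x - T x) \<le> norm (S x) + norm (T x)" by (rule norm_triangle_ineq4)
    also have "\<dots> \<le> a * norm x + b * norm x" using a(2)[OF x] b(2)[OF x] by linarith
    finally show "norm (S x - T x) \<le> (a + b) * norm x" by (simp add: distrib_right)
  qed (simp_all add: bop_add[OF assms(1)] bop_scaleC[OF assms(1)] bop_add[OF assms(2)]
      bop_scaleC[OF assms(2)] scaleC_diff_right)
qed

lemma bop_UNIV: "bounded_op H K T \<Longrightarrow> bounded_op H UNIV T"
  by (simp add: bounded_op_def)

lemma bop_restrict: "bounded_op H K T \<Longrightarrow> H' \<subseteq> H \<Longrightarrow> (\<And>x. x \<in> H' \<Longrightarrow> T x \<in> K') \<Longrightarrow> bounded_op H' K' T"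
  unfolding bounded_op_def by (meson subset_iff)

lemma bop_cong:
  assumes "csub H" "bounded_op H K T" "\<And>x. x \<in> H \<Longrightarrow> T' x = T x" shows "bounded_op H K T'"
  using assms(2) assms(3) csub_add[OF assms(1)] csub_scaleC[OF assms(1)]
  unfolding bounded_op_def by simp

section \<open>Adjoints of operators between subspaces\<close>

lemma adj_ex1:
  assumes H: "csub H" and T: "bounded_op H K T"
  shows "\<exists>!x. x \<in> H \<and> (\<forall>h\<in>H. cinner (T h) y = cinner h x)"
proof -
  obtain b where b: "b > 0" "\<And>x. x \<in> H \<Longrightarrow> norm (T x) \<le> b * norm x" using bop_bound[OF T] by metis
  have "\<exists>v\<in>H. \<forall>h\<in>H. inner (T h) y = inner h v"
  proof (rule riesz_real[OF csub_subspace[OF H] csub_closed[OF H], where b="b * norm y"])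
    fix x assume x: "x \<in> H"
    have "\<bar>inner (T x) y\<bar> \<le> norm (T x) * norm y" by (rule Cauchy_Schwarz_ineq2)
    also have "\<dots> \<le> (b * norm x) * norm y" using b(2)[OF x] by (simp add: mult_right_mono)
    finally show "\<bar>inner (T x) y\<bar> \<le> b * norm y * norm x" by (simp add: mult_ac)
  qed (simp_all add: bop_add[OF T] bop_scaleR[OF T] inner_simps)
  then obtain v where v: "v \<in> H" "\<And>h. h \<in> H \<Longrightarrow> Re (cinner (T h) y) = Re (cinner h v)"
    by (auto simp: inner_eq_Re_cinner)
  have "cinner (T h) y = cinner h v" if "h \<in> H" for h
    using v(2)[OF that] v(2)[OF csub_scaleC[OF H that, of \<i>]] that
    by (simp add: complex_eq_iff cinner_lin bop_scaleC[OF T])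
  moreover have "x = z" if "x \<in> H" "z \<in> H" "\<forall>h\<in>H. cinner (T h) y = cinner h x"
      "\<forall>h\<in>H. cinner (T h) y = cinner h z" for x z
    by (rule orth_self_eq[OF csub_csubspace[OF H] that(1,2)]) (use that in auto)
  ultimately show ?thesis using v(1) by blast
qed

lemma adj_mem: "csub H \<Longrightarrow> bounded_op H K T \<Longrightarrow> adj H K T y \<in> H"
  and adj_cinner: "csub H \<Longrightarrow> bounded_op H K T \<Longrightarrow> h \<in> H \<Longrightarrow> cinner h (adj H K T y) = cinner (T h) y"
  unfolding adj_def using theI'[OF adj_ex1, of H K T y] by auto

lemma adj_cinner': "csub H \<Longrightarrow> bounded_op H K T \<Longrightarrow> h \<in> H \<Longrightarrow> cinner (adj H K T y) h = cinner y (T h)"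
  by (metis adj_cinner cinner_commute)

lemma adj_eqI:
  "csub H \<Longrightarrow> bounded_op H K T \<Longrightarrow> x \<in> H \<Longrightarrow> (\<And>h. h \<in> H \<Longrightarrow> cinner (T h) y = cinner h x) \<Longrightarrow>
    adj H K T y = x"
  unfolding adj_def by (rule the1_equality[OF adj_ex1]) auto

lemma adj_norm_le:
  assumes "csub H" "bounded_op H K T" "b \<ge> 0" "\<And>x. x \<in> H \<Longrightarrow> norm (T x) \<le> b * norm x"
  shows "norm (adj H K T y) \<le> b * norm y"
proof (cases "adj H K T y = 0")
  case False
  let ?x = "adj H K T y"
  have "(norm ?x)\<^sup>2 = cmod (cinner ?x ?x)" by (simp add: cinner_self norm_power)
  also have "\<dots> = cmod (cinner (T ?x) y)" using assms adj_cinner adj_mem by metis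
  also have "\<dots> \<le> norm (T ?x) * norm y" by (rule cinner_CS)
  also have "\<dots> \<le> (b * norm ?x) * norm y"
    using assms(4)[OF adj_mem[OF assms(1,2)]] by (simp add: mult_right_mono)
  finally show ?thesis using False by (simp add: power2_eq_square mult_ac)
qed (use assms in simp)

subsection \<open>Square roots\<close>

text \<open>The Taylor coefficients of (1 - t)^(1/2) at 0.\<close>

definition sqrt_coeff :: "nat \<Rightarrow> real"
  where "sqrt_coeff n = ((1/2) gchoose n) * (-1) ^ n"

lemma sqrt_coeff_0 [simp]: "sqrt_coeff 0 = 1"
  by (simp add: sqrt_coeff_def)

text \<open>The rising factorial of -1/2 has -1/2 as its only negative factor. That all coefficients
  but the first share one sign drives both the summability and the positivity of the series.\<close>

lemma sqrt_coeff_Suc: "sqrt_coeff (Suc n) \<le> 0"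
proof -
  have "sqrt_coeff (Suc n) = pochhammer (- (1/2)) (Suc n) / fact (Suc n)"
    by (simp add: sqrt_coeff_def gbinomial_pochhammer power_mult_distrib[symmetric] del: power_Suc)
  moreover have "pochhammer (- (1/2)) (Suc n) = - (1/2) * pochhammer (1/2 :: real) n"
    by (simp add: pochhammer_rec)
  moreover have "pochhammer (1/2 :: real) n \<ge> 0" by (intro pochhammer_nonneg) auto
  ultimately show ?thesis by (simp add: divide_nonpos_pos)
qed

text \<open>The partial sums are the Taylor coefficients of (1 - t)^(1/2) / (1 - t) = (1 -
  t)^(-1/2), which are nonnegative.\<close>

lemma sum_sqrt_coeff: "(\<Sum>k\<le>n. sqrt_coeff k) \<ge> 0"
proof -
  have "(\<Sum>k\<le>n. sqrt_coeff k) = (-1)^n * ((1/2 - 1) gchoose n)"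
    unfolding sqrt_coeff_def by (rule gbinomial_sum_lower_neg)
  also have "\<dots> = pochhammer (1/2) n / fact n"
    by (simp add: gbinomial_pochhammer power_mult_distrib[symmetric])
  also have "\<dots> \<ge> 0" by (intro divide_nonneg_pos pochhammer_nonneg) auto
  finally show ?thesis .
qed

text \<open>By the signs and the nonnegative partial sums, the absolute values after the first add
  up to at most the first coefficient 1. Hence the operator series converges even for norm
  1.\<close>

lemma summable_abs_sqrt_coeff: "summable (\<lambda>n. \<bar>sqrt_coeff n\<bar>)"
proof -
  have "summable (\<lambda>n. - sqrt_coeff (Suc n))"
  proof (rule summableI_nonneg_bounded[where x=1])
    fix n show "0 \<le> - sqrt_coeff (Suc n)" using sqrt_coeff_Suc by simp
    have "(\<Sum>k\<le>n. sqrt_coeff k) = sqrt_coeff 0 + (\<Sum>i<n. sqrt_coeff (Suc i))"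
      by (metis lessThan_Suc_atMost sum.lessThan_Suc_shift)
    then show "(\<Sum>i<n. - sqrt_coeff (Suc i)) \<le> 1" using sum_sqrt_coeff[of n] by (simp add: sum_negf)
  qed
  moreover have "\<bar>sqrt_coeff (Suc n)\<bar> = - sqrt_coeff (Suc n)" for n
    using sqrt_coeff_Suc[of n] by simp
  ultimately have "summable (\<lambda>n. \<bar>sqrt_coeff (Suc n)\<bar>)" by simp
  then show ?thesis using summable_Suc_iff[of "\<lambda>n. \<bar>sqrt_coeff n\<bar>"] by blast
qed

lemma sqrt_coeff_summable_on: "(\<lambda>n. \<bar>sqrt_coeff n\<bar>) summable_on UNIV"
  by (rule norm_summable_imp_summable_on) (simp add: summable_abs_sqrt_coeff)

lemma sqrt_coeff_summable_on': "sqrt_coeff summable_on UNIV"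
  by (rule norm_summable_imp_summable_on) (simp add: summable_abs_sqrt_coeff)

lemma infsum_sqrt_coeff: "infsum sqrt_coeff UNIV \<ge> 0"
proof -
  have "sqrt_coeff sums infsum sqrt_coeff UNIV"
    by (rule has_sum_imp_sums[OF has_sum_infsum[OF sqrt_coeff_summable_on']])
  then have "(\<lambda>n. \<Sum>k\<le>n. sqrt_coeff k) \<longlonglongrightarrow> infsum sqrt_coeff UNIV" by (simp add: sums_def_le)
  then show ?thesis by (rule LIMSEQ_le_const) (auto intro: sum_sqrt_coeff)
qed

text \<open>Vandermonde's identity for 1/2 + 1/2 = 1: the Cauchy square of the series is 1 -
  t.\<close>

lemma sqrt_coeff_convolution:
  "(\<Sum>i\<le>n. sqrt_coeff i * sqrt_coeff (n - i)) = (if n = 0 then 1 else if n = 1 then -1 else 0)"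
proof -
  have "(\<Sum>i\<le>n. sqrt_coeff i * sqrt_coeff (n - i))
      = (\<Sum>i\<le>n. (-1)^n * (((1/2) gchoose i) * ((1/2) gchoose (n - i))))"
  proof (rule sum.cong)
    fix i assume "i \<in> {..n}"
    then have "(-1::real)^n = (-1)^i * (-1)^(n-i)" by (simp add: power_add[symmetric])
    then show "sqrt_coeff i * sqrt_coeff (n - i) = (-1)^n * (((1/2) gchoose i) * ((1/2) gchoose (n - i)))"
      by (simp add: sqrt_coeff_def)
  qed simp
  also have "\<dots> = (-1)^n * ((1/2 + 1/2 :: real) gchoose n)"
    by (simp only: sum_distrib_left[symmetric] gbinomial_Vandermonde[symmetric] atLeast0AtMost)
  also have "(1/2 + 1/2 :: real) gchoose n = of_nat (1 choose n)"
    using binomial_gbinomial[of 1 n, where ?'a=real] by simp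
  also have "(-1)^n * real (1 choose n) = (if n = 0 then 1 else if n = 1 then -1 else 0)"
    by (auto simp: binomial_eq_0)
  finally show ?thesis .
qed

text \<open>This is (I - X)^(1/2) for a self-adjoint contraction X. Two cases occur: X = Z^* Z for
  the defect operator of Z, and X = (I + Y_R)/2, for which I - Y_R = 2 (I - X).\<close>

definition sqrt_series :: "('a::complex_hilbert_space \<Rightarrow> 'a) \<Rightarrow> 'a \<Rightarrow> 'a"
  where "sqrt_series X x = (\<Sum>\<^sub>\<infinity>n. sqrt_coeff n *\<^sub>R (X ^^ n) x)"

lemma csub_infsum:
  fixes f :: "nat \<Rightarrow> 'a::complex_hilbert_space"
  assumes "csub H" "f summable_on UNIV" "\<And>n. f n \<in> H" shows "infsum f UNIV \<in> H"
proof -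
  have "f sums infsum f UNIV" by (rule has_sum_imp_sums[OF has_sum_infsum[OF assms(2)]])
  then have lim: "(\<lambda>n. \<Sum>i<n. f i) \<longlonglongrightarrow> infsum f UNIV" by (simp add: sums_def)
  have "(\<Sum>i<n. f i) \<in> H" for n
    by (rule complex_vector.subspace_sum[OF csub_csubspace[OF assms(1)]]) (rule assms(3))
  then show ?thesis by (rule closed_sequentially[OF csub_closed[OF assms(1)] _ lim])
qed

section \<open>The binomial series of a self-adjoint contraction\<close>

locale sa_contraction =
  fixes H :: "'a::complex_hilbert_space set" and X :: "'a \<Rightarrow> 'a"
  assumes H: "csub H" and bX: "bounded_op H H X"
    and sym: "\<And>x y. x \<in> H \<Longrightarrow> y \<in> H \<Longrightarrow> cinner (X x) y = cinner x (X y)"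
    and contr: "\<And>x. x \<in> H \<Longrightarrow> norm (X x) \<le> norm x"
begin

lemma pow_mem: "x \<in> H \<Longrightarrow> (X ^^ n) x \<in> H"
  by (induction n) (auto intro: bop_mem[OF bX])

lemma pow_norm: "x \<in> H \<Longrightarrow> norm ((X ^^ n) x) \<le> norm x"
proof (induction n)
  case (Suc n)
  then show ?case using contr[OF pow_mem[OF Suc.prems, of n]] by simp
qed simp

lemma pow_bop: "bounded_op H H (X ^^ n)"
proof (rule bopI[where b=1])
  fix x y assume "x \<in> H" "y \<in> H"
  then show "(X ^^ n) (x + y) = (X ^^ n) x + (X ^^ n) y"
    by (induction n) (simp_all add: bop_add[OF bX] pow_mem)
next
  fix c x assume "x \<in> H"
  then show "(X ^^ n) (c *\<^sub>C x) = c *\<^sub>C (X ^^ n) x"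
    by (induction n) (simp_all add: bop_scaleC[OF bX] pow_mem)
qed (use pow_mem pow_norm in auto)

lemma pow_sym: "x \<in> H \<Longrightarrow> y \<in> H \<Longrightarrow> cinner ((X ^^ n) x) y = cinner x ((X ^^ n) y)"
proof (induction n arbitrary: y)
  case (Suc n)
  then show ?case using sym[OF pow_mem[OF Suc.prems(1)] Suc.prems(2)] bop_mem[OF bX]
    by (simp add: funpow_swap1)
qed simp

lemma summ: assumes "x \<in> H" shows "(\<lambda>n. sqrt_coeff n *\<^sub>R (X ^^ n) x) summable_on UNIV"
proof -
  have "summable (\<lambda>n. norm (sqrt_coeff n *\<^sub>R (X ^^ n) x))"
  proof (rule summable_comparison_test')
    show "summable (\<lambda>n. \<bar>sqrt_coeff n\<bar> * norm x)"
      by (intro summable_mult2 summable_abs_sqrt_coeff)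
    show "norm (norm (sqrt_coeff n *\<^sub>R (X ^^ n) x)) \<le> \<bar>sqrt_coeff n\<bar> * norm x" if "n \<ge> 0" for n
      using pow_norm[OF assms] by (simp add: mult_left_mono)
  qed
  then show ?thesis by (rule norm_summable_imp_summable_on)
qed

lemma series_mem: "x \<in> H \<Longrightarrow> sqrt_series X x \<in> H"
  unfolding sqrt_series_def
  by (intro csub_infsum H summ) (auto intro: csub_scaleR[OF H] pow_mem)

lemma series_linear:
  assumes "bounded_linear f" "x \<in> H"
  shows "f (sqrt_series X x) = (\<Sum>\<^sub>\<infinity>n. sqrt_coeff n *\<^sub>R f ((X ^^ n) x))"
    and "(\<lambda>n. sqrt_coeff n *\<^sub>R f ((X ^^ n) x)) summable_on UNIV"
proof -
  interpret f: bounded_linear f by fact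
  have "((\<lambda>n. sqrt_coeff n *\<^sub>R (X ^^ n) x) has_sum sqrt_series X x) UNIV"
    unfolding sqrt_series_def using summ[OF assms(2)] by simp
  then have "((\<lambda>n. f (sqrt_coeff n *\<^sub>R (X ^^ n) x)) has_sum f (sqrt_series X x)) UNIV"
    by (rule has_sum_bounded_linear[OF assms(1)])
  then have *: "((\<lambda>n. sqrt_coeff n *\<^sub>R f ((X ^^ n) x)) has_sum f (sqrt_series X x)) UNIV"
    by (simp add: f.scaleR)
  then show "f (sqrt_series X x) = (\<Sum>\<^sub>\<infinity>n. sqrt_coeff n *\<^sub>R f ((X ^^ n) x))"
    by (simp add: infsumI)
  show "(\<lambda>n. sqrt_coeff n *\<^sub>R f ((X ^^ n) x)) summable_on UNIV"
    using * summable_on_def by blast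
qed

lemma series_bop: "bounded_op H H (sqrt_series X)"
proof (rule bopI[where b="infsum (\<lambda>n. \<bar>sqrt_coeff n\<bar>) UNIV"])
  fix x assume x: "x \<in> H"
  then show "sqrt_series X x \<in> H" by (rule series_mem)
  show "sqrt_series X (c *\<^sub>C x) = c *\<^sub>C sqrt_series X x" for c
    unfolding series_linear(1)[OF bounded_linear_scaleC x]
    by (simp add: sqrt_series_def bop_scaleC[OF pow_bop x])
  have s: "(\<lambda>n. \<bar>sqrt_coeff n\<bar> * norm x) summable_on UNIV"
    by (intro summable_on_cmult_left sqrt_coeff_summable_on)
  have "norm (sqrt_series X x) \<le> infsum (\<lambda>n. \<bar>sqrt_coeff n\<bar> * norm x) UNIV"
    unfolding sqrt_series_def
  proof (rule norm_infsum_le)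
    show "((\<lambda>n. sqrt_coeff n *\<^sub>R (X ^^ n) x) has_sum (\<Sum>\<^sub>\<infinity>n. sqrt_coeff n *\<^sub>R (X ^^ n) x)) UNIV"
      using summ[OF x] by simp
    show "((\<lambda>n. \<bar>sqrt_coeff n\<bar> * norm x) has_sum (\<Sum>\<^sub>\<infinity>n. \<bar>sqrt_coeff n\<bar> * norm x)) UNIV"
      using s by simp
  qed (use pow_norm[OF x] in \<open>simp add: mult_left_mono\<close>)
  then show "norm (sqrt_series X x) \<le> infsum (\<lambda>n. \<bar>sqrt_coeff n\<bar>) UNIV * norm x"
    by (simp add: infsum_cmult_left')
next
  fix x y assume x: "x \<in> H" and y: "y \<in> H"
  have "(\<Sum>\<^sub>\<infinity>n. sqrt_coeff n *\<^sub>R (X ^^ n) x + sqrt_coeff n *\<^sub>R (X ^^ n) y)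
      = sqrt_series X x + sqrt_series X y"
    unfolding sqrt_series_def by (intro infsum_add summ x y)
  then show "sqrt_series X (x + y) = sqrt_series X x + sqrt_series X y"
    by (simp add: sqrt_series_def bop_add[OF pow_bop x y] scaleR_add_right)
qed

lemma series_sym:
  assumes x: "x \<in> H" and y: "y \<in> H"
  shows "cinner (sqrt_series X x) y = cinner x (sqrt_series X y)"
  using series_linear(1)[OF bounded_bilinear.bounded_linear_left[OF bounded_bilinear_cinner] x]
    series_linear(1)[OF bounded_bilinear.bounded_linear_right[OF bounded_bilinear_cinner] y]
  by (simp add: pow_sym[OF x y])

text \<open>Since (X^n x, x) \<le> |x|^2 and the coefficients after the first are nonpositive, the
  form is bounded below, term by term, by |x|^2 times the sum of all coefficients, which is
  nonnegative. Symmetry makes the form real.\<close>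

lemma series_pos:
  assumes x: "x \<in> H" shows "cinner (sqrt_series X x) x \<in> \<real>\<^sub>\<ge>\<^sub>0"
proof -
  have "cinner (sqrt_series X x) x = cnj (cinner (sqrt_series X x) x)"
    using series_sym[OF x x] by (metis cinner_commute)
  then have im: "Im (cinner (sqrt_series X x) x) = 0"
    by (metis Reals_cnj_iff complex_is_Real_iff)
  have bl: "bounded_linear (\<lambda>v. inner v x)" by (rule bounded_linear_inner_left)
  have "inner (sqrt_series X x) x = (\<Sum>\<^sub>\<infinity>n. sqrt_coeff n *\<^sub>R inner ((X ^^ n) x) x)"
    by (rule series_linear(1)[OF bl x])
  also have "\<dots> \<ge> (\<Sum>\<^sub>\<infinity>n. sqrt_coeff n * (norm x)\<^sup>2)"
  proof (rule infsum_mono)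
    show "(\<lambda>n. sqrt_coeff n * (norm x)\<^sup>2) summable_on UNIV"
      by (intro summable_on_cmult_left sqrt_coeff_summable_on')
    show "(\<lambda>n. sqrt_coeff n *\<^sub>R inner ((X ^^ n) x) x) summable_on UNIV"
      by (rule series_linear(2)[OF bl x])
    fix n :: nat
    show "sqrt_coeff n * (norm x)\<^sup>2 \<le> sqrt_coeff n *\<^sub>R inner ((X ^^ n) x) x"
    proof (cases n)
      case 0
      then show ?thesis by (simp add: power2_norm_eq_inner[symmetric])
    next
      case (Suc m)
      have "inner ((X ^^ n) x) x \<le> norm ((X ^^ n) x) * norm x" by (rule norm_cauchy_schwarz)
      also have "\<dots> \<le> norm x * norm x" using pow_norm[OF x] by (simp add: mult_right_mono)
      finally have "inner ((X ^^ n) x) x \<le> (norm x)\<^sup>2" by (simp add: power2_eq_square)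
      then show ?thesis using sqrt_coeff_Suc[of m] Suc by (simp add: mult_left_mono_neg)
    qed
  qed
  also have "(\<Sum>\<^sub>\<infinity>n. sqrt_coeff n * (norm x)\<^sup>2) = infsum sqrt_coeff UNIV * (norm x)\<^sup>2"
    by (rule infsum_cmult_left')
  finally have "inner (sqrt_series X x) x \<ge> 0"
    using infsum_sqrt_coeff by (smt (verit) mult_nonneg_nonneg zero_le_power2)
  then show ?thesis using im by (simp add: complex_nonneg_Reals_iff inner_eq_Re_cinner)
qed

text \<open>Cauchy product: the double family is absolutely summable, hence may be regrouped by k =
  n + m, and the convolution leaves only k = 0 and k = 1.\<close>

lemma series_square:
  assumes x: "x \<in> H" shows "sqrt_series X (sqrt_series X x) = x - X x"
proof -
  let ?b = sqrt_coeff
  define g where "g = (\<lambda>n m. (?b n * ?b m) *\<^sub>R (X ^^ (n + m)) x)"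
  have "(\<lambda>(n, m). g n m) summable_on UNIV \<times> UNIV"
  proof (rule abs_summable_summable)
    show "(\<lambda>z. norm ((\<lambda>(n, m). g n m) z)) summable_on UNIV \<times> UNIV"
    proof (rule nonneg_bdd_above_summable_on)
      define c where "c = suminf (\<lambda>n. \<bar>?b n\<bar>)"
      have fin: "(\<Sum>n\<in>F. \<bar>?b n\<bar>) \<le> c" if "finite F" for F
        unfolding c_def using that by (intro sum_le_suminf summable_abs_sqrt_coeff) auto
      have "sum (\<lambda>z. norm ((\<lambda>(n, m). g n m) z)) F \<le> c * c * norm x" if F: "finite F" for F
      proof -
        let ?A = "fst ` F" and ?B = "snd ` F"
        have "sum (\<lambda>z. norm ((\<lambda>(n, m). g n m) z)) F
            \<le> sum (\<lambda>z. norm ((\<lambda>(n, m). g n m) z)) (?A \<times> ?B)"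
          using F by (intro sum_mono2) (auto intro: rev_image_eqI)
        also have "\<dots> \<le> sum (\<lambda>(n, m). \<bar>?b n\<bar> * \<bar>?b m\<bar> * norm x) (?A \<times> ?B)"
          using pow_norm[OF x] by (intro sum_mono) (auto simp: g_def abs_mult mult_left_mono)
        also have "\<dots> = (\<Sum>n\<in>?A. \<bar>?b n\<bar>) * (\<Sum>m\<in>?B. \<bar>?b m\<bar>) * norm x"
          by (subst sum_product) (simp add: sum.cartesian_product[symmetric] sum_distrib_right)
        also have "\<dots> \<le> c * c * norm x"
          using F by (intro mult_right_mono mult_mono fin) (auto intro!: sum_nonneg order_trans[OF _ fin[of "{}"]])
        finally show ?thesis .
      qed
      then show "bdd_above (sum (\<lambda>z. norm ((\<lambda>(n, m). g n m) z)) ` {F. F \<subseteq> UNIV \<times> UNIV \<and> finite F})"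
        by (auto intro!: bdd_aboveI)
    qed auto
  qed
  note S = this
  have "sqrt_series X (sqrt_series X x) = (\<Sum>\<^sub>\<infinity>n. ?b n *\<^sub>R (X ^^ n) (sqrt_series X x))"
    by (simp add: sqrt_series_def)
  also have "\<dots> = (\<Sum>\<^sub>\<infinity>n. \<Sum>\<^sub>\<infinity>m. g n m)"
  proof (rule infsum_cong)
    fix n
    have bl: "bounded_linear (\<lambda>v. ?b n *\<^sub>R (X ^^ n) (proj H v))"
      by (intro bounded_linear_const_scaleR bounded_linear_bop_proj[OF H pow_bop])
    show "?b n *\<^sub>R (X ^^ n) (sqrt_series X x) = (\<Sum>\<^sub>\<infinity>m. g n m)"
      using series_linear(1)[OF bl x]
      by (simp add: proj_id[OF H] series_mem[OF x] pow_mem[OF x] g_def funpow_add mult.commute)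
  qed
  also have "\<dots> = infsum (\<lambda>(n, m). g n m) (UNIV \<times> UNIV)" by (rule infsum_Sigma'_banach[OF S])
  also have "\<dots> = infsum (\<lambda>(k, i). g i (k - i)) (Sigma UNIV (\<lambda>k. {..k}))"
  proof -
    have bij: "bij_betw (\<lambda>(k, i). (i, k - i)) (Sigma UNIV (\<lambda>k::nat. {..k})) (UNIV \<times> UNIV)"
      by (rule bij_betwI[where g="\<lambda>(n, m). (n + m, n)"]) auto
    show ?thesis
      using infsum_reindex_bij_betw[OF bij, of "\<lambda>(n, m). g n m"] by (simp add: case_prod_unfold)
  qed
  also have "\<dots> = (\<Sum>\<^sub>\<infinity>k. infsum (\<lambda>i. g i (k - i)) {..k})"
  proof (rule infsum_Sigma'_banach[symmetric])
    have bij: "bij_betw (\<lambda>(k, i). (i, k - i)) (Sigma UNIV (\<lambda>k::nat. {..k})) (UNIV \<times> UNIV)"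
      by (rule bij_betwI[where g="\<lambda>(n, m). (n + m, n)"]) auto
    show "(\<lambda>(k, i). g i (k - i)) summable_on Sigma UNIV (\<lambda>k. {..k})"
      using summable_on_reindex_bij_betw[OF bij, of "\<lambda>(n, m). g n m"] S by (simp add: case_prod_unfold)
  qed
  also have "\<dots> = (\<Sum>\<^sub>\<infinity>k. (if k = 0 then 1 else if k = 1 then -1 else 0 :: real) *\<^sub>R (X ^^ k) x)"
  proof (rule infsum_cong)
    fix k :: nat
    have "infsum (\<lambda>i. g i (k - i)) {..k} = (\<Sum>i\<le>k. (?b i * ?b (k - i)) *\<^sub>R (X ^^ k) x)"
      by (simp add: g_def)
    also have "\<dots> = (\<Sum>i\<le>k. ?b i * ?b (k - i)) *\<^sub>R (X ^^ k) x" by (simp add: scaleR_sum_left)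
    finally show "infsum (\<lambda>i. g i (k - i)) {..k}
        = (if k = 0 then 1 else if k = 1 then -1 else 0 :: real) *\<^sub>R (X ^^ k) x"
      by (simp only: sqrt_coeff_convolution)
  qed
  also have "\<dots> = infsum (\<lambda>k. (if k = 0 then 1 else if k = 1 then -1 else 0 :: real) *\<^sub>R (X ^^ k) x) {0, 1}"
    by (rule infsum_cong_neutral) auto
  also have "\<dots> = x - X x" by simp
  finally show ?thesis .
qed

end

text \<open>The relation T X = X' T passes to powers and to the sum. It makes operators that commute
  with X commute with the root, and it will yield Y D_Y = D Y with D the defect operator of the
  adjoint.\<close>

lemma series_intertwine:
  assumes "sa_contraction H X" "sa_contraction K X'" "bounded_op H K T"
    "\<And>x. x \<in> H \<Longrightarrow> T (X x) = X' (T x)" "x \<in> H"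
  shows "T (sqrt_series X x) = sqrt_series X' (T x)"
proof -
  interpret A: sa_contraction H X by fact
  have p: "T ((X ^^ n) x) = (X' ^^ n) (T x)" for n
    by (induction n) (simp_all add: assms A.pow_mem)
  have "T (sqrt_series X x) = (\<Sum>\<^sub>\<infinity>n. sqrt_coeff n *\<^sub>R (X' ^^ n) (T x))"
    using A.series_linear(1)[OF bounded_linear_bop_proj[OF A.H assms(3)] assms(5)]
    by (simp add: proj_id[OF A.H] A.series_mem[OF assms(5)] A.pow_mem[OF assms(5)] p)
  then show ?thesis by (simp add: sqrt_series_def)
qed

section \<open>Positive operators and uniqueness of the positive square root\<close>

lemma positive_op_sym:
  assumes H: "csub H" and R: "positive_op H R" and x: "x \<in> H" and y: "y \<in> H"
  shows "cinner (R x) y = cinner x (R y)"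
proof -
  have b: "bounded_op H H R" using R by (simp add: positive_op_def)
  have re: "Im (cinner (R z) z) = 0" if "z \<in> H" for z
    using R that by (auto simp: positive_op_def complex_nonneg_Reals_iff)
  have "Im (cinner (R x) y) + Im (cinner (R y) x) = 0"
    using re[OF csub_add[OF H x y]] re[OF x] re[OF y] by (simp add: bop_add[OF b x y] cinner_lin)
  moreover have "Re (cinner (R y) x) - Re (cinner (R x) y) = 0"
    using re[OF csub_add[OF H x csub_scaleC[OF H y, of \<i>]]] re[OF x] re[OF y] csub_scaleC[OF H y, of \<i>]
    by (simp add: bop_add[OF b] bop_scaleC[OF b] x y cinner_lin)
  ultimately have "cinner (R x) y = cnj (cinner (R y) x)" by (simp add: complex_eq_iff)
  then show ?thesis by (metis cinner_commute)
qed

text \<open>If R y were nonzero, the form at y - t R y would be t^2 c - 2 t a with a = |R y|^2 > 0,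
  which is negative for small t > 0.\<close>

lemma positive_op_null:
  assumes H: "csub H" and R: "positive_op H R" and y: "y \<in> H" and z: "cinner (R y) y = 0"
  shows "R y = 0"
proof (rule ccontr)
  assume n: "R y \<noteq> 0"
  have b: "bounded_op H H R" using R by (simp add: positive_op_def)
  define a c where "a = (norm (R y))\<^sup>2" and "c = Re (cinner (R (R y)) (R y))"
  have Ry: "R y \<in> H" by (rule bop_mem[OF b y])
  have a: "a > 0" using n by (simp add: a_def)
  have c: "c \<ge> 0" using R Ry by (auto simp: positive_op_def complex_nonneg_Reals_iff c_def)
  \<comment> \<open>Small enough for t c \<le> a; the added 1 covers c = 0.\<close>
  define t where "t = a / (c + 1)"
  have t: "t > 0" using a c by (simp add: t_def)
  define w where "w = y - t *\<^sub>R R y"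
  have w: "w \<in> H" using y Ry H by (auto simp: w_def intro: csub_diff csub_scaleR)
  have "0 \<le> Re (cinner (R w) w)"
    using R w by (auto simp: positive_op_def complex_nonneg_Reals_iff)
  also have "cinner (R (R y)) y = cinner (R y) (R y)" by (rule positive_op_sym[OF H R Ry y])
  then have "Re (cinner (R w) w) = t * (t * c) - 2 * (t * a)"
    using y Ry csub_scaleR[OF H Ry, of t] z
    by (simp add: w_def bop_diff[OF H b] bop_scaleR[OF b] cinner_lin a_def c_def norm_sq_cinner
        algebra_simps)
  finally have "t * (2 * a) \<le> t * (t * c)" by linarith
  then have "2 * a \<le> t * c" using t by (simp only: mult_le_cancel_left_pos)
  moreover have "t * c \<le> a" using a c by (simp add: t_def divide_simps)
  ultimately show False using a by simp
qed

lemma (in sa_contraction) scaled_root: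
  assumes r: "r > 0"
  shows "positive_op H (\<lambda>x. sqrt r *\<^sub>R sqrt_series X x)"
    and "x \<in> H \<Longrightarrow> sqrt r *\<^sub>R sqrt_series X (sqrt r *\<^sub>R sqrt_series X x) = r *\<^sub>R (x - X x)"
proof -
  obtain k where k: "k > 0" "\<And>x. x \<in> H \<Longrightarrow> norm (sqrt_series X x) \<le> k * norm x"
    using bop_bound[OF series_bop] by metis
  have "bounded_op H H (\<lambda>x. sqrt r *\<^sub>R sqrt_series X x)"
    by (rule bopI[where b="sqrt r * k"])
      (use k r in \<open>auto simp: bop_add[OF series_bop] bop_scaleC[OF series_bop] scaleR_add_right
          scaleR_eq_scaleC scaleC_scaleC scaleC_add_right mult_ac norm_scaleC mult_left_mono
        intro: csub_scaleC[OF H] series_mem\<close>)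
  moreover have "cinner (sqrt r *\<^sub>R sqrt_series X x) x \<in> \<real>\<^sub>\<ge>\<^sub>0" if "x \<in> H" for x
    using series_pos[OF that] r by (auto simp: cinner_lin complex_nonneg_Reals_iff)
  ultimately show "positive_op H (\<lambda>x. sqrt r *\<^sub>R sqrt_series X x)" by (simp add: positive_op_def)
  show "x \<in> H \<Longrightarrow> sqrt r *\<^sub>R sqrt_series X (sqrt r *\<^sub>R sqrt_series X x) = r *\<^sub>R (x - X x)"
    using r by (simp add: bop_scaleR[OF series_bop] series_mem series_square)
qed

text \<open>R commutes with its square, hence with X and with the series root Q. So z = (R - Q) x
  satisfies (R + Q) z = 0; both forms vanish at z, whence R z = Q z = 0, and |z|^2 = (z, (R - Q) x)
  = 0.\<close>

lemma sqrt_unique: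
  assumes X: "sa_contraction H X" and r: "r > 0" and R: "positive_op H R"
    and RR: "\<And>x. x \<in> H \<Longrightarrow> R (R x) = r *\<^sub>R (x - X x)" and x: "x \<in> H"
  shows "R x = sqrt r *\<^sub>R sqrt_series X x"
proof -
  interpret sa_contraction H X by fact
  have b: "bounded_op H H R" using R by (simp add: positive_op_def)
  define Q where "Q = (\<lambda>x. sqrt r *\<^sub>R sqrt_series X x)"
  have Q: "positive_op H Q" unfolding Q_def by (rule scaled_root(1)[OF r])
  then have Qb: "bounded_op H H Q" by (simp add: positive_op_def)
  have QQ: "Q (Q x) = r *\<^sub>R (x - X x)" if "x \<in> H" for x
    unfolding Q_def by (rule scaled_root(2)[OF r that])
  have "R (X x) = X (R x)" if x: "x \<in> H" for x
  proof -
    have "r *\<^sub>R (R x - X (R x)) = R (R (R x))" using RR bop_mem[OF b x] by simp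
    also have "\<dots> = R (r *\<^sub>R (x - X x))" using RR x by simp
    also have "\<dots> = r *\<^sub>R (R x - R (X x))"
      using x bop_mem[OF bX x] by (simp add: bop_scaleR[OF b] bop_diff[OF H b] csub_diff[OF H])
    finally show ?thesis using r by simp
  qed
  then have comm: "R (Q x) = Q (R x)" if "x \<in> H" for x
    using series_intertwine[OF X X b _ that] that
    by (simp add: Q_def bop_scaleR[OF b series_mem])
  define z where "z = R x - Q x"
  have z: "z \<in> H" using x bop_mem[OF b] bop_mem[OF Qb] by (simp add: z_def csub_diff[OF H])
  have "R z + Q z = 0"
    using x bop_mem[OF b] bop_mem[OF Qb]
    by (simp add: z_def bop_diff[OF H b] bop_diff[OF H Qb] comm RR QQ)
  then have s0: "cinner (R z) z + cinner (Q z) z = 0" by (metis cinner_add_left cinner_zero_left)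
  have "cinner (R z) z \<in> \<real>\<^sub>\<ge>\<^sub>0" "cinner (Q z) z \<in> \<real>\<^sub>\<ge>\<^sub>0"
    using R Q z by (auto simp: positive_op_def)
  with s0 have "cinner (R z) z = 0" "cinner (Q z) z = 0"
    by (auto simp: complex_eq_iff complex_nonneg_Reals_iff)
  then have "R z = 0" "Q z = 0" using positive_op_null[OF H] R Q z by auto
  moreover have "cinner z z = cinner (R z) x - cinner (Q z) x"
    using positive_op_sym[OF H R z x] positive_op_sym[OF H Q z x] by (simp add: z_def cinner_lin)
  ultimately have "z = 0" by (simp add: cinner_zero_left)
  then show ?thesis by (simp add: z_def Q_def)
qed

text \<open>Uniqueness makes the values on H independent of the choice in \<open>sqrt_op\<close>, so
  there the root may be computed by the series.\<close>

lemma sqrt_op_props: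
  assumes X: "sa_contraction H X" and r: "r > 0" and A: "\<And>x. x \<in> H \<Longrightarrow> A x = r *\<^sub>R (x - X x)"
  shows "positive_op H (sqrt_op H A)" and "x \<in> H \<Longrightarrow> sqrt_op H A (sqrt_op H A x) = A x"
    and "x \<in> H \<Longrightarrow> sqrt_op H A x = sqrt r *\<^sub>R sqrt_series X x"
proof -
  interpret sa_contraction H X by fact
  have "\<exists>R. positive_op H R \<and> (\<forall>x\<in>H. R (R x) = A x)"
    using scaled_root[OF r] A by (intro exI[of _ "\<lambda>x. sqrt r *\<^sub>R sqrt_series X x"]) simp
  then have "positive_op H (sqrt_op H A) \<and> (\<forall>x\<in>H. sqrt_op H A (sqrt_op H A x) = A x)"
    unfolding sqrt_op_def by (rule someI_ex)
  then show *: "positive_op H (sqrt_op H A)" "x \<in> H \<Longrightarrow> sqrt_op H A (sqrt_op H A x) = A x" for x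
    by auto
  show "x \<in> H \<Longrightarrow> sqrt_op H A x = sqrt r *\<^sub>R sqrt_series X x"
    using sqrt_unique[OF X r *(1)] *(2) A by simp
qed

subsection \<open>Adjoints and defect operators\<close>

lemma adj_bop:
  assumes H: "csub H" and K: "csub K" and T: "bounded_op H K T"
  shows "bounded_op K H (adj H K T)"
proof -
  obtain b where b: "b > 0" "\<And>x. x \<in> H \<Longrightarrow> norm (T x) \<le> b * norm x" using bop_bound[OF T] by metis
  show ?thesis
  proof (rule bopI[where b=b])
    show "adj H K T x \<in> H" for x by (rule adj_mem[OF H T])
    show "norm (adj H K T x) \<le> b * norm x" for x
      by (rule adj_norm_le[OF H T]) (use b in auto)
    show "adj H K T (x + y) = adj H K T x + adj H K T y" for x y
      by (rule adj_eqI[OF H T]) (simp_all add: csub_add[OF H] adj_mem[OF H T] cinner_lin adj_cinner[OF H T])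
    show "adj H K T (c *\<^sub>C x) = c *\<^sub>C adj H K T x" for c x
      by (rule adj_eqI[OF H T]) (simp_all add: csub_scaleC[OF H] adj_mem[OF H T] cinner_lin adj_cinner[OF H T])
  qed
qed

lemma adj_adj:
  assumes H: "csub H" and K: "csub K" and T: "bounded_op H K T" and x: "x \<in> H"
  shows "adj K H (adj H K T) x = T x"
  by (rule adj_eqI[OF K adj_bop[OF H K T] bop_mem[OF T x]]) (simp add: adj_cinner'[OF H T x])

lemma contr_bop: "contraction_op H K T \<Longrightarrow> bounded_op H K T"
  by (simp add: contraction_op_def)

lemma contr_norm: "contraction_op H K T \<Longrightarrow> x \<in> H \<Longrightarrow> norm (T x) \<le> norm x"
  by (simp add: contraction_op_def)

lemma adj_contr:
  assumes H: "csub H" and K: "csub K" and T: "contraction_op H K T"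
  shows "contraction_op K H (adj H K T)"
  using adj_bop[OF H K contr_bop[OF T]] adj_norm_le[OF H contr_bop[OF T], of 1] contr_norm[OF T]
  by (simp add: contraction_op_def)

lemma isometry_contr: "isometry_op H K T \<Longrightarrow> contraction_op H K T"
  by (simp add: contraction_op_def isometry_op_def)

lemma isometry_bop: "isometry_op H K T \<Longrightarrow> bounded_op H K T"
  by (simp add: isometry_op_def)

lemma isometry_cong:
  assumes "csub H" "isometry_op H K T" "\<And>x. x \<in> H \<Longrightarrow> T' x = T x" shows "isometry_op H K T'"
  using assms bop_cong[OF assms(1) _ assms(3)] by (auto simp: isometry_op_def)

lemma isometry_cinner:
  assumes H: "csub H" and T: "bounded_op H K T" and n: "\<And>x. x \<in> H \<Longrightarrow> norm (T x) = norm x"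
    and x: "x \<in> H" and y: "y \<in> H"
  shows "cinner (T x) (T y) = cinner x y"
proof -
  have e: "Re (cinner (T x) (T y)) = Re (cinner x y)" if x: "x \<in> H" and y: "y \<in> H" for x y
  proof -
    have "(norm (T (x + y)))\<^sup>2 = (norm (x + y))\<^sup>2" using n csub_add[OF H x y] by simp
    moreover have "(norm (a + b))\<^sup>2 = (norm a)\<^sup>2 + (norm b)\<^sup>2 + 2 * Re (cinner a b)" for a b :: 'a
      by (simp add: norm_sq_cinner cinner_lin cinner_commute[of b a])
    ultimately show ?thesis using n[OF x] n[OF y] by (simp add: bop_add[OF T x y])
  qed
  show ?thesis
    using e[OF x y] e[OF x csub_scaleC[OF H y, of \<i>]]
    by (simp add: bop_scaleC[OF T y] cinner_lin complex_eq_iff)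
qed

lemma adj_isometry:
  assumes H: "csub H" and T: "isometry_op H K T" and x: "x \<in> H"
  shows "adj H K T (T x) = x"
  by (rule adj_eqI[OF H isometry_bop[OF T] x])
    (use isometry_cinner[OF H isometry_bop[OF T]] T x in \<open>auto simp: isometry_op_def\<close>)

lemma adj_unitary:
  assumes H: "csub H" and K: "csub K" and T: "unitary_op H K T"
  shows "unitary_op K H (adj H K T)"
proof -
  have i: "isometry_op H K T" and im: "T ` H = K" using T by (auto simp: unitary_op_def)
  have "norm (adj H K T x) = norm x" if x: "x \<in> K" for x
  proof -
    obtain k where "k \<in> H" "x = T k" using x im by blast
    then show ?thesis using i adj_isometry[OF H i] by (simp add: isometry_op_def)
  qed
  moreover have "(\<lambda>x. adj H K T (T x)) ` H = H" using adj_isometry[OF H i] by simp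
  then have "adj H K T ` K = H" using im by (simp add: image_image[symmetric])
  ultimately show ?thesis using adj_bop[OF H K isometry_bop[OF i]] by (simp add: unitary_op_def isometry_op_def)
qed

text \<open>Distances of preimages equal those of images, so the preimages of a convergent sequence
  form a Cauchy sequence in H.\<close>

lemma isometry_image_closed:
  assumes H: "csub H" and T: "bounded_op H K T" and n: "\<And>x. x \<in> H \<Longrightarrow> norm (T x) = norm x"
  shows "csub (T ` H)"
proof -
  have "closed (T ` H)"
    unfolding closed_sequential_limits
  proof (intro allI impI)
    fix u l assume u: "(\<forall>n. u n \<in> T ` H) \<and> u \<longlonglongrightarrow> l"
    then have "\<forall>n. \<exists>v. v \<in> H \<and> u n = T v" by blast
    then obtain v where v: "\<And>n. v n \<in> H" "\<And>n. u n = T (v n)" by metis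
    have "dist (v i) (v j) = dist (u i) (u j)" for i j
      using n[OF csub_diff[OF H v(1)[of i] v(1)[of j]]] v
      by (simp add: dist_norm bop_diff[OF H T])
    moreover have "Cauchy u" using u LIMSEQ_imp_Cauchy by blast
    ultimately have "Cauchy v" by (simp add: Cauchy_def)
    then obtain w where w: "v \<longlonglongrightarrow> w" using Cauchy_convergent_iff convergent_def by blast
    then have wH: "w \<in> H" using closed_sequentially[OF csub_closed[OF H] v(1)] by simp
    have "(\<lambda>n. T (v n)) \<longlonglongrightarrow> T w" by (rule bop_tendsto[OF H T v(1) w])
    then have "l = T w" using u v(2) LIMSEQ_unique by (metis (no_types, lifting) ext)
    then show "l \<in> T ` H" using wH by blast
  qed
  then show ?thesis using bop_image_csubspace[OF H T] by (simp add: csub_def)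
qed

lemma contraction_gram:
  assumes H: "csub H" and K: "csub K" and T: "contraction_op H K T"
  shows "sa_contraction H (\<lambda>x. adj H K T (T x))"
proof
  note b = contr_bop[OF T]
  show "csub H" by fact
  show "bounded_op H H (\<lambda>x. adj H K T (T x))"
  proof (rule bopI[where b=1])
    fix x assume x: "x \<in> H"
    have "norm (adj H K T (T x)) \<le> 1 * norm (T x)"
      using adj_contr[OF H K T] bop_mem[OF b x] contr_norm by fastforce
    then show "norm (adj H K T (T x)) \<le> 1 * norm x" using contr_norm[OF T x] by linarith
  qed (use bop_mem[OF b] bop_add[OF b] bop_scaleC[OF b] bop_add[OF adj_bop[OF H K b]]
      bop_scaleC[OF adj_bop[OF H K b]] adj_mem[OF H b] in auto)
  fix x assume x: "x \<in> H"
  show "cinner (adj H K T (T x)) y = cinner x (adj H K T (T y))" if "y \<in> H" for y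
    using x that by (simp add: adj_cinner[OF H b] adj_cinner'[OF H b])
  have "norm (adj H K T (T x)) \<le> norm (T x)"
    using adj_contr[OF H K T] bop_mem[OF b x] contr_norm by blast
  then show "norm (adj H K T (T x)) \<le> norm x" using contr_norm[OF T x] by linarith
qed

section \<open>The defect operator and the defect space of a contraction\<close>

locale contr =
  fixes H K :: "'a::complex_hilbert_space set" and Z :: "'a \<Rightarrow> 'a"
  assumes H: "csub H" and K: "csub K" and Z: "contraction_op H K Z"
begin

abbreviation "D \<equiv> defect_op H K Z"
abbreviation "KD \<equiv> defect_sp H K Z"

lemma D_eq: "x \<in> H \<Longrightarrow> D x = sqrt_series (\<lambda>x. adj H K Z (Z x)) x"
  unfolding defect_op_def
  using sqrt_op_props(3)[OF contraction_gram[OF H K Z], of 1 "\<lambda>x. x - adj H K Z (Z x)"] by simp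

lemma D_positive: "positive_op H D"
  unfolding defect_op_def
  using sqrt_op_props(1)[OF contraction_gram[OF H K Z], of 1 "\<lambda>x. x - adj H K Z (Z x)"] by simp

lemma D_bop: "bounded_op H H D"
  using D_positive by (simp add: positive_op_def)

lemma D_sq: "x \<in> H \<Longrightarrow> D (D x) = x - adj H K Z (Z x)"
  unfolding defect_op_def
  using sqrt_op_props(2)[OF contraction_gram[OF H K Z], of 1 "\<lambda>x. x - adj H K Z (Z x)"] by simp

lemma D_mem: "x \<in> H \<Longrightarrow> D x \<in> H"
  by (rule bop_mem[OF D_bop])

lemma D_sym: "x \<in> H \<Longrightarrow> y \<in> H \<Longrightarrow> cinner (D x) y = cinner x (D y)"
  by (rule positive_op_sym[OF H D_positive])

lemma D_norm:
  assumes x: "x \<in> H" shows "(norm (D x))\<^sup>2 = (norm x)\<^sup>2 - (norm (Z x))\<^sup>2"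
proof -
  have "cinner (D x) (D x) = cinner x (D (D x))" using D_sym[OF x D_mem[OF x]] .
  also have "\<dots> = cinner x x - cinner (Z x) (Z x)"
    using x by (simp add: D_sq cinner_lin adj_cinner[OF H contr_bop[OF Z]])
  finally show ?thesis by (simp add: norm_sq_cinner)
qed

lemma D_unique:
  assumes "positive_op H R" "\<And>x. x \<in> H \<Longrightarrow> R (R x) = x - adj H K Z (Z x)" "x \<in> H"
  shows "D x = R x"
  using sqrt_unique[OF contraction_gram[OF H K Z], of 1 R] assms D_eq by simp

lemma KD: "csub KD"
  unfolding defect_sp_def by (rule csubspace_closure[OF bop_image_csubspace[OF H D_bop]])

lemma KD_H: "KD \<subseteq> H"
  unfolding defect_sp_def using D_mem csub_closed[OF H] by (intro closure_minimal) auto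

lemma D_KD: "x \<in> H \<Longrightarrow> D x \<in> KD"
  unfolding defect_sp_def by (rule subsetD[OF closure_subset]) (rule imageI)

lemma D_orth:
  assumes "x \<in> H" "\<And>k. k \<in> KD \<Longrightarrow> cinner x k = 0" shows "D x = 0"
proof -
  have "cinner (D x) (D x) = cinner x (D (D x))" by (rule D_sym[OF assms(1) D_mem[OF assms(1)]])
  also have "\<dots> = 0" by (rule assms(2)[OF D_KD[OF D_mem[OF assms(1)]]])
  finally show ?thesis by simp
qed

text \<open>The kernel of a symmetric operator is orthogonal to its range, and \<open>KD\<close> is
  the closure of the range.\<close>

lemma D_inj: assumes "x \<in> KD" "D x = 0" shows "x = 0"
proof (rule dense_orth_0[OF bop_image_csubspace[OF H D_bop] _ assms(1)])
  show "KD = closure (D ` H)" by (simp add: defect_sp_def)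
  fix a assume "a \<in> D ` H"
  then obtain h where h: "h \<in> H" "a = D h" by blast
  have "x \<in> H" using assms(1) KD_H by blast
  then show "cinner x a = 0" using D_sym[OF _ h(1), of x] h assms(2) by simp
qed

lemma D_inj_on: "inj_on D KD"
proof (rule inj_onI)
  fix x y assume "x \<in> KD" "y \<in> KD" "D x = D y"
  then have "D (x - y) = 0" using KD_H by (simp add: bop_diff[OF H D_bop] subset_iff)
  then have "x - y = 0" by (rule D_inj[OF csub_diff[OF KD \<open>x \<in> KD\<close> \<open>y \<in> KD\<close>]])
  then show "x = y" by simp
qed

text \<open>D vanishes on the orthogonal complement of \<open>KD\<close>, so restriction to
  \<open>KD\<close> loses no range. With injectivity there, \<open>inv_into KD D\<close> is the
  Moore-Penrose inverse on ran D.\<close>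

lemma D_image: "D ` KD = D ` H"
proof
  show "D ` KD \<subseteq> D ` H" using KD_H by blast
  show "D ` H \<subseteq> D ` KD"
  proof
    fix y assume "y \<in> D ` H"
    then obtain x where x: "x \<in> H" "y = D x" by blast
    have p: "proj KD x \<in> KD" by (rule proj_mem[OF KD])
    then have pH: "proj KD x \<in> H" using KD_H by blast
    have "D (x - proj KD x) = 0"
      by (rule D_orth) (auto simp: csub_diff[OF H] x pH proj_orth[OF KD])
    then have "y = D (proj KD x)" using x pH by (simp add: bop_diff[OF H D_bop])
    then show "y \<in> D ` KD" using p by blast
  qed
qed

text \<open>If Z Z^* = I, then I - Z^* Z is an orthogonal projection, and a projection is its own
  positive square root.\<close>

lemma D_coisometry:
  assumes co: "\<And>w. w \<in> K \<Longrightarrow> Z (adj H K Z w) = w" and x: "x \<in> H"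
  shows "D x = x - adj H K Z (Z x)"
proof (rule D_unique[OF _ _ x])
  let ?P = "\<lambda>x. x - adj H K Z (Z x)"
  note b = contr_bop[OF Z]
  note ab = adj_bop[OF H K b]
  have m: "?P x \<in> H" if "x \<in> H" for x by (intro csub_diff[OF H] that adj_mem[OF H b])
  show PP: "?P (?P x) = ?P x" if x: "x \<in> H" for x
    using x bop_mem[OF b x] adj_mem[OF H b] by (simp add: bop_diff[OF H b] co bop_0[OF K ab])
  have Zn: "(norm (?P x))\<^sup>2 = (norm x)\<^sup>2 - (norm (Z x))\<^sup>2" if x: "x \<in> H" for x
    using x bop_mem[OF b x] adj_mem[OF H b]
    by (simp add: norm_sq_cinner cinner_lin adj_cinner[OF H b] adj_cinner'[OF H b] co)
  show "positive_op H ?P"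
    unfolding positive_op_def
  proof
    show "bounded_op H H ?P"
    proof (rule bopI[where b=1])
      fix x assume x: "x \<in> H"
      have "(norm (?P x))\<^sup>2 \<le> (norm x)\<^sup>2" using Zn[OF x] by simp
      from power2_le_imp_le[OF this norm_ge_zero] show "norm (?P x) \<le> 1 * norm x" by simp
    qed (use m in \<open>auto simp: bop_add[OF b] bop_scaleC[OF b] bop_add[OF ab] bop_scaleC[OF ab]
        bop_mem[OF b] scaleC_simps\<close>)
    show "\<forall>x\<in>H. cinner (?P x) x \<in> \<real>\<^sub>\<ge>\<^sub>0"
    proof
      fix x assume x: "x \<in> H"
      have "cinner (?P x) x = of_real ((norm x)\<^sup>2 - (norm (Z x))\<^sup>2)"
        using x by (simp add: cinner_lin adj_cinner'[OF H b] cinner_self)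
      also have "\<dots> = of_real ((norm (?P x))\<^sup>2)" using Zn[OF x] by simp
      finally show "cinner (?P x) x \<in> \<real>\<^sub>\<ge>\<^sub>0" by (simp del: of_real_power)
    qed
  qed
qed

end

section \<open>A contraction of one space together with its adjoint\<close>

locale sq_contr =
  fixes L :: "'a::complex_hilbert_space set" and Y :: "'a \<Rightarrow> 'a"
  assumes L: "csub L" and Y: "contraction_op L L Y"
begin

abbreviation "Ys \<equiv> adj L L Y"

lemma Ys: "contraction_op L L Ys"
  by (rule adj_contr[OF L L Y])

sublocale A: contr L L Y by standard (rule L L Y)+
sublocale B: contr L L Ys by standard (rule L L Ys)+

lemmas bY = contr_bop[OF Y]
lemmas bYs = contr_bop[OF Ys]

lemma dual: "sq_contr L Ys" by standard (rule L Ys)+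

lemma Yss: "x \<in> L \<Longrightarrow> adj L L Ys x = Y x"
  by (rule adj_adj[OF L L bY])

lemma intertwine: assumes x: "x \<in> L" shows "Y (A.D x) = B.D (Y x)"
  unfolding A.D_eq[OF x] B.D_eq[OF bop_mem[OF bY x]]
  by (rule series_intertwine[OF contraction_gram[OF L L Y] contraction_gram[OF L L Ys] bY _ x])
    (simp add: Yss bop_mem[OF bY] bop_mem[OF bYs])

text \<open>The second adjoint is known to agree with Y on L only, so the two defect operators stem
  from separate choices of root; uniqueness identifies their values on L.\<close>

lemma defect_Yss: assumes x: "x \<in> L" shows "defect_op L L (adj L L Ys) x = A.D x"
proof (rule sym, rule A.D_unique[OF _ _ x])
  have c: "contr L L (adj L L Ys)" by standard (rule L adj_contr[OF L L Ys])+
  show "positive_op L (defect_op L L (adj L L Ys))" by (rule contr.D_positive[OF c])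
  fix x assume x: "x \<in> L"
  have "adj L L (adj L L Ys) (adj L L Ys x) = Ys (Y x)"
    using x by (simp add: Yss adj_adj[OF L L bYs] bop_mem[OF bY])
  then show "defect_op L L (adj L L Ys) (defect_op L L (adj L L Ys) x) = x - Ys (Y x)"
    using contr.D_sq[OF c x] by simp
qed

lemma intertwine': assumes x: "x \<in> L" shows "Ys (B.D x) = A.D (Ys x)"
  using sq_contr.intertwine[OF dual x] defect_Yss[OF bop_mem[OF bYs x]] by simp

text \<open>Intertwining gives this on the range of D_Y, which is dense in the defect space, and Y
  is continuous.\<close>

lemma Y_KD: assumes "w \<in> A.KD" shows "Y w \<in> B.KD"
proof -
  from assms obtain u where u: "\<And>n. u n \<in> A.D ` L" "u \<longlonglongrightarrow> w"
    by (auto simp: defect_sp_def closure_sequential)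
  have uL: "u n \<in> L" for n using u(1)[of n] by (auto intro: A.D_mem)
  have "Y (u n) \<in> B.KD" for n using u(1)[of n] B.D_KD bop_mem[OF bY] by (auto simp: intertwine)
  moreover have "(\<lambda>n. Y (u n)) \<longlonglongrightarrow> Y w" by (rule bop_tendsto[OF L bY uL u(2)])
  ultimately show ?thesis by (rule closed_sequentially[OF csub_closed[OF B.KD]])
qed

lemma defect_Yss_image: "defect_op L L (adj L L Ys) ` L = A.D ` L"
  by (rule image_cong[OF refl defect_Yss])

lemma Ys_KD: "w \<in> B.KD \<Longrightarrow> Ys w \<in> A.KD"
  using sq_contr.Y_KD[OF dual] by (simp add: defect_sp_def defect_Yss_image)

text \<open>In |Y^* x - x|^2 both cross terms are (x, Y x) = |x|^2, which leaves |Y^* x|^2 - |x|^2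
  \<le> 0. So I - Y and its adjoint are injective together.\<close>

lemma fix_adj:
  assumes "x \<in> L" "Y x = x" shows "Ys x = x"
proof -
  have "(norm (Ys x - x))\<^sup>2 = (norm (Ys x))\<^sup>2 - (norm x)\<^sup>2"
    using assms by (simp add: norm_sq_cinner cinner_lin adj_cinner[OF L bY] adj_cinner'[OF L bY])
  also have "\<dots> \<le> 0" using contr_norm[OF Ys assms(1)] by simp
  finally show ?thesis by simp
qed

end

subsection \<open>Hilbert space dimension\<close>

definition orthonormal :: "'a::complex_hilbert_space set \<Rightarrow> bool"
  where "orthonormal B \<longleftrightarrow> (\<forall>x\<in>B. \<forall>y\<in>B. cinner x y = (if x = y then 1 else 0))"

lemma orthonormal_norm: "orthonormal B \<Longrightarrow> x \<in> B \<Longrightarrow> norm x = 1"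
proof -
  assume "orthonormal B" "x \<in> B"
  then have "cinner x x = 1" by (simp add: orthonormal_def)
  then have "(norm x)\<^sup>2 = 1" by (simp add: norm_sq_cinner)
  then show ?thesis by (metis norm_ge_zero power2_eq_1_iff abs_norm_cancel abs_one one_neq_neg_one not_one_le_zero neg_0_le_iff_le)
qed

lemma orthonormal_proj_norm:
  assumes "orthonormal F" "finite F" "\<And>b. b \<in> F \<Longrightarrow> c b = cinner x b"
  shows "(norm (x - (\<Sum>b\<in>F. c b *\<^sub>C b)))\<^sup>2 = (norm x)\<^sup>2 - (\<Sum>b\<in>F. (cmod (cinner x b))\<^sup>2)"
proof -
  let ?p = "\<Sum>b\<in>F. c b *\<^sub>C b"
  have sl: "cinner (\<Sum>b\<in>F. c b *\<^sub>C b) y = (\<Sum>b\<in>F. c b * cinner b y)" for y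
    using assms(2) by (induction F rule: finite_induct) (auto simp: cinner_lin)
  have sr: "cinner y (\<Sum>b\<in>F. c b *\<^sub>C b) = (\<Sum>b\<in>F. cnj (c b) * cinner y b)" for y
    using assms(2) by (induction F rule: finite_induct) (auto simp: cinner_lin)
  have pb: "cinner ?p b = c b" if "b \<in> F" for b
  proof -
    have "cinner ?p b = (\<Sum>a\<in>F. if a = b then c a else 0)"
      unfolding sl using assms(1) that by (intro sum.cong) (auto simp: orthonormal_def)
    then show ?thesis using assms(2) that by simp
  qed
  have cz: "z * cnj z = of_real ((cmod z)\<^sup>2)" "cnj z * z = of_real ((cmod z)\<^sup>2)" for z
    by (simp_all only: complex_norm_square mult.commute)
  have "cinner ?p ?p = (\<Sum>b\<in>F. of_real ((cmod (cinner x b))\<^sup>2))"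
    unfolding sr using pb assms(3) by (intro sum.cong) (simp_all add: cz del: of_real_power)
  moreover have "cinner x ?p = (\<Sum>b\<in>F. of_real ((cmod (cinner x b))\<^sup>2))"
    unfolding sr using assms(3) by (intro sum.cong) (simp_all add: cz del: of_real_power)
  moreover have "cinner ?p x = cnj (cinner x ?p)" by (rule cinner_commute)
  ultimately have "cinner (x - ?p) (x - ?p) = cinner x x - (\<Sum>b\<in>F. of_real ((cmod (cinner x b))\<^sup>2))"
    by (simp add: cinner_lin)
  then have "of_real ((norm (x - ?p))\<^sup>2)
      = (of_real ((norm x)\<^sup>2 - (\<Sum>b\<in>F. (cmod (cinner x b))\<^sup>2)) :: complex)"
    unfolding cinner_self by simp
  then show ?thesis by (simp only: of_real_eq_iff)
qed

lemma bessel: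
  assumes "orthonormal F" "finite F" shows "(\<Sum>b\<in>F. (cmod (cinner x b))\<^sup>2) \<le> (norm x)\<^sup>2"
  using orthonormal_proj_norm[OF assms, of "cinner x" x] by (smt (verit) zero_le_power2)

text \<open>The residual of the Fourier sum lies in the closed span of F and is orthogonal to F, so
  it vanishes.\<close>

lemma parseval:
  assumes o: "orthonormal F" and f: "finite F" and x: "x \<in> closure (complex_vector.span F)"
  shows "(norm x)\<^sup>2 = (\<Sum>b\<in>F. (cmod (cinner x b))\<^sup>2)"
proof -
  define y where "y = x - (\<Sum>b\<in>F. cinner x b *\<^sub>C b)"
  have s: "(\<Sum>b\<in>F. cinner x b *\<^sub>C b) \<in> complex_vector.span F"
    by (intro complex_vector.span_sum complex_vector.span_scale complex_vector.span_base)
  have c: "csub (closure (complex_vector.span F))"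
    by (rule csubspace_closure[OF complex_vector.subspace_span])
  have "y \<in> closure (complex_vector.span F)"
    unfolding y_def using s closure_subset by (intro csub_diff[OF c x]) blast
  moreover have "cinner y b = 0" if "b \<in> F" for b
  proof -
    have "cinner (\<Sum>a\<in>F. cinner x a *\<^sub>C a) b = (\<Sum>a\<in>F. cinner x a * cinner a b)"
      using f by (induction F rule: finite_induct) (auto simp: cinner_lin)
    also have "\<dots> = (\<Sum>a\<in>F. if a = b then cinner x a else 0)"
      using o that by (intro sum.cong) (auto simp: orthonormal_def)
    finally show ?thesis using f that by (simp add: y_def cinner_lin)
  qed
  then have "complex_vector.span F \<subseteq> {b. cinner y b = 0}"
    by (intro complex_vector.span_minimal) (auto simp: complex_vector.subspace_def cinner_lin)
  ultimately have "y = 0"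
    using dense_orth_0[OF complex_vector.subspace_span refl] by blast
  then show ?thesis using orthonormal_proj_norm[OF o f, of "cinner x" x] by (simp add: y_def)
qed

text \<open>Double counting of |(c, b)|^2 over a finite part of C and over B: for each c Parseval
  gives 1, for each b Bessel gives at most 1.\<close>

lemma orthonormal_card_le:
  assumes B: "orthonormal B" "finite B" and C: "orthonormal C" "C \<subseteq> closure (complex_vector.span B)"
  shows "finite C \<and> card C \<le> card B"
proof -
  have "card F \<le> card B" if F: "finite F" "F \<subseteq> C" for F
  proof -
    have oF: "orthonormal F" using C(1) F(2) by (auto simp: orthonormal_def subset_iff)
    have "real (card F) = (\<Sum>c\<in>F. (norm c)\<^sup>2)" using orthonormal_norm[OF oF] by simp
    also have "\<dots> = (\<Sum>c\<in>F. \<Sum>b\<in>B. (cmod (cinner c b))\<^sup>2)"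
      using F C(2) by (intro sum.cong parseval[OF B]) auto
    also have "\<dots> = (\<Sum>b\<in>B. \<Sum>c\<in>F. (cmod (cinner c b))\<^sup>2)" by (rule sum.swap)
    also have "\<dots> = (\<Sum>b\<in>B. \<Sum>c\<in>F. (cmod (cinner b c))\<^sup>2)"
      by (intro sum.cong refl) (metis cinner_commute complex_mod_cnj)
    also have "\<dots> \<le> (\<Sum>b\<in>B. (norm b)\<^sup>2)" by (intro sum_mono bessel[OF oF F(1)])
    also have "\<dots> = real (card B)" using orthonormal_norm[OF B(1)] by simp
    finally show ?thesis by simp
  qed
  then show ?thesis by (metis finite_if_finite_subsets_card_bdd le_refl)
qed

text \<open>Zorn's lemma: a unit vector orthogonal to a maximal orthonormal set could be added to
  it.\<close>

lemma orthonormal_basis_ex: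
  assumes K: "csub K" shows "\<exists>B. orthonormal_basis B K"
proof -
  define A where "A = {B. orthonormal B \<and> B \<subseteq> K}"
  have "\<exists>M\<in>A. \<forall>X\<in>A. M \<subseteq> X \<longrightarrow> X = M"
  proof (rule subset_Zorn_nonempty)
    show "A \<noteq> {}" by (auto simp: A_def orthonormal_def intro!: exI[of _ "{}"])
    fix C assume C: "C \<noteq> {}" "subset.chain A C"
    have "orthonormal (\<Union>C)"
      unfolding orthonormal_def
    proof (intro ballI)
      fix x y assume "x \<in> \<Union>C" "y \<in> \<Union>C"
      then obtain X Y where XY: "x \<in> X" "X \<in> C" "y \<in> Y" "Y \<in> C" by blast
      then obtain Z where "Z \<in> C" "x \<in> Z" "y \<in> Z" using C(2) unfolding subset_chain_def by blast
      then show "cinner x y = (if x = y then 1 else 0)"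
        using C(2) by (auto simp: subset_chain_def A_def orthonormal_def)
    qed
    then show "\<Union>C \<in> A" using C(2) by (auto simp: subset_chain_def A_def)
  qed
  then obtain B where B: "B \<in> A" "\<And>X. X \<in> A \<Longrightarrow> B \<subseteq> X \<Longrightarrow> X = B" by blast
  have "closure (complex_vector.span B) = K"
  proof (rule dense_if_orth_0[OF complex_vector.subspace_span K])
    show "complex_vector.span B \<subseteq> K"
      using B(1) csub_csubspace[OF K] by (auto simp: A_def intro: complex_vector.span_minimal[THEN subsetD])
    fix x assume x: "x \<in> K" "\<And>a. a \<in> complex_vector.span B \<Longrightarrow> cinner x a = 0"
    show "x = 0"
    proof (rule ccontr)
      assume n: "x \<noteq> 0"
      define e where "e = (1 / norm x) *\<^sub>R x"
      have ex: "cinner e b = 0" if "b \<in> B" for b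
        using x(2)[OF complex_vector.span_base[OF that]] by (simp add: e_def cinner_lin)
      then have be: "cinner b e = 0" if "b \<in> B" for b using that cinner_eq_sym by blast
      have ee: "cinner e e = 1"
        using n by (simp add: e_def cinner_self)
      have "insert e B \<in> A"
        using B(1) csub_scaleR[OF K x(1), of "1 / norm x"] ex ee be
        by (auto simp: A_def orthonormal_def e_def[symmetric])
      from B(2)[OF this] have "e \<in> B" by blast
      then show False using ex ee by force
    qed
  qed
  then have "orthonormal_basis B K" using B(1) by (simp add: orthonormal_basis_def A_def orthonormal_def)
  then show ?thesis ..
qed

lemma orthonormal_basisD:
  assumes "orthonormal_basis B K" shows "orthonormal B" "closure (complex_vector.span B) = K" "B \<subseteq> K"
  using assms closure_subset complex_vector.span_superset
  by (auto simp: orthonormal_basis_def orthonormal_def)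

text \<open>Two bases of one space are both infinite or finite of equal size, so the definite
  description in \<open>hdim\<close> has exactly one candidate.\<close>

lemma hdim_eq:
  assumes "orthonormal_basis B K" shows "hdim K = (if finite B then enat (card B) else \<infinity>)"
  unfolding hdim_def
proof (rule the_equality)
  show "\<exists>B'. orthonormal_basis B' K \<and>
    (if finite B then enat (card B) else \<infinity>) = (if finite B' then enat (card B') else \<infinity>)"
    using assms by blast
  fix n assume "\<exists>B. orthonormal_basis B K \<and> n = (if finite B then enat (card B) else \<infinity>)"
  then obtain C where C: "orthonormal_basis C K" "n = (if finite C then enat (card C) else \<infinity>)" by blast
  note b = orthonormal_basisD[OF assms] and c = orthonormal_basisD[OF C(1)]
  have "finite B \<Longrightarrow> finite C \<and> card C \<le> card B"
    using orthonormal_card_le[OF b(1) _ c(1)] b(2) c(3) by simp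
  moreover have "finite C \<Longrightarrow> finite B \<and> card B \<le> card C"
    using orthonormal_card_le[OF c(1) _ b(1)] c(2) b(3) by simp
  ultimately show "n = (if finite B then enat (card B) else \<infinity>)" using C(2) by auto
qed

lemma hdim_isometry_le:
  assumes K: "csub K" and N: "csub N" and T: "isometry_op K N T"
  shows "hdim K \<le> hdim N"
proof -
  obtain B where B: "orthonormal_basis B K" using orthonormal_basis_ex[OF K] by blast
  obtain C where C: "orthonormal_basis C N" using orthonormal_basis_ex[OF N] by blast
  note b = orthonormal_basisD[OF B] and c = orthonormal_basisD[OF C]
  have ci: "cinner (T x) (T y) = cinner x y" if "x \<in> B" "y \<in> B" for x y
    using isometry_cinner[OF K isometry_bop[OF T]] T that b(3) by (auto simp: isometry_op_def)
  have inj: "inj_on T B"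
  proof (rule inj_onI)
    fix x y assume xy: "x \<in> B" "y \<in> B" "T x = T y"
    then have "cinner x y = cinner x x" using ci[of x y] ci[of x x] by simp
    then show "x = y" using b(1) xy by (auto simp: orthonormal_def split: if_splits)
  qed
  have "orthonormal (T ` B)"
    using b(1) ci inj by (auto simp: orthonormal_def inj_on_eq_iff)
  moreover have "T ` B \<subseteq> N" using bop_mem[OF isometry_bop[OF T]] b(3) by blast
  ultimately have "finite C \<Longrightarrow> finite (T ` B) \<and> card (T ` B) \<le> card C"
    using orthonormal_card_le[OF c(1)] c(2) by simp
  then show ?thesis
    unfolding hdim_eq[OF B] hdim_eq[OF C] using inj by (auto simp: card_image finite_image_iff)
qed

lemma hdim_unitary_eq:
  assumes K: "csub K" and N: "csub N" and T: "unitary_op K N T" shows "hdim K = hdim N"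
  using hdim_isometry_le[OF K N] hdim_isometry_le[OF N K] T adj_unitary[OF K N T]
  by (metis antisym unitary_op_def)

lemma hdim_eq_0: assumes K: "csub K" shows "hdim K = 0 \<longleftrightarrow> K = {0}"
proof -
  obtain B where B: "orthonormal_basis B K" using orthonormal_basis_ex[OF K] by blast
  note b = orthonormal_basisD[OF B]
  have "hdim K = 0 \<longleftrightarrow> B = {}"
    unfolding hdim_eq[OF B] by (auto simp: zero_enat_def)
  also have "\<dots> \<longleftrightarrow> K = {0}"
  proof
    assume "B = {}"
    then show "K = {0}" using b(2) by simp
  next
    assume "K = {0}"
    then show "B = {}" using b(3) orthonormal_norm[OF b(1)] by force
  qed
  finally show ?thesis .
qed

subsection \<open>Uniform boundedness and operator ranges\<close>

text \<open>Uniform boundedness principle. By Baire some \<open>E n\<close> contains a ball;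
  comparing the values at its centre and at a nearby point bounds (z, y) for all short z, in
  particular for z parallel to y.\<close>

lemma weakly_bounded_imp_bounded:
  fixes F :: "'b::{real_inner,complete_space} set"
  assumes "\<And>x. \<exists>c. \<forall>y\<in>F. \<bar>inner x y\<bar> \<le> c"
  shows "\<exists>C>0. \<forall>y\<in>F. norm y \<le> C"
proof -
  define E where "E n = {x. \<forall>y\<in>F. \<bar>inner x y\<bar> \<le> real n}" for n :: nat
  have cl: "closed (E n)" for n
  proof -
    have "E n = (\<Inter>y\<in>F. {x. \<bar>inner x y\<bar> \<le> real n})" by (auto simp: E_def)
    moreover have "closed {x. \<bar>inner x y\<bar> \<le> real n}" for y :: 'b
      by (intro closed_Collect_le continuous_intros)
    ultimately show ?thesis by auto
  qed
  have "\<Union>(range E) = UNIV"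
  proof -
    have "\<exists>n. x \<in> E n" for x
    proof -
      obtain c where "\<forall>y\<in>F. \<bar>inner x y\<bar> \<le> c" using assms by blast
      moreover obtain n where "c \<le> real n" using real_arch_simple by blast
      ultimately show ?thesis by (intro exI[of _ n]) (auto simp: E_def intro: order_trans)
    qed
    then show ?thesis by blast
  qed
  have "\<exists>n. interior (E n) \<noteq> {}"
  proof (rule ccontr)
    assume "\<not> ?thesis"
    then have "(euclidean :: 'b topology) interior_of \<Union>(range E) = {}"
      by (intro Baire_category_alt disjI1 completely_metrizable_space_euclidean)
        (auto simp: cl)
    then show False using \<open>\<Union>(range E) = UNIV\<close> by simp
  qed
  then obtain n x r where r: "r > 0" "ball x r \<subseteq> E n" by (auto simp: mem_interior)
  have "norm y \<le> 4 * (real n + 1) / r" if y: "y \<in> F" for y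
  proof (cases "y = 0")
    case False
    \<comment> \<open>The multiple of y of length r/2, which keeps x + z inside the ball.\<close>
    define z where "z = (r / (2 * norm y)) *\<^sub>R y"
    have "norm z < r" using False r(1) by (simp add: z_def)
    then have "x + z \<in> E n" "x \<in> E n" using r by (auto simp: dist_norm subset_iff)
    then have "\<bar>inner (x + z) y\<bar> \<le> real n" "\<bar>inner x y\<bar> \<le> real n" using y by (auto simp: E_def)
    then have "\<bar>inner z y\<bar> \<le> 2 * real n" by (simp add: inner_add_left)
    moreover have "inner z y = r * norm y / 2"
      using False by (simp add: z_def power2_norm_eq_inner[symmetric] power2_eq_square)
    ultimately have "r * norm y \<le> 4 * real n" using r(1) by simp
    then show ?thesis using r(1) by (simp add: pos_le_divide_eq mult.commute)
  qed (use r in simp)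
  then show ?thesis using r(1) by (intro exI[of _ "4 * (real n + 1) / r"]) auto
qed

text \<open>The weak bound shows that the adjoint is bounded below, hence onto; an operator with a
  surjective adjoint is bounded below.\<close>

lemma bounded_below_if_closed_range:
  fixes H :: "'b::{real_inner,complete_space} set" and A :: "'b \<Rightarrow> 'c::{real_inner,complete_space}"
  assumes H: "subspace H" "closed H"
    and add: "\<And>x y. x \<in> H \<Longrightarrow> y \<in> H \<Longrightarrow> A (x + y) = A x + A y"
    and sc: "\<And>c x. x \<in> H \<Longrightarrow> A (c *\<^sub>R x) = c *\<^sub>R A x"
    and bd: "\<And>x. x \<in> H \<Longrightarrow> norm (A x) \<le> b * norm x"
    and inj: "\<And>x. x \<in> H \<Longrightarrow> A x = 0 \<Longrightarrow> x = 0"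
    and cl: "closed (A ` H)"
  shows "\<exists>c>0. \<forall>x\<in>H. c * norm x \<le> norm (A x)"
proof -
  define K where "K = A ` H"
  have K0: "A 0 = 0" using sc[of 0 0] subspace_0[OF H(1)] by simp
  have K: "subspace K"
    unfolding K_def subspace_def
  proof (intro conjI ballI allI)
    show "0 \<in> A ` H" using K0 subspace_0[OF H(1)] by (metis image_eqI)
    show "x + y \<in> A ` H" if "x \<in> A ` H" "y \<in> A ` H" for x y
      using that add subspace_add[OF H(1)] by (smt (verit, best) imageE imageI)
    show "c *\<^sub>R x \<in> A ` H" if "x \<in> A ` H" for c x
      using that sc subspace_scale[OF H(1)] by (smt (verit, best) imageE imageI)
  qed
  \<comment> \<open>\<open>P y v\<close> states that v is the value at y of the adjoint of A for the
    real inner products.\<close>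
  define P where "P y v \<longleftrightarrow> v \<in> H \<and> (\<forall>h\<in>H. inner (A h) y = inner h v)" for y v
  have ex: "\<exists>v. P y v" for y
  proof -
    have "\<exists>v\<in>H. \<forall>h\<in>H. inner (A h) y = inner h v"
    proof (rule riesz_real[OF H, where b="b * norm y"])
      fix x assume x: "x \<in> H"
      have "\<bar>inner (A x) y\<bar> \<le> norm (A x) * norm y" by (rule Cauchy_Schwarz_ineq2)
      also have "\<dots> \<le> (b * norm x) * norm y" using bd[OF x] by (simp add: mult_right_mono)
      finally show "\<bar>inner (A x) y\<bar> \<le> b * norm y * norm x" by (simp add: mult_ac)
    qed (simp_all add: add sc inner_simps)
    then show ?thesis by (auto simp: P_def)
  qed
  \<comment> \<open>Range vectors whose adjoint image lies in the unit ball; a bound for F is a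
    lower bound for the adjoint on K.\<close>
  define F where "F = {y \<in> K. \<exists>v. P y v \<and> norm v \<le> 1}"
  have "\<exists>C>0. \<forall>y\<in>F. norm y \<le> C"
  proof (rule weakly_bounded_imp_bounded)
    fix x
    \<comment> \<open>As K is closed, x may be replaced by its projection onto K, which is some A h;
      then (A h, y) = (h, v) is bounded by |h|.\<close>
    have "\<exists>p\<in>K. \<forall>k\<in>K. inner k x = inner k p"
      by (rule riesz_real[OF K, where b="norm x"])
        (use cl in \<open>simp_all add: inner_simps K_def, metis Cauchy_Schwarz_ineq2 mult.commute\<close>)
    then obtain h where h: "h \<in> H" "\<And>k. k \<in> K \<Longrightarrow> inner k x = inner k (A h)"
      by (auto simp: K_def)
    have "\<bar>inner x y\<bar> \<le> norm h" if "y \<in> F" for y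
    proof -
      from that obtain v where v: "y \<in> K" "P y v" "norm v \<le> 1" by (auto simp: F_def)
      have "inner x y = inner y x" by (rule inner_commute)
      also have "\<dots> = inner (A h) y" using h(2)[OF v(1)] by (simp add: inner_commute)
      also have "\<dots> = inner h v" using h(1) v(2) by (simp add: P_def)
      finally have "inner x y = inner h v" .
      moreover have "\<bar>inner h v\<bar> \<le> norm h * norm v" by (rule Cauchy_Schwarz_ineq2)
      moreover have "norm h * norm v \<le> norm h * 1" using v(3) by (intro mult_left_mono) auto
      ultimately show ?thesis by simp
    qed
    then show "\<exists>c. \<forall>y\<in>F. \<bar>inner x y\<bar> \<le> c" by blast
  qed
  then obtain C where C: "C > 0" "\<And>y. y \<in> F \<Longrightarrow> norm y \<le> C" by blast
  have est: "norm y \<le> C * norm v" if y: "y \<in> K" and v: "P y v" for y v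
  proof (cases "v = 0")
    case True
    obtain h where "h \<in> H" "y = A h" using y by (auto simp: K_def)
    then have "inner y y = 0" using v True by (auto simp: P_def)
    then show ?thesis using C(1) by simp
  next
    case False
    have "P ((1 / norm v) *\<^sub>R y) ((1 / norm v) *\<^sub>R v)"
      using v H(1) by (auto simp: P_def subspace_scale)
    moreover have "(1 / norm v) *\<^sub>R y \<in> K" using y K by (rule subspace_scale[rotated])
    ultimately have "(1 / norm v) *\<^sub>R y \<in> F"
      using False unfolding F_def by (auto intro!: exI[of _ "(1 / norm v) *\<^sub>R v"])
    then have "norm ((1 / norm v) *\<^sub>R y) \<le> C" by (rule C(2))
    then show ?thesis using False by (simp add: divide_le_eq)
  qed
  have Pd: "P (y - y') (v - v')" if "P y v" "P y' v'" for y y' v v'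
    using that H(1) by (auto simp: P_def inner_simps subspace_diff)
  define W where "W = {v. \<exists>y\<in>K. P y v}"
  have WH: "W \<subseteq> H" by (auto simp: W_def P_def)
  have W: "subspace W"
    unfolding subspace_def
  proof (intro conjI ballI allI)
    have "P 0 0" by (simp add: P_def subspace_0[OF H(1)])
    then show "0 \<in> W" using subspace_0[OF K] by (auto simp: W_def)
  next
    fix x y assume "x \<in> W" "y \<in> W"
    then obtain x' y' where *: "x' \<in> K" "P x' x" "y' \<in> K" "P y' y" by (auto simp: W_def)
    then have "P (x' + y') (x + y)" using H(1) by (auto simp: P_def inner_simps subspace_add)
    then show "x + y \<in> W" using subspace_add[OF K *(1,3)] by (auto simp: W_def)
  next
    fix c x assume "x \<in> W"
    then obtain x' where *: "x' \<in> K" "P x' x" by (auto simp: W_def)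
    then have "P (c *\<^sub>R x') (c *\<^sub>R x)" using H(1) by (auto simp: P_def inner_simps subspace_scale)
    then show "c *\<^sub>R x \<in> W" using subspace_scale[OF K *(1)] by (auto simp: W_def)
  qed
  \<comment> \<open>The lower bound \<open>est\<close> makes the preimages in K of a convergent
    sequence Cauchy.\<close>
  have Wcl: "closed W"
    unfolding closed_sequential_limits
  proof (intro allI impI)
    fix u l assume u: "(\<forall>n. u n \<in> W) \<and> u \<longlonglongrightarrow> l"
    then have "\<forall>n. \<exists>y. y \<in> K \<and> P y (u n)" by (auto simp: W_def)
    then obtain y where y: "\<And>n. y n \<in> K" "\<And>n. P (y n) (u n)" by metis
    have d: "dist (y i) (y j) \<le> C * dist (u i) (u j)" for i j
      using est[OF subspace_diff[OF K y(1)[of i] y(1)[of j]] Pd[OF y(2)[of i] y(2)[of j]]]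
      by (simp add: dist_norm)
    have "Cauchy y"
    proof (rule metric_CauchyI)
      fix e :: real assume e: "e > 0"
      have "Cauchy u" using u LIMSEQ_imp_Cauchy by blast
      then obtain M where M: "\<And>i j. i \<ge> M \<Longrightarrow> j \<ge> M \<Longrightarrow> dist (u i) (u j) < e / C"
        using metric_CauchyD[of u "e / C"] e C(1) by auto
      have "dist (y i) (y j) < e" if "i \<ge> M" "j \<ge> M" for i j
      proof -
        have "C * dist (u i) (u j) < e"
          using M[OF that] C(1) by (simp add: pos_less_divide_eq mult.commute)
        then show ?thesis using d[of i j] by linarith
      qed
      then show "\<exists>M. \<forall>i\<ge>M. \<forall>j\<ge>M. dist (y i) (y j) < e" by blast
    qed
    then obtain z where z: "y \<longlonglongrightarrow> z" using Cauchy_convergent_iff convergent_def by blast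
    have "z \<in> K" by (rule closed_sequentially[OF _ y(1) z]) (use cl in \<open>simp add: K_def\<close>)
    moreover have "P z l"
      unfolding P_def
    proof (intro conjI ballI)
      show "l \<in> H" using closed_sequentially[OF H(2), of u l] u y(2) by (auto simp: P_def)
      fix h assume h: "h \<in> H"
      have "(\<lambda>n. inner (A h) (y n)) \<longlonglongrightarrow> inner (A h) z" by (intro tendsto_intros z)
      moreover have "(\<lambda>n. inner h (u n)) \<longlonglongrightarrow> inner h l" using u by (intro tendsto_intros) auto
      moreover have "inner (A h) (y n) = inner h (u n)" for n using y(2)[of n] h by (simp add: P_def)
      ultimately show "inner (A h) z = inner h l" using LIMSEQ_unique by simp
    qed
    ultimately show "l \<in> W" by (auto simp: W_def)
  qed
  \<comment> \<open>The adjoint is onto H: x - p is orthogonal to W, and W contains the adjoint of A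
    at A (x - p), so A (x - p) = 0 and injectivity gives x = p.\<close>
  have HW: "x \<in> W" if x: "x \<in> H" for x
  proof -
    have "\<exists>p\<in>W. \<forall>k\<in>W. inner k x = inner k p"
      by (rule riesz_real[OF W Wcl, where b="norm x"])
        (simp_all add: inner_simps, metis Cauchy_Schwarz_ineq2 mult.commute)
    then obtain p where p: "p \<in> W" "\<And>k. k \<in> W \<Longrightarrow> inner k x = inner k p" by blast
    have d: "x - p \<in> H" using x p(1) WH H(1) by (auto intro: subspace_diff)
    obtain v where v: "P (A (x - p)) v" using ex by blast
    have "v \<in> W" using v d by (auto simp: W_def K_def)
    then have "inner (x - p) v = 0" using p(2) by (simp add: inner_simps inner_commute)
    moreover have "inner (A (x - p)) (A (x - p)) = inner (x - p) v" using v d by (simp add: P_def)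
    ultimately have "x - p = 0" using inj[OF d] by simp
    then show ?thesis using p(1) by simp
  qed
  have "(1 / C) * norm x \<le> norm (A x)" if x: "x \<in> H" for x
  proof (cases "x = 0")
    case False
    from HW[OF x] obtain y where y: "y \<in> K" "P y x" by (auto simp: W_def)
    have "norm x * norm x = inner (A x) y"
      using y(2) x by (simp add: P_def power2_norm_eq_inner[symmetric] power2_eq_square)
    also have "\<dots> \<le> norm (A x) * norm y" by (rule norm_cauchy_schwarz)
    also have "\<dots> \<le> norm (A x) * (C * norm x)" using est[OF y] by (intro mult_left_mono) auto
    finally have "norm x \<le> norm (A x) * C" using False by simp
    then show ?thesis using C(1) by (simp add: pos_divide_le_eq)
  qed simp
  then show ?thesis using C(1) by (intro exI[of _ "1 / C"]) auto
qed

text \<open>Douglas' range lemma: both ranges consist of the \<open>y\<close> such that \<open>\<langle>x, y\<rangle>\<close> is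
  dominated by \<open>\<parallel>R x\<parallel>\<close>.\<close>

lemma range_sqrt_sum:
  fixes L :: "'a::complex_hilbert_space set"
  assumes L: "csub L" and R: "bounded_op L L R" "\<And>x y. x \<in> L \<Longrightarrow> y \<in> L \<Longrightarrow> cinner (R x) y = cinner x (R y)"
    and B: "bounded_op L L B" and Bs: "bounded_op L L Bs"
      "\<And>x y. x \<in> L \<Longrightarrow> y \<in> L \<Longrightarrow> cinner (Bs x) y = cinner x (B y)"
    and C: "bounded_op L L C" and Cs: "bounded_op L L Cs"
      "\<And>x y. x \<in> L \<Longrightarrow> y \<in> L \<Longrightarrow> cinner (Cs x) y = cinner x (C y)"
    and k: "k > 0" and eq: "\<And>x. x \<in> L \<Longrightarrow> (norm (Bs x))\<^sup>2 + (norm (Cs x))\<^sup>2 = k * (norm (R x))\<^sup>2"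
  shows "R ` L = {B u + C v | u v. u \<in> L \<and> v \<in> L}"
proof -
  have sL: "subspace L" by (rule csub_subspace[OF L])
  \<comment> \<open>Pairing the two operators makes |T x| a multiple of |R x|, and the two
    components of one Riesz vector supply both u and v.\<close>
  define T where "T x = (Bs x, Cs x)" for x
  have nT: "norm (T x) = sqrt k * norm (R x)" if "x \<in> L" for x
    using eq[OF that] k by (simp add: T_def norm_Pair real_sqrt_mult)
  have TL: "closure (T ` L) \<subseteq> L \<times> L"
    using bop_mem[OF Bs(1)] bop_mem[OF Cs(1)] csub_closed[OF L]
    by (intro closure_minimal closed_Times) (auto simp: T_def)
  have eqI: "y = z" if "y \<in> L" "z \<in> L" "\<And>x. x \<in> L \<Longrightarrow> inner x y = inner x z" for y z
  proof -
    have "y - z \<in> L" by (rule csub_diff[OF L that(1,2)])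
    from that(3)[OF this] have "inner (y - z) (y - z) = 0" by (simp add: inner_simps)
    then show ?thesis by simp
  qed
  have 1: "y \<in> R ` L" if y: "y \<in> L" and c: "\<And>x. x \<in> L \<Longrightarrow> \<bar>inner x y\<bar> \<le> c * norm (R x)" for y c
  proof -
    have "\<exists>w\<in>closure (R ` L). \<forall>h\<in>L. inner h y = inner (R h) w"
      by (rule riesz_general[OF sL, where b=c])
        (use c in \<open>auto simp: bop_add[OF R(1)] bop_scaleR[OF R(1)] inner_simps\<close>)
    then obtain w where w: "w \<in> closure (R ` L)" "\<And>h. h \<in> L \<Longrightarrow> inner h y = inner (R h) w" by blast
    have wL: "w \<in> L" using w(1) closure_minimal[of "R ` L" L] bop_mem[OF R(1)] csub_closed[OF L] by blast
    have "y = R w"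
      by (rule eqI[OF y bop_mem[OF R(1) wL]]) (use w wL R(2) in \<open>simp add: inner_eq_Re_cinner\<close>)
    then show ?thesis using wL by blast
  qed
  have 2: "\<exists>u\<in>L. \<exists>v\<in>L. y = B u + C v"
    if y: "y \<in> L" and c: "\<And>x. x \<in> L \<Longrightarrow> \<bar>inner x y\<bar> \<le> c * norm (T x)" for y c
  proof -
    have "\<exists>w\<in>closure (T ` L). \<forall>h\<in>L. inner h y = inner (T h) w"
      by (rule riesz_general[OF sL, where b=c])
        (use c in \<open>auto simp: T_def bop_add[OF Bs(1)] bop_scaleR[OF Bs(1)] bop_add[OF Cs(1)]
          bop_scaleR[OF Cs(1)] inner_simps\<close>)
    then obtain u v where w: "(u, v) \<in> closure (T ` L)" "\<And>h. h \<in> L \<Longrightarrow> inner h y = inner (T h) (u, v)"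
      by (metis surj_pair)
    have uv: "u \<in> L" "v \<in> L" using w(1) TL by auto
    have "y = B u + C v"
      by (rule eqI[OF y csub_add[OF L bop_mem[OF B uv(1)] bop_mem[OF C uv(2)]]])
        (use w uv Bs(2) Cs(2) in \<open>simp add: T_def inner_simps inner_eq_Re_cinner cinner_lin\<close>)
    then show ?thesis using uv by blast
  qed
  show ?thesis
  proof (intro equalityI subsetI)
    fix y assume "y \<in> R ` L"
    then obtain w where w: "w \<in> L" "y = R w" by blast
    have "\<bar>inner x y\<bar> \<le> (norm w / sqrt k) * norm (T x)" if x: "x \<in> L" for x
    proof -
      have "inner x y = inner (R x) w" using w x R(2) by (simp add: inner_eq_Re_cinner)
      also have "\<bar>\<dots>\<bar> \<le> norm (R x) * norm w" by (rule Cauchy_Schwarz_ineq2)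
      finally show ?thesis using nT[OF x] k by (simp add: mult.commute)
    qed
    from 2[OF _ this] w show "y \<in> {B u + C v | u v. u \<in> L \<and> v \<in> L}"
      using bop_mem[OF R(1)] by blast
  next
    fix y assume "y \<in> {B u + C v | u v. u \<in> L \<and> v \<in> L}"
    then obtain u v where uv: "u \<in> L" "v \<in> L" "y = B u + C v" by blast
    have "\<bar>inner x y\<bar> \<le> (sqrt k * norm (u, v)) * norm (R x)" if x: "x \<in> L" for x
    proof -
      have "inner x y = inner (T x) (u, v)"
        using uv x Bs(2) Cs(2) by (simp add: T_def inner_simps inner_eq_Re_cinner cinner_lin)
      also have "\<bar>\<dots>\<bar> \<le> norm (T x) * norm (u, v)" by (rule Cauchy_Schwarz_ineq2)
      finally show ?thesis using nT[OF x] by (simp add: mult_ac)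
    qed
    then show "y \<in> R ` L"
      using 1[of y] uv csub_add[OF L bop_mem[OF B uv(1)] bop_mem[OF C uv(2)]] by blast
  qed
qed

lemma closed_range_if_bounded_below:
  assumes L: "csub L" and A: "bounded_op L K A" and c: "c > 0" "\<And>x. x \<in> L \<Longrightarrow> c * norm x \<le> norm (A x)"
  shows "closed (A ` L)"
  unfolding closed_sequential_limits
proof (intro allI impI)
  fix u l assume u: "(\<forall>n. u n \<in> A ` L) \<and> u \<longlonglongrightarrow> l"
  then have "\<forall>n. \<exists>v. v \<in> L \<and> u n = A v" by blast
  then obtain v where v: "\<And>n. v n \<in> L" "\<And>n. u n = A (v n)" by metis
  have d: "c * dist (v i) (v j) \<le> dist (u i) (u j)" for i j
    using c(2)[OF csub_diff[OF L v(1)[of i] v(1)[of j]]] v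
    by (simp add: dist_norm bop_diff[OF L A])
  have "Cauchy v"
  proof (rule metric_CauchyI)
    fix e :: real assume e: "e > 0"
    have "Cauchy u" using u LIMSEQ_imp_Cauchy by blast
    then obtain M where M: "\<And>i j. i \<ge> M \<Longrightarrow> j \<ge> M \<Longrightarrow> dist (u i) (u j) < c * e"
      using metric_CauchyD[of u "c * e"] e c(1) by auto
    have "dist (v i) (v j) < e" if "i \<ge> M" "j \<ge> M" for i j
    proof -
      have "c * dist (v i) (v j) < c * e" using M[OF that] d[of i j] by linarith
      then show ?thesis using c(1) by simp
    qed
    then show "\<exists>M. \<forall>i\<ge>M. \<forall>j\<ge>M. dist (v i) (v j) < e" by blast
  qed
  then obtain w where w: "v \<longlonglongrightarrow> w" using Cauchy_convergent_iff convergent_def by blast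
  then have wL: "w \<in> L" using closed_sequentially[OF csub_closed[OF L] v(1)] by simp
  have "(\<lambda>n. A (v n)) \<longlonglongrightarrow> A w" by (rule bop_tendsto[OF L A v(1) w])
  moreover have "u = (\<lambda>n. A (v n))" using v(2) by (rule ext)
  then have "(\<lambda>n. A (v n)) \<longlonglongrightarrow> l" using u by simp
  ultimately have "l = A w" using LIMSEQ_unique by blast
  then show "l \<in> A ` L" using wL by blast
qed

section \<open>Contractions with ker (I - Y) = {0} and the ranges of I - Y, its adjoint and (I -
  Y_R)^(1/2)\<close>

locale inj_contr = sq_contr +
  assumes fix0: "\<And>x. x \<in> L \<Longrightarrow> Y x = x \<Longrightarrow> x = 0"
begin

abbreviation "ImY \<equiv> \<lambda>x. x - Y x"
abbreviation "ImYs \<equiv> \<lambda>x. x - Ys x"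
abbreviation "R \<equiv> sqrt_op L (\<lambda>x. x - (1/2) *\<^sub>R (Y x + Ys x))"

lemma dual': "inj_contr L Ys"
proof -
  interpret d: sq_contr L Ys by (rule dual)
  show ?thesis
  proof
    fix x assume x: "x \<in> L" "Ys x = x"
    show "x = 0" using d.fix_adj[OF x] Yss[OF x(1)] fix0[OF x(1)] by simp
  qed
qed

lemma ImY_bop: "bounded_op L L ImY"
proof (rule bopI[where b=2])
  fix x assume x: "x \<in> L"
  have "norm (x - Y x) \<le> norm x + norm (Y x)" by (rule norm_triangle_ineq4)
  then show "norm (x - Y x) \<le> 2 * norm x" using contr_norm[OF Y x] by linarith
qed (auto simp: csub_diff[OF L] bop_mem[OF bY] bop_add[OF bY] bop_scaleC[OF bY] scaleC_simps)

lemma ImY_inj: "x \<in> L \<Longrightarrow> x - Y x = 0 \<Longrightarrow> x = 0"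
  by (rule fix0) auto

lemma ImY_inj_on: "inj_on ImY L"
proof (rule inj_onI)
  fix x y assume xy: "x \<in> L" "y \<in> L" "x - Y x = y - Y y"
  have "(x - y) - Y (x - y) = 0"
    unfolding bop_diff[OF L bY xy(1,2)] using xy(3) by (simp add: algebra_simps)
  from ImY_inj[OF csub_diff[OF L xy(1,2)] this] show "x = y" by simp
qed

lemma ImY_adj: "x \<in> L \<Longrightarrow> y \<in> L \<Longrightarrow> cinner (ImYs x) y = cinner x (ImY y)"
  by (simp add: cinner_lin adj_cinner'[OF L bY])

lemma gram: "sa_contraction L (\<lambda>x. (1/2) *\<^sub>R (x + (1/2) *\<^sub>R (Y x + Ys x)))"
proof
  let ?X = "\<lambda>x. (1/2) *\<^sub>R (x + (1/2) *\<^sub>R (Y x + Ys x))"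
  show "csub L" by (rule L)
  show n: "norm (?X x) \<le> norm x" if x: "x \<in> L" for x
  proof -
    have "norm (x + (1/2) *\<^sub>R (Y x + Ys x)) \<le> norm x + norm ((1/2) *\<^sub>R (Y x + Ys x))"
      by (rule norm_triangle_ineq)
    moreover have "norm (Y x + Ys x) \<le> norm (Y x) + norm (Ys x)" by (rule norm_triangle_ineq)
    ultimately show ?thesis using contr_norm[OF Y x] contr_norm[OF Ys x] by simp
  qed
  show "bounded_op L L ?X"
    by (rule bopI[where b=1])
      (use n in \<open>auto simp: bop_mem[OF bY] bop_mem[OF bYs] bop_add[OF bY] bop_add[OF bYs]
        bop_scaleC[OF bY] bop_scaleC[OF bYs] scaleR_eq_scaleC scaleC_simps mult_ac
        intro!: csub_scaleC[OF L] csub_add[OF L]\<close>)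
  show "cinner (?X x) y = cinner x (?X y)" if "x \<in> L" "y \<in> L" for x y
    using that by (simp add: cinner_lin adj_cinner'[OF L bY] adj_cinner[OF L bY] algebra_simps)
qed

lemma R_aux: "x - (1/2) *\<^sub>R (Y x + Ys x) = 2 *\<^sub>R (x - (1/2) *\<^sub>R (x + (1/2) *\<^sub>R (Y x + Ys x)))"
  by (simp add: scaleR_diff_right scaleR_add_right) (simp add: scaleR_2 algebra_simps)

lemma R_positive: "positive_op L R"
  by (rule sqrt_op_props(1)[OF gram zero_less_numeral R_aux])

lemma R_sq: "x \<in> L \<Longrightarrow> R (R x) = x - (1/2) *\<^sub>R (Y x + Ys x)"
  by (rule sqrt_op_props(2)[OF gram zero_less_numeral R_aux])

lemma R_bop: "bounded_op L L R"
  using R_positive by (simp add: positive_op_def)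

lemma R_norm: "x \<in> L \<Longrightarrow> (norm (R x))\<^sup>2 = (norm x)\<^sup>2 - Re (cinner (Y x) x)"
proof -
  assume x: "x \<in> L"
  have "cinner (R x) (R x) = cinner x (R (R x))"
    by (rule positive_op_sym[OF L R_positive x bop_mem[OF R_bop x]])
  also have "\<dots> = cinner x x - (1/2) *\<^sub>R (cinner x (Y x) + cinner (Y x) x)"
    using x by (simp add: R_sq cinner_lin adj_cinner[OF L bY])
  finally have "Re (cinner (R x) (R x)) = Re (cinner x x) - (1/2) * (Re (cinner x (Y x)) + Re (cinner (Y x) x))"
    by simp
  moreover have "Re (cinner x (Y x)) = Re (cinner (Y x) x)" by (subst cinner_commute) simp
  ultimately show ?thesis by (simp add: norm_sq_cinner)
qed

text \<open>The terms |Y^* x|^2 cancel, and 2 |x|^2 - 2 Re (Y x, x) remains.\<close>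

lemma R_norm_eq: "x \<in> L \<Longrightarrow> (norm (ImYs x))\<^sup>2 + (norm (B.D x))\<^sup>2 = 2 * (norm (R x))\<^sup>2"
proof -
  assume x: "x \<in> L"
  have "cinner (Ys x) x = cinner x (Y x)" using x by (rule adj_cinner'[OF L bY])
  then have "Re (cinner (Ys x) x) = Re (cinner (Y x) x)" "Re (cinner x (Ys x)) = Re (cinner (Y x) x)"
    using x by (simp_all add: adj_cinner[OF L bY] cinner_commute[of x "Y x"])
  then show ?thesis
    using R_norm[OF x] B.D_norm[OF x] by (simp add: norm_sq_cinner[of "x - Ys x"] cinner_lin)
      (simp add: norm_sq_cinner)
qed

lemma R_range: "R ` L = {ImY u + B.D v | u v. u \<in> L \<and> v \<in> L}"
  by (rule range_sqrt_sum[OF L R_bop positive_op_sym[OF L R_positive] ImY_bop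
        inj_contr.ImY_bop[OF dual'] ImY_adj B.D_bop B.D_bop B.D_sym _ R_norm_eq]) auto

text \<open>Y_R is symmetric in Y and its adjoint, but the arguments of the two occurrences of
  \<open>sqrt_op\<close> are compared on L only; therefore both roots are expressed by one and the
  same series.\<close>

lemma R_dual: "sqrt_op L (\<lambda>x. x - (1/2) *\<^sub>R (Ys x + adj L L Ys x)) x = R x" if "x \<in> L"
proof -
  interpret d: inj_contr L Ys by (rule dual')
  have "d.R x = sqrt 2 *\<^sub>R sqrt_series (\<lambda>x. (1/2) *\<^sub>R (x + (1/2) *\<^sub>R (Y x + Ys x))) x"
    by (rule sqrt_op_props(3)[OF gram zero_less_numeral _ that])
      (simp add: Yss add.commute R_aux[symmetric])
  moreover have "R x = sqrt 2 *\<^sub>R sqrt_series (\<lambda>x. (1/2) *\<^sub>R (x + (1/2) *\<^sub>R (Y x + Ys x))) x"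
    by (rule sqrt_op_props(3)[OF gram zero_less_numeral R_aux that])
  ultimately show ?thesis by simp
qed

text \<open>ran R is the sum of ran (I - Y) and the range of \<open>B.D\<close>, so equality means
  that the second summand adds nothing.\<close>

lemma ran_eq_iff: "ImY ` L = R ` L \<longleftrightarrow> B.D ` L \<subseteq> ImY ` L"
proof
  assume e: "ImY ` L = R ` L"
  show "B.D ` L \<subseteq> ImY ` L"
  proof
    fix y assume "y \<in> B.D ` L"
    then obtain v where "v \<in> L" "y = ImY 0 + B.D v" using bop_0[OF L bY] by auto
    then show "y \<in> ImY ` L" unfolding e R_range using csub_0[OF L] by blast
  qed
next
  assume s: "B.D ` L \<subseteq> ImY ` L"
  have c: "csubspace (ImY ` L)" by (rule bop_image_csubspace[OF L ImY_bop])
  have "R ` L \<subseteq> ImY ` L"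
    unfolding R_range using s by (auto intro!: complex_vector.subspace_add[OF c])
  moreover have "ImY ` L \<subseteq> R ` L"
  proof
    fix y assume "y \<in> ImY ` L"
    then obtain u where "u \<in> L" "y = ImY u + B.D 0" using bop_0[OF L B.D_bop] by auto
    then show "y \<in> R ` L" unfolding R_range using csub_0[OF L] by blast
  qed
  ultimately show "ImY ` L = R ` L" by blast
qed

lemma ran_eq_iff': "ImYs ` L = R ` L \<longleftrightarrow> A.D ` L \<subseteq> ImYs ` L"
proof -
  have "sqrt_op L (\<lambda>x. x - (1/2) *\<^sub>R (Ys x + adj L L Ys x)) ` L = R ` L"
    by (rule image_cong[OF refl R_dual])
  then show ?thesis using inj_contr.ran_eq_iff[OF dual'] by (simp add: defect_Yss_image)
qed

lemma full_bounded_below: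
  assumes "ImY ` L = L" shows "\<exists>c>0. \<forall>x\<in>L. c * norm x \<le> norm (ImY x)"
  by (rule bounded_below_if_closed_range[OF csub_subspace[OF L] csub_closed[OF L], where b=2])
    (use assms csub_closed[OF L] ImY_inj norm_triangle_ineq4 contr_norm[OF Y] in
      \<open>auto simp: bop_add[OF bY] bop_scaleR[OF bY] scaleR_diff_right intro: order_trans[OF norm_triangle_ineq4]\<close>)

text \<open>The lower bound closes the range, and the orthogonal complement of the range is the
  kernel of \<open>ImYs\<close>, which is trivial.\<close>

lemma full_if_bounded_below:
  assumes "c > 0" "\<And>x. x \<in> L \<Longrightarrow> c * norm x \<le> norm (ImY x)" shows "ImY ` L = L"
proof -
  have "closed (ImY ` L)" by (rule closed_range_if_bounded_below[OF L ImY_bop assms])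
  moreover have "closure (ImY ` L) = L"
  proof (rule dense_if_orth_0[OF bop_image_csubspace[OF L ImY_bop] L])
    show "ImY ` L \<subseteq> L" using bop_mem[OF ImY_bop] by blast
    fix x assume x: "x \<in> L" "\<And>a. a \<in> ImY ` L \<Longrightarrow> cinner x a = 0"
    have m: "ImYs x \<in> L" by (rule bop_mem[OF inj_contr.ImY_bop[OF dual'] x(1)])
    have "cinner (ImYs x) (ImYs x) = cinner x (ImY (ImYs x))" by (rule ImY_adj[OF x(1) m])
    also have "\<dots> = 0" by (rule x(2)[OF imageI[OF m]])
    finally have "ImYs x = 0" by simp
    then show "x = 0" by (rule inj_contr.ImY_inj[OF dual' x(1)])
  qed
  ultimately show ?thesis by simp
qed

text \<open>An injective R that is onto is bounded below, and |R x|^2 = Re ((I - Y) x, x) \<le> |(I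
  - Y) x| |x| passes the bound on to I - Y.\<close>

lemma full_if_R_full:
  assumes "R ` L = L" shows "ImY ` L = L"
proof -
  obtain b where b: "b > 0" "\<And>x. x \<in> L \<Longrightarrow> norm (R x) \<le> b * norm x" using bop_bound[OF R_bop] by metis
  have inj: "x = 0" if x: "x \<in> L" "R x = 0" for x
  proof -
    have "(norm (ImYs x))\<^sup>2 + (norm (B.D x))\<^sup>2 = 0" using R_norm_eq[OF x(1)] x(2) by simp
    then have "ImYs x = 0" by (simp add: sum_power2_eq_zero_iff)
    then show ?thesis by (rule inj_contr.ImY_inj[OF dual' x(1)])
  qed
  have "\<exists>c>0. \<forall>x\<in>L. c * norm x \<le> norm (R x)"
    by (rule bounded_below_if_closed_range[OF csub_subspace[OF L] csub_closed[OF L] bop_add[OF R_bop]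
          bop_scaleR[OF R_bop] b(2) inj]) (simp_all add: assms csub_closed[OF L])
  then obtain c where c: "c > 0" "\<And>x. x \<in> L \<Longrightarrow> c * norm x \<le> norm (R x)" by blast
  have "c\<^sup>2 * norm x \<le> norm (ImY x)" if x: "x \<in> L" for x
  proof (cases "x = 0")
    case False
    have "(c * norm x)\<^sup>2 \<le> (norm (R x))\<^sup>2" using c(2)[OF x] c(1) by (intro power_mono) auto
    also have "\<dots> = Re (cinner (ImY x) x)" using R_norm[OF x] by (simp add: norm_sq_cinner cinner_lin)
    also have "\<dots> \<le> cmod (cinner (ImY x) x)" by (rule complex_Re_le_cmod)
    also have "\<dots> \<le> norm (ImY x) * norm x" by (rule cinner_CS)
    finally have "(c\<^sup>2 * norm x) * norm x \<le> norm (ImY x) * norm x"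
      by (simp add: power2_eq_square mult_ac)
    then show ?thesis using False by simp
  qed simp
  then show ?thesis using full_if_bounded_below[of "c\<^sup>2"] c(1) by simp
qed

lemma R_full_if_full: "ImY ` L = L \<Longrightarrow> B.D ` L \<subseteq> ImY ` L"
  using B.D_mem by auto

text \<open>The passage to the adjoint goes through R, whose values on L are the same for Y and for
  its adjoint.\<close>

lemma full_dual:
  assumes f: "ImY ` L = L" shows "ImYs ` L = L"
proof -
  have "R ` L = L" using ran_eq_iff R_full_if_full[OF f] f by simp
  moreover have "sqrt_op L (\<lambda>x. x - (1/2) *\<^sub>R (Ys x + adj L L Ys x)) ` L = R ` L"
    by (rule image_cong[OF refl R_dual])
  ultimately show ?thesis using inj_contr.full_if_R_full[OF dual'] by simp
qed

lemma coisometry_range: assumes i: "isometry_op L L Ys" shows "B.D ` L \<subseteq> ImY ` L"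
proof
  fix y assume "y \<in> B.D ` L"
  then have "y = ImY 0" using B.D_norm i bop_0[OF L bY] by (auto simp: isometry_op_def)
  then show "y \<in> ImY ` L" using csub_0[OF L] by blast
qed

text \<open>D_Y is here the projection onto ker Y. If x in ker Y equals g - Y^* g, applying Y gives
  Y g = g, so g = 0 and x = 0. Thus the inclusion would make Y injective and hence unitary.\<close>

lemma coisometry_not_range:
  assumes i: "isometry_op L L Ys" and nu: "\<not> unitary_op L L Y" shows "\<not> A.D ` L \<subseteq> ImYs ` L"
proof
  assume s: "A.D ` L \<subseteq> ImYs ` L"
  have YYs: "Y (Ys x) = x" if x: "x \<in> L" for x
    using adj_isometry[OF L i x] Yss[OF bop_mem[OF bYs x]] by simp
  have ker: "x = 0" if x: "x \<in> L" "Y x = 0" for x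
  proof -
    have "A.D x = x" using A.D_coisometry[OF YYs x(1)] x(2) bop_0[OF L bYs] by simp
    then have "x \<in> ImYs ` L" using subsetD[OF s imageI[OF x(1), of A.D]] by (simp only:)
    then obtain g where g: "g \<in> L" "x = g - Ys g" by blast
    have "Y x = Y g - g" using g bop_mem[OF bYs g(1)] by (simp add: bop_diff[OF L bY] YYs)
    then have "g = 0" using x(2) fix0[OF g(1)] by simp
    then show "x = 0" using g(2) bop_0[OF L bYs] by simp
  qed
  have YsY: "Ys (Y x) = x" if x: "x \<in> L" for x
  proof -
    have yx: "Y x \<in> L" by (rule bop_mem[OF bY x])
    have m: "Ys (Y x) \<in> L" by (rule bop_mem[OF bYs yx])
    have "Ys (Y x) - x = 0"
      by (rule ker[OF csub_diff[OF L m x]]) (simp add: bop_diff[OF L bY m x] YYs[OF yx])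
    then show ?thesis by simp
  qed
  have "norm (Y x) = norm x" if x: "x \<in> L" for x
    using i bop_mem[OF bY x] YsY[OF x] unfolding isometry_op_def by metis
  moreover have "Y ` L = L"
  proof
    show "Y ` L \<subseteq> L" using bop_mem[OF bY] by blast
    show "L \<subseteq> Y ` L"
    proof
      fix x assume x: "x \<in> L"
      show "x \<in> Y ` L" using imageI[OF bop_mem[OF bYs x], of Y] YYs[OF x] by simp
    qed
  qed
  ultimately show False using nu bY by (simp add: unitary_op_def isometry_op_def)
qed

lemma isometry_range: "isometry_op L L Y \<Longrightarrow> A.D ` L \<subseteq> ImYs ` L"
  using inj_contr.coisometry_range[OF dual' isometry_cong[OF L _ Yss]] unfolding defect_Yss_image .

lemma isometry_not_range:
  assumes "isometry_op L L Y" "\<not> unitary_op L L Y" shows "\<not> B.D ` L \<subseteq> ImY ` L"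
proof -
  have "\<not> unitary_op L L Ys"
  proof
    assume "unitary_op L L Ys"
    then have u: "unitary_op L L (adj L L Ys)" by (rule adj_unitary[OF L L])
    then have "adj L L Ys ` L = L" by (simp add: unitary_op_def)
    moreover have "adj L L Ys ` L = Y ` L" by (rule image_cong[OF refl Yss])
    ultimately have "Y ` L = L" by simp
    then show False using assms by (simp add: unitary_op_def)
  qed
  moreover have "(\<lambda>x. x - adj L L Ys x) ` L = ImY ` L" by (rule image_cong[OF refl]) (simp add: Yss)
  ultimately show ?thesis
    using inj_contr.coisometry_not_range[OF dual' isometry_cong[OF L assms(1) Yss]] by simp
qed

end

subsection \<open>Symmetric operators\<close>

text \<open>One letter e for i and -i, so that a statement about the two half-planes is proved
  once.\<close>

definition imag_unit :: "complex \<Rightarrow> bool"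
  where "imag_unit e \<longleftrightarrow> e = \<i> \<or> e = -\<i>"

lemma imag_unit_i [simp]: "imag_unit \<i>" "imag_unit (-\<i>)"
  by (auto simp: imag_unit_def)

lemma imag_unit_neg: "imag_unit e \<Longrightarrow> imag_unit (- e)"
  by (auto simp: imag_unit_def)

lemma imag_unit_cnj: "imag_unit e \<Longrightarrow> cnj e = - e"
  by (auto simp: imag_unit_def)

lemma imag_unit_sq: "imag_unit e \<Longrightarrow> e * e = -1"
  by (auto simp: imag_unit_def)

lemma scaleC_2: "2 *\<^sub>C (x :: 'a::complex_hilbert_space) = x + x"
  by (metis one_add_one scaleC_add_left scaleC_one)

lemma lop_0: "linear_operator T \<Longrightarrow> (0, 0) \<in> T"
  and lop_add: "linear_operator T \<Longrightarrow> (f, f') \<in> T \<Longrightarrow> (g, g') \<in> T \<Longrightarrow> (f + g, f' + g') \<in> T"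
  and lop_scaleC: "linear_operator T \<Longrightarrow> (f, f') \<in> T \<Longrightarrow> (c *\<^sub>C f, c *\<^sub>C f') \<in> T"
  and lop_unique: "linear_operator T \<Longrightarrow> (f, f') \<in> T \<Longrightarrow> (f, g') \<in> T \<Longrightarrow> f' = g'"
  by (auto simp: linear_operator_def single_valued_def)

lemma linear_operatorI:
  assumes "(0, 0) \<in> T" "\<And>f f' g g'. (f, f') \<in> T \<Longrightarrow> (g, g') \<in> T \<Longrightarrow> (f + g, f' + g') \<in> T"
    "\<And>c f f'. (f, f') \<in> T \<Longrightarrow> (c *\<^sub>C f, c *\<^sub>C f') \<in> T"
    "\<And>f f' g'. (f, f') \<in> T \<Longrightarrow> (f, g') \<in> T \<Longrightarrow> f' = g'"
  shows "linear_operator T"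
  unfolding linear_operator_def single_valued_def using assms by fast

lemma symmetric_operatorI:
  assumes "linear_operator T" "\<And>f f'. (f, f') \<in> T \<Longrightarrow> Im (cinner f' f) = 0"
  shows "symmetric_operator T"
  unfolding symmetric_operator_def using assms by fast

lemma lop_diff: "linear_operator T \<Longrightarrow> (f, f') \<in> T \<Longrightarrow> (g, g') \<in> T \<Longrightarrow> (f - g, f' - g') \<in> T"
  using lop_add[of T f f' "-g" "-g'"] lop_scaleC[of T g g' "-1"] by (simp add: scaleC_simps)

lemma lop_Domain: "linear_operator T \<Longrightarrow> csubspace (Domain T)"
  unfolding complex_vector.subspace_def
  by (auto intro: lop_0 lop_add lop_scaleC)

lemma sym_lop: "symmetric_operator T \<Longrightarrow> linear_operator T"
  by (simp add: symmetric_operator_def)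

lemma sym_cinner:
  assumes T: "symmetric_operator T" and f: "(f, f') \<in> T" and g: "(g, g') \<in> T"
  shows "cinner f' g = cinner f g'"
proof -
  note l = sym_lop[OF T]
  have im: "Im (cinner h' h) = 0" if "(h, h') \<in> T" for h h'
    using T that by (auto simp: symmetric_operator_def)
  have "Im (cinner f' g) + Im (cinner g' f) = 0"
    using im[OF lop_add[OF l f g]] im[OF f] im[OF g] by (simp add: cinner_lin)
  moreover have "Re (cinner g' f) - Re (cinner f' g) = 0"
    using im[OF lop_add[OF l f lop_scaleC[OF l g, of \<i>]]] im[OF f] im[OF g] by (simp add: cinner_lin)
  ultimately have "cinner f' g = cnj (cinner g' f)" by (simp add: complex_eq_iff)
  then show ?thesis by (metis cinner_commute)
qed

text \<open>For e = \<plusminus>i one has \<open>cnj e = - e\<close>, so this is the range of T -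
  \<open>cnj e\<close> I, whose complement is the deficiency space at e itself.\<close>

definition ran_sp :: "('a::complex_hilbert_space \<times> 'a) set \<Rightarrow> complex \<Rightarrow> 'a set"
  where "ran_sp T e = {f' + e *\<^sub>C f | f f'. (f, f') \<in> T}"

lemma deficiency_sp_eq: "imag_unit e \<Longrightarrow> deficiency_sp K T e = K \<ominus> ran_sp T e"
  by (simp add: deficiency_sp_def ran_sp_def imag_unit_cnj scaleC_minus_left)

lemma ran_spI: "(f, f') \<in> T \<Longrightarrow> f' + e *\<^sub>C f \<in> ran_sp T e"
  by (auto simp: ran_sp_def)

lemma ran_sp_ball: "(\<forall>y\<in>ran_sp T e. P y) \<longleftrightarrow> (\<forall>f f'. (f, f') \<in> T \<longrightarrow> P (f' + e *\<^sub>C f))"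
  unfolding ran_sp_def by blast

text \<open>Symmetry cancels the mixed terms. That e disappears from the result is what ties the two
  half-planes together later on.\<close>

lemma sym_cross:
  assumes T: "symmetric_operator T" and e: "imag_unit e" and f: "(f, f') \<in> T" and u: "(u, u') \<in> T"
  shows "cinner (f' + e *\<^sub>C f) (u' + e *\<^sub>C u) = cinner f' u' + cinner f u"
proof -
  have "cinner (f' + e *\<^sub>C f) (u' + e *\<^sub>C u)
      = cinner f' u' + e * cinner f u' - e * cinner f' u - (e * e) * cinner f u"
    by (simp add: cinner_lin imag_unit_cnj[OF e] algebra_simps)
  then show ?thesis by (simp add: sym_cinner[OF T f u] imag_unit_sq[OF e])
qed

lemma ran_sp_csubspace:
  assumes "linear_operator T" shows "csubspace (ran_sp T e)"
  unfolding complex_vector.subspace_def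
proof (intro conjI ballI allI)
  show "0 \<in> ran_sp T e" using ran_spI[OF lop_0[OF assms], of e] by simp
  fix x assume "x \<in> ran_sp T e"
  then obtain f f' where f: "(f, f') \<in> T" "x = f' + e *\<^sub>C f" by (auto simp: ran_sp_def)
  show "c *\<^sub>C x \<in> ran_sp T e" for c
    using ran_spI[OF lop_scaleC[OF assms f(1)], of c e] f(2)
    by (simp add: scaleC_simps mult.commute)
  fix y assume "y \<in> ran_sp T e"
  then obtain g g' where g: "(g, g') \<in> T" "y = g' + e *\<^sub>C g" by (auto simp: ran_sp_def)
  show "x + y \<in> ran_sp T e"
    using ran_spI[OF lop_add[OF assms f(1) g(1)], of e] f(2) g(2)
    by (simp add: scaleC_simps algebra_simps)
qed

lemma sym_norm:
  assumes T: "symmetric_operator T" and e: "imag_unit e" and f: "(f, f') \<in> T"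
  shows "(norm (f' + e *\<^sub>C f))\<^sup>2 = (norm f')\<^sup>2 + (norm f)\<^sup>2"
proof -
  have "cinner (f' + e *\<^sub>C f) (f' + e *\<^sub>C f) = cinner f' f' + cinner f f"
    by (rule sym_cross[OF T e f f])
  then show ?thesis by (simp add: norm_sq_cinner)
qed

text \<open>By |f' + e f|^2 = |f'|^2 + |f|^2 both components of a convergent sequence of values are
  Cauchy, and the graph is closed.\<close>

lemma ran_sp_closed:
  assumes T: "symmetric_operator T" and cl: "closed T" and e: "imag_unit e"
  shows "csub (ran_sp T e)"
proof -
  note l = sym_lop[OF T]
  have "closed (ran_sp T e)"
    unfolding closed_sequential_limits
  proof (intro allI impI)
    fix u x assume u: "(\<forall>n. u n \<in> ran_sp T e) \<and> u \<longlonglongrightarrow> x"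
    then have "\<forall>n. \<exists>f f'. (f, f') \<in> T \<and> u n = f' + e *\<^sub>C f"
      unfolding ran_sp_def by blast
    then obtain f f' where f: "\<And>n. (f n, f' n) \<in> T" "\<And>n. u n = f' n + e *\<^sub>C f n" by metis
    have d: "(norm (u i - u j))\<^sup>2 = (norm (f' i - f' j))\<^sup>2 + (norm (f i - f j))\<^sup>2" for i j
      using sym_norm[OF T e lop_diff[OF l f(1)[of i] f(1)[of j]]] f(2)
      by (simp add: scaleC_simps algebra_simps)
    have "norm (f' i - f' j) \<le> norm (u i - u j)" "norm (f i - f j) \<le> norm (u i - u j)" for i j
      by (rule power2_le_imp_le; simp add: d)+
    moreover have "Cauchy u" using u LIMSEQ_imp_Cauchy by blast
    ultimately have "Cauchy f" "Cauchy f'"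
      unfolding Cauchy_def dist_norm by (meson le_less_trans)+
    then obtain g g' where g: "f \<longlonglongrightarrow> g" "f' \<longlonglongrightarrow> g'"
      using Cauchy_convergent_iff convergent_def by blast
    have "(g, g') \<in> T"
      by (rule closed_sequentially[OF cl f(1) tendsto_Pair[OF g]])
    moreover have "x = g' + e *\<^sub>C g"
    proof (rule LIMSEQ_unique)
      show "u \<longlonglongrightarrow> x" using u by simp
      have "u = (\<lambda>n. f' n + e *\<^sub>C f n)" using f(2) by (rule ext)
      then show "u \<longlonglongrightarrow> g' + e *\<^sub>C g" using g by (auto intro!: tendsto_intros)
    qed
    ultimately show "x \<in> ran_sp T e" by (auto simp: ran_sp_def)
  qed
  then show ?thesis using ran_sp_csubspace[OF l] by (simp add: csub_def)
qed

text \<open>For an extension T', every element of T' has the same value under T' + e I as some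
  element of T, and T' + e I is injective by the norm identity.\<close>

lemma maximal_if_full_range:
  assumes T: "symmetric_operator T" "T \<subseteq> K \<times> K" and e: "imag_unit e" and full: "ran_sp T e = K"
  shows "maximal_symmetric_in K T"
  unfolding maximal_symmetric_in_def
proof (intro conjI allI impI T)
  fix T' assume T': "symmetric_operator T' \<and> T' \<subseteq> K \<times> K \<and> T \<subseteq> T'"
  show "T' = T"
  proof (rule ccontr)
    assume "T' \<noteq> T"
    then obtain g g' where g: "(g, g') \<in> T'" "(g, g') \<notin> T" using T' by auto
    have l: "linear_operator T'" using T' sym_lop by blast
    have "g \<in> K" "g' \<in> K" using g T' by auto
    have "csubspace K" using full ran_sp_csubspace[OF sym_lop[OF T(1)]] by metis
    then have "g' + e *\<^sub>C g \<in> ran_sp T e"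
      using \<open>g \<in> K\<close> \<open>g' \<in> K\<close> full by (simp add: complex_vector.subspace_add complex_vector.subspace_scale)
    then obtain f f' where f: "(f, f') \<in> T" "g' + e *\<^sub>C g = f' + e *\<^sub>C f" by (auto simp: ran_sp_def)
    have "(g - f, g' - f') \<in> T'" using f(1) g(1) T' by (intro lop_diff[OF l]) auto
    from sym_norm[OF _ e this] T' have "(norm (g' - f'))\<^sup>2 + (norm (g - f))\<^sup>2 = 0"
      using f(2) by (simp add: scaleC_simps algebra_simps)
    then have "g' = f'" "g = f" by (auto simp: sum_power2_eq_zero_iff)
    then show False using f(1) g(2) by simp
  qed
qed

text \<open>The closure of T is again a symmetric operator in K: two values at the same point differ
  by a vector orthogonal to the dense domain. Maximality leaves no room for a larger graph.\<close>

lemma closed_if_maximal: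
  assumes K: "csub K" and m: "maximal_symmetric_in K T" and d: "closure (Domain T) = K"
  shows "closed T"
proof -
  have T: "symmetric_operator T" "T \<subseteq> K \<times> K" using m by (auto simp: maximal_symmetric_in_def)
  note l = sym_lop[OF T(1)]
  have seq: "\<exists>u u'. (\<forall>n. (u n, u' n) \<in> T) \<and> u \<longlonglongrightarrow> f \<and> u' \<longlonglongrightarrow> f'" if fT: "(f, f') \<in> closure T" for f f'
  proof -
    from fT obtain w where w: "\<And>n. w n \<in> T" "w \<longlonglongrightarrow> (f, f')" by (auto simp: closure_sequential)
    then show ?thesis
      using tendsto_fst[OF w(2)] tendsto_snd[OF w(2)]
      by (intro exI[of _ "\<lambda>n. fst (w n)"] exI[of _ "\<lambda>n. snd (w n)"]) auto
  qed
  have lim: "(f, f') \<in> closure T" if "\<And>n. (u n, u' n) \<in> T" "u \<longlonglongrightarrow> f" "u' \<longlonglongrightarrow> f'" for u u' f f'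
    unfolding closure_sequential using that by (intro exI[of _ "\<lambda>n. (u n, u' n)"]) (auto intro: tendsto_Pair)
  have clK: "closure T \<subseteq> K \<times> K"
    using T(2) csub_closed[OF K] by (intro closure_minimal closed_Times)
  have symc: "cinner f' g = cinner f g'" if a: "(f, f') \<in> closure T" and b: "(g, g') \<in> T" for f f' g g'
  proof -
    obtain u u' where u: "\<And>n. (u n, u' n) \<in> T" "u \<longlonglongrightarrow> f" "u' \<longlonglongrightarrow> f'" using seq[OF a] by blast
    have "(\<lambda>n. cinner (u' n) g) \<longlonglongrightarrow> cinner f' g" by (intro tendsto_intros u)
    moreover have "(\<lambda>n. cinner (u n) g') \<longlonglongrightarrow> cinner f g'" by (intro tendsto_intros u)
    moreover have "cinner (u' n) g = cinner (u n) g'" for n by (rule sym_cinner[OF T(1) u(1) b])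
    ultimately show ?thesis using LIMSEQ_unique by simp
  qed
  have lc: "linear_operator (closure T)"
  proof (rule linear_operatorI)
    show "(0, 0) \<in> closure T" by (rule subsetD[OF closure_subset lop_0[OF l]])
  next
    fix f f' g g' assume fg: "(f, f') \<in> closure T" "(g, g') \<in> closure T"
    obtain u u' where u: "\<And>n. (u n, u' n) \<in> T" "u \<longlonglongrightarrow> f" "u' \<longlonglongrightarrow> f'" using seq[OF fg(1)] by blast
    obtain v v' where v: "\<And>n. (v n, v' n) \<in> T" "v \<longlonglongrightarrow> g" "v' \<longlonglongrightarrow> g'" using seq[OF fg(2)] by blast
    show "(f + g, f' + g') \<in> closure T"
      by (rule lim[of "\<lambda>n. u n + v n" "\<lambda>n. u' n + v' n"]) (auto intro: lop_add[OF l] tendsto_add u v)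
  next
    fix c f f' assume fg: "(f, f') \<in> closure T"
    obtain u u' where u: "\<And>n. (u n, u' n) \<in> T" "u \<longlonglongrightarrow> f" "u' \<longlonglongrightarrow> f'" using seq[OF fg] by blast
    show "(c *\<^sub>C f, c *\<^sub>C f') \<in> closure T"
      by (rule lim[of "\<lambda>n. c *\<^sub>C u n" "\<lambda>n. c *\<^sub>C u' n"]) (auto intro: lop_scaleC[OF l] tendsto_scaleC u)
  next
    fix f f' f'' assume a: "(f, f') \<in> closure T" "(f, f'') \<in> closure T"
    have "cinner (f' - f'') g = 0" if gd: "g \<in> Domain T" for g
    proof -
      from gd obtain g' where "(g, g') \<in> T" by blast
      then show ?thesis using symc[OF a(1), of g g'] symc[OF a(2), of g g'] by (simp add: cinner_lin)
    qed
    moreover have "f' - f'' \<in> K" using a clK by (intro csub_diff[OF K]) auto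
    ultimately have "f' - f'' = 0" using dense_orth_0[OF lop_Domain[OF l] d[symmetric]] by blast
    then show "f' = f''" by simp
  qed
  have "symmetric_operator (closure T)"
  proof (rule symmetric_operatorI[OF lc])
    fix f f' assume a: "(f, f') \<in> closure T"
    obtain u u' where u: "\<And>n. (u n, u' n) \<in> T" "u \<longlonglongrightarrow> f" "u' \<longlonglongrightarrow> f'" using seq[OF a] by blast
    have "(\<lambda>n. Im (cinner (u' n) (u n))) \<longlonglongrightarrow> Im (cinner f' f)" by (intro tendsto_intros u)
    moreover have "Im (cinner (u' n) (u n)) = 0" for n
      using T(1) u(1)[of n] by (auto simp: symmetric_operator_def)
    ultimately have "(\<lambda>n. 0) \<longlonglongrightarrow> Im (cinner f' f)" by simp
    then show "Im (cinner f' f) = 0" by (simp add: LIMSEQ_const_iff)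
  qed
  then have "closure T = T"
    using m clK closure_subset unfolding maximal_symmetric_in_def by blast
  then show ?thesis by (metis closed_closure)
qed

lemma adjoint_closed:
  assumes K: "csub K" shows "closed (adjoint_in K T)"
proof -
  have "adjoint_in K T = (K \<times> K) \<inter> (\<Inter>(f, f')\<in>T. {p. cinner f' (fst p) = cinner f (snd p)})"
    by (auto simp: adjoint_in_def)
  moreover have "closed {p :: 'a \<times> 'a. cinner f' (fst p) = cinner f (snd p)}" for f f'
    by (intro closed_Collect_eq continuous_intros)
  ultimately show ?thesis using csub_closed[OF K] by (auto intro!: closed_Int closed_Times closed_INT)
qed

text \<open>Von Neumann's range criterion. It replaces work with adjoints by the two ranges, which
  are computable for extensions given by an isometry.\<close>

lemma selfadjoint_iff:
  assumes K: "csub K"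
  shows "selfadjoint_in K T \<longleftrightarrow> symmetric_operator T \<and> T \<subseteq> K \<times> K \<and> ran_sp T \<i> = K \<and> ran_sp T (-\<i>) = K"
    (is "?L \<longleftrightarrow> ?R")
proof
  assume sa: ?L
  then have l: "linear_operator T" and TK: "T \<subseteq> K \<times> K" and ad: "adjoint_in K T = T"
    by (auto simp: selfadjoint_in_def)
  have eq: "cinner f' g = cinner f g'" if "(f, f') \<in> T" "(g, g') \<in> T" for f f' g g'
  proof -
    have "(g, g') \<in> adjoint_in K T" using that ad by simp
    then show ?thesis using that(1) unfolding adjoint_in_def by blast
  qed
  have s: "symmetric_operator T"
  proof (rule symmetric_operatorI[OF l])
    fix f f' assume "(f, f') \<in> T"
    then have "cinner f' f = cnj (cinner f' f)" using eq by (metis cinner_commute)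
    then show "Im (cinner f' f) = 0" by (metis Reals_cnj_iff complex_is_Real_iff)
  qed
  have cl: "closed T" using adjoint_closed[OF K, of T] ad by simp
  have "ran_sp T e = K" if e: "imag_unit e" for e
  proof -
    have sub: "ran_sp T e \<subseteq> K"
      using TK by (auto simp: ran_sp_def intro!: csub_add[OF K] csub_scaleC[OF K])
    have "closure (ran_sp T e) = K"
    proof (rule dense_if_orth_0[OF ran_sp_csubspace[OF l] K sub])
      fix x assume x: "x \<in> K" "\<And>a. a \<in> ran_sp T e \<Longrightarrow> cinner x a = 0"
      \<comment> \<open>A vector orthogonal to ran (T + e I) is an eigenvector of the adjoint for e.
        The adjoint being T, symmetry leaves only x = 0.\<close>
      have "(x, e *\<^sub>C x) \<in> adjoint_in K T"
        unfolding adjoint_in_def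
      proof (clarsimp simp: x(1) csub_scaleC[OF K x(1)])
        fix f f' assume f: "(f, f') \<in> T"
        have "cinner (f' + e *\<^sub>C f) x = 0" using x(2)[OF ran_spI[OF f]] cinner_eq_sym by blast
        then show "cinner f' x = cinner f (e *\<^sub>C x)"
          by (simp add: cinner_lin imag_unit_cnj[OF e] eq_neg_iff_add_eq_0)
      qed
      then have xT: "(x, e *\<^sub>C x) \<in> T" using ad by simp
      from eq[OF xT xT] have "e * cinner x x = 0"
        by (simp add: cinner_lin imag_unit_cnj[OF e])
      then show "x = 0" using e by (auto simp: imag_unit_def)
    qed
    then show ?thesis using ran_sp_closed[OF s cl e] by (simp add: csub_def)
  qed
  then show ?R using s TK by simp
next
  assume r: ?R
  then have s: "symmetric_operator T" and TK: "T \<subseteq> K \<times> K" and full: "ran_sp T \<i> = K" "ran_sp T (-\<i>) = K"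
    by auto
  note l = sym_lop[OF s]
  have "closure (Domain T) = K"
  proof (rule dense_if_orth_0[OF lop_Domain[OF l] K])
    show "Domain T \<subseteq> K" using TK by auto
    fix x assume x: "x \<in> K" "\<And>a. a \<in> Domain T \<Longrightarrow> cinner x a = 0"
    \<comment> \<open>Pairing x = f' + i f with f isolates |f|^2 in the imaginary part.\<close>
    obtain f f' where f: "(f, f') \<in> T" "x = f' + \<i> *\<^sub>C f" using x(1) full(1) by (auto simp: ran_sp_def)
    have "cinner (f' + \<i> *\<^sub>C f) f = 0" using x(2) f by blast
    then have "Im (cinner f' f) + (norm f)\<^sup>2 = 0"
      by (simp add: cinner_lin cinner_self complex_eq_iff)
    then have "f = 0" using s f(1) by (auto simp: symmetric_operator_def)
    then show "x = 0" using f lop_unique[OF l _ lop_0[OF l]] by auto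
  qed
  moreover have "adjoint_in K T = T"
  proof
    show "T \<subseteq> adjoint_in K T" using TK sym_cinner[OF s] by (auto simp: adjoint_in_def)
    show "adjoint_in K T \<subseteq> T"
    proof clarify
      fix g g' assume g: "(g, g') \<in> adjoint_in K T"
      then have gK: "g \<in> K" "g' \<in> K" and ga: "\<And>f f'. (f, f') \<in> T \<Longrightarrow> cinner f' g = cinner f g'"
        by (auto simp: adjoint_in_def)
      have "g' + \<i> *\<^sub>C g \<in> K" by (intro csub_add[OF K] csub_scaleC[OF K] gK)
      then obtain f f' where f: "(f, f') \<in> T" "g' + \<i> *\<^sub>C g = f' + \<i> *\<^sub>C f"
        using full(1) by (auto simp: ran_sp_def)
      \<comment> \<open>The difference belongs to the adjoint graph with d' = - i d. Writing d as (T
        - i I) h then shows that d is orthogonal to itself.\<close>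
      define d d' where "d = g - f" and "d' = g' - f'"
      have dd: "d' = - \<i> *\<^sub>C d" using f(2) by (simp add: d_def d'_def scaleC_simps algebra_simps)
      have dK: "d \<in> K" unfolding d_def using gK TK f(1) by (intro csub_diff[OF K]) auto
      then obtain h h' where h: "(h, h') \<in> T" "d = h' + (-\<i>) *\<^sub>C h" using full(2) by (auto simp: ran_sp_def)
      have "cinner h' d = cinner h d'"
        using ga[OF h(1)] sym_cinner[OF s h(1) f(1)] by (simp add: d_def d'_def cinner_lin)
      then have "cinner (h' + (-\<i>) *\<^sub>C h) d = 0" by (simp add: dd cinner_lin)
      then have "d = 0" using h(2) by simp
      moreover from this have "d' = 0" by (simp add: dd)
      ultimately show "(g, g') \<in> T" using f(1) by (simp add: d_def d'_def)
    qed
  qed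
  ultimately show ?L using l TK by (simp add: selfadjoint_in_def)
qed

subsection \<open>Geometry of the deficiency subspaces\<close>

locale closed_sym =
  fixes S :: "('a::complex_hilbert_space \<times> 'a) set"
  assumes S: "symmetric_operator S" and closedS: "closed S"
begin

abbreviation "H0 \<equiv> dom_closure S"
abbreviation "LL \<equiv> dom_orth S"
abbreviation "N \<equiv> N_sp S"
abbreviation "Lz \<equiv> L_sp S"
abbreviation "N' \<equiv> N'_sp S"
abbreviation "V \<equiv> V_op S"
abbreviation "S0 \<equiv> proj_operator H0 S"

lemmas lS = sym_lop[OF S]

lemma H0: "csub H0"
  unfolding dom_closure_def by (rule csubspace_closure[OF lop_Domain[OF lS]])

lemma LL: "csub LL"
  unfolding dom_orth_def by (rule csub_orth_diff[OF csub_UNIV])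

lemma Domain_H0: "(f, f') \<in> S \<Longrightarrow> f \<in> H0"
  unfolding dom_closure_def by (rule subsetD[OF closure_subset DomainI])

lemma LL_orth: "h \<in> LL \<Longrightarrow> x \<in> H0 \<Longrightarrow> cinner h x = 0"
  by (simp add: dom_orth_def orth_diff_def)

lemma LL_I:
  assumes "\<And>f f'. (f, f') \<in> S \<Longrightarrow> cinner h f = 0" shows "h \<in> LL"
proof -
  have "closed {x. cinner h x = 0}" by (intro closed_Collect_eq continuous_intros)
  then have "closure (Domain S) \<subseteq> {x. cinner h x = 0}" using assms by (intro closure_minimal) auto
  then show ?thesis by (auto simp: dom_orth_def orth_diff_def dom_closure_def)
qed

lemma H0_I: assumes "\<And>h. h \<in> LL \<Longrightarrow> cinner x h = 0" shows "x \<in> H0"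
  by (rule orth_orth[OF H0], rule assms) (simp add: dom_orth_def orth_diff_def)

lemma H0_iff: "x \<in> H0 \<longleftrightarrow> (\<forall>h\<in>LL. cinner x h = 0)"
  using H0_I LL_orth cinner_eq_sym by blast

lemma proj_H0_LL: "h \<in> LL \<Longrightarrow> proj H0 h = 0"
  using LL_orth by (simp add: proj_eq_0_iff[OF H0])

lemma N_eq: "imag_unit e \<Longrightarrow> N e = UNIV \<ominus> ran_sp S e"
  by (simp add: N_sp_def deficiency_sp_eq)

lemma N_csub: "imag_unit e \<Longrightarrow> csub (N e)"
  by (simp add: N_eq csub_orth_diff[OF csub_UNIV])

lemma N_orth: "imag_unit e \<Longrightarrow> \<phi> \<in> N e \<Longrightarrow> (f, f') \<in> S \<Longrightarrow> cinner \<phi> (f' + e *\<^sub>C f) = 0"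
  by (auto simp: N_eq orth_diff_def ran_sp_def)

lemma decomp:
  assumes e: "imag_unit e" shows "\<exists>f f'. (f, f') \<in> S \<and> x = proj (N e) x + (f' + e *\<^sub>C f)"
proof -
  have "x - proj (N e) x \<in> ran_sp S e"
  proof (rule orth_orth[OF ran_sp_closed[OF S closedS e]])
    fix y assume "\<And>k. k \<in> ran_sp S e \<Longrightarrow> cinner y k = 0"
    then have "y \<in> N e" by (simp add: N_eq[OF e] orth_diff_def)
    then show "cinner (x - proj (N e) x) y = 0" by (rule proj_orth[OF N_csub[OF e]])
  qed
  then obtain f f' where "(f, f') \<in> S" "x - proj (N e) x = f' + e *\<^sub>C f" by (auto simp: ran_sp_def)
  then show ?thesis by (intro exI[of _ f] exI[of _ f']) (simp add: algebra_simps)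
qed

text \<open>The two decompositions of \<open>h \<in> \<LL>\<close> along \<open>ran (S \<plusminus> i I)\<close> involve the same vector of
  \<open>dom S\<close>; this is the reason why \<open>V\<^sub>z\<close> is a well-defined isometry.\<close>

lemma LL_decomp:
  assumes e: "imag_unit e" and h: "h \<in> LL"
  shows "\<exists>g g'. (g, g') \<in> S \<and> h = proj (N e) h + (g' + e *\<^sub>C g) \<and> h = proj (N (-e)) h + (g' - e *\<^sub>C g)"
proof -
  obtain f f' where f: "(f, f') \<in> S" "h = proj (N e) h + (f' + e *\<^sub>C f)" using decomp[OF e] by blast
  obtain g g' where g: "(g, g') \<in> S" "h = proj (N (-e)) h + (g' + (-e) *\<^sub>C g)"
    using decomp[OF imag_unit_neg[OF e]] by blast
  \<comment> \<open>As h is orthogonal to dom S, testing h on u' + e u leaves (h, u') on the left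
    and an expression without e on the right. So both decompositions induce the same functional,
    which is then evaluated at their difference.\<close>
  have key: "cinner h u' = cinner f' u' + cinner f u"
    if e: "imag_unit e" and f: "(f, f') \<in> S" "h = proj (N e) h + (f' + e *\<^sub>C f)" and u: "(u, u') \<in> S" for e f f' u u'
  proof -
    have "cinner h (u' + e *\<^sub>C u) = cinner (proj (N e) h) (u' + e *\<^sub>C u) + cinner (f' + e *\<^sub>C f) (u' + e *\<^sub>C u)"
      by (subst f(2)) (simp only: cinner_add_left)
    also have "cinner (proj (N e) h) (u' + e *\<^sub>C u) = 0"
      by (rule N_orth[OF e proj_mem[OF N_csub[OF e]] u])
    also have "cinner (f' + e *\<^sub>C f) (u' + e *\<^sub>C u) = cinner f' u' + cinner f u"
      by (rule sym_cross[OF S e f(1) u])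
    finally show ?thesis using LL_orth[OF h Domain_H0[OF u]] by (simp add: cinner_lin)
  qed
  have d: "(f - g, f' - g') \<in> S" by (rule lop_diff[OF lS f(1) g(1)])
  have "cinner (f' - g') (f' - g') + cinner (f - g) (f - g) = 0"
    using key[OF e f d] key[OF imag_unit_neg[OF e] g d] by (simp add: cinner_diff_left algebra_simps)
  then have "of_real ((norm (f' - g'))\<^sup>2 + (norm (f - g))\<^sup>2) = (0::complex)"
    by (simp add: cinner_self)
  then have "(norm (f' - g'))\<^sup>2 + (norm (f - g))\<^sup>2 = 0" by (simp only: of_real_eq_0_iff)
  then have "f' = g'" "f = g" by (auto simp: sum_power2_eq_zero_iff)
  then show ?thesis using f g by (intro exI[of _ f] exI[of _ f']) (simp add: scaleC_simps)
qed

text \<open>Subtracting |g'|^2 + |g|^2, with the same g for both half-planes, from |h|^2 gives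
  either square.\<close>

lemma LL_proj_norm:
  assumes e: "imag_unit e" and h: "h \<in> LL" shows "norm (proj (N (-e)) h) = norm (proj (N e) h)"
proof -
  obtain g g' where g: "(g, g') \<in> S" "h = proj (N e) h + (g' + e *\<^sub>C g)"
      "h = proj (N (-e)) h + (g' - e *\<^sub>C g)" using LL_decomp[OF e h] by blast
  have "(norm h)\<^sup>2 = (norm (proj (N e) h))\<^sup>2 + (norm (g' + e *\<^sub>C g))\<^sup>2"
    using N_orth[OF e proj_mem[OF N_csub[OF e]] g(1)] g(2) norm_add_orth by metis
  moreover have "(norm h)\<^sup>2 = (norm (proj (N (-e)) h))\<^sup>2 + (norm (g' + (-e) *\<^sub>C g))\<^sup>2"
    using N_orth[OF imag_unit_neg[OF e] proj_mem[OF N_csub[OF imag_unit_neg[OF e]]] g(1)] g(3) norm_add_orth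
    by (metis (no_types, lifting) scaleC_minus_left uminus_add_conv_diff add.commute)
  ultimately have "(norm (proj (N (-e)) h))\<^sup>2 = (norm (proj (N e) h))\<^sup>2"
    using sym_norm[OF S e g(1)] sym_norm[OF S imag_unit_neg[OF e] g(1)] by simp
  then show ?thesis by (simp add: power2_eq_iff_nonneg)
qed

text \<open>Pairing h = g' + e g with g \<in> dom S has the imaginary part \<plusminus>|g|^2, while
  h is orthogonal to dom S. Injectivity makes \<open>V_op\<close> well defined.\<close>

lemma LL_proj_inj:
  assumes e: "imag_unit e" and h: "h \<in> LL" and z: "proj (N e) h = 0" shows "h = 0"
proof -
  obtain g g' where g: "(g, g') \<in> S" "h = g' + e *\<^sub>C g" using LL_decomp[OF e h] z by auto
  have "cinner (g' + e *\<^sub>C g) g = 0" using LL_orth[OF h Domain_H0[OF g(1)]] g(2) by simp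
  then have "Im (cinner g' g) + Im e * (norm g)\<^sup>2 = 0" using e
    by (auto simp: cinner_lin cinner_self complex_eq_iff imag_unit_def)
  then have "g = 0" using S g(1) e by (auto simp: symmetric_operator_def imag_unit_def)
  then show ?thesis using g lop_unique[OF lS _ lop_0[OF lS]] by auto
qed

lemma LL_proj_eq:
  assumes e: "imag_unit e" and h: "h \<in> LL" "k \<in> LL" and z: "proj (N e) h = proj (N e) k" shows "h = k"
proof -
  have "proj (N e) (h - k) = 0" using z by (simp add: proj_diff[OF N_csub[OF e]])
  then have "h - k = 0" by (rule LL_proj_inj[OF e csub_diff[OF LL h]])
  then show ?thesis by simp
qed

lemma V_proj:
  assumes e: "imag_unit e" and h: "h \<in> LL" shows "V e (proj (N e) h) = proj (N (-e)) h"
  unfolding V_op_def imag_unit_cnj[OF e]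
  by (rule the_equality) (use h LL_proj_eq[OF e h] in blast)+

lemma Lz_I: "h \<in> LL \<Longrightarrow> proj (N e) h \<in> Lz e"
  by (auto simp: L_sp_def)

lemma Lz_E: assumes "\<phi> \<in> Lz e" obtains h where "h \<in> LL" "\<phi> = proj (N e) h"
  using assms by (auto simp: L_sp_def)

lemma Lz_N: "imag_unit e \<Longrightarrow> \<phi> \<in> Lz e \<Longrightarrow> \<phi> \<in> N e"
  by (auto simp: L_sp_def proj_mem[OF N_csub])

lemma V_Lz: "imag_unit e \<Longrightarrow> \<phi> \<in> Lz e \<Longrightarrow> V e \<phi> \<in> Lz (-e)"
  by (auto elim!: Lz_E simp: V_proj Lz_I)

lemma V_inv: "imag_unit e \<Longrightarrow> \<phi> \<in> Lz e \<Longrightarrow> V (-e) (V e \<phi>) = \<phi>"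
  using V_proj[OF imag_unit_neg] by (auto elim!: Lz_E simp: V_proj)

lemma V_inv': "imag_unit e \<Longrightarrow> \<phi> \<in> Lz (-e) \<Longrightarrow> V e (V (-e) \<phi>) = \<phi>"
  using V_inv[OF imag_unit_neg] by simp

lemma Lz_decomp:
  assumes e: "imag_unit e" and p: "\<phi> \<in> Lz e"
  shows "\<exists>h g g'. h \<in> LL \<and> (g, g') \<in> S \<and> \<phi> = proj (N e) h \<and> h = \<phi> + (g' + e *\<^sub>C g) \<and> h = V e \<phi> + (g' - e *\<^sub>C g)"
proof -
  obtain h where h: "h \<in> LL" "\<phi> = proj (N e) h" using p by (rule Lz_E)
  then show ?thesis using LL_decomp[OF e h(1)] V_proj[OF e h(1)] by metis
qed

text \<open>The decompositions h = \<phi> + (g' + e g) = V \<phi> + (g' - e g) give \<phi> - V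
  \<phi> = - 2 e g and \<phi> + V \<phi> = 2 h - 2 g', and the projection onto \<open>H0\<close>
  kills h.\<close>

lemma V_diff_dom:
  assumes e: "imag_unit e" and p: "\<phi> \<in> Lz e"
  shows "\<exists>f'. (\<phi> - V e \<phi>, f') \<in> S \<and> proj H0 f' = proj H0 (e *\<^sub>C (\<phi> + V e \<phi>))"
proof -
  obtain h g g' where g: "h \<in> LL" "(g, g') \<in> S" "h = \<phi> + (g' + e *\<^sub>C g)" "h = V e \<phi> + (g' - e *\<^sub>C g)"
    using Lz_decomp[OF e p] by blast
  have a: "\<phi> = h - (g' + e *\<^sub>C g)" "V e \<phi> = h - (g' - e *\<^sub>C g)"
    using g(3,4) by (metis add_diff_cancel_right')+
  have "\<phi> - V e \<phi> = (- 2 * e) *\<^sub>C g"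
  proof -
    have "- 2 * e = (- e) + (- e)" by simp
    then show ?thesis
      by (subst a(2), subst a(1)) (simp only: scaleC_add_left scaleC_minus_left, simp)
  qed
  then have 1: "(\<phi> - V e \<phi>, (- 2 * e) *\<^sub>C g') \<in> S" using lop_scaleC[OF lS g(2), of "- 2 * e"] by simp
  have "\<phi> + V e \<phi> = 2 *\<^sub>C h - 2 *\<^sub>C g'"
    by (subst a(2), subst a(1)) (simp add: scaleC_2)
  then have "e *\<^sub>C (\<phi> + V e \<phi>) = (2 * e) *\<^sub>C h + (- 2 * e) *\<^sub>C g'"
    by (simp add: scaleC_simps mult.commute)
  then have "proj H0 (e *\<^sub>C (\<phi> + V e \<phi>)) = proj H0 ((- 2 * e) *\<^sub>C g')"
    by (simp only: proj_add[OF H0] proj_scaleC[OF H0] proj_H0_LL[OF g(1)] scaleC_zero_right add_0)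
  then show ?thesis using 1 by metis
qed

text \<open>Converse of \<open>V_diff_dom\<close>: f determines g, then h, and h turns out to lie in
  \<LL>. So only the graph of V obstructs a direct sum, which is the origin of the condition that U
  - V_i be injective on \<LL>_i.\<close>

lemma dom_intersect:
  assumes e: "imag_unit e" and f: "(f, f') \<in> S" and p: "\<phi> \<in> N e" "\<psi> \<in> N (-e)" and eq: "f = \<phi> - \<psi>"
  shows "\<phi> \<in> Lz e \<and> \<psi> = V e \<phi>"
proof -
  \<comment> \<open>Solves \<phi> - V \<phi> = - 2 e g for g, as e^2 = -1.\<close>
  define g g' where "g = (e / 2) *\<^sub>C f" and "g' = (e / 2) *\<^sub>C f'"
  have g: "(g, g') \<in> S" unfolding g_def g'_def by (rule lop_scaleC[OF lS f])
  define h where "h = \<phi> + (g' + e *\<^sub>C g)"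
  have eg: "e *\<^sub>C g + e *\<^sub>C g = - f"
  proof -
    have "e *\<^sub>C g + e *\<^sub>C g = (e * (e / 2) + e * (e / 2)) *\<^sub>C f"
      by (simp only: g_def scaleC_scaleC scaleC_add_left)
    also have "e * (e / 2) + e * (e / 2) = -1" using imag_unit_sq[OF e] by simp
    finally show ?thesis by (simp add: scaleC_simps)
  qed
  have h2: "h = \<psi> + (g' + (-e) *\<^sub>C g)"
  proof -
    have "h - (\<psi> + (g' + (-e) *\<^sub>C g)) = f + (e *\<^sub>C g + e *\<^sub>C g)"
      by (simp add: h_def eq scaleC_minus_left)
    then show ?thesis using eg by simp
  qed
  have k: "cinner h u' = cinner g' u' + cinner g u + e * cinner h u"
    if e: "imag_unit e" and p: "\<phi> \<in> N e" and h: "h = \<phi> + (g' + e *\<^sub>C g)" and u: "(u, u') \<in> S" for e \<phi> u u'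
  proof -
    have "cinner h (u' + e *\<^sub>C u) = cinner (g' + e *\<^sub>C g) (u' + e *\<^sub>C u)"
      using N_orth[OF e p u] by (simp add: h cinner_add_left)
    also have "\<dots> = cinner g' u' + cinner g u"
      by (rule sym_cross[OF S e g u])
    finally show ?thesis by (simp add: cinner_lin imag_unit_cnj[OF e] diff_eq_eq)
  qed
  have hL: "h \<in> LL"
  proof (rule LL_I)
    fix u u' assume u: "(u, u') \<in> S"
    \<comment> \<open>The two formulas for (h, u') share the part without e, so only the terms
      \<plusminus>e (h, u) are compared.\<close>
    have "e * cinner h u = - e * cinner h u"
      using k[OF e p(1) h_def u] k[OF imag_unit_neg[OF e] p(2) h2 u] by simp
    then show "cinner h u = 0" using e by (auto simp: imag_unit_def)
  qed
  have prj: "proj (N e) h = \<phi>"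
    if e: "imag_unit e" and p: "\<phi> \<in> N e" and h: "h = \<phi> + (g' + e *\<^sub>C g)" for e \<phi>
  proof (rule proj_eqI[OF N_csub[OF e] p])
    fix k assume k: "k \<in> N e"
    show "cinner (h - \<phi>) k = 0" using iffD1[OF cinner_eq_sym N_orth[OF e k g]] by (simp add: h)
  qed
  show ?thesis
    using prj[OF e p(1) h_def] prj[OF imag_unit_neg[OF e] p(2) h2] Lz_I[OF hL, of e] V_proj[OF e hL] by simp
qed

end

section \<open>Consequences of regularity: closed \<LL>_e and the splitting of the deficiency
  spaces\<close>

locale reg_sym = closed_sym +
  assumes reg: "regular_extension S S"
begin

lemma S0_mem: "(f, f') \<in> S \<Longrightarrow> (f, proj H0 f') \<in> S0"
  by (auto simp: proj_operator_def)

lemma S0_E: assumes "(f, f') \<in> S0" obtains f'' where "(f, f'') \<in> S" "f' = proj H0 f''"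
  using assms by (auto simp: proj_operator_def)

lemma closedS0: "closed S0"
  using reg by (simp add: regular_extension_def)

lemma S0_sym: "symmetric_operator S0"
proof (intro symmetric_operatorI linear_operatorI)
  show "(0, 0) \<in> S0" using S0_mem[OF lop_0[OF lS]] by (simp add: proj_0[OF H0])
next
  fix f f' g g' assume "(f, f') \<in> S0" "(g, g') \<in> S0"
  then obtain f'' g'' where *: "(f, f'') \<in> S" "f' = proj H0 f''" "(g, g'') \<in> S" "g' = proj H0 g''"
    by (auto elim!: S0_E)
  then show "(f + g, f' + g') \<in> S0" using S0_mem[OF lop_add[OF lS *(1,3)]] by (simp add: proj_add[OF H0])
next
  fix c f f' assume "(f, f') \<in> S0"
  then obtain f'' where *: "(f, f'') \<in> S" "f' = proj H0 f''" by (auto elim!: S0_E)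
  then show "(c *\<^sub>C f, c *\<^sub>C f') \<in> S0" using S0_mem[OF lop_scaleC[OF lS *(1)]] by (simp add: proj_scaleC[OF H0])
next
  fix f f' g' assume "(f, f') \<in> S0" "(f, g') \<in> S0"
  then show "f' = g'" using lop_unique[OF lS] by (auto elim!: S0_E)
next
  fix f f' assume "(f, f') \<in> S0"
  then obtain f'' where f: "(f, f'') \<in> S" "f' = proj H0 f''" by (auto elim: S0_E)
  have "cinner f' f = cinner f'' f" unfolding f(2) by (rule proj_cinner[OF H0 Domain_H0[OF f(1)]])
  then show "Im (cinner f' f) = 0" using S f(1) by (auto simp: symmetric_operator_def)
qed

lemma S0_Domain: "Domain S0 = Domain S"
  by (auto simp: proj_operator_def)

lemma S0_H0: "S0 \<subseteq> H0 \<times> H0"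
  by (auto simp: proj_operator_def Domain_H0 proj_mem[OF H0])

lemma ran_S0: "imag_unit e \<Longrightarrow> csub (ran_sp S0 e)"
  by (rule ran_sp_closed[OF S0_sym closedS0])

text \<open>For u_n in \<LL>_e some u_n + (S + e I) g_n lies in \<LL>, so the projection of - u_n
  onto \<open>H0\<close> lies in ran (S_0 + e I), which is closed because S is regular. The limit
  therefore has the same form, and this produces k \<in> \<LL> whose projection is y.\<close>

lemma Lz_csub:
  assumes e: "imag_unit e" shows "csub (Lz e)"
proof -
  note nc = N_csub[OF e]
  have cs: "csubspace (Lz e)"
    unfolding complex_vector.subspace_def L_sp_def
    by (auto simp: proj_add[OF nc, symmetric] proj_scaleC[OF nc, symmetric]
        intro!: imageI csub_add[OF LL] csub_scaleC[OF LL])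
      (metis csub_0[OF LL] image_eqI proj_0[OF nc])
  have "closed (Lz e)"
    unfolding closed_sequential_limits
  proof (intro allI impI)
    fix u y assume u: "(\<forall>n. u n \<in> Lz e) \<and> u \<longlonglongrightarrow> y"
    then have "\<forall>n. \<exists>h g g'. h \<in> LL \<and> (g, g') \<in> S \<and> h = u n + (g' + e *\<^sub>C g)"
      using Lz_decomp[OF e] by metis
    then obtain h g g' where g: "\<And>n. h n \<in> LL" "\<And>n. (g n, g' n) \<in> S" "\<And>n. h n = u n + (g' n + e *\<^sub>C g n)"
      by metis
    have pe: "- proj H0 (u n) = proj H0 (g' n) + e *\<^sub>C g n" for n
    proof -
      have "0 = proj H0 (h n)" using proj_H0_LL[OF g(1)] by simp
      also have "\<dots> = proj H0 (u n) + (proj H0 (g' n) + e *\<^sub>C g n)"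
        by (simp add: g(3)[of n] proj_add[OF H0] proj_scaleC[OF H0] proj_id[OF H0 Domain_H0[OF g(2)]])
      finally show ?thesis by (simp add: neg_eq_iff_add_eq_0)
    qed
    have "- proj H0 (u n) \<in> ran_sp S0 e" for n
      unfolding pe by (rule ran_spI[OF S0_mem[OF g(2)]])
    moreover have "(\<lambda>n. - proj H0 (u n)) \<longlonglongrightarrow> - proj H0 y"
      using u by (intro tendsto_minus bounded_linear.tendsto[OF bounded_linear_proj[OF H0]]) auto
    ultimately have "- proj H0 y \<in> ran_sp S0 e"
      by (rule closed_sequentially[OF csub_closed[OF ran_S0[OF e]]])
    then obtain f f' where f: "(f, f') \<in> S" "- proj H0 y = proj H0 f' + e *\<^sub>C f"
      by (auto simp: ran_sp_def elim!: S0_E)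
    define k where "k = y + (f' + e *\<^sub>C f)"
    have "proj H0 k = 0"
      using f by (simp add: k_def proj_add[OF H0] proj_scaleC[OF H0] proj_id[OF H0 Domain_H0[OF f(1)]]
          neg_eq_iff_add_eq_0)
    then have kL: "k \<in> LL" by (simp add: proj_eq_0_iff[OF H0] dom_orth_def orth_diff_def)
    have yN: "y \<in> N e" by (rule closed_sequentially[OF csub_closed[OF nc], of u]) (use u Lz_N[OF e] in auto)
    have "proj (N e) k = y"
    proof (rule proj_eqI[OF nc yN])
      fix x assume x: "x \<in> N e"
      show "cinner (k - y) x = 0"
        using iffD1[OF cinner_eq_sym N_orth[OF e x f(1)]] by (simp add: k_def)
    qed
    then show "y \<in> Lz e" using Lz_I[OF kL, of e] by simp
  qed
  then show ?thesis using cs by (simp add: csub_def)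
qed

lemma V_isometry:
  assumes e: "imag_unit e" shows "isometry_op (Lz e) (Lz (-e)) (V e)"
  unfolding isometry_op_def
proof
  note nc = N_csub[OF e] N_csub[OF imag_unit_neg[OF e]]
  have n: "norm (V e \<phi>) = norm \<phi>" if "\<phi> \<in> Lz e" for \<phi>
    using that by (auto elim!: Lz_E simp: V_proj[OF e] LL_proj_norm[OF e])
  then show "\<forall>x\<in>Lz e. norm (V e x) = norm x" by blast
  show "bounded_op (Lz e) (Lz (-e)) (V e)"
  proof (rule bopI[where b=1])
    fix x y assume "x \<in> Lz e" "y \<in> Lz e"
    then obtain h k where hk: "h \<in> LL" "x = proj (N e) h" "k \<in> LL" "y = proj (N e) k" by (auto elim!: Lz_E)
    then show "V e (x + y) = V e x + V e y"
      using V_proj[OF e csub_add[OF LL hk(1,3)]] by (simp add: proj_add nc V_proj[OF e])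
  next
    fix c x assume "x \<in> Lz e"
    then obtain h where h: "h \<in> LL" "x = proj (N e) h" by (auto elim!: Lz_E)
    then show "V e (c *\<^sub>C x) = c *\<^sub>C V e x"
      using V_proj[OF e csub_scaleC[OF LL h(1), of c]] by (simp add: proj_scaleC nc V_proj[OF e])
  qed (use n V_Lz[OF e] in auto)
qed

lemma V_bop: "imag_unit e \<Longrightarrow> bounded_op (Lz e) (Lz (-e)) (V e)"
  by (rule isometry_bop[OF V_isometry])

lemma V_cinner: "imag_unit e \<Longrightarrow> x \<in> Lz e \<Longrightarrow> y \<in> Lz e \<Longrightarrow> cinner (V e x) (V e y) = cinner x y"
  using isometry_cinner[OF Lz_csub V_bop] V_isometry by (auto simp: isometry_op_def)

lemma N'_csub: "imag_unit e \<Longrightarrow> csub (N' e)"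
  by (simp add: N'_sp_def csub_orth_diff[OF N_csub])

lemma N'_N: "\<phi> \<in> N' e \<Longrightarrow> \<phi> \<in> N e"
  by (simp add: N'_sp_def orth_diff_def)

lemma N'_Lz: "\<phi> \<in> N' e \<Longrightarrow> l \<in> Lz e \<Longrightarrow> cinner \<phi> l = 0"
  by (simp add: N'_sp_def orth_diff_def)

text \<open>For \<phi> \<in> N_e projecting h onto N_e does not change (\<phi>, h), so orthogonality
  to \<LL>_e is orthogonality to \<LL>.\<close>

lemma N'_iff: assumes e: "imag_unit e" shows "\<phi> \<in> N' e \<longleftrightarrow> \<phi> \<in> N e \<and> \<phi> \<in> H0"
proof -
  have "(\<forall>l\<in>Lz e. cinner \<phi> l = 0) \<longleftrightarrow> (\<forall>h\<in>LL. cinner \<phi> h = 0)" if "\<phi> \<in> N e"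
    using that by (auto simp: L_sp_def proj_cinner'[OF N_csub[OF e]])
  then show ?thesis unfolding H0_iff by (auto simp: N'_sp_def orth_diff_def)
qed

text \<open>For x \<in> \<open>H0\<close> the projection in front of S f is invisible. So N'_e is a
  deficiency space of the densely defined operator \<open>S0\<close> in \<open>H0\<close>, to which
  von Neumann's picture applies.\<close>

lemma N'_eq_S0: assumes e: "imag_unit e" shows "N' e = H0 \<ominus> ran_sp S0 e"
proof (intro set_eqI)
  fix x
  have "x \<in> N e \<longleftrightarrow> (\<forall>y\<in>ran_sp S0 e. cinner x y = 0)" if x: "x \<in> H0"
  proof -
    have "cinner x (proj H0 f' + e *\<^sub>C f) = cinner x (f' + e *\<^sub>C f)" for f f'
      by (simp add: cinner_add_right proj_cinner'[OF H0 x])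
    moreover have "(\<forall>y\<in>ran_sp S0 e. cinner x y = 0) \<longleftrightarrow>
        (\<forall>f f'. (f, f') \<in> S \<longrightarrow> cinner x (proj H0 f' + e *\<^sub>C f) = 0)"
      unfolding ran_sp_ball by (auto simp: proj_operator_def)
    ultimately show ?thesis unfolding N_eq[OF e] by (simp add: orth_diff_def ran_sp_ball)
  qed
  then show "x \<in> N' e \<longleftrightarrow> x \<in> H0 \<ominus> ran_sp S0 e"
    unfolding N'_iff[OF e] by (auto simp: orth_diff_def)
qed

lemma N_split:
  assumes e: "imag_unit e" and p: "\<phi> \<in> N e"
  shows "\<phi> - proj (Lz e) \<phi> \<in> N' e"
  using p proj_orth[OF Lz_csub[OF e]] Lz_N[OF e proj_mem[OF Lz_csub[OF e]]]
  by (auto simp: N'_sp_def orth_diff_def intro: csub_diff[OF N_csub[OF e]])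

lemma proj_split:
  assumes e: "imag_unit e" and l: "l \<in> Lz e" and n: "\<phi> \<in> N' e"
  shows "proj (Lz e) (l + \<phi>) = l" "proj (N' e) (l + \<phi>) = \<phi>"
  using l n N'_Lz[OF n] N'_Lz[OF _ l]
  by (auto intro!: proj_eqI simp: Lz_csub[OF e] N'_csub[OF e] cinner_lin) (meson cinner_eq_sym)

lemma proj_N': 
  assumes e: "imag_unit e" and p: "\<phi> \<in> N e" shows "proj (N' e) \<phi> = \<phi> - proj (Lz e) \<phi>"
  using proj_split(2)[OF e proj_mem[OF Lz_csub[OF e], of \<phi>] N_split[OF e p]] by simp

text \<open>Tested on h \<in> \<LL>, a vector of a deficiency space shows only its \<LL>-component
  there; V_e moves the pairing of the first one isometrically to the other space.\<close>

lemma H0_diff_eq: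
  assumes e: "imag_unit e" and p: "\<phi> \<in> N e" "\<psi> \<in> N (-e)" and h: "h \<in> LL"
  shows "cinner (\<psi> - \<phi>) h = cinner (proj (Lz (-e)) \<psi> - V e (proj (Lz e) \<phi>)) (proj (N (-e)) h)"
proof -
  note ne = imag_unit_neg[OF e]
  note lc = Lz_csub[OF e] and lc' = Lz_csub[OF ne]
  have m: "proj (Lz e) \<phi> \<in> Lz e" by (rule proj_mem[OF lc])
  have "cinner \<phi> h = cinner (proj (Lz e) \<phi>) (proj (N e) h)"
    using proj_cinner[OF lc Lz_I[OF h]] proj_cinner'[OF N_csub[OF e] p(1)] by simp
  also have "\<dots> = cinner (V e (proj (Lz e) \<phi>)) (V e (proj (N e) h))"
    using V_cinner[OF e m Lz_I[OF h]] by simp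
  finally have "cinner \<phi> h = cinner (V e (proj (Lz e) \<phi>)) (proj (N (-e)) h)"
    by (simp add: V_proj[OF e h])
  moreover have "cinner \<psi> h = cinner (proj (Lz (-e)) \<psi>) (proj (N (-e)) h)"
    using proj_cinner[OF lc' Lz_I[OF h]] proj_cinner'[OF N_csub[OF ne] p(2)] by simp
  ultimately show ?thesis by (simp add: cinner_diff_left)
qed

lemma H0_diff_iff:
  assumes e: "imag_unit e" and p: "\<phi> \<in> N e" "\<psi> \<in> N (-e)"
  shows "\<psi> - \<phi> \<in> H0 \<longleftrightarrow> proj (Lz (-e)) \<psi> = V e (proj (Lz e) \<phi>)"
proof -
  note lc' = Lz_csub[OF imag_unit_neg[OF e]]
  have m: "proj (Lz e) \<phi> \<in> Lz e" by (rule proj_mem[OF Lz_csub[OF e]])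
  have "(\<forall>h\<in>LL. cinner (\<psi> - \<phi>) h = 0) \<longleftrightarrow>
      (\<forall>l\<in>Lz (-e). cinner (proj (Lz (-e)) \<psi> - V e (proj (Lz e) \<phi>)) l = 0)"
    by (auto simp: H0_diff_eq[OF e p] L_sp_def)
  also have "\<dots> \<longleftrightarrow> proj (Lz (-e)) \<psi> - V e (proj (Lz e) \<phi>) = 0"
    using csub_diff[OF lc' proj_mem[OF lc', of \<psi>] V_Lz[OF e m]] by (metis cinner_self_eq_0 cinner_zero_left)
  finally show ?thesis unfolding H0_iff by simp
qed

end

subsection \<open>Unitary parameters and the compression\<close>

locale vN_ext = reg_sym +
  fixes U :: "'a::complex_hilbert_space \<Rightarrow> 'a"
  assumes unitU: "unitary_op (N \<i>) (N (-\<i>)) U"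
    and UV: "\<forall>f \<in> Lz \<i> - {0}. U f - V \<i> f \<noteq> 0"
begin

abbreviation "St \<equiv> vN_extension S U"
abbreviation "St0 \<equiv> compression H0 St"
abbreviation "Ui \<equiv> inv_into (N \<i>) U"
abbreviation "kerP \<equiv> {\<phi> \<in> N \<i>. proj (Lz (-\<i>)) (U \<phi>) - V \<i> (proj (Lz \<i>) \<phi>) = 0}"
definition "U0 = {(proj (N' \<i>) \<phi>, proj (N' (-\<i>)) (U \<phi>)) | \<phi>. \<phi> \<in> kerP}"

lemmas Np = N_csub[OF imag_unit_i(1)] and Nm = N_csub[OF imag_unit_i(2)]
lemmas Lp = Lz_csub[OF imag_unit_i(1)] and Lm = Lz_csub[OF imag_unit_i(2)]
lemmas N'p = N'_csub[OF imag_unit_i(1)] and N'm = N'_csub[OF imag_unit_i(2)]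

lemma isoU: "isometry_op (N \<i>) (N (-\<i>)) U" and imU: "U ` N \<i> = N (-\<i>)"
  using unitU by (auto simp: unitary_op_def)

lemmas bU = isometry_bop[OF isoU]

lemma U_norm: "\<phi> \<in> N \<i> \<Longrightarrow> norm (U \<phi>) = norm \<phi>"
  using isoU by (simp add: isometry_op_def)

lemma U_mem: "\<phi> \<in> N \<i> \<Longrightarrow> U \<phi> \<in> N (-\<i>)"
  by (rule bop_mem[OF bU])

lemma U_cinner: "x \<in> N \<i> \<Longrightarrow> y \<in> N \<i> \<Longrightarrow> cinner (U x) (U y) = cinner x y"
  by (rule isometry_cinner[OF Np bU U_norm])

lemma U_inj: "inj_on U (N \<i>)"
proof (rule inj_onI)
  fix x y assume xy: "x \<in> N \<i>" "y \<in> N \<i>" "U x = U y"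
  then have "norm (U (x - y)) = 0" by (simp add: bop_diff[OF Np bU])
  then show "x = y" using U_norm[OF csub_diff[OF Np xy(1,2)]] by simp
qed

lemma Ui_U: "\<phi> \<in> N \<i> \<Longrightarrow> Ui (U \<phi>) = \<phi>"
  by (rule inv_into_f_f[OF U_inj])

lemma U_Ui: "\<psi> \<in> N (-\<i>) \<Longrightarrow> U (Ui \<psi>) = \<psi>"
  by (rule f_inv_into_f) (simp add: imU)

lemma Ui_mem: "\<psi> \<in> N (-\<i>) \<Longrightarrow> Ui \<psi> \<in> N \<i>"
  by (rule inv_into_into) (simp add: imU)

lemma Ui_cinner: "x \<in> N \<i> \<Longrightarrow> y \<in> N (-\<i>) \<Longrightarrow> cinner x (Ui y) = cinner (U x) y"
  using U_cinner[of x "Ui y"] Ui_mem U_Ui by simp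

lemma Ui_bop: "bounded_op (N (-\<i>)) (N \<i>) Ui"
proof (rule bopI[where b=1])
  fix x y assume x: "x \<in> N (-\<i>)" and y: "y \<in> N (-\<i>)"
  show "Ui (x + y) = Ui x + Ui y"
    using Ui_U[OF csub_add[OF Np Ui_mem[OF x] Ui_mem[OF y]]]
    by (simp add: bop_add[OF bU] Ui_mem x y U_Ui)
next
  fix c x assume x: "x \<in> N (-\<i>)"
  show "Ui (c *\<^sub>C x) = c *\<^sub>C Ui x"
    using Ui_U[OF csub_scaleC[OF Np Ui_mem[OF x], of c]]
    by (simp add: bop_scaleC[OF bU] Ui_mem x U_Ui)
  show "norm (Ui x) \<le> 1 * norm x" using U_norm[OF Ui_mem[OF x]] U_Ui[OF x] by simp
qed (rule Ui_mem)

text \<open>By \<open>dom_intersect\<close> a common vector comes from \<phi> \<in> \<LL>_i with U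
  \<phi> = V_i \<phi>, which the condition on U allows only for \<phi> = 0.\<close>

lemma dom_disjoint:
  assumes f: "(f, f') \<in> S" and p: "\<phi> \<in> N \<i>" and eq: "f = \<phi> - U \<phi>" shows "\<phi> = 0 \<and> f = 0"
proof -
  have "\<phi> \<in> Lz \<i> \<and> U \<phi> = V \<i> \<phi>" by (rule dom_intersect[OF imag_unit_i(1) f p U_mem[OF p] eq])
  then have "\<phi> = 0" using UV by auto
  then show ?thesis using eq bop_0[OF Np bU] by simp
qed

lemma St_I: "(f, f') \<in> S \<Longrightarrow> \<phi> \<in> N \<i> \<Longrightarrow> (f + (\<phi> - U \<phi>), f' + \<i> *\<^sub>C (\<phi> + U \<phi>)) \<in> St"
  by (auto simp: vN_extension_def)

lemma St_E:
  assumes "(F, F') \<in> St"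
  obtains f f' \<phi> where "(f, f') \<in> S" "\<phi> \<in> N \<i>" "F = f + (\<phi> - U \<phi>)" "F' = f' + \<i> *\<^sub>C (\<phi> + U \<phi>)"
  using assms by (auto simp: vN_extension_def)

lemma St_direct: "is_direct_sum (Domain St) (Domain S) ((\<lambda>\<phi>. \<phi> - U \<phi>) ` N \<i>)"
  unfolding is_direct_sum_def
proof
  show "Domain St = {a + b | a b. a \<in> Domain S \<and> b \<in> (\<lambda>\<phi>. \<phi> - U \<phi>) ` N \<i>}"
    unfolding vN_extension_def by blast
  show "Domain S \<inter> (\<lambda>\<phi>. \<phi> - U \<phi>) ` N \<i> = {0}"
  proof (intro equalityI subsetI)
    fix x assume "x \<in> Domain S \<inter> (\<lambda>\<phi>. \<phi> - U \<phi>) ` N \<i>"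
    then show "x \<in> {0}" using dom_disjoint by blast
  next
    fix x :: 'a assume "x \<in> {0}"
    then have "x = 0 - U 0" "(x, 0) \<in> S" using bop_0[OF Np bU] lop_0[OF lS] by auto
    then show "x \<in> Domain S \<inter> (\<lambda>\<phi>. \<phi> - U \<phi>) ` N \<i>" using csub_0[OF Np] by blast
  qed
qed

lemma S_St: "S \<subseteq> St"
proof clarify
  fix f f' assume "(f, f') \<in> S"
  then show "(f, f') \<in> St" using St_I[OF _ csub_0[OF Np]] bop_0[OF Np bU] by fastforce
qed

text \<open>Cayley transform: adding or subtracting i I turns the contribution of \<phi> into 2 i
  \<phi> or 2 i U \<phi>. Symmetry and full ranges of the extension thus reduce to S and U.\<close>

lemma St_plus: "f' + \<i> *\<^sub>C (\<phi> + U \<phi>) + \<i> *\<^sub>C (f + (\<phi> - U \<phi>)) = (f' + \<i> *\<^sub>C f) + (2 * \<i>) *\<^sub>C \<phi>"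
  and St_minus: "f' + \<i> *\<^sub>C (\<phi> + U \<phi>) + (-\<i>) *\<^sub>C (f + (\<phi> - U \<phi>)) = (f' + (-\<i>) *\<^sub>C f) + (2 * \<i>) *\<^sub>C U \<phi>"
proof -
  have 2: "(2 * \<i>) *\<^sub>C x = \<i> *\<^sub>C x + \<i> *\<^sub>C x" for x :: 'a
    by (simp add: scaleC_add_left[symmetric])
  show "f' + \<i> *\<^sub>C (\<phi> + U \<phi>) + \<i> *\<^sub>C (f + (\<phi> - U \<phi>)) = (f' + \<i> *\<^sub>C f) + (2 * \<i>) *\<^sub>C \<phi>"
    by (simp add: 2 scaleC_add_right scaleC_diff_right)
  show "f' + \<i> *\<^sub>C (\<phi> + U \<phi>) + (-\<i>) *\<^sub>C (f + (\<phi> - U \<phi>)) = (f' + (-\<i>) *\<^sub>C f) + (2 * \<i>) *\<^sub>C U \<phi>"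
    by (simp add: 2 scaleC_add_right scaleC_diff_right scaleC_minus_left)
qed

lemma St_linear: "linear_operator St"
proof (rule linear_operatorI)
  show "(0, 0) \<in> St" using S_St lop_0[OF lS] by blast
next
  fix f f' g g' assume "(f, f') \<in> St" "(g, g') \<in> St"
  then obtain u u' \<phi> v v' \<psi> where *: "(u, u') \<in> S" "\<phi> \<in> N \<i>" "f = u + (\<phi> - U \<phi>)" "f' = u' + \<i> *\<^sub>C (\<phi> + U \<phi>)"
    "(v, v') \<in> S" "\<psi> \<in> N \<i>" "g = v + (\<psi> - U \<psi>)" "g' = v' + \<i> *\<^sub>C (\<psi> + U \<psi>)" by (metis St_E)
  show "(f + g, f' + g') \<in> St"
    using St_I[OF lop_add[OF lS *(1,5)] csub_add[OF Np *(2,6)]]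
    by (simp add: * bop_add[OF bU] scaleC_simps algebra_simps)
next
  fix c f f' assume "(f, f') \<in> St"
  then obtain u u' \<phi> where *: "(u, u') \<in> S" "\<phi> \<in> N \<i>" "f = u + (\<phi> - U \<phi>)" "f' = u' + \<i> *\<^sub>C (\<phi> + U \<phi>)"
    by (metis St_E)
  show "(c *\<^sub>C f, c *\<^sub>C f') \<in> St"
    using St_I[OF lop_scaleC[OF lS *(1)] csub_scaleC[OF Np *(2)], of c c]
    by (simp add: * bop_scaleC[OF bU] scaleC_simps mult.commute)
next
  fix f f' g' assume "(f, f') \<in> St" "(f, g') \<in> St"
  then obtain u u' \<phi> v v' \<psi> where *: "(u, u') \<in> S" "\<phi> \<in> N \<i>" "f = u + (\<phi> - U \<phi>)" "f' = u' + \<i> *\<^sub>C (\<phi> + U \<phi>)"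
    "(v, v') \<in> S" "\<psi> \<in> N \<i>" "f = v + (\<psi> - U \<psi>)" "g' = v' + \<i> *\<^sub>C (\<psi> + U \<psi>)" by (metis St_E)
  have "v - u = (\<phi> - \<psi>) - U (\<phi> - \<psi>)"
    using *(3,7) by (simp add: bop_diff[OF Np bU *(2,6)] algebra_simps)
  from dom_disjoint[OF lop_diff[OF lS *(5,1)] csub_diff[OF Np *(2,6)] this]
  have "\<phi> = \<psi>" "u = v" by auto
  then show "f' = g'" using * lop_unique[OF lS] by blast
qed

text \<open>|F' + i F|^2 - |F' - i F|^2 = 4 Im (F', F), and the two norms agree by orthogonality of
  the summands and isometry of U.\<close>

lemma St_sym: "symmetric_operator St"
proof (rule symmetric_operatorI[OF St_linear])
  fix F F' assume "(F, F') \<in> St"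
  then obtain f f' \<phi> where *: "(f, f') \<in> S" "\<phi> \<in> N \<i>" "F = f + (\<phi> - U \<phi>)" "F' = f' + \<i> *\<^sub>C (\<phi> + U \<phi>)"
    by (rule St_E)
  have o1: "cinner (f' + \<i> *\<^sub>C f) ((2 * \<i>) *\<^sub>C \<phi>) = 0"
    using iffD1[OF cinner_eq_sym N_orth[OF imag_unit_i(1) *(2,1)]] by (simp add: cinner_scaleC_right)
  have o2: "cinner (f' + (-\<i>) *\<^sub>C f) ((2 * \<i>) *\<^sub>C U \<phi>) = 0"
    using iffD1[OF cinner_eq_sym N_orth[OF imag_unit_i(2) U_mem[OF *(2)] *(1)]]
    by (simp add: cinner_scaleC_right)
  have "(norm (F' + \<i> *\<^sub>C F))\<^sup>2 = (norm (F' + (-\<i>) *\<^sub>C F))\<^sup>2"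
    unfolding *(3,4) St_plus St_minus norm_add_orth[OF o1] norm_add_orth[OF o2]
      sym_norm[OF S imag_unit_i(1) *(1)] sym_norm[OF S imag_unit_i(2) *(1)]
    by (simp add: norm_scaleC U_norm[OF *(2)])
  moreover have "(norm (F' + \<i> *\<^sub>C F))\<^sup>2 - (norm (F' + (-\<i>) *\<^sub>C F))\<^sup>2 = 4 * Im (cinner F' F)"
    by (simp add: norm_sq_cinner cinner_lin scaleC_minus_left cinner_commute[of F F'])
  ultimately show "Im (cinner F' F) = 0" by simp
qed

lemma St_full: "ran_sp St \<i> = UNIV" "ran_sp St (-\<i>) = UNIV"
proof -
  have "x \<in> ran_sp St \<i>" for x
  proof -
    obtain f f' where f: "(f, f') \<in> S" "x = proj (N \<i>) x + (f' + \<i> *\<^sub>C f)" using decomp[OF imag_unit_i(1)] by blast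
    \<comment> \<open>Undoes the factor 2 i of \<open>St_plus\<close>.\<close>
    define \<phi> where "\<phi> = (1 / (2 * \<i>)) *\<^sub>C proj (N \<i>) x"
    have p: "\<phi> \<in> N \<i>" unfolding \<phi>_def by (rule csub_scaleC[OF Np proj_mem[OF Np]])
    have "(2 * \<i>) *\<^sub>C \<phi> = proj (N \<i>) x" by (simp add: \<phi>_def scaleC_simps)
    then have "x = f' + \<i> *\<^sub>C (\<phi> + U \<phi>) + \<i> *\<^sub>C (f + (\<phi> - U \<phi>))"
      unfolding St_plus using f(2) by (simp add: add.commute)
    then show ?thesis using ran_spI[OF St_I[OF f(1) p], of \<i>] by simp
  qed
  then show "ran_sp St \<i> = UNIV" by blast
  have "x \<in> ran_sp St (-\<i>)" for x
  proof -
    obtain f f' where f: "(f, f') \<in> S" "x = proj (N (-\<i>)) x + (f' + (-\<i>) *\<^sub>C f)"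
      using decomp[OF imag_unit_i(2)] by blast
    define \<psi> where "\<psi> = (1 / (2 * \<i>)) *\<^sub>C proj (N (-\<i>)) x"
    have p: "\<psi> \<in> N (-\<i>)" unfolding \<psi>_def by (rule csub_scaleC[OF Nm proj_mem[OF Nm]])
    have "(2 * \<i>) *\<^sub>C U (Ui \<psi>) = proj (N (-\<i>)) x" by (simp add: U_Ui[OF p]) (simp add: \<psi>_def scaleC_simps)
    then have "x = f' + \<i> *\<^sub>C (Ui \<psi> + U (Ui \<psi>)) + (-\<i>) *\<^sub>C (f + (Ui \<psi> - U (Ui \<psi>)))"
      unfolding St_minus using f(2) by (simp add: add.commute)
    then show ?thesis using ran_spI[OF St_I[OF f(1) Ui_mem[OF p]], of "-\<i>"] by metis
  qed
  then show "ran_sp St (-\<i>) = UNIV" by blast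
qed

lemma St_selfadjoint: "selfadjoint_in UNIV St"
  using selfadjoint_iff[OF csub_UNIV] St_sym St_full by auto

section \<open>The vectors with U \<phi> - \<phi> in \<open>H0\<close> and the isometry
  \<open>U0\<close>\<close>

lemma H0_minus: "x - y \<in> H0 \<longleftrightarrow> y - x \<in> H0"
  by (metis csub_neg[OF H0] minus_diff_eq)

lemma Nt_kerP: "{\<phi> \<in> N \<i>. U \<phi> - \<phi> \<in> H0} = kerP"
  using H0_diff_iff[OF imag_unit_i(1) _ U_mem] by auto

lemma Nt_csub: "csub {\<phi> \<in> N \<i>. U \<phi> - \<phi> \<in> H0}"
proof -
  have "bounded_op (N \<i>) (N \<i>) (\<lambda>\<phi>. \<phi>)" by (rule bopI[where b=1]) simp_all
  then have b: "bounded_op (N \<i>) UNIV (\<lambda>\<phi>. U \<phi> - \<phi>)" by (rule bop_minus_op[OF bU])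
  have "closed {\<phi> \<in> N \<i>. U \<phi> - \<phi> \<in> H0}"
    unfolding closed_sequential_limits
  proof (intro allI impI)
    fix u l assume u: "(\<forall>n. u n \<in> {\<phi> \<in> N \<i>. U \<phi> - \<phi> \<in> H0}) \<and> u \<longlonglongrightarrow> l"
    then have un: "\<And>n. u n \<in> N \<i>" "\<And>n. U (u n) - u n \<in> H0" and ul: "u \<longlonglongrightarrow> l" by auto
    have "l \<in> N \<i>" by (rule closed_sequentially[OF csub_closed[OF Np] un(1) ul])
    moreover have "U l - l \<in> H0"
      by (rule closed_sequentially[OF csub_closed[OF H0] un(2) bop_tendsto[OF Np b un(1) ul]])
    ultimately show "l \<in> {\<phi> \<in> N \<i>. U \<phi> - \<phi> \<in> H0}" by simp
  qed
  moreover have "csubspace {\<phi> \<in> N \<i>. U \<phi> - \<phi> \<in> H0}"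
    unfolding complex_vector.subspace_def
  proof (intro conjI ballI allI)
    show "0 \<in> {\<phi> \<in> N \<i>. U \<phi> - \<phi> \<in> H0}" by (simp add: csub_0 Np H0 bop_0[OF Np bU])
    fix x assume x: "x \<in> {\<phi> \<in> N \<i>. U \<phi> - \<phi> \<in> H0}"
    show "c *\<^sub>C x \<in> {\<phi> \<in> N \<i>. U \<phi> - \<phi> \<in> H0}" for c
      using x csub_scaleC[OF H0, of "U x - x" c] by (simp add: csub_scaleC[OF Np] bop_scaleC[OF bU] scaleC_simps)
    fix y assume y: "y \<in> {\<phi> \<in> N \<i>. U \<phi> - \<phi> \<in> H0}"
    show "x + y \<in> {\<phi> \<in> N \<i>. U \<phi> - \<phi> \<in> H0}"
      using x y csub_add[OF H0, of "U x - x" "U y - y"]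
      by (simp add: csub_add[OF Np] bop_add[OF bU] algebra_simps)
  qed
  ultimately show ?thesis by (simp add: csub_def)
qed

lemma U_Nt_csub: "csub (U ` {\<phi> \<in> N \<i>. U \<phi> - \<phi> \<in> H0})"
  by (rule isometry_image_closed[OF Nt_csub bop_subset[OF bU]]) (auto simp: U_norm)

lemma U_Nt: "U ` {\<phi> \<in> N \<i>. U \<phi> - \<phi> \<in> H0} = {\<phi> \<in> N (-\<i>). Ui \<phi> - \<phi> \<in> H0}"
proof (intro equalityI subsetI)
  fix x assume "x \<in> U ` {\<phi> \<in> N \<i>. U \<phi> - \<phi> \<in> H0}"
  then show "x \<in> {\<phi> \<in> N (-\<i>). Ui \<phi> - \<phi> \<in> H0}" using H0_minus by (auto simp: Ui_U U_mem)
next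
  fix x assume x: "x \<in> {\<phi> \<in> N (-\<i>). Ui \<phi> - \<phi> \<in> H0}"
  then have "x = U (Ui x)" "Ui x \<in> N \<i>" "U (Ui x) - Ui x \<in> H0" using H0_minus by (auto simp: U_Ui Ui_mem)
  then show "x \<in> U ` {\<phi> \<in> N \<i>. U \<phi> - \<phi> \<in> H0}" by blast
qed

lemma Nt_kerPi: "{\<phi> \<in> N (-\<i>). Ui \<phi> - \<phi> \<in> H0} =
    {\<phi> \<in> N (-\<i>). proj (Lz \<i>) (Ui \<phi>) - V (-\<i>) (proj (Lz (-\<i>)) \<phi>) = 0}"
  using H0_diff_iff[OF imag_unit_i(2)] Ui_mem by auto

text \<open>A kernel vector is l + p with l \<in> \<LL>_i; the kernel condition makes V_i l the
  \<LL>_-i component of its image, and q is the rest. In this form \<open>U0\<close> no longer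
  mentions projections.\<close>

lemma U0_iff:
  "(p, q) \<in> U0 \<longleftrightarrow> p \<in> N' \<i> \<and> q \<in> N' (-\<i>) \<and> (\<exists>l\<in>Lz \<i>. U (l + p) = V \<i> l + q)"
proof
  assume "(p, q) \<in> U0"
  then obtain \<phi> where f: "\<phi> \<in> N \<i>" "proj (Lz (-\<i>)) (U \<phi>) = V \<i> (proj (Lz \<i>) \<phi>)"
    "p = proj (N' \<i>) \<phi>" "q = proj (N' (-\<i>)) (U \<phi>)" by (auto simp: U0_def)
  have p: "p = \<phi> - proj (Lz \<i>) \<phi>" using proj_N'[OF imag_unit_i(1) f(1)] f(3) by simp
  have q: "q = U \<phi> - proj (Lz (-\<i>)) (U \<phi>)" using proj_N'[OF imag_unit_i(2) U_mem[OF f(1)]] f(4) by simp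
  have "U (proj (Lz \<i>) \<phi> + p) = V \<i> (proj (Lz \<i>) \<phi>) + q" using p q f(2) by simp
  then show "p \<in> N' \<i> \<and> q \<in> N' (-\<i>) \<and> (\<exists>l\<in>Lz \<i>. U (l + p) = V \<i> l + q)"
    using f(3,4) proj_mem[OF N'p] proj_mem[OF N'm] proj_mem[OF Lp] by blast
next
  assume "p \<in> N' \<i> \<and> q \<in> N' (-\<i>) \<and> (\<exists>l\<in>Lz \<i>. U (l + p) = V \<i> l + q)"
  then obtain l where l: "p \<in> N' \<i>" "q \<in> N' (-\<i>)" "l \<in> Lz \<i>" "U (l + p) = V \<i> l + q" by blast
  have m: "l + p \<in> N \<i>" by (rule csub_add[OF Np Lz_N[OF imag_unit_i(1) l(3)] N'_N[OF l(1)]])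
  note s1 = proj_split[OF imag_unit_i(1) l(3,1)] and s2 = proj_split[OF imag_unit_i(2) _ l(2), of "V \<i> l"]
  have vl: "V \<i> l \<in> Lz (-\<i>)" by (rule V_Lz[OF imag_unit_i(1) l(3)])
  have "l + p \<in> kerP" using m s1(1) s2(1)[OF vl] l(4) by simp
  moreover have "p = proj (N' \<i>) (l + p)" "q = proj (N' (-\<i>)) (U (l + p))"
    using s1(2) s2(2)[OF vl] l(4) by simp_all
  ultimately show "(p, q) \<in> U0" unfolding U0_def by blast
qed

lemma U0_linear: "(0, 0) \<in> U0"
  "(p, q) \<in> U0 \<Longrightarrow> (p', q') \<in> U0 \<Longrightarrow> (p + p', q + q') \<in> U0"
  "(p, q) \<in> U0 \<Longrightarrow> (c *\<^sub>C p, c *\<^sub>C q) \<in> U0"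
proof -
  note bV = V_bop[OF imag_unit_i(1)]
  have m: "l + p \<in> N \<i>" if "l \<in> Lz \<i>" "p \<in> N' \<i>" for l p
    by (rule csub_add[OF Np Lz_N[OF imag_unit_i(1) that(1)] N'_N[OF that(2)]])
  show "(0, 0) \<in> U0"
    unfolding U0_iff using csub_0[OF N'p] csub_0[OF N'm] csub_0[OF Lp] bop_0[OF Np bU] bop_0[OF Lp bV] by force
  show "(c *\<^sub>C p, c *\<^sub>C q) \<in> U0" if a: "(p, q) \<in> U0"
  proof -
    obtain l where l: "p \<in> N' \<i>" "q \<in> N' (-\<i>)" "l \<in> Lz \<i>" "U (l + p) = V \<i> l + q" using a unfolding U0_iff by blast
    have "U (c *\<^sub>C l + c *\<^sub>C p) = V \<i> (c *\<^sub>C l) + c *\<^sub>C q"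
      using bop_scaleC[OF bU m[OF l(3,1)], of c] l(4) by (simp add: bop_scaleC[OF bV l(3)] scaleC_add_right)
    then show ?thesis unfolding U0_iff
      using csub_scaleC[OF N'p l(1)] csub_scaleC[OF N'm l(2)] csub_scaleC[OF Lp l(3)] by blast
  qed
  show "(p + p', q + q') \<in> U0" if a: "(p, q) \<in> U0" and b: "(p', q') \<in> U0"
  proof -
    obtain l where l: "p \<in> N' \<i>" "q \<in> N' (-\<i>)" "l \<in> Lz \<i>" "U (l + p) = V \<i> l + q" using a unfolding U0_iff by blast
    obtain k where k: "p' \<in> N' \<i>" "q' \<in> N' (-\<i>)" "k \<in> Lz \<i>" "U (k + p') = V \<i> k + q'" using b unfolding U0_iff by blast
    have "U ((l + k) + (p + p')) = U ((l + p) + (k + p'))" by (simp add: algebra_simps)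
    also have "\<dots> = V \<i> (l + k) + (q + q')"
      using bop_add[OF bU m[OF l(3,1)] m[OF k(3,1)]] l(4) k(4) by (simp add: bop_add[OF bV l(3) k(3)])
    finally show ?thesis unfolding U0_iff
      using csub_add[OF N'p l(1) k(1)] csub_add[OF N'm l(2) k(2)] csub_add[OF Lp l(3) k(3)] by blast
  qed
qed

text \<open>Both l + p and V_i l + q are orthogonal sums; U preserves the whole and V_i the first
  summand.\<close>

lemma U0_norm: assumes "(p, q) \<in> U0" shows "norm q = norm p"
proof -
  obtain l where l: "p \<in> N' \<i>" "q \<in> N' (-\<i>)" "l \<in> Lz \<i>" "U (l + p) = V \<i> l + q"
    using assms unfolding U0_iff by blast
  have m: "l + p \<in> N \<i>" by (rule csub_add[OF Np Lz_N[OF imag_unit_i(1) l(3)] N'_N[OF l(1)]])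
  have o1: "cinner l p = 0" using N'_Lz[OF l(1,3)] cinner_eq_sym by blast
  have o2: "cinner (V \<i> l) q = 0" using N'_Lz[OF l(2) V_Lz[OF imag_unit_i(1) l(3)]] cinner_eq_sym by blast
  have "(norm (V \<i> l))\<^sup>2 + (norm q)\<^sup>2 = (norm l)\<^sup>2 + (norm p)\<^sup>2"
    using U_norm[OF m] l(4) norm_add_orth[OF o1] norm_add_orth[OF o2] by simp
  moreover have "norm (V \<i> l) = norm l"
    using V_isometry[OF imag_unit_i(1)] l(3) by (simp add: isometry_op_def)
  ultimately show ?thesis by (simp add: power2_eq_iff_nonneg)
qed

lemma U0_diff: "(p, q) \<in> U0 \<Longrightarrow> (p', q') \<in> U0 \<Longrightarrow> (p - p', q - q') \<in> U0"
  using U0_linear(2)[of p q "-p'" "-q'"] U0_linear(3)[of p' q' "-1"]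
  unfolding scaleC_minus_left scaleC_one by (simp only: diff_conv_add_uminus)

lemma U0_isometric: "isometric_operator U0"
proof -
  have "linear_operator U0"
  proof (rule linear_operatorI)
    fix f f' g' assume "(f, f') \<in> U0" "(f, g') \<in> U0"
    then have "(f - f, f' - g') \<in> U0" by (rule U0_diff)
    from U0_norm[OF this] show "f' = g'" by simp
  qed (rule U0_linear; assumption)+
  then show ?thesis unfolding isometric_operator_def using U0_norm by blast
qed

lemma U0_mem: "(p, q) \<in> U0 \<Longrightarrow> p \<in> N' \<i>" "(p, q) \<in> U0 \<Longrightarrow> q \<in> N' (-\<i>)"
  unfolding U0_iff by blast+

lemma N'_H0: "imag_unit e \<Longrightarrow> p \<in> N' e \<Longrightarrow> p \<in> H0"
  by (simp add: N'_iff)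

text \<open>For \<phi> = l + p and U \<phi> = V_i l + q, the part l - V_i l of \<phi> - U \<phi>
  lies in dom S, and S_0 sends it to the projection of i (l + V_i l). So l is absorbed by S_0 and
  only (p, q) remains.\<close>

lemma St0_iff:
  "(F, F') \<in> St0 \<longleftrightarrow> (\<exists>f f' p q. (f, f') \<in> S0 \<and> (p, q) \<in> U0 \<and> F = f + (p - q) \<and> F' = f' + \<i> *\<^sub>C (p + q))"
proof
  assume "(F, F') \<in> St0"
  then obtain F'' where F: "(F, F'') \<in> St" "F \<in> H0" "F' = proj H0 F''" by (auto simp: compression_def)
  obtain f f' \<phi> where *: "(f, f') \<in> S" "\<phi> \<in> N \<i>" "F = f + (\<phi> - U \<phi>)" "F'' = f' + \<i> *\<^sub>C (\<phi> + U \<phi>)"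
    using F(1) by (rule St_E)
  have "U \<phi> - \<phi> = f - F" using *(3) by (simp add: algebra_simps)
  then have "U \<phi> - \<phi> \<in> H0" using csub_diff[OF H0 Domain_H0[OF *(1)] F(2)] by simp
  then have k: "\<phi> \<in> kerP" using Nt_kerP *(2) by blast
  define l p q where "l = proj (Lz \<i>) \<phi>" and "p = proj (N' \<i>) \<phi>" and "q = proj (N' (-\<i>)) (U \<phi>)"
  have pq: "(p, q) \<in> U0" unfolding U0_def using k p_def q_def by blast
  have l: "l \<in> Lz \<i>" unfolding l_def by (rule proj_mem[OF Lp])
  have fe: "\<phi> = l + p" using proj_N'[OF imag_unit_i(1) *(2)] by (simp add: l_def p_def)
  have ue: "U \<phi> = V \<i> l + q" using proj_N'[OF imag_unit_i(2) U_mem[OF *(2)]] k by (simp add: l_def q_def)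
  obtain k' where k': "(l - V \<i> l, k') \<in> S" "proj H0 k' = proj H0 (\<i> *\<^sub>C (l + V \<i> l))"
    using V_diff_dom[OF imag_unit_i(1) l] by blast
  have "(f + (l - V \<i> l), proj H0 (f' + k')) \<in> S0" by (rule S0_mem[OF lop_add[OF lS *(1) k'(1)]])
  moreover have "F = f + (l - V \<i> l) + (p - q)" unfolding *(3) ue by (subst fe) simp
  moreover have "F' = proj H0 (f' + k') + \<i> *\<^sub>C (p + q)"
  proof -
    have "F'' = f' + \<i> *\<^sub>C (l + V \<i> l) + \<i> *\<^sub>C (p + q)"
      unfolding *(4) ue by (subst fe) (simp add: scaleC_add_right algebra_simps)
    moreover have "\<i> *\<^sub>C (p + q) \<in> H0"
      by (intro csub_scaleC[OF H0] csub_add[OF H0] N'_H0[OF imag_unit_i(1) U0_mem(1)[OF pq]]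
          N'_H0[OF imag_unit_i(2) U0_mem(2)[OF pq]])
    ultimately show ?thesis using F(3) k'(2) by (simp add: proj_add[OF H0] proj_id[OF H0])
  qed
  ultimately show "\<exists>f f' p q. (f, f') \<in> S0 \<and> (p, q) \<in> U0 \<and> F = f + (p - q) \<and> F' = f' + \<i> *\<^sub>C (p + q)"
    using pq by blast
next
  assume "\<exists>f f' p q. (f, f') \<in> S0 \<and> (p, q) \<in> U0 \<and> F = f + (p - q) \<and> F' = f' + \<i> *\<^sub>C (p + q)"
  then obtain f f' p q where *: "(f, f') \<in> S0" "(p, q) \<in> U0" "F = f + (p - q)" "F' = f' + \<i> *\<^sub>C (p + q)" by blast
  obtain f'' where f: "(f, f'') \<in> S" "f' = proj H0 f''" using *(1) by (rule S0_E)
  obtain l where l: "l \<in> Lz \<i>" "U (l + p) = V \<i> l + q" using *(2) unfolding U0_iff by blast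
  obtain k' where k': "(l - V \<i> l, k') \<in> S" "proj H0 k' = proj H0 (\<i> *\<^sub>C (l + V \<i> l))"
    using V_diff_dom[OF imag_unit_i(1) l(1)] by blast
  have m: "l + p \<in> N \<i>" by (rule csub_add[OF Np Lz_N[OF imag_unit_i(1) l(1)] N'_N[OF U0_mem(1)[OF *(2)]]])
  have "(f - (l - V \<i> l) + ((l + p) - U (l + p)), (f'' - k') + \<i> *\<^sub>C ((l + p) + U (l + p))) \<in> St"
    by (rule St_I[OF lop_diff[OF lS f(1) k'(1)] m])
  moreover have "f - (l - V \<i> l) + ((l + p) - U (l + p)) = F" unfolding *(3) l(2) by simp
  moreover have pqH: "p \<in> H0" "q \<in> H0"
    using N'_H0[OF imag_unit_i(1) U0_mem(1)[OF *(2)]] N'_H0[OF imag_unit_i(2) U0_mem(2)[OF *(2)]] .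
  then have "\<i> *\<^sub>C (p + q) \<in> H0" by (intro csub_scaleC[OF H0] csub_add[OF H0])
  then have "proj H0 ((f'' - k') + \<i> *\<^sub>C ((l + p) + U (l + p))) = F'"
  proof -
    assume pq: "\<i> *\<^sub>C (p + q) \<in> H0"
    have "(f'' - k') + \<i> *\<^sub>C ((l + p) + U (l + p)) = (f'' - k') + \<i> *\<^sub>C (l + V \<i> l) + \<i> *\<^sub>C (p + q)"
      unfolding l(2) by (simp add: scaleC_add_right algebra_simps)
    then show ?thesis unfolding *(4) f(2)
      by (simp only: proj_add[OF H0] proj_diff[OF H0] proj_id[OF H0 pq] k'(2)) simp
  qed
  moreover have "F \<in> H0"
    unfolding *(3) using pqH by (intro csub_add[OF H0] csub_diff[OF H0] Domain_H0[OF f(1)])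
  ultimately show "(F, F') \<in> St0" unfolding compression_def by blast
qed

text \<open>\<open>dom_intersect\<close> would put p into \<LL>_i, to which p \<in> N'_i is
  orthogonal.\<close>

lemma U0_dom_disjoint:
  assumes "(p, q) \<in> U0" "(p - q, f') \<in> S" shows "p = 0 \<and> q = 0"
proof -
  have a: "p \<in> N' \<i>" "q \<in> N' (-\<i>)" using U0_mem[OF assms(1)] .
  have "p \<in> Lz \<i> \<and> q = V \<i> p"
    by (rule dom_intersect[OF imag_unit_i(1) assms(2) N'_N[OF a(1)] N'_N[OF a(2)] refl])
  then have "cinner p p = 0" using N'_Lz[OF a(1)] by blast
  then show ?thesis using U0_norm[OF assms(1)] by simp
qed

lemma St0_direct: "is_direct_sum (Domain St0) (Domain S) {\<phi> - \<phi>' | \<phi> \<phi>'. (\<phi>, \<phi>') \<in> U0}"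
  unfolding is_direct_sum_def
proof
  show "Domain St0 = {a + b | a b. a \<in> Domain S \<and> b \<in> {\<phi> - \<phi>' | \<phi> \<phi>'. (\<phi>, \<phi>') \<in> U0}}"
  proof (intro equalityI subsetI)
    fix F assume "F \<in> Domain St0"
    then obtain F' where "(F, F') \<in> St0" by blast
    then obtain f f' p q where "(f, f') \<in> S0" "(p, q) \<in> U0" "F = f + (p - q)" unfolding St0_iff by blast
    then show "F \<in> {a + b | a b. a \<in> Domain S \<and> b \<in> {\<phi> - \<phi>' | \<phi> \<phi>'. (\<phi>, \<phi>') \<in> U0}}"
      using S0_Domain by blast
  next
    fix F assume "F \<in> {a + b | a b. a \<in> Domain S \<and> b \<in> {\<phi> - \<phi>' | \<phi> \<phi>'. (\<phi>, \<phi>') \<in> U0}}"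
    then obtain f f' p q where *: "(f, f') \<in> S" "(p, q) \<in> U0" "F = f + (p - q)" by blast
    have "(F, proj H0 f' + \<i> *\<^sub>C (p + q)) \<in> St0"
      unfolding St0_iff using S0_mem[OF *(1)] *(2,3) by blast
    then show "F \<in> Domain St0" by blast
  qed
  show "Domain S \<inter> {\<phi> - \<phi>' | \<phi> \<phi>'. (\<phi>, \<phi>') \<in> U0} = {0}"
  proof (intro equalityI subsetI)
    fix x assume "x \<in> Domain S \<inter> {\<phi> - \<phi>' | \<phi> \<phi>'. (\<phi>, \<phi>') \<in> U0}"
    then obtain p q f' where "(p, q) \<in> U0" "x = p - q" "(x, f') \<in> S" by blast
    then show "x \<in> {0}" using U0_dom_disjoint[of p q f'] by auto
  next
    fix x :: 'a assume "x \<in> {0}"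
    then have "x = 0 - 0" "(x, 0) \<in> S" using lop_0[OF lS] by auto
    then show "x \<in> Domain S \<inter> {\<phi> - \<phi>' | \<phi> \<phi>'. (\<phi>, \<phi>') \<in> U0}" using U0_linear(1) by blast
  qed
qed

text \<open>q - p = (- p) - (- q), and the graph of \<open>U0\<close> contains (- p, - q) with (p,
  q).\<close>

lemma U0_converse_diff: "{\<phi> - \<phi>' | \<phi> \<phi>'. (\<phi>, \<phi>') \<in> U0\<inverse>} = {\<phi> - \<phi>' | \<phi> \<phi>'. (\<phi>, \<phi>') \<in> U0}"
proof -
  have n: "(- p, - q) \<in> U0" if "(p, q) \<in> U0" for p q
    using U0_linear(3)[OF that, of "-1"] unfolding scaleC_minus_left scaleC_one .
  have e: "q - p = (- p) - (- q)" for p q :: 'a by simp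
  show ?thesis
  proof (intro equalityI subsetI)
    fix x assume "x \<in> {\<phi> - \<phi>' | \<phi> \<phi>'. (\<phi>, \<phi>') \<in> U0\<inverse>}"
    then obtain p q where "(p, q) \<in> U0" "x = q - p" unfolding converse_iff by blast
    then show "x \<in> {\<phi> - \<phi>' | \<phi> \<phi>'. (\<phi>, \<phi>') \<in> U0}" using n e by blast
  next
    fix x assume "x \<in> {\<phi> - \<phi>' | \<phi> \<phi>'. (\<phi>, \<phi>') \<in> U0}"
    then obtain p q where "(p, q) \<in> U0" "x = p - q" by blast
    then have "(- p, - q) \<in> U0" "x = (- q) - (- p)" using n by auto
    then show "x \<in> {\<phi> - \<phi>' | \<phi> \<phi>'. (\<phi>, \<phi>') \<in> U0\<inverse>}" unfolding converse_iff by blast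
  qed
qed

section \<open>Symmetry, deficiency spaces and maximality of the compression\<close>

lemma St0_H0: "St0 \<subseteq> H0 \<times> H0"
  by (auto simp: compression_def proj_mem[OF H0])

lemma St0_sym: "symmetric_operator St0"
proof (intro symmetric_operatorI linear_operatorI)
  show "(0, 0) \<in> St0" unfolding compression_def
    using lop_0[OF St_linear] csub_0[OF H0] proj_0[OF H0] by force
next
  fix f f' g g' assume "(f, f') \<in> St0" "(g, g') \<in> St0"
  then obtain f'' g'' where *: "(f, f'') \<in> St" "f' = proj H0 f''" "f \<in> H0" "(g, g'') \<in> St" "g' = proj H0 g''" "g \<in> H0"
    unfolding compression_def by blast
  have "f' + g' = proj H0 (f'' + g'')" by (simp add: proj_add[OF H0] *)
  then show "(f + g, f' + g') \<in> St0" unfolding compression_def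
    using lop_add[OF St_linear *(1,4)] csub_add[OF H0 *(3,6)] by blast
next
  fix c f f' assume "(f, f') \<in> St0"
  then obtain f'' where *: "(f, f'') \<in> St" "f' = proj H0 f''" "f \<in> H0" unfolding compression_def by blast
  have "c *\<^sub>C f' = proj H0 (c *\<^sub>C f'')" by (simp add: proj_scaleC[OF H0] *)
  then show "(c *\<^sub>C f, c *\<^sub>C f') \<in> St0" unfolding compression_def
    using lop_scaleC[OF St_linear *(1), of c] csub_scaleC[OF H0 *(3), of c] by blast
next
  fix f f' g' assume "(f, f') \<in> St0" "(f, g') \<in> St0"
  then show "f' = g'" unfolding compression_def using lop_unique[OF St_linear] by blast
next
  fix f f' assume "(f, f') \<in> St0"
  then obtain f'' where *: "(f, f'') \<in> St" "f' = proj H0 f''" "f \<in> H0" unfolding compression_def by blast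
  have "cinner f' f = cinner f'' f" unfolding *(2) by (rule proj_cinner[OF H0 *(3)])
  then show "Im (cinner f' f) = 0" using St_sym *(1) by (auto simp: symmetric_operator_def)
qed

lemma St0_dense: "closure (Domain St0) = H0"
proof
  show "closure (Domain St0) \<subseteq> H0" using St0_H0 csub_closed[OF H0] by (intro closure_minimal) auto
  have "Domain S \<subseteq> Domain St0"
  proof
    fix f assume "f \<in> Domain S"
    then obtain f' where f': "(f, f') \<in> S" by blast
    have "f = f + (0 - 0)" by simp
    then have "(f, proj H0 f' + \<i> *\<^sub>C (0 + 0)) \<in> St0"
      unfolding St0_iff using S0_mem[OF f'] U0_linear(1) by blast
    then show "f \<in> Domain St0" by blast
  qed
  then show "H0 \<subseteq> closure (Domain St0)" unfolding dom_closure_def by (rule closure_mono)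
qed

text \<open>Domain of \<open>U0\<close> for e = i and its range for e = -i: the companion of
  \<open>N' e\<close> that lets both half-planes share one proof.\<close>

definition domW :: "complex \<Rightarrow> 'a set" where "domW e = (if e = \<i> then Domain U0 else Range U0)"

lemma domW_simps: "domW \<i> = Domain U0" "domW (-\<i>) = Range U0"
proof -
  have "\<i> \<noteq> - \<i>" by (simp add: complex_eq_iff)
  then show "domW \<i> = Domain U0" "domW (-\<i>) = Range U0" by (auto simp: domW_def)
qed

lemma domW_N': "imag_unit e \<Longrightarrow> domW e \<subseteq> N' e"
  using U0_mem by (auto simp: imag_unit_def domW_simps)

lemma domW_csubspace: "csubspace (domW e)"
proof -
  have "csubspace (Domain U0)"
    using lop_Domain U0_isometric by (auto simp: isometric_operator_def)
  moreover have "csubspace (Range U0)"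
    unfolding complex_vector.subspace_def
  proof (intro conjI ballI allI)
    show "0 \<in> Range U0" using U0_linear(1) by (rule RangeI)
    show "x + y \<in> Range U0" if "x \<in> Range U0" "y \<in> Range U0" for x y
      using that U0_linear(2) by (meson Range_iff)
    show "c *\<^sub>C x \<in> Range U0" if "x \<in> Range U0" for c x
      using that U0_linear(3) by (meson Range_iff)
  qed
  ultimately show ?thesis by (simp add: domW_def)
qed

text \<open>Adding e I to the compression leaves 2 i p for e = i and 2 i q for e = -i; the factor is
  harmless because \<open>domW e\<close> is a linear manifold.\<close>

lemma ran_St0:
  assumes e: "imag_unit e" shows "ran_sp St0 e = {r + d | r d. r \<in> ran_sp S0 e \<and> d \<in> domW e}"
proof -
  have 2: "(2 * \<i>) *\<^sub>C x = \<i> *\<^sub>C x + \<i> *\<^sub>C x" for x :: 'a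
    by (simp add: scaleC_add_left[symmetric])
  have plus: "f' + \<i> *\<^sub>C (p + q) + \<i> *\<^sub>C (f + (p - q)) = (f' + \<i> *\<^sub>C f) + (2 * \<i>) *\<^sub>C p"
    and minus: "f' + \<i> *\<^sub>C (p + q) + (-\<i>) *\<^sub>C (f + (p - q)) = (f' + (-\<i>) *\<^sub>C f) + (2 * \<i>) *\<^sub>C q" for f f' p q :: 'a
    by (simp_all add: 2 scaleC_add_right scaleC_diff_right scaleC_minus_left)
  have *: "f' + \<i> *\<^sub>C (p + q) + e *\<^sub>C (f + (p - q)) = (f' + e *\<^sub>C f) + (2 * \<i>) *\<^sub>C (if e = \<i> then p else q)" for f f' p q :: 'a
    using e plus minus by (auto simp: imag_unit_def)
  show ?thesis
  proof (intro equalityI subsetI)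
    fix x assume "x \<in> ran_sp St0 e"
    then obtain F F' where F: "(F, F') \<in> St0" "x = F' + e *\<^sub>C F" unfolding ran_sp_def by blast
    obtain f f' p q where o: "(f, f') \<in> S0" "(p, q) \<in> U0" "F = f + (p - q)" "F' = f' + \<i> *\<^sub>C (p + q)"
      using F(1) unfolding St0_iff by blast
    have "(if e = \<i> then p else q) \<in> domW e" using o(2) by (auto simp: domW_def)
    then have "(2 * \<i>) *\<^sub>C (if e = \<i> then p else q) \<in> domW e"
      by (rule complex_vector.subspace_scale[OF domW_csubspace])
    moreover have "x = (f' + e *\<^sub>C f) + (2 * \<i>) *\<^sub>C (if e = \<i> then p else q)" using F(2) o(3,4) * by simp
    ultimately show "x \<in> {r + d | r d. r \<in> ran_sp S0 e \<and> d \<in> domW e}" using ran_spI[OF o(1), of e] by blast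
  next
    fix x assume "x \<in> {r + d | r d. r \<in> ran_sp S0 e \<and> d \<in> domW e}"
    then obtain f f' d where o: "(f, f') \<in> S0" "d \<in> domW e" "x = f' + e *\<^sub>C f + d" unfolding ran_sp_def by blast
    have "(1 / (2 * \<i>)) *\<^sub>C d \<in> domW e" by (rule complex_vector.subspace_scale[OF domW_csubspace o(2)])
    then obtain p q where pq: "(p, q) \<in> U0" "(if e = \<i> then p else q) = (1 / (2 * \<i>)) *\<^sub>C d"
      unfolding domW_def by (auto split: if_splits)
    have "(f + (p - q), f' + \<i> *\<^sub>C (p + q)) \<in> St0" unfolding St0_iff using o(1) pq(1) by blast
    from ran_spI[OF this, of e] show "x \<in> ran_sp St0 e"
      unfolding * pq(2) o(3) by (simp add: scaleC_scaleC scaleC_one)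
  qed
qed

lemma deficiency_St0:
  assumes e: "imag_unit e" shows "deficiency_sp H0 St0 e = N' e \<ominus> domW e"
proof -
  have "0 \<in> ran_sp S0 e" "0 \<in> domW e"
    using csub_0[OF ran_S0[OF e]] complex_vector.subspace_0[OF domW_csubspace] by auto
  then have "(\<forall>y\<in>ran_sp St0 e. cinner x y = 0) \<longleftrightarrow>
      (\<forall>r\<in>ran_sp S0 e. cinner x r = 0) \<and> (\<forall>d\<in>domW e. cinner x d = 0)" for x
    unfolding ran_St0[OF e] by (auto simp: cinner_add_right) (metis add.right_neutral add_0)+
  then show ?thesis
    unfolding deficiency_sp_eq[OF e] N'_eq_S0[OF e] by (auto simp: orth_diff_def)
qed

text \<open>ran (S_0 + e I) and N'_e are orthogonal complements of each other in \<open>H0\<close>,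
  so fullness can be tested on N'_e alone.\<close>

lemma ran_St0_full:
  assumes e: "imag_unit e" shows "ran_sp St0 e = H0 \<longleftrightarrow> domW e = N' e"
proof
  assume full: "ran_sp St0 e = H0"
  have "N' e \<subseteq> domW e"
  proof
    fix x assume x: "x \<in> N' e"
    then have "x \<in> ran_sp St0 e" using full N'_H0[OF e] by simp
    then obtain r d where rd: "r \<in> ran_sp S0 e" "d \<in> domW e" "x = r + d" unfolding ran_St0[OF e] by blast
    have "x - d \<in> N' e" using csub_diff[OF N'_csub[OF e] x] rd(2) domW_N'[OF e] by blast
    then have "cinner r r = 0" using rd(1,3) unfolding N'_eq_S0[OF e] orth_diff_def by simp
    then show "x \<in> domW e" using rd by simp
  qed
  then show "domW e = N' e" using domW_N'[OF e] by blast
next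
  assume d: "domW e = N' e"
  note rc = ran_S0[OF e]
  have rH: "ran_sp S0 e \<subseteq> H0"
    using S0_H0 by (auto simp: ran_sp_def intro!: csub_add[OF H0] csub_scaleC[OF H0])
  have "x \<in> ran_sp St0 e" if x: "x \<in> H0" for x
  proof -
    have pr: "proj (ran_sp S0 e) x \<in> ran_sp S0 e" by (rule proj_mem[OF rc])
    have "x - proj (ran_sp S0 e) x \<in> N' e"
      using x pr rH proj_orth[OF rc] by (auto simp: N'_eq_S0[OF e] orth_diff_def intro: csub_diff[OF H0])
    moreover have "x = proj (ran_sp S0 e) x + (x - proj (ran_sp S0 e) x)" by simp
    ultimately show ?thesis unfolding ran_St0[OF e] d using pr by blast
  qed
  moreover have "ran_sp St0 e \<subseteq> H0"
    using St0_H0 by (auto simp: ran_sp_def intro!: csub_add[OF H0] csub_scaleC[OF H0])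
  ultimately show "ran_sp St0 e = H0" by blast
qed

lemma St0_selfadjoint_iff: "selfadjoint_in H0 St0 \<longleftrightarrow> domW \<i> = N' \<i> \<and> domW (-\<i>) = N' (-\<i>)"
  unfolding selfadjoint_iff[OF H0] using St0_sym St0_H0 ran_St0_full by simp

text \<open>If one of the two manifolds is all of the complete space N'_e, the other is its
  isometric image. A vanishing deficiency space says only that \<open>domW\<close> is dense;
  closedness turns this into equality.\<close>

lemma domW_closed:
  assumes e: "imag_unit e" and full: "domW e = N' e" shows "closed (domW (-e))"
proof -
  define W where "W = (if e = \<i> then U0 else U0\<inverse>)"
  have dom: "domW e = Domain W" "domW (-e) = Range W"
  proof -
    have n: "- \<i> \<noteq> \<i>" by (simp add: complex_eq_iff)
    have "domW e = Domain W \<and> domW (-e) = Range W"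
      using e n unfolding imag_unit_def W_def by (elim disjE) (simp_all add: domW_simps)
    then show "domW e = Domain W" "domW (-e) = Range W" by simp_all
  qed
  have diff: "(p - p', q - q') \<in> W" if "(p, q) \<in> W" "(p', q') \<in> W" for p q p' q'
    using that U0_diff by (cases "e = \<i>") (simp_all add: W_def)
  have nrm: "norm q = norm p" if "(p, q) \<in> W" for p q
    using that U0_norm by (cases "e = \<i>") (simp_all add: W_def)
  show ?thesis
    unfolding closed_sequential_limits dom(2)
  proof (intro allI impI)
    fix u l assume u: "(\<forall>n. u n \<in> Range W) \<and> u \<longlonglongrightarrow> l"
    then have "\<forall>n. \<exists>p. (p, u n) \<in> W" by blast
    then obtain p where p: "\<And>n. (p n, u n) \<in> W" by metis
    have "dist (p i) (p j) = dist (u i) (u j)" for i j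
      using nrm[OF diff[OF p[of i] p[of j]]] by (simp add: dist_norm)
    moreover have "Cauchy u" using u LIMSEQ_imp_Cauchy by blast
    ultimately have "Cauchy p" by (simp add: Cauchy_def)
    then obtain x where x: "p \<longlonglongrightarrow> x" using Cauchy_convergent_iff convergent_def by blast
    have "p n \<in> N' e" for n using p[of n] full dom(1) by blast
    then have "x \<in> N' e" by (rule closed_sequentially[OF csub_closed[OF N'_csub[OF e]] _ x])
    then obtain y where y: "(x, y) \<in> W" using full dom(1) by blast
    have "dist (u n) y = dist (p n) x" for n
      using nrm[OF diff[OF p[of n] y]] by (simp add: dist_norm)
    then have "u \<longlonglongrightarrow> y" using x by (simp add: tendsto_dist_iff[of u] tendsto_dist_iff[of p])
    then have "l = y" using u LIMSEQ_unique by blast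
    then show "l \<in> Range W" using y by blast
  qed
qed

lemma deficiency_csub: "imag_unit e \<Longrightarrow> csub (deficiency_sp H0 St0 e)"
  by (simp add: deficiency_St0 csub_orth_diff[OF N'_csub])

lemma deficiency_0_iff:
  assumes e: "imag_unit e" and c: "closed (domW e)"
  shows "deficiency_sp H0 St0 e = {0} \<longleftrightarrow> domW e = N' e"
proof
  assume "deficiency_sp H0 St0 e = {0}"
  then have z: "x = 0" if "x \<in> N' e" "\<And>a. a \<in> domW e \<Longrightarrow> cinner x a = 0" for x
    using that unfolding deficiency_St0[OF e] orth_diff_def by blast
  have "closure (domW e) = N' e"
    by (rule dense_if_orth_0[OF domW_csubspace N'_csub[OF e] domW_N'[OF e] z])
  then show "domW e = N' e" using c by simp
next
  assume d: "domW e = N' e"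
  show "deficiency_sp H0 St0 e = {0}"
    unfolding deficiency_St0[OF e] d
    using csub_0[OF N'_csub[OF e]] by (auto simp: orth_diff_def)
qed

text \<open>A maximal operator is closed and so has a closed range, whence a zero deficiency space
  means a full range. Conversely a full range gives maximality, and \<open>domW_closed\<close> lets
  a proper \<open>domW (-e)\<close> be seen in the other deficiency space.\<close>

lemma maximal_iff:
  assumes e: "imag_unit e"
  shows "maximal_symmetric_in H0 St0 \<and> hdim (deficiency_sp H0 St0 e) = 0 \<and> hdim (deficiency_sp H0 St0 (-e)) > 0
    \<longleftrightarrow> domW e = N' e \<and> domW (-e) \<noteq> N' (-e)"
proof -
  note ne = imag_unit_neg[OF e]
  note h0 = hdim_eq_0[OF deficiency_csub[OF e]] hdim_eq_0[OF deficiency_csub[OF ne]]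
  show ?thesis
  proof
    assume a: "maximal_symmetric_in H0 St0 \<and> hdim (deficiency_sp H0 St0 e) = 0 \<and> hdim (deficiency_sp H0 St0 (-e)) > 0"
    have cl: "closed St0" using closed_if_maximal[OF H0 _ St0_dense] a by blast
    have rc: "csub (ran_sp St0 e)" by (rule ran_sp_closed[OF St0_sym cl e])
    have sub: "ran_sp St0 e \<subseteq> H0"
      using St0_H0 by (auto simp: ran_sp_def intro!: csub_add[OF H0] csub_scaleC[OF H0])
    have "deficiency_sp H0 St0 e = {0}" using a h0 by simp
    then have z: "x = 0" if "x \<in> H0" "\<And>a. a \<in> ran_sp St0 e \<Longrightarrow> cinner x a = 0" for x
      using that unfolding deficiency_sp_eq[OF e] orth_diff_def by blast
    have "closure (ran_sp St0 e) = H0"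
      by (rule dense_if_orth_0[OF csub_csubspace[OF rc] H0 sub z])
    then have d: "domW e = N' e" using ran_St0_full[OF e] csub_closed[OF rc] by simp
    have "domW (-e) \<noteq> N' (-e)"
    proof
      assume d': "domW (-e) = N' (-e)"
      have "deficiency_sp H0 St0 (-e) = {0}"
        using deficiency_0_iff[OF ne] d' csub_closed[OF N'_csub[OF ne]] by simp
      then show False using a h0 by simp
    qed
    then show "domW e = N' e \<and> domW (-e) \<noteq> N' (-e)" using d by blast
  next
    assume a: "domW e = N' e \<and> domW (-e) \<noteq> N' (-e)"
    then have "maximal_symmetric_in H0 St0"
      using maximal_if_full_range[OF St0_sym St0_H0 e] ran_St0_full[OF e] by blast
    moreover have "deficiency_sp H0 St0 e = {0}"
      using deficiency_0_iff[OF e] a csub_closed[OF N'_csub[OF e]] by simp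
    moreover have "deficiency_sp H0 St0 (-e) \<noteq> {0}"
      using deficiency_0_iff[OF ne domW_closed[OF e]] a by simp
    ultimately show "maximal_symmetric_in H0 St0 \<and> hdim (deficiency_sp H0 St0 e) = 0 \<and> hdim (deficiency_sp H0 St0 (-e)) > 0"
      using h0 by simp
  qed
qed

text \<open>If the extension adds nothing, each p - q lies in dom S, where
  \<open>U0_dom_disjoint\<close> applies. By isometry it suffices that one of domain and range is
  trivial.\<close>

lemma St0_eq_S0_iff:
  assumes e: "imag_unit e" shows "St0 = S0 \<longleftrightarrow> domW e = {0}"
proof
  assume eq: "St0 = S0"
  have "p = 0 \<and> q = 0" if pq: "(p, q) \<in> U0" for p q
  proof -
    have "(0 + (p - q), 0 + \<i> *\<^sub>C (p + q)) \<in> St0"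
      unfolding St0_iff using lop_0[OF sym_lop[OF S0_sym]] pq by blast
    then obtain f' where "(p - q, f') \<in> S" using eq by (auto elim: S0_E)
    then show ?thesis by (rule U0_dom_disjoint[OF pq])
  qed
  then have "domW e \<subseteq> {0}" unfolding domW_def by auto
  then show "domW e = {0}" using complex_vector.subspace_0[OF domW_csubspace] by blast
next
  assume d: "domW e = {0}"
  have z: "p = 0 \<and> q = 0" if pq: "(p, q) \<in> U0" for p q
  proof -
    have "p \<in> domW e \<or> q \<in> domW e"
      using DomainI[OF pq] RangeI[OF pq] unfolding domW_def
      by (cases "e = \<i>") (simp_all only: if_True if_False simp_thms)
    then have "p = 0 \<or> q = 0" unfolding d by blast
    then show ?thesis using U0_norm[OF pq] by auto
  qed
  have "(F, F') \<in> St0 \<longleftrightarrow> (F, F') \<in> S0" for F F'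
  proof
    assume "(F, F') \<in> St0"
    then obtain f f' p q where o: "(f, f') \<in> S0" "(p, q) \<in> U0" "F = f + (p - q)" "F' = f' + \<i> *\<^sub>C (p + q)"
      unfolding St0_iff by blast
    then show "(F, F') \<in> S0" using z[OF o(2)] by simp
  next
    assume a: "(F, F') \<in> S0"
    have "F = F + (0 - 0)" "F' = F' + \<i> *\<^sub>C (0 + 0)" by simp_all
    then show "(F, F') \<in> St0" unfolding St0_iff using a U0_linear(1) by blast
  qed
  then show "St0 = S0" by auto
qed

end

subsection \<open>Block representations\<close>

lemma bop_agree:
  assumes C: "csub (closure D)" and A: "bounded_op (closure D) K A" and B: "bounded_op (closure D) K' B"
    and eq: "\<And>d. d \<in> D \<Longrightarrow> A d = B d" and w: "w \<in> closure D"
  shows "A w = B w"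
proof -
  obtain u where u: "\<And>n. u n \<in> D" "u \<longlonglongrightarrow> w" using w by (auto simp: closure_sequential)
  have uc: "u n \<in> closure D" for n by (rule subsetD[OF closure_subset u(1)])
  have "(\<lambda>n. A (u n)) \<longlonglongrightarrow> A w" by (rule bop_tendsto[OF C A uc u(2)])
  moreover have "(\<lambda>n. B (u n)) \<longlonglongrightarrow> B w" by (rule bop_tendsto[OF C B uc u(2)])
  moreover have "(\<lambda>n. A (u n)) = (\<lambda>n. B (u n))" using eq[OF u(1)] by simp
  ultimately show ?thesis using LIMSEQ_unique by metis
qed

text \<open>The adjoint of the extension is constructed first, by Riesz representation, which avoids
  extending by continuity.\<close>

lemma isometry_extension:
  assumes L: "csub L" and K: "csub K" and D: "bounded_op L L' D" and E: "bounded_op L K E"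
    and n: "\<And>x. x \<in> L \<Longrightarrow> norm (E x) = norm (D x)"
  shows "\<exists>G. isometry_op (closure (D ` L)) K G \<and> (\<forall>x\<in>L. G (D x) = E x)"
proof -
  define C where "C = closure (D ` L)"
  have C: "csub C" unfolding C_def by (rule csubspace_closure[OF bop_image_csubspace[OF L D]])
  have DC: "D x \<in> C" if "x \<in> L" for x
    unfolding C_def by (rule subsetD[OF closure_subset imageI[OF that]])
  have ex: "\<exists>w\<in>C. \<forall>x\<in>L. cinner (D x) w = cinner (E x) \<psi>" for \<psi>
  proof -
    have "\<exists>w\<in>closure (D ` L). \<forall>h\<in>L. inner (E h) \<psi> = inner (D h) w"
    proof (rule riesz_general[OF csub_subspace[OF L], where b="norm \<psi>"])
      fix x assume "x \<in> L"
      then show "\<bar>inner (E x) \<psi>\<bar> \<le> norm \<psi> * norm (D x)"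
        using Cauchy_Schwarz_ineq2[of "E x" \<psi>] n by (simp add: mult.commute)
    qed (simp_all add: bop_add[OF D] bop_scaleR[OF D] bop_add[OF E] bop_scaleR[OF E] inner_simps)
    then obtain w where w: "w \<in> C" "\<And>h. h \<in> L \<Longrightarrow> Re (cinner (E h) \<psi>) = Re (cinner (D h) w)"
      unfolding C_def inner_eq_Re_cinner by blast
    have "cinner (D h) w = cinner (E h) \<psi>" if "h \<in> L" for h
      using w(2)[OF that] w(2)[OF csub_scaleC[OF L that, of \<i>]] that
      by (simp add: complex_eq_iff cinner_lin bop_scaleC[OF D] bop_scaleC[OF E])
    then show ?thesis using w(1) by blast
  qed
  then obtain Gs where Gs: "\<And>\<psi>. Gs \<psi> \<in> C" "\<And>\<psi> x. x \<in> L \<Longrightarrow> cinner (D x) (Gs \<psi>) = cinner (E x) \<psi>"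
    by metis
  have uniq: "w = Gs \<psi>" if w: "w \<in> C" "\<And>x. x \<in> L \<Longrightarrow> cinner (D x) w = cinner (E x) \<psi>" for w \<psi>
  proof -
    have "w - Gs \<psi> \<in> C" by (rule csub_diff[OF C w(1) Gs(1)])
    moreover have "cinner (w - Gs \<psi>) a = 0" if "a \<in> D ` L" for a
    proof -
      have "cinner a (w - Gs \<psi>) = 0" using that w(2) Gs(2) by (auto simp: cinner_lin)
      then show ?thesis using cinner_eq_sym by blast
    qed
    ultimately have "w - Gs \<psi> = 0" using dense_orth_0[OF bop_image_csubspace[OF L D] C_def] by blast
    then show ?thesis by simp
  qed
  have bGs: "bounded_op K C Gs"
  proof (rule bopI[where b=1])
    show "Gs (x + y) = Gs x + Gs y" for x y
      by (rule uniq[symmetric]) (simp_all add: csub_add[OF C] Gs cinner_lin)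
    show "Gs (c *\<^sub>C x) = c *\<^sub>C Gs x" for c x
      by (rule uniq[symmetric]) (simp_all add: csub_scaleC[OF C] Gs cinner_lin)
    fix x
    \<comment> \<open>The estimate holds on the image of D because E and D have equal norms, extends
      to the closure, and is then used for v = \<open>Gs x\<close>.\<close>
    have "closed {v. norm (cinner v (Gs x)) \<le> norm v * norm x}"
      by (intro closed_Collect_le continuous_intros)
    moreover have "D ` L \<subseteq> {v. norm (cinner v (Gs x)) \<le> norm v * norm x}"
      using cinner_CS[of _ x] by (auto simp: Gs n[symmetric])
    ultimately have "C \<subseteq> {v. norm (cinner v (Gs x)) \<le> norm v * norm x}"
      unfolding C_def by (intro closure_minimal)
    then have "norm (cinner (Gs x) (Gs x)) \<le> norm (Gs x) * norm x" using Gs(1) by blast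
    then have "norm (Gs x) * norm (Gs x) \<le> norm (Gs x) * norm x"
      by (simp add: cinner_self norm_power power2_eq_square norm_mult)
    then show "norm (Gs x) \<le> 1 * norm x"
      by (cases "Gs x = 0") auto
  qed (rule Gs(1))
  define G where "G = adj K C Gs"
  have bG: "bounded_op C K G" unfolding G_def by (rule adj_bop[OF K C bGs])
  have GD: "G (D x) = E x" if x: "x \<in> L" for x
    unfolding G_def
  proof (rule adj_eqI[OF K bGs bop_mem[OF E x]])
    fix h assume "h \<in> K"
    show "cinner (Gs h) (D x) = cinner h (E x)" using Gs(2)[OF x, of h] by (metis cinner_commute)
  qed
  have "norm (G w) = norm w" if w: "w \<in> C" for w
  proof -
    obtain u where u: "\<And>n. u n \<in> D ` L" "u \<longlonglongrightarrow> w" using w by (auto simp: C_def closure_sequential)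
    have uC: "u n \<in> C" for n using u(1)[of n] by (auto intro: DC)
    have "(\<lambda>n. norm (G (u n))) \<longlonglongrightarrow> norm (G w)"
      by (rule tendsto_norm[OF bop_tendsto[OF C bG uC u(2)]])
    moreover have "norm (G (u k)) = norm (u k)" for k using u(1)[of k] GD n by auto
    ultimately have "(\<lambda>n. norm (u n)) \<longlonglongrightarrow> norm (G w)" by simp
    then show ?thesis using tendsto_norm[OF u(2)] LIMSEQ_unique by blast
  qed
  then have "isometry_op C K G" using bG by (simp add: isometry_op_def)
  then show ?thesis unfolding C_def using GD by blast
qed

text \<open>By \<open>D_coisometry\<close> the defect operator is the orthogonal projection onto ker
  Z.\<close>

lemma (in contr) KD_coisometry:
  assumes co: "\<And>w. w \<in> K \<Longrightarrow> Z (adj H K Z w) = w" shows "KD = {x \<in> H. Z x = 0}"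
proof
  note b = contr_bop[OF Z]
  have ZD: "Z (D x) = 0" if x: "x \<in> H" for x
    using bop_mem[OF b x] x adj_mem[OF H b]
    by (simp add: D_coisometry[OF co x] bop_diff[OF H b] co)
  show "KD \<subseteq> {x \<in> H. Z x = 0}"
  proof
    fix w assume w: "w \<in> KD"
    then obtain u where u: "\<And>n. u n \<in> D ` H" "u \<longlonglongrightarrow> w" by (auto simp: defect_sp_def closure_sequential)
    have uH: "u n \<in> H" for n using u(1)[of n] by (auto intro: D_mem)
    have "(\<lambda>n. Z (u n)) \<longlonglongrightarrow> Z w" by (rule bop_tendsto[OF H b uH u(2)])
    moreover have "Z (u n) = 0" for n using u(1)[of n] ZD by auto
    ultimately have "Z w = 0" by (simp add: LIMSEQ_const_iff)
    then show "w \<in> {x \<in> H. Z x = 0}" using w KD_H by blast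
  qed
  show "{x \<in> H. Z x = 0} \<subseteq> KD"
  proof
    fix x assume "x \<in> {x \<in> H. Z x = 0}"
    then have x: "x \<in> H" "Z x = 0" by auto
    have "D x = x" using x(2) by (simp add: D_coisometry[OF co x(1)] bop_0[OF K adj_bop[OF H K b]])
    then show "x \<in> KD" using D_KD[OF x(1)] by simp
  qed
qed

text \<open>The part of the block structure that determines the domain of the parameter of the
  compression. It is used for \<open>(Y, M)\<close> and, by duality, for \<open>(Y\<^sup>*, G\<^sup>*)\<close>.\<close>

locale half_block =
  fixes L B KD :: "'a::complex_hilbert_space set" and Y D M Ms :: "'a \<Rightarrow> 'a"
  assumes L: "csub L" and B: "csub B" and KD: "csub KD" and KDL: "KD \<subseteq> L"
    and inj: "inj_on (\<lambda>x. x - Y x) L" and bY: "bounded_op L L Y"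
    and bD: "bounded_op L L D" and Dinj: "inj_on D KD" and Dim: "D ` KD = D ` L"
    and bM: "bounded_op B KD M" and bMs: "bounded_op KD B Ms" and MMs: "\<And>w. w \<in> KD \<Longrightarrow> M (Ms w) = w"
begin

abbreviation "ImY \<equiv> \<lambda>x. x - Y x"
abbreviation "\<Omega> \<equiv> ImY ` L \<inter> D ` L"

lemma DM: "\<phi> \<in> B \<Longrightarrow> D (M \<phi>) \<in> D ` L"
  using bop_mem[OF bM] KDL by blast

lemma inv_ImY: assumes "h \<in> \<Omega>" shows "inv_into L ImY h \<in> L" "ImY (inv_into L ImY h) = h"
  using assms inv_into_into[of h ImY L] f_inv_into_f[of h ImY L] by auto

lemma inv_eq: "x \<in> L \<Longrightarrow> inv_into L ImY (ImY x) = x"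
  by (rule inv_into_f_f[OF inj])

lemma inv_D: assumes "h \<in> \<Omega>" shows "inv_into KD D h \<in> KD" "D (inv_into KD D h) = h"
proof -
  have "h \<in> D ` KD" using assms Dim by blast
  then show "inv_into KD D h \<in> KD" "D (inv_into KD D h) = h"
    by (rule inv_into_into, rule f_inv_into_f)
qed

lemma inv_D_M: "\<phi> \<in> B \<Longrightarrow> inv_into KD D (D (M \<phi>)) = M \<phi>"
  by (rule inv_into_f_f[OF Dinj bop_mem[OF bM]])

lemma \<Omega>_I: "\<phi> \<in> B \<Longrightarrow> x \<in> L \<Longrightarrow> x - Y x = D (M \<phi>) \<Longrightarrow> D (M \<phi>) \<in> \<Omega>"
  using DM[of \<phi>] imageI[of x L ImY] by simp

text \<open>As M Ms = I on \<open>KD\<close>, the vector \<phi> - Ms (M \<phi>) lies in ker M, and M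
  \<phi> is recovered from h = D (M \<phi>) by the pseudoinverse.\<close>

lemma kernel_form:
  "x \<in> L \<and> \<phi> \<in> B \<and> x - Y x = D (M \<phi>) \<longleftrightarrow>
    (\<exists>h \<psi>. h \<in> \<Omega> \<and> \<psi> \<in> {\<psi> \<in> B. M \<psi> = 0} \<and> x = inv_into L ImY h \<and> \<phi> = \<psi> + Ms (inv_into KD D h))"
proof
  assume a: "x \<in> L \<and> \<phi> \<in> B \<and> x - Y x = D (M \<phi>)"
  then have x: "x \<in> L" and p: "\<phi> \<in> B" and e: "x - Y x = D (M \<phi>)" by auto
  define \<psi> where "\<psi> = \<phi> - Ms (M \<phi>)"
  have m: "Ms (M \<phi>) \<in> B" by (rule bop_mem[OF bMs bop_mem[OF bM p]])
  have "\<psi> \<in> B" "M \<psi> = 0"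
    using p m MMs[OF bop_mem[OF bM p]] by (simp_all add: \<psi>_def csub_diff[OF B] bop_diff[OF B bM])
  moreover have "x = inv_into L ImY (D (M \<phi>))" using inv_eq[OF x] e by simp
  moreover have "\<phi> = \<psi> + Ms (inv_into KD D (D (M \<phi>)))" by (simp add: inv_D_M[OF p] \<psi>_def)
  ultimately show "\<exists>h \<psi>. h \<in> \<Omega> \<and> \<psi> \<in> {\<psi> \<in> B. M \<psi> = 0} \<and> x = inv_into L ImY h \<and> \<phi> = \<psi> + Ms (inv_into KD D h)"
    using \<Omega>_I[OF p x e] by blast
next
  assume "\<exists>h \<psi>. h \<in> \<Omega> \<and> \<psi> \<in> {\<psi> \<in> B. M \<psi> = 0} \<and> x = inv_into L ImY h \<and> \<phi> = \<psi> + Ms (inv_into KD D h)"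
  then obtain h \<psi> where h: "h \<in> \<Omega>" "\<psi> \<in> B" "M \<psi> = 0" "x = inv_into L ImY h" "\<phi> = \<psi> + Ms (inv_into KD D h)"
    by blast
  have m: "Ms (inv_into KD D h) \<in> B" by (rule bop_mem[OF bMs inv_D(1)[OF h(1)]])
  have "M \<phi> = inv_into KD D h"
    by (simp add: h(3,5) bop_add[OF bM h(2) m] MMs[OF inv_D(1)[OF h(1)]])
  then have "D (M \<phi>) = h" using inv_D(2)[OF h(1)] by simp
  then show "x \<in> L \<and> \<phi> \<in> B \<and> x - Y x = D (M \<phi>)"
    using inv_ImY[OF h(1)] h(4,5) csub_add[OF B h(2) m] by simp
qed

lemma dom_iff: "\<phi> \<in> B \<Longrightarrow> (\<exists>x\<in>L. x - Y x = D (M \<phi>)) \<longleftrightarrow> D (M \<phi>) \<in> \<Omega>"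
  using \<Omega>_I inv_ImY by blast

lemma pinv_iff: "\<phi> \<in> B \<Longrightarrow> M \<phi> \<in> inv_into KD D ` \<Omega> \<longleftrightarrow> D (M \<phi>) \<in> \<Omega>"
proof
  assume "\<phi> \<in> B" "D (M \<phi>) \<in> \<Omega>"
  then show "M \<phi> \<in> inv_into KD D ` \<Omega>" using inv_D_M by (metis imageI)
next
  assume "\<phi> \<in> B" "M \<phi> \<in> inv_into KD D ` \<Omega>"
  then obtain h where h: "h \<in> \<Omega>" "M \<phi> = inv_into KD D h" by blast
  then show "D (M \<phi>) \<in> \<Omega>" using inv_D(2)[OF h(1)] by simp
qed

text \<open>M is onto \<open>KD\<close> because M Ms = I, so D M has the same range as D.\<close>

lemma full_iff: "{\<phi> \<in> B. D (M \<phi>) \<in> \<Omega>} = B \<longleftrightarrow> D ` L \<subseteq> ImY ` L"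
proof
  assume a: "{\<phi> \<in> B. D (M \<phi>) \<in> \<Omega>} = B"
  show "D ` L \<subseteq> ImY ` L"
  proof
    fix h assume "h \<in> D ` L"
    then obtain w where w: "w \<in> KD" "h = D w" using Dim by blast
    have "Ms w \<in> B" by (rule bop_mem[OF bMs w(1)])
    then have "D (M (Ms w)) \<in> \<Omega>" using a by blast
    then show "h \<in> ImY ` L" using MMs[OF w(1)] w(2) by simp
  qed
qed (use DM in blast)

text \<open>The set contains ker M, as 0 \<in> \<Omega>, and it contains for each h \<in> \<Omega>
  the vector \<phi> = Ms applied to the pseudoinverse at h, for which D (M \<phi>) = h.\<close>

lemma zero_iff: "{\<phi> \<in> B. D (M \<phi>) \<in> \<Omega>} = {0} \<longleftrightarrow> {\<phi> \<in> B. M \<phi> = 0} = {0} \<and> \<Omega> = {0}"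
proof
  have D0: "D 0 = 0" by (rule bop_0[OF L bD])
  have O0: "0 \<in> \<Omega>"
  proof
    show "0 \<in> ImY ` L" by (rule image_eqI[OF _ csub_0[OF L]]) (simp add: bop_0[OF L bY])
    show "0 \<in> D ` L" by (rule image_eqI[OF _ csub_0[OF L]]) (simp add: D0)
  qed
  have M0: "M 0 = 0" by (rule bop_0[OF B bM])
  show "{\<phi> \<in> B. M \<phi> = 0} = {0} \<and> \<Omega> = {0}" if a: "{\<phi> \<in> B. D (M \<phi>) \<in> \<Omega>} = {0}"
  proof
    have "{\<phi> \<in> B. M \<phi> = 0} \<subseteq> {\<phi> \<in> B. D (M \<phi>) \<in> \<Omega>}" using O0 D0 by auto
    then show "{\<phi> \<in> B. M \<phi> = 0} = {0}" using a M0 csub_0[OF B] by blast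
    have "h = 0" if h: "h \<in> \<Omega>" for h
    proof -
      have m: "Ms (inv_into KD D h) \<in> B" by (rule bop_mem[OF bMs inv_D(1)[OF h]])
      have e: "D (M (Ms (inv_into KD D h))) = h" using inv_D[OF h] MMs by simp
      have "Ms (inv_into KD D h) \<in> {\<phi> \<in> B. D (M \<phi>) \<in> \<Omega>}" using m h by (simp only: mem_Collect_eq e simp_thms)
      then have "Ms (inv_into KD D h) = 0" unfolding a by simp
      then show "h = 0" using e M0 D0 by simp
    qed
    then show "\<Omega> = {0}" using O0 by blast
  qed
  show "{\<phi> \<in> B. D (M \<phi>) \<in> \<Omega>} = {0}" if a: "{\<phi> \<in> B. M \<phi> = 0} = {0} \<and> \<Omega> = {0}"
  proof -
    have "\<phi> = 0" if p: "\<phi> \<in> B" "D (M \<phi>) \<in> \<Omega>" for \<phi>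
    proof -
      have "D (M \<phi>) = D 0" using p(2) unfolding conjunct2[OF a] by (simp add: D0)
      then have "M \<phi> = 0" by (rule inj_onD[OF Dinj _ bop_mem[OF bM p(1)] csub_0[OF KD]])
      then have "\<phi> \<in> {\<phi> \<in> B. M \<phi> = 0}" using p(1) by simp
      then show ?thesis unfolding conjunct1[OF a] by simp
    qed
    moreover have "0 \<in> {\<phi> \<in> B. D (M \<phi>) \<in> \<Omega>}" using O0 by (simp add: D0 M0 csub_0[OF B])
    ultimately show ?thesis by blast
  qed
qed

end

section \<open>Existence of the block representation\<close>

context vN_ext
begin

lemma ex_block_representation: "\<exists>Y M G X. block_representation S U Y M G X"
proof -
  let ?L = "Lz (-\<i>)" and ?Vm = "V (-\<i>)"
  have bVm: "bounded_op ?L (Lz \<i>) ?Vm" using V_bop[OF imag_unit_i(2)] by simp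
  have Vm: "?Vm x \<in> Lz \<i>" if "x \<in> ?L" for x by (rule bop_mem[OF bVm that])
  have VmN: "?Vm x \<in> N \<i>" if "x \<in> ?L" for x by (rule Lz_N[OF imag_unit_i(1) Vm[OF that]])
  have Vmn: "norm (?Vm x) = norm x" if "x \<in> ?L" for x
    using V_isometry[OF imag_unit_i(2)] that by (simp add: isometry_op_def)
  have LN: "x \<in> N (-\<i>)" if "x \<in> ?L" for x by (rule Lz_N[OF imag_unit_i(2) that])
  have bpL: "bounded_op (N (-\<i>)) ?L (proj ?L)"
    by (rule bopI[where b=1]) (simp_all add: proj_mem Lm proj_add proj_scaleC proj_norm_le)
  have bpN: "bounded_op (N (-\<i>)) (N' (-\<i>)) (proj (N' (-\<i>)))"
    by (rule bopI[where b=1]) (simp_all add: proj_mem N'm proj_add proj_scaleC proj_norm_le)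
  have bpN': "bounded_op (N \<i>) (N' \<i>) (proj (N' \<i>))"
    by (rule bopI[where b=1]) (simp_all add: proj_mem N'p proj_add proj_scaleC proj_norm_le)
  \<comment> \<open>Y and E are the two components of U V_{-i}; E is going to be G D_Y.\<close>
  define Y where "Y = (\<lambda>x. proj ?L (U (?Vm x)))"
  define E where "E = (\<lambda>x. proj (N' (-\<i>)) (U (?Vm x)))"
  have bVN: "bounded_op ?L (N \<i>) ?Vm" by (rule bop_restrict[OF bVm]) (use VmN in auto)
  have bY: "bounded_op ?L ?L Y" unfolding Y_def by (rule bop_compose[OF bop_compose[OF bVN bU] bpL])
  have bE: "bounded_op ?L (N' (-\<i>)) E" unfolding E_def by (rule bop_compose[OF bop_compose[OF bVN bU] bpN])
  have UVm: "U (?Vm x) = Y x + E x" if "x \<in> ?L" for x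
    using proj_N'[OF imag_unit_i(2) U_mem[OF VmN[OF that]]] by (simp add: Y_def E_def)
  have LN0: "cinner l n = 0" if "l \<in> ?L" "n \<in> N' (-\<i>)" for l n
    using N'_Lz[OF that(2,1)] cinner_eq_sym by blast
  have nYE: "(norm x)\<^sup>2 = (norm (Y x))\<^sup>2 + (norm (E x))\<^sup>2" if x: "x \<in> ?L" for x
    using norm_add_orth[OF LN0[OF bop_mem[OF bY x] bop_mem[OF bE x]]] UVm[OF x] U_norm[OF VmN[OF x]] Vmn[OF x]
    by simp
  have cY: "contraction_op ?L ?L Y"
    unfolding contraction_op_def
  proof (intro conjI bY ballI)
    fix x assume x: "x \<in> ?L"
    show "norm (Y x) \<le> norm x" by (rule power2_le_imp_le) (simp_all add: nYE[OF x])
  qed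
  \<comment> \<open>A fixed vector x of Y leaves no norm for E x, so U V_{-i} x = x = V_i V_{-i} x,
    and the condition on U gives x = 0.\<close>
  have fix0: "x = 0" if x: "x \<in> ?L" "Y x = x" for x
  proof -
    have "E x = 0" using nYE[OF x(1)] x(2) by simp
    then have "U (?Vm x) = x" using UVm[OF x(1)] x(2) by simp
    moreover have "V \<i> (?Vm x) = x" by (rule V_inv'[OF imag_unit_i(1) x(1)])
    ultimately have "?Vm x = 0" using UV Vm[OF x(1)] by force
    then show ?thesis using Vmn[OF x(1)] by simp
  qed
  interpret q: inj_contr ?L Y by standard (use Lm cY fix0 in auto)
  let ?Ys = "adj ?L ?L Y" and ?KY = "q.A.KD" and ?KYs = "q.B.KD" and ?DY = "q.A.D" and ?DYs = "q.B.D"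
  have nE: "norm (E x) = norm (?DY x)" if x: "x \<in> ?L" for x
  proof -
    have "(norm (E x))\<^sup>2 = (norm (?DY x))\<^sup>2" using nYE[OF x] q.A.D_norm[OF x] by simp
    then show ?thesis by (simp add: power2_eq_iff_nonneg)
  qed
  obtain G where iG: "isometry_op ?KY (N' (-\<i>)) G" and GD: "\<And>x. x \<in> ?L \<Longrightarrow> G (?DY x) = E x"
    using isometry_extension[OF Lm N'm q.A.D_bop bE nE] unfolding defect_sp_def[symmetric] by blast
  \<comment> \<open>The N'_i-component of U^{-1} on \<LL>_-i; a norm comparison will factor it as
    \<open>Ms0\<close> after \<open>?DYs\<close>.\<close>
  define E' where "E' = (\<lambda>x. proj (N' \<i>) (Ui x))"
  have bE': "bounded_op ?L (N' \<i>) E'"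
    unfolding E'_def by (rule bop_compose[OF bop_restrict[OF Ui_bop] bpN']) (use LN Ui_mem in auto)
  \<comment> \<open>U^{-1} is the adjoint of U, so its corner in \<LL>_i is V_{-i} times the adjoint
    of Y.\<close>
  have UiY: "proj (Lz \<i>) (Ui x) = ?Vm (?Ys x)" if x: "x \<in> ?L" for x
  proof (rule proj_eqI[OF Lp Vm[OF bop_mem[OF q.bYs x]]])
    fix k assume k: "k \<in> Lz \<i>"
    define z where "z = V \<i> k"
    have z: "z \<in> ?L" unfolding z_def by (rule V_Lz[OF imag_unit_i(1) k])
    have kz: "k = ?Vm z" unfolding z_def using V_inv[OF imag_unit_i(1) k] by simp
    have "cinner k (Ui x) = cinner (Y z + E z) x"
      using Ui_cinner[OF VmN[OF z] LN[OF x]] UVm[OF z] kz by simp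
    also have "\<dots> = cinner (Y z) x"
      using N'_Lz[OF bop_mem[OF bE z] x] by (simp add: cinner_add_left)
    also have "\<dots> = cinner z (?Ys x)" using adj_cinner[OF Lm bY z] by simp
    also have "\<dots> = cinner k (?Vm (?Ys x))"
      using V_cinner[OF imag_unit_i(2) z bop_mem[OF q.bYs x]] kz by simp
    finally have "cinner k (Ui x - ?Vm (?Ys x)) = 0" by (simp add: cinner_diff_right)
    then show "cinner (Ui x - ?Vm (?Ys x)) k = 0" using cinner_eq_sym by blast
  qed
  have UiE: "Ui x = ?Vm (?Ys x) + E' x" if x: "x \<in> ?L" for x
    using proj_N'[OF imag_unit_i(1) Ui_mem[OF LN[OF x]]] UiY[OF x] by (simp add: E'_def)
  have nE': "norm (E' x) = norm (?DYs x)" if x: "x \<in> ?L" for x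
  proof -
    have "cinner (?Vm (?Ys x)) (E' x) = 0"
      using N'_Lz[OF bop_mem[OF bE' x] Vm[OF bop_mem[OF q.bYs x]]] cinner_eq_sym by blast
    from norm_add_orth[OF this]
    have "(norm x)\<^sup>2 = (norm (?Ys x))\<^sup>2 + (norm (E' x))\<^sup>2"
      using UiE[OF x] U_norm[OF Ui_mem[OF LN[OF x]]] U_Ui[OF LN[OF x]] Vmn[OF bop_mem[OF q.bYs x]] by simp
    then have "(norm (E' x))\<^sup>2 = (norm (?DYs x))\<^sup>2" using q.B.D_norm[OF x] by simp
    then show ?thesis by (simp add: power2_eq_iff_nonneg)
  qed
  obtain Ms0 where iMs: "isometry_op ?KYs (N' \<i>) Ms0" and MD: "\<And>x. x \<in> ?L \<Longrightarrow> Ms0 (?DYs x) = E' x"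
    using isometry_extension[OF Lm N'p q.B.D_bop bE' nE'] unfolding defect_sp_def[symmetric] by blast
  note bG = isometry_bop[OF iG] and bMs0 = isometry_bop[OF iMs]
  \<comment> \<open>M is obtained as an adjoint because the extension lemma delivers the isometry
    \<open>Ms0\<close> on the defect space.\<close>
  define M where "M = adj ?KYs (N' \<i>) Ms0"
  define Gs where "Gs = adj ?KY (N' (-\<i>)) G"
  have cM: "contraction_op (N' \<i>) ?KYs M"
    unfolding M_def by (rule adj_contr[OF q.B.KD N'p isometry_contr[OF iMs]])
  have cGs: "contraction_op (N' (-\<i>)) ?KY Gs"
    unfolding Gs_def by (rule adj_contr[OF q.A.KD N'm isometry_contr[OF iG]])
  note bM = contr_bop[OF cM] and bGs = contr_bop[OF cGs]
  have Ms_eq: "adj (N' \<i>) ?KYs M w = Ms0 w" if "w \<in> ?KYs" for w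
    unfolding M_def by (rule adj_adj[OF q.B.KD N'p bMs0 that])
  have G_eq: "adj (N' (-\<i>)) ?KY Gs w = G w" if "w \<in> ?KY" for w
    unfolding Gs_def by (rule adj_adj[OF q.A.KD N'm bG that])
  have MMs: "M (Ms0 w) = w" if "w \<in> ?KYs" for w
    unfolding M_def by (rule adj_isometry[OF q.B.KD iMs that])
  have GsG: "Gs (G w) = w" if "w \<in> ?KY" for w
    unfolding Gs_def by (rule adj_isometry[OF q.A.KD iG that])
  interpret cM: contr "N' \<i>" ?KYs M by standard (rule N'p q.B.KD cM)+
  interpret cG: contr "N' (-\<i>)" ?KY Gs by standard (rule N'm q.A.KD cGs)+
  have coM: "M (adj (N' \<i>) ?KYs M w) = w" if "w \<in> ?KYs" for w using Ms_eq[OF that] MMs[OF that] by simp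
  have coG: "Gs (adj (N' (-\<i>)) ?KY Gs w) = w" if "w \<in> ?KY" for w using G_eq[OF that] GsG[OF that] by simp
  have KM: "cM.KD = {x \<in> N' \<i>. M x = 0}" by (rule cM.KD_coisometry[OF coM])
  have KG: "cG.KD = {x \<in> N' (-\<i>). Gs x = 0}" by (rule cG.KD_coisometry[OF coG])
  \<comment> \<open>\<psi> \<in> ker M is orthogonal to every E' x and to \<LL>_i, hence to U^{-1}
    x, so U \<psi> is orthogonal to \<LL>_-i. It is also orthogonal to every U V_{-i} x, hence to
    all G D_Y x.\<close>
  have UM: "U \<psi> \<in> cG.KD" if p: "\<psi> \<in> N' \<i>" "M \<psi> = 0" for \<psi>
  proof -
    have pN: "\<psi> \<in> N \<i>" by (rule N'_N[OF p(1)])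
    have z: "cinner (U \<psi>) x = 0" if x: "x \<in> ?L" for x
    proof -
      have "cinner (U \<psi>) x = cinner \<psi> (?Vm (?Ys x) + E' x)"
        using Ui_cinner[OF pN LN[OF x]] UiE[OF x] by simp
      also have "\<dots> = cinner \<psi> (Ms0 (?DYs x))"
        using N'_Lz[OF p(1) Vm[OF bop_mem[OF q.bYs x]]] MD[OF x] by (simp add: cinner_add_right)
      also have "\<dots> = cinner (M \<psi>) (?DYs x)"
        unfolding M_def by (rule adj_cinner'[OF q.B.KD bMs0 q.B.D_KD[OF x], symmetric])
      finally show ?thesis using p(2) by simp
    qed
    have m: "U \<psi> \<in> N' (-\<i>)"
      unfolding N'_sp_def orth_diff_def using z U_mem[OF pN] by blast
    have "Gs (U \<psi>) = 0"
    proof (rule dense_orth_0[OF bop_image_csubspace[OF Lm q.A.D_bop] defect_sp_def bop_mem[OF bGs m]])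
      fix a assume "a \<in> ?DY ` ?L"
      then obtain x where x: "x \<in> ?L" "a = ?DY x" by blast
      have "cinner (Gs (U \<psi>)) a = cinner (U \<psi>) (G (?DY x))"
        unfolding Gs_def x(2) by (rule adj_cinner'[OF q.A.KD bG q.A.D_KD[OF x(1)]])
      also have "\<dots> = cinner (U \<psi>) (U (?Vm x))"
        using z[OF bop_mem[OF bY x(1)]] GD[OF x(1)] UVm[OF x(1)] by (simp add: cinner_add_right)
      also have "\<dots> = cinner \<psi> (?Vm x)" by (rule U_cinner[OF pN VmN[OF x(1)]])
      also have "\<dots> = 0" by (rule N'_Lz[OF p(1) Vm[OF x(1)]])
      finally show "cinner (Gs (U \<psi>)) a = 0" .
    qed
    then show ?thesis using m KG by simp
  qed
  have UG: "Ui \<psi> \<in> cM.KD" if p: "\<psi> \<in> N' (-\<i>)" "Gs \<psi> = 0" for \<psi>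
  proof -
    have pN: "\<psi> \<in> N (-\<i>)" by (rule N'_N[OF p(1)])
    have z: "cinner (Ui \<psi>) k = 0" if k: "k \<in> Lz \<i>" for k
    proof -
      define x where "x = V \<i> k"
      have x: "x \<in> ?L" unfolding x_def by (rule V_Lz[OF imag_unit_i(1) k])
      have kx: "k = ?Vm x" unfolding x_def using V_inv[OF imag_unit_i(1) k] by simp
      have "cinner k (Ui \<psi>) = cinner (Y x + E x) \<psi>" using Ui_cinner[OF VmN[OF x] pN] UVm[OF x] kx by simp
      also have "\<dots> = cinner (G (?DY x)) \<psi>"
        using LN0[OF bop_mem[OF bY x] p(1)] GD[OF x] by (simp add: cinner_add_left)
      also have "\<dots> = cinner (?DY x) (Gs \<psi>)"
        unfolding Gs_def by (rule adj_cinner[OF q.A.KD bG q.A.D_KD[OF x], symmetric])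
      finally have "cinner k (Ui \<psi>) = 0" using p(2) by simp
      then show ?thesis using cinner_eq_sym by blast
    qed
    have m: "Ui \<psi> \<in> N' \<i>" unfolding N'_sp_def orth_diff_def using z Ui_mem[OF pN] by blast
    have "M (Ui \<psi>) = 0"
    proof (rule dense_orth_0[OF bop_image_csubspace[OF Lm q.B.D_bop] defect_sp_def bop_mem[OF bM m]])
      fix a assume "a \<in> ?DYs ` ?L"
      then obtain x where x: "x \<in> ?L" "a = ?DYs x" by blast
      have "cinner (M (Ui \<psi>)) a = cinner (Ui \<psi>) (Ms0 (?DYs x))"
        unfolding M_def x(2) by (rule adj_cinner'[OF q.B.KD bMs0 q.B.D_KD[OF x(1)]])
      also have "\<dots> = cinner (Ui \<psi>) (Ui x)"
        using z[OF Vm[OF bop_mem[OF q.bYs x(1)]]] MD[OF x(1)] UiE[OF x(1)] by (simp add: cinner_add_right)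
      also have "\<dots> = cinner \<psi> x" using Ui_cinner[OF Ui_mem[OF pN] LN[OF x(1)]] U_Ui[OF pN] by simp
      also have "\<dots> = 0" by (rule N'_Lz[OF p(1) x(1)])
      finally show "cinner (M (Ui \<psi>)) a = 0" .
    qed
    then show ?thesis using m KM by simp
  qed
  have KMN: "cM.KD \<subseteq> N \<i>" using KM N'_N by blast
  have uX: "unitary_op cM.KD cG.KD U"
    unfolding unitary_op_def isometry_op_def
  proof (intro conjI ballI)
    show "bounded_op cM.KD cG.KD U" by (rule bop_restrict[OF bU KMN]) (use UM KM in blast)
    show "norm (U x) = norm x" if "x \<in> cM.KD" for x using U_norm that KMN by blast
    show "U ` cM.KD = cG.KD"
    proof
      show "U ` cM.KD \<subseteq> cG.KD" using UM KM by blast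
      show "cG.KD \<subseteq> U ` cM.KD"
      proof
        fix \<psi> assume "\<psi> \<in> cG.KD"
        then have p: "\<psi> \<in> N' (-\<i>)" "Gs \<psi> = 0" using KG by auto
        have "\<psi> = U (Ui \<psi>)" using U_Ui[OF N'_N[OF p(1)]] by simp
        then show "\<psi> \<in> U ` cM.KD" using UG[OF p] by blast
      qed
    qed
  qed
  \<comment> \<open>Second column of the block matrix on the range of \<open>Ms0\<close>. On the
    dense range of \<open>?DYs\<close> it follows from Ms0 (?DYs x) = U^{-1} x - V_{-i} (?Ys x),
    since I - Y \<open>?Ys\<close> is the square of \<open>?DYs\<close>; both sides are
    continuous.\<close>
  have UMs: "U (Ms0 w) = ?DYs w - G (?Ys w)" if w: "w \<in> ?KYs" for w
  proof (rule bop_agree[where D="?DYs ` ?L" and K=UNIV and K'=UNIV and A="\<lambda>w. U (Ms0 w)"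
        and B="\<lambda>w. ?DYs w - G (?Ys w)"])
    show "csub (closure (?DYs ` ?L))" using q.B.KD unfolding defect_sp_def .
    show "w \<in> closure (?DYs ` ?L)" using w unfolding defect_sp_def .
    show "bounded_op (closure (?DYs ` ?L)) UNIV (\<lambda>w. U (Ms0 w))"
      unfolding defect_sp_def[symmetric]
      by (rule bop_compose[OF bop_restrict[OF bMs0 subset_refl] bop_UNIV[OF bU]])
        (use bop_mem[OF bMs0] N'_N in blast)
    show "bounded_op (closure (?DYs ` ?L)) UNIV (\<lambda>w. ?DYs w - G (?Ys w))"
      unfolding defect_sp_def[symmetric]
      by (rule bop_minus_op[OF bop_subset[OF q.B.D_bop q.B.KD_H]
            bop_compose[OF bop_restrict[OF q.bYs q.B.KD_H q.Ys_KD] bG]])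
    fix d assume "d \<in> ?DYs ` ?L"
    then obtain x where x: "x \<in> ?L" "d = ?DYs x" by blast
    have yx: "?Ys x \<in> ?L" by (rule bop_mem[OF q.bYs x(1)])
    have "Ms0 d = Ui x - ?Vm (?Ys x)" using MD[OF x(1)] UiE[OF x(1)] x(2) by simp
    then have "U (Ms0 d) = x - U (?Vm (?Ys x))"
      by (simp add: bop_diff[OF Np bU Ui_mem[OF LN[OF x(1)]] VmN[OF yx]] U_Ui[OF LN[OF x(1)]])
    also have "\<dots> = (x - Y (?Ys x)) - G (?DY (?Ys x))" using UVm[OF yx] GD[OF yx] by simp
    also have "x - Y (?Ys x) = ?DYs d" using q.B.D_sq[OF x(1)] q.Yss[OF yx] x(2) by simp
    also have "?DY (?Ys x) = ?Ys d" using q.intertwine'[OF x(1)] x(2) by simp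
    finally show "U (Ms0 d) = ?DYs d - G (?Ys d)" .
  qed
  \<comment> \<open>X is U itself: it maps ker M, the defect space of M, unitarily onto ker
    \<open>Gs\<close>, the defect space of \<open>Gs\<close>, on which the defect operator is the
    identity.\<close>
  have "block_representation S U Y M G U"
    unfolding block_representation_def Let_def Gs_def[symmetric]
  proof (intro conjI ballI impI)
    show "contraction_op ?L ?L Y" by (rule cY)
    show "{x \<in> ?L. x - Y x = 0} = {0}" using q.ImY_inj csub_0[OF Lm] bop_0[OF Lm bY] by auto
    show "hdim ?KY \<le> hdim (N' (-\<i>))" by (rule hdim_isometry_le[OF q.A.KD N'm iG])
    show "hdim ?KYs \<le> hdim (N' \<i>)" by (rule hdim_isometry_le[OF q.B.KD N'p iMs])
    show "bounded_op (N' \<i>) ?KYs M" by (rule bM)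
    show "isometry_op ?KYs (N' \<i>) (adj (N' \<i>) ?KYs M)" by (rule isometry_cong[OF q.B.KD iMs Ms_eq])
    show "isometry_op ?KY (N' (-\<i>)) G" by (rule iG)
    show "hdim cM.KD = hdim cG.KD" by (rule hdim_unitary_eq[OF cM.KD cG.KD uX])
    show "bounded_op cM.KD cG.KD U" using uX by (simp add: unitary_op_def isometry_op_def)
    show "unitary_op cM.KD cG.KD U" by (rule uX)
    fix f \<phi> assume f: "f \<in> Lz \<i>" and p: "\<phi> \<in> N' \<i>"
    define x where "x = V \<i> f"
    have x: "x \<in> ?L" unfolding x_def by (rule V_Lz[OF imag_unit_i(1) f])
    have fx: "f = ?Vm x" unfolding x_def using V_inv[OF imag_unit_i(1) f] by simp
    define w where "w = M \<phi>"
    have w: "w \<in> ?KYs" unfolding w_def by (rule bop_mem[OF bM p])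
    \<comment> \<open>Splits \<phi> into the part \<open>Ms0 w\<close>, governed by
      \<open>UMs\<close>, and a part in ker M, governed by X.\<close>
    have DM: "cM.D \<phi> = \<phi> - Ms0 w" using cM.D_coisometry[OF coM p] Ms_eq[OF w] by (simp add: w_def)
    have DMm: "cM.D \<phi> \<in> cM.KD" by (rule cM.D_KD[OF p])
    have m: "Ms0 w \<in> N \<i>" "cM.D \<phi> \<in> N \<i>" using N'_N[OF bop_mem[OF bMs0 w]] DMm KMN by auto
    have ug: "U (cM.D \<phi>) \<in> cG.KD" using UM DMm KM by blast
    then have "cG.D (U (cM.D \<phi>)) = U (cM.D \<phi>)"
      using cG.D_coisometry[OF coG, of "U (cM.D \<phi>)"] KG bop_0[OF q.A.KD adj_bop[OF N'm q.A.KD bGs]] by auto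
    moreover have "U (f + \<phi>) = U (?Vm x) + (U (Ms0 w) + U (cM.D \<phi>))"
    proof -
      have "f + \<phi> = ?Vm x + (Ms0 w + cM.D \<phi>)" using DM fx by simp
      then show ?thesis
        using bop_add[OF bU VmN[OF x] csub_add[OF Np m]] bop_add[OF bU m] by simp
    qed
    ultimately show "U (f + \<phi>) = (Y (V \<i> f) + ?DYs (M \<phi>)) +
        (G (?DY (V \<i> f)) + (- G (?Ys (M \<phi>)) + cG.D (U (cM.D \<phi>))))"
      unfolding x_def[symmetric] w_def[symmetric] using UVm[OF x] GD[OF x] UMs[OF w] by simp
  qed
  then show ?thesis by blast
qed

end

section \<open>Kernels, \<open>U0\<close> and the compression in terms of the block
  parameters\<close>

locale block = vN_ext +
  fixes Y M G X :: "'a \<Rightarrow> 'a"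
  assumes rep: "block_representation S U Y M G X"
begin

abbreviation "L \<equiv> Lz (-\<i>)"
abbreviation "Vm \<equiv> V (-\<i>)"
abbreviation "Ys \<equiv> adj L L Y"
abbreviation "DY \<equiv> defect_op L L Y"
abbreviation "KY \<equiv> defect_sp L L Y"
abbreviation "DYs \<equiv> defect_op L L Ys"
abbreviation "KYs \<equiv> defect_sp L L Ys"
abbreviation "Ms \<equiv> adj (N' \<i>) KYs M"
abbreviation "Gs \<equiv> adj KY (N' (-\<i>)) G"
abbreviation "DM \<equiv> defect_op (N' \<i>) KYs M"
abbreviation "KM \<equiv> defect_sp (N' \<i>) KYs M"
abbreviation "DGs \<equiv> defect_op (N' (-\<i>)) KY Gs"
abbreviation "KGs \<equiv> defect_sp (N' (-\<i>)) KY Gs"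
abbreviation "Xs \<equiv> adj KM KGs X"
abbreviation "ImY \<equiv> \<lambda>x. x - Y x"
abbreviation "ImYs \<equiv> \<lambda>x. x - Ys x"

lemma rep_unfolded:
  "contraction_op L L Y" "{x \<in> L. x - Y x = 0} = {0}"
  "bounded_op (N' \<i>) KYs M" "isometry_op KYs (N' \<i>) Ms" "isometry_op KY (N' (-\<i>)) G"
  "bounded_op KM KGs X"
  "\<And>f \<phi>. f \<in> Lz \<i> \<Longrightarrow> \<phi> \<in> N' \<i> \<Longrightarrow> U (f + \<phi>) = (Y (V \<i> f) + DYs (M \<phi>)) +
    (G (DY (V \<i> f)) + (- G (Ys (M \<phi>)) + DGs (X (DM \<phi>))))"
  using rep unfolding block_representation_def Let_def by blast+

sublocale q: inj_contr L Y
proof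
  fix x assume "x \<in> L" "Y x = x"
  then have "x \<in> {x \<in> L. x - Y x = 0}" by simp
  then show "x = 0" unfolding rep_unfolded(2) by simp
qed (rule Lm rep_unfolded(1))+

lemmas bM = rep_unfolded(3) and iMs = rep_unfolded(4) and iG = rep_unfolded(5) and bX = rep_unfolded(6)
lemmas bMs = isometry_bop[OF iMs] and bG = isometry_bop[OF iG]

text \<open>The representation asserts isometry of \<open>Ms\<close>; M enters as its adjoint, with
  which it agrees on N'_i.\<close>

lemma MMs: assumes "w \<in> KYs" shows "M (Ms w) = w"
proof -
  have m: "Ms w \<in> N' \<i>" by (rule bop_mem[OF bMs assms])
  have "adj KYs (N' \<i>) Ms (Ms w) = w" by (rule adj_isometry[OF q.B.KD iMs assms])
  then show ?thesis using adj_adj[OF N'p q.B.KD bM m] by simp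
qed

lemma cM: "contraction_op (N' \<i>) KYs M"
proof -
  have c: "contraction_op (N' \<i>) KYs (adj KYs (N' \<i>) Ms)"
    by (rule adj_contr[OF q.B.KD N'p isometry_contr[OF iMs]])
  have "norm (M x) \<le> norm x" if "x \<in> N' \<i>" for x
    using contr_norm[OF c that] adj_adj[OF N'p q.B.KD bM that] by simp
  then show ?thesis using bM by (simp add: contraction_op_def)
qed

lemma cGs: "contraction_op (N' (-\<i>)) KY Gs"
  by (rule adj_contr[OF q.A.KD N'm isometry_contr[OF iG]])

lemmas bGs = contr_bop[OF cGs]

lemma GsG: "w \<in> KY \<Longrightarrow> Gs (G w) = w"
  by (rule adj_isometry[OF q.A.KD iG])

sublocale cM: contr "N' \<i>" KYs M by standard (rule N'p q.B.KD cM)+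
sublocale cG: contr "N' (-\<i>)" KY Gs by standard (rule N'm q.A.KD cGs)+

sublocale P: half_block L "N' \<i>" KYs Y DYs M Ms
  by standard (use Lm N'p q.B.KD q.B.KD_H q.ImY_inj_on q.bY q.B.D_bop q.B.D_inj_on q.B.D_image bM bMs MMs in auto)

sublocale Q: half_block L "N' (-\<i>)" KY Ys DY Gs G
  by standard (use Lm N'm q.A.KD q.A.KD_H inj_contr.ImY_inj_on[OF q.dual'] q.bYs q.A.D_bop q.A.D_inj_on
    q.A.D_image bGs bG GsG in auto)

lemma Vm_mem: "x \<in> L \<Longrightarrow> Vm x \<in> Lz \<i>"
  using V_Lz[OF imag_unit_i(2)] by simp

lemma VVm: "x \<in> L \<Longrightarrow> V \<i> (Vm x) = x"
  using V_inv'[OF imag_unit_i(1)] by simp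

lemma VmV: "l \<in> Lz \<i> \<Longrightarrow> Vm (V \<i> l) = l"
  by (rule V_inv[OF imag_unit_i(1)])

lemma V_mem: "l \<in> Lz \<i> \<Longrightarrow> V \<i> l \<in> L"
  by (rule V_Lz[OF imag_unit_i(1)])

text \<open>\<open>U1\<close> and \<open>U2\<close> are the rows of the block matrix applied to
  V_{-i} x + \<phi>; \<open>W1\<close> and \<open>W2\<close> are the rows of its adjoint, which will
  be identified with U^{-1}.\<close>

definition "U1 x \<phi> = Y x + DYs (M \<phi>)"
definition "U2 x \<phi> = G (DY x) + (- G (Ys (M \<phi>)) + DGs (X (DM \<phi>)))"
definition "W1 x \<psi> = Ys x + DY (Gs \<psi>)"
definition "W2 x \<psi> = Ms (DYs x) + (- Ms (Y (Gs \<psi>)) + DM (Xs (DGs \<psi>)))"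

lemma mems:
  assumes "x \<in> L" "\<phi> \<in> N' \<i>"
  shows "M \<phi> \<in> KYs" "M \<phi> \<in> L" "Ys (M \<phi>) \<in> KY" "X (DM \<phi>) \<in> KGs" "X (DM \<phi>) \<in> N' (-\<i>)" "DM \<phi> \<in> KM" "DY x \<in> KY"
proof -
  show m: "M \<phi> \<in> KYs" by (rule bop_mem[OF bM assms(2)])
  then show "M \<phi> \<in> L" using q.B.KD_H by blast
  show "Ys (M \<phi>) \<in> KY" by (rule q.Ys_KD[OF m])
  show d: "DM \<phi> \<in> KM" by (rule cM.D_KD[OF assms(2)])
  show x: "X (DM \<phi>) \<in> KGs" by (rule bop_mem[OF bX d])
  then show "X (DM \<phi>) \<in> N' (-\<i>)" using cG.KD_H by blast
  show "DY x \<in> KY" by (rule q.A.D_KD[OF assms(1)])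
qed

lemma mems':
  assumes "x \<in> L" "\<psi> \<in> N' (-\<i>)"
  shows "Gs \<psi> \<in> KY" "Gs \<psi> \<in> L" "Y (Gs \<psi>) \<in> KYs" "DGs \<psi> \<in> KGs" "Xs (DGs \<psi>) \<in> KM" "Xs (DGs \<psi>) \<in> N' \<i>" "DYs x \<in> KYs"
proof -
  show m: "Gs \<psi> \<in> KY" by (rule bop_mem[OF bGs assms(2)])
  then show "Gs \<psi> \<in> L" using q.A.KD_H by blast
  show "Y (Gs \<psi>) \<in> KYs" by (rule q.Y_KD[OF m])
  show d: "DGs \<psi> \<in> KGs" by (rule cG.D_KD[OF assms(2)])
  show x: "Xs (DGs \<psi>) \<in> KM" by (rule adj_mem[OF cM.KD bX])
  then show "Xs (DGs \<psi>) \<in> N' \<i>" using cM.KD_H by blast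
  show "DYs x \<in> KYs" by (rule q.B.D_KD[OF assms(1)])
qed

lemma U_block: "x \<in> L \<Longrightarrow> \<phi> \<in> N' \<i> \<Longrightarrow> U (Vm x + \<phi>) = U1 x \<phi> + U2 x \<phi>"
  unfolding U1_def U2_def using rep_unfolded(7)[OF Vm_mem] by (simp add: VVm)

lemma U12_mem:
  assumes "x \<in> L" "\<phi> \<in> N' \<i>" shows "U1 x \<phi> \<in> L" "U2 x \<phi> \<in> N' (-\<i>)"
  unfolding U1_def U2_def
  by (intro csub_add[OF Lm] csub_add[OF N'm] csub_neg[OF N'm] bop_mem[OF q.bY] q.B.D_mem bop_mem[OF bG]
      cG.D_mem mems assms; (rule assms)?)+

lemma W12_mem:
  assumes "x \<in> L" "\<psi> \<in> N' (-\<i>)" shows "W1 x \<psi> \<in> L" "W2 x \<psi> \<in> N' \<i>"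
  unfolding W1_def W2_def
  by (intro csub_add[OF Lm] csub_add[OF N'p] csub_neg[OF N'p] bop_mem[OF q.bYs] q.A.D_mem bop_mem[OF bMs]
      cM.D_mem mems' assms; (rule assms)?)+

lemma cinner_Lp_N': "l \<in> Lz \<i> \<Longrightarrow> p \<in> N' \<i> \<Longrightarrow> cinner l p = 0" "l \<in> L \<Longrightarrow> q \<in> N' (-\<i>) \<Longrightarrow> cinner l q = 0"
  using N'_Lz cinner_eq_sym by blast+

text \<open>U^{-1} is the adjoint of U, so the block matrix has only to be transposed: each entry is
  moved across the inner product with an arbitrary v = V_{-i} z + \<phi>.\<close>

lemma Ui_block:
  assumes x: "x \<in> L" and p: "\<psi> \<in> N' (-\<i>)" shows "Ui (x + \<psi>) = Vm (W1 x \<psi>) + W2 x \<psi>"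
proof (rule orth_self_eq[OF csub_csubspace[OF Np]])
  note w = W12_mem[OF x p]
  have xp: "x + \<psi> \<in> N (-\<i>)" by (rule csub_add[OF Nm Lz_N[OF imag_unit_i(2) x] N'_N[OF p]])
  then show "Ui (x + \<psi>) \<in> N \<i>" by (rule Ui_mem)
  show "Vm (W1 x \<psi>) + W2 x \<psi> \<in> N \<i>"
    by (rule csub_add[OF Np Lz_N[OF imag_unit_i(1) Vm_mem[OF w(1)]] N'_N[OF w(2)]])
  fix v assume v: "v \<in> N \<i>"
  define z \<phi> where "z = V \<i> (proj (Lz \<i>) v)" and "\<phi> = v - proj (Lz \<i>) v"
  have pl: "proj (Lz \<i>) v \<in> Lz \<i>" by (rule proj_mem[OF Lp])
  have z: "z \<in> L" unfolding z_def by (rule V_mem[OF pl])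
  have f: "\<phi> \<in> N' \<i>" unfolding \<phi>_def by (rule N_split[OF imag_unit_i(1) v])
  have vz: "v = Vm z + \<phi>" unfolding z_def VmV[OF pl] \<phi>_def by simp
  note u = U12_mem[OF z f] and m = mems[OF z f] and m' = mems'[OF x p]
  have "cinner v (Ui (x + \<psi>)) = cinner (U1 z \<phi> + U2 z \<phi>) (x + \<psi>)"
    using Ui_cinner[OF v xp] U_block[OF z f] vz by simp
  also have "\<dots> = cinner (U1 z \<phi>) x + cinner (U2 z \<phi>) \<psi>"
    using cinner_Lp_N'(2)[OF u(1) p] N'_Lz[OF u(2) x] by (simp add: cinner_lin)
  also have "cinner (U1 z \<phi>) x = cinner z (Ys x) + cinner \<phi> (Ms (DYs x))"
    unfolding U1_def using q.B.D_sym[OF m(2) x] adj_cinner[OF Lm q.bY z] adj_cinner[OF N'p bM f]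
    by (simp add: cinner_add_left)
  also have "cinner (U2 z \<phi>) \<psi> = cinner z (DY (Gs \<psi>)) - cinner \<phi> (Ms (Y (Gs \<psi>))) + cinner \<phi> (DM (Xs (DGs \<psi>)))"
  proof -
    have "cinner (G (DY z)) \<psi> = cinner (DY z) (Gs \<psi>)" by (rule adj_cinner[OF q.A.KD bG m(7), symmetric])
    also have "\<dots> = cinner z (DY (Gs \<psi>))" by (rule q.A.D_sym[OF z m'(2)])
    finally have 1: "cinner (G (DY z)) \<psi> = cinner z (DY (Gs \<psi>))" .
    have "cinner (G (Ys (M \<phi>))) \<psi> = cinner (Ys (M \<phi>)) (Gs \<psi>)" by (rule adj_cinner[OF q.A.KD bG m(3), symmetric])
    also have "\<dots> = cinner (M \<phi>) (Y (Gs \<psi>))" by (rule adj_cinner'[OF Lm q.bY m'(2)])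
    also have "\<dots> = cinner \<phi> (Ms (Y (Gs \<psi>)))" by (rule adj_cinner[OF N'p bM f, symmetric])
    finally have 2: "cinner (G (Ys (M \<phi>))) \<psi> = cinner \<phi> (Ms (Y (Gs \<psi>)))" .
    have "cinner (DGs (X (DM \<phi>))) \<psi> = cinner (X (DM \<phi>)) (DGs \<psi>)" by (rule cG.D_sym[OF m(5) p])
    also have "\<dots> = cinner (DM \<phi>) (Xs (DGs \<psi>))" by (rule adj_cinner[OF cM.KD bX m(6), symmetric])
    also have "\<dots> = cinner \<phi> (DM (Xs (DGs \<psi>)))" by (rule cM.D_sym[OF f m'(6)])
    finally have 3: "cinner (DGs (X (DM \<phi>))) \<psi> = cinner \<phi> (DM (Xs (DGs \<psi>)))" .
    show ?thesis unfolding U2_def by (simp only: cinner_add_left cinner_minus_left 1 2 3, simp)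
  qed
  also have "cinner z (Ys x) + cinner \<phi> (Ms (DYs x)) + (cinner z (DY (Gs \<psi>)) - cinner \<phi> (Ms (Y (Gs \<psi>))) + cinner \<phi> (DM (Xs (DGs \<psi>))))
      = cinner z (W1 x \<psi>) + cinner \<phi> (W2 x \<psi>)"
    unfolding W1_def W2_def by (simp add: cinner_add_right cinner_diff_right)
  also have "cinner z (W1 x \<psi>) = cinner (Vm z) (Vm (W1 x \<psi>))"
    using V_cinner[OF imag_unit_i(2) z w(1)] by simp
  also have "cinner (Vm z) (Vm (W1 x \<psi>)) + cinner \<phi> (W2 x \<psi>) = cinner v (Vm (W1 x \<psi>) + W2 x \<psi>)"
    unfolding vz using cinner_Lp_N'(1)[OF Vm_mem[OF z] w(2)] N'_Lz[OF f Vm_mem[OF w(1)]] by (simp add: cinner_lin)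
  finally show "cinner v (Ui (x + \<psi>)) = cinner v (Vm (W1 x \<psi>) + W2 x \<psi>)" .
qed

text \<open>With x = V_i l the kernel condition reads \<open>U1 x \<phi> = x\<close>.\<close>

lemma kerP_iff: "v \<in> kerP \<longleftrightarrow> (\<exists>x \<phi>. x \<in> L \<and> \<phi> \<in> N' \<i> \<and> x - Y x = DYs (M \<phi>) \<and> v = Vm x + \<phi>)"
proof
  assume "v \<in> kerP"
  then have v: "v \<in> N \<i>" "proj L (U v) = V \<i> (proj (Lz \<i>) v)" by auto
  define x \<phi> where "x = V \<i> (proj (Lz \<i>) v)" and "\<phi> = v - proj (Lz \<i>) v"
  have pl: "proj (Lz \<i>) v \<in> Lz \<i>" by (rule proj_mem[OF Lp])
  have x: "x \<in> L" unfolding x_def by (rule V_mem[OF pl])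
  have f: "\<phi> \<in> N' \<i>" unfolding \<phi>_def by (rule N_split[OF imag_unit_i(1) v(1)])
  have vz: "v = Vm x + \<phi>" unfolding x_def VmV[OF pl] \<phi>_def by simp
  have "proj L (U (Vm x + \<phi>)) = U1 x \<phi>"
    unfolding U_block[OF x f] by (rule proj_split(1)[OF imag_unit_i(2) U12_mem[OF x f]])
  then have "U1 x \<phi> = x" unfolding vz[symmetric] v(2) x_def[symmetric] by (rule sym)
  then have "x - Y x = DYs (M \<phi>)" unfolding U1_def by (simp add: algebra_simps)
  then show "\<exists>x \<phi>. x \<in> L \<and> \<phi> \<in> N' \<i> \<and> x - Y x = DYs (M \<phi>) \<and> v = Vm x + \<phi>" using x f vz by blast
next
  assume "\<exists>x \<phi>. x \<in> L \<and> \<phi> \<in> N' \<i> \<and> x - Y x = DYs (M \<phi>) \<and> v = Vm x + \<phi>"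
  then obtain x \<phi> where a: "x \<in> L" "\<phi> \<in> N' \<i>" "x - Y x = DYs (M \<phi>)" "v = Vm x + \<phi>" by blast
  have "U1 x \<phi> = x" unfolding U1_def using a(3) by (simp add: algebra_simps)
  then have "proj L (U v) = x"
    using proj_split(1)[OF imag_unit_i(2) U12_mem[OF a(1,2)]] U_block[OF a(1,2)] a(4) by simp
  moreover have "V \<i> (proj (Lz \<i>) v) = x"
    using proj_split(1)[OF imag_unit_i(1) Vm_mem[OF a(1)] a(2)] VVm[OF a(1)] a(4) by simp
  moreover have "v \<in> N \<i>"
    unfolding a(4) by (rule csub_add[OF Np Lz_N[OF imag_unit_i(1) Vm_mem[OF a(1)]] N'_N[OF a(2)]])
  ultimately show "v \<in> kerP" by simp
qed

abbreviation "kerPi \<equiv> {\<phi> \<in> N (-\<i>). proj (Lz \<i>) (Ui \<phi>) - Vm (proj L \<phi>) = 0}"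

lemma kerPi_iff: "v \<in> kerPi \<longleftrightarrow> (\<exists>x \<psi>. x \<in> L \<and> \<psi> \<in> N' (-\<i>) \<and> x - Ys x = DY (Gs \<psi>) \<and> v = x + \<psi>)"
proof
  assume "v \<in> kerPi"
  then have v: "v \<in> N (-\<i>)" "proj (Lz \<i>) (Ui v) = Vm (proj L v)" by auto
  define x \<psi> where "x = proj L v" and "\<psi> = v - proj L v"
  have x: "x \<in> L" unfolding x_def by (rule proj_mem[OF Lm])
  have f: "\<psi> \<in> N' (-\<i>)" unfolding \<psi>_def by (rule N_split[OF imag_unit_i(2) v(1)])
  have vz: "v = x + \<psi>" by (simp add: x_def \<psi>_def)
  note w = W12_mem[OF x f]
  have "proj (Lz \<i>) (Ui (x + \<psi>)) = Vm (W1 x \<psi>)"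
    unfolding Ui_block[OF x f] by (rule proj_split(1)[OF imag_unit_i(1) Vm_mem[OF w(1)] w(2)])
  then have "Vm (W1 x \<psi>) = Vm x" unfolding vz[symmetric] v(2) x_def[symmetric] by (rule sym)
  then have "W1 x \<psi> = x" using VVm[OF w(1)] VVm[OF x] by simp
  then have "x - Ys x = DY (Gs \<psi>)" unfolding W1_def by (simp add: algebra_simps)
  then show "\<exists>x \<psi>. x \<in> L \<and> \<psi> \<in> N' (-\<i>) \<and> x - Ys x = DY (Gs \<psi>) \<and> v = x + \<psi>" using x f vz by blast
next
  assume "\<exists>x \<psi>. x \<in> L \<and> \<psi> \<in> N' (-\<i>) \<and> x - Ys x = DY (Gs \<psi>) \<and> v = x + \<psi>"
  then obtain x \<psi> where a: "x \<in> L" "\<psi> \<in> N' (-\<i>)" "x - Ys x = DY (Gs \<psi>)" "v = x + \<psi>" by blast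
  note w = W12_mem[OF a(1,2)]
  have e: "W1 x \<psi> = x" unfolding W1_def using a(3) by (simp add: algebra_simps)
  have "proj (Lz \<i>) (Ui v) = Vm x"
    using proj_split(1)[OF imag_unit_i(1) Vm_mem[OF w(1)] w(2)] Ui_block[OF a(1,2)] a(4) e by simp
  moreover have "proj L v = x"
    using proj_split(1)[OF imag_unit_i(2) a(1,2)] a(4) by simp
  moreover have "v \<in> N (-\<i>)"
    unfolding a(4) by (rule csub_add[OF Nm Lz_N[OF imag_unit_i(2) a(1)] N'_N[OF a(2)]])
  ultimately show "v \<in> kerPi" by simp
qed

lemma kerP_form: "kerP = {Vm (inv_into L ImY h) + (\<psi> + Ms (inv_into KYs DYs h)) | h \<psi>.
    h \<in> ImY ` L \<inter> DYs ` L \<and> \<psi> \<in> {\<phi> \<in> N' \<i>. M \<phi> = 0}}" (is "_ = ?R")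
proof (intro set_eqI)
  fix v
  have "v \<in> kerP \<longleftrightarrow> (\<exists>x \<phi>. (x \<in> L \<and> \<phi> \<in> N' \<i> \<and> x - Y x = DYs (M \<phi>)) \<and> v = Vm x + \<phi>)"
    unfolding kerP_iff by blast
  also have "\<dots> \<longleftrightarrow> v \<in> ?R" unfolding P.kernel_form by blast
  finally show "v \<in> kerP \<longleftrightarrow> v \<in> ?R" .
qed

lemma kerPi_form: "kerPi = {inv_into L ImYs g + (\<psi> + G (inv_into KY DY g)) | g \<psi>.
    g \<in> ImYs ` L \<inter> DY ` L \<and> \<psi> \<in> {\<phi> \<in> N' (-\<i>). Gs \<phi> = 0}}" (is "_ = ?R")
proof (intro set_eqI)
  fix v
  have "v \<in> kerPi \<longleftrightarrow> (\<exists>x \<phi>. (x \<in> L \<and> \<phi> \<in> N' (-\<i>) \<and> x - Ys x = DY (Gs \<phi>)) \<and> v = x + \<phi>)"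
    unfolding kerPi_iff by blast
  also have "\<dots> \<longleftrightarrow> v \<in> ?R" unfolding Q.kernel_form by blast
  finally show "v \<in> kerPi \<longleftrightarrow> v \<in> ?R" .
qed

lemma U0_I:
  assumes p: "p \<in> N' \<i>" and x: "x \<in> L" and e: "x - Y x = DYs (M p)" shows "(p, U2 x p) \<in> U0"
proof -
  have "U1 x p = x" unfolding U1_def using e by (simp add: algebra_simps)
  then have "U (Vm x + p) = V \<i> (Vm x) + U2 x p" using U_block[OF x p] VVm[OF x] by simp
  then show ?thesis unfolding U0_iff using p U12_mem(2)[OF x p] Vm_mem[OF x] by blast
qed

lemma U0_I':
  assumes p: "q \<in> N' (-\<i>)" and x: "x \<in> L" and e: "x - Ys x = DY (Gs q)" shows "(W2 x q, q) \<in> U0"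
proof -
  have "W1 x q = x" unfolding W1_def using e by (simp add: algebra_simps)
  then have "Ui (x + q) = Vm x + W2 x q" using Ui_block[OF x p] by simp
  then have "U (Vm x + W2 x q) = V \<i> (Vm x) + q"
    using U_Ui[OF csub_add[OF Nm Lz_N[OF imag_unit_i(2) x] N'_N[OF p]]] VVm[OF x] by simp
  then show ?thesis unfolding U0_iff using p W12_mem(2)[OF x p] Vm_mem[OF x] by blast
qed

text \<open>The relation U (l + p) = V_i l + q is read once through U and once through U^{-1}. Both
  equations are solved by the same x = V_i l.\<close>

lemma U0_D:
  assumes "(p, q) \<in> U0"
  shows "\<exists>x\<in>L. x - Y x = DYs (M p)" and "\<exists>x\<in>L. x - Ys x = DY (Gs q)"
proof -
  obtain l where l: "p \<in> N' \<i>" "q \<in> N' (-\<i>)" "l \<in> Lz \<i>" "U (l + p) = V \<i> l + q" using assms unfolding U0_iff by blast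
  have m: "l + p \<in> N \<i>" by (rule csub_add[OF Np Lz_N[OF imag_unit_i(1) l(3)] N'_N[OF l(1)]])
  define x where "x = V \<i> l"
  have x: "x \<in> L" unfolding x_def by (rule V_mem[OF l(3)])
  have lx: "l = Vm x" unfolding x_def VmV[OF l(3)] ..
  have "U1 x p + U2 x p = x + q" using U_block[OF x l(1)] l(4) lx VVm[OF x] by simp
  then have "U1 x p = x"
    using proj_split(1)[OF imag_unit_i(2) U12_mem[OF x l(1)]] proj_split(1)[OF imag_unit_i(2) x l(2)] by simp
  then have "x - Y x = DYs (M p)" unfolding U1_def by (simp add: algebra_simps)
  then show "\<exists>x\<in>L. x - Y x = DYs (M p)" using x by blast
  note w = W12_mem[OF x l(2)]
  have "U (l + p) = x + q" using l(4) x_def by simp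
  then have "Vm (W1 x q) + W2 x q = Vm x + p" using Ui_U[OF m] Ui_block[OF x l(2)] lx by simp
  then have "Vm (W1 x q) = Vm x"
    using proj_split(1)[OF imag_unit_i(1) Vm_mem[OF w(1)] w(2)] proj_split(1)[OF imag_unit_i(1) Vm_mem[OF x] l(1)] by simp
  then have "W1 x q = x" using VVm[OF w(1)] VVm[OF x] by simp
  then have "x - Ys x = DY (Gs q)" unfolding W1_def by (simp add: algebra_simps)
  then show "\<exists>x\<in>L. x - Ys x = DY (Gs q)" using x by blast
qed

lemma Domain_U0: "Domain U0 = {\<phi> \<in> N' \<i>. DYs (M \<phi>) \<in> ImY ` L \<inter> DYs ` L}"
proof (intro equalityI subsetI)
  fix p assume "p \<in> Domain U0"
  then obtain q where "(p, q) \<in> U0" by blast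
  then show "p \<in> {\<phi> \<in> N' \<i>. DYs (M \<phi>) \<in> ImY ` L \<inter> DYs ` L}"
    using U0_mem(1) U0_D(1) P.dom_iff by blast
next
  fix p assume "p \<in> {\<phi> \<in> N' \<i>. DYs (M \<phi>) \<in> ImY ` L \<inter> DYs ` L}"
  then show "p \<in> Domain U0" using P.dom_iff U0_I by blast
qed

lemma Range_U0: "Range U0 = {\<phi> \<in> N' (-\<i>). DY (Gs \<phi>) \<in> ImYs ` L \<inter> DY ` L}"
proof (intro equalityI subsetI)
  fix q assume "q \<in> Range U0"
  then obtain p where "(p, q) \<in> U0" by blast
  then show "q \<in> {\<phi> \<in> N' (-\<i>). DY (Gs \<phi>) \<in> ImYs ` L \<inter> DY ` L}"
    using U0_mem(2) U0_D(2) Q.dom_iff by blast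
next
  fix q assume "q \<in> {\<phi> \<in> N' (-\<i>). DY (Gs \<phi>) \<in> ImYs ` L \<inter> DY ` L}"
  then show "q \<in> Range U0" using Q.dom_iff U0_I' by blast
qed

lemma U0_formula:
  assumes "p \<in> Domain U0"
  shows "(p, G (- Ys (M p) + DY (inv_into L ImY (DYs (M p)))) + DGs (X (DM p))) \<in> U0"
proof -
  have p: "p \<in> N' \<i>" "DYs (M p) \<in> ImY ` L \<inter> DYs ` L" using assms unfolding Domain_U0 by auto
  define x where "x = inv_into L ImY (DYs (M p))"
  have x: "x \<in> L" "x - Y x = DYs (M p)" unfolding x_def using P.inv_ImY[OF p(2)] .
  note m = mems[OF x(1) p(1)]
  have "U2 x p = G (- Ys (M p) + DY x) + DGs (X (DM p))"
    unfolding U2_def using bop_add[OF bG csub_neg[OF q.A.KD m(3)] m(7)] bop_minus[OF bG m(3)] by simp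
  then show ?thesis using U0_I[OF p(1) x] x_def by simp
qed

lemma U0_formula':
  assumes "q \<in> Range U0"
  shows "(Ms (- Y (Gs q) + DYs (inv_into L ImYs (DY (Gs q)))) + DM (Xs (DGs q)), q) \<in> U0"
proof -
  have p: "q \<in> N' (-\<i>)" "DY (Gs q) \<in> ImYs ` L \<inter> DY ` L" using assms unfolding Range_U0 by auto
  define x where "x = inv_into L ImYs (DY (Gs q))"
  have x: "x \<in> L" "x - Ys x = DY (Gs q)" unfolding x_def using Q.inv_ImY[OF p(2)] .
  note m = mems'[OF x(1) p(1)]
  have "W2 x q = Ms (- Y (Gs q) + DYs x) + DM (Xs (DGs q))"
    unfolding W2_def using bop_add[OF bMs csub_neg[OF q.B.KD m(3)] m(7)] bop_minus[OF bMs m(3)] by simp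
  then show ?thesis using U0_I'[OF p(1) x] x_def by simp
qed

lemma domW_full: "domW \<i> = N' \<i> \<longleftrightarrow> DYs ` L \<subseteq> ImY ` L" "domW (-\<i>) = N' (-\<i>) \<longleftrightarrow> DY ` L \<subseteq> ImYs ` L"
  unfolding domW_simps Domain_U0 Range_U0 by (rule P.full_iff Q.full_iff)+

section \<open>Regularity of the extension and surjectivity of I - Y\<close>

lemma proj_LL_bounded_below: "\<exists>c>0. \<forall>h\<in>LL. c * norm h \<le> norm (proj (N (-\<i>)) h)"
proof (rule bounded_below_if_closed_range[OF csub_subspace[OF LL] csub_closed[OF LL], where b=1])
  \<comment> \<open>The image is \<LL>_-i, which is closed because S is regular.\<close>
  show "closed (proj (N (-\<i>)) ` LL)" using csub_closed[OF Lm] by (simp add: L_sp_def)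
qed (auto simp: proj_add Nm scaleR_eq_scaleC proj_scaleC proj_norm_le LL_proj_inj[OF imag_unit_i(2)])

text \<open>If \<open>ran (I - Y) = \<LL>\<^sub>-\<^sub>i\<close>, every \<open>h \<in> \<LL>\<close> is the \<open>\<LL>\<close>-component of some
  \<open>k = \<phi> - U \<phi>\<close> with \<open>\<phi> \<in> \<LL>\<^sub>i\<close>, with bounds; pairing with \<open>k\<close> then controls the
  \<open>\<LL>\<close>-component of the extension by its \<open>H\<^sub>0\<close>-component.\<close>

lemma lift_LL:
  assumes full: "ImY ` L = L"
  shows "\<exists>C>0. \<forall>h\<in>LL. \<exists>\<phi>\<in>N \<i>. norm \<phi> \<le> C * norm h \<and> (\<phi> - U \<phi>) - h \<in> H0"
proof -
  obtain c where c: "c > 0" "\<And>h. h \<in> LL \<Longrightarrow> c * norm h \<le> norm (proj (N (-\<i>)) h)"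
    using proj_LL_bounded_below by blast
  obtain d where d: "d > 0" "\<And>x. x \<in> L \<Longrightarrow> d * norm x \<le> norm (ImY x)"
    using q.full_bounded_below[OF full] by blast
  have "\<exists>\<phi>\<in>N \<i>. norm \<phi> \<le> (1 / (d * c)) * norm h \<and> (\<phi> - U \<phi>) - h \<in> H0" if h: "h \<in> LL" for h
  proof -
    have psc: "proj (N (-\<i>)) (c *\<^sub>R x) = c *\<^sub>R proj (N (-\<i>)) x" for c x
      by (simp add: scaleR_eq_scaleC proj_scaleC[OF Nm])
    \<comment> \<open>w represents the functional k \<mapsto> (h, k) of \<LL> through the
      projections of k in \<LL>_-i.\<close>
    have "\<exists>w\<in>closure (proj (N (-\<i>)) ` LL). \<forall>k\<in>LL. inner h k = inner (proj (N (-\<i>)) k) w"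
    proof (rule riesz_general[OF csub_subspace[OF LL], where b="norm h / c"])
      fix k assume k: "k \<in> LL"
      have "norm k \<le> norm (proj (N (-\<i>)) k) / c" using c(2)[OF k] c(1) by (simp add: pos_le_divide_eq mult.commute)
      then have "norm h * norm k \<le> norm h * (norm (proj (N (-\<i>)) k) / c)" by (rule mult_left_mono) simp
      then show "\<bar>inner h k\<bar> \<le> norm h / c * norm (proj (N (-\<i>)) k)"
        using Cauchy_Schwarz_ineq2[of h k] by simp
    qed (simp_all add: proj_add[OF Nm] psc inner_simps)
    then obtain w where w: "w \<in> L" "\<And>k. k \<in> LL \<Longrightarrow> Re (cinner h k) = Re (cinner (proj (N (-\<i>)) k) w)"
      using csub_closed[OF Lm] by (auto simp: L_sp_def inner_eq_Re_cinner)
    have wc: "cinner w (proj (N (-\<i>)) k) = cinner h k" if k: "k \<in> LL" for k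
    proof -
      have 1: "Re (cinner w (proj (N (-\<i>)) k)) = Re (cinner h k)" if k: "k \<in> LL" for k
        using w(2)[OF k] by (metis cinner_commute complex_cnj(1) cnj.simps(1))
      show ?thesis
        using 1[OF k] 1[OF csub_scaleC[OF LL k, of \<i>]]
        by (simp add: complex_eq_iff cinner_lin proj_scaleC[OF Nm])
    qed
    obtain k where k: "k \<in> LL" "w = proj (N (-\<i>)) k" using w(1) by (rule Lz_E)
    have "norm w * norm w = Re (cinner h k)"
      using wc[OF k(1)] k(2) norm_sq_cinner[of w] by (simp add: power2_eq_square)
    also have "\<dots> \<le> norm h * norm k" using cinner_CS[of h k] complex_Re_le_cmod order_trans by blast
    also have "\<dots> \<le> norm h * (norm w / c)"
      using c k by (intro mult_left_mono) (auto simp: pos_le_divide_eq mult.commute)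
    finally have wn: "norm w \<le> norm h / c" by (cases "w = 0") (use c(1) in \<open>simp_all add: field_simps\<close>)
    \<comment> \<open>With (I - Y) x = w the \<LL>_-i component of U \<phi> minus V_i \<phi> is - w
      for \<phi> = V_{-i} x, so \<phi> - U \<phi> has the same \<LL>-component as h.\<close>
    obtain x where x: "x \<in> L" "ImY x = w" using full w(1) by (metis imageE)
    define \<phi> where "\<phi> = Vm x"
    have l: "\<phi> \<in> Lz \<i>" unfolding \<phi>_def by (rule Vm_mem[OF x(1)])
    have p: "\<phi> \<in> N \<i>" by (rule Lz_N[OF imag_unit_i(1) l])
    have "norm \<phi> = norm x" unfolding \<phi>_def using V_isometry[OF imag_unit_i(2)] x(1) by (simp add: isometry_op_def)
    also have "\<dots> \<le> norm w / d" using d(2)[OF x(1)] x(2) d(1) by (simp add: pos_le_divide_eq mult.commute)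
    also have "\<dots> \<le> (norm h / c) / d" by (rule divide_right_mono[OF wn]) (use d(1) in simp)
    finally have n: "norm \<phi> \<le> (1 / (d * c)) * norm h" by (simp add: mult.commute)
    have pU: "proj L (U \<phi>) = Y x"
    proof -
      have "U1 x 0 = Y x" "U (Vm x) = U1 x 0 + U2 x 0"
        using U_block[OF x(1) csub_0[OF N'p]] bop_0[OF N'p bM] bop_0[OF Lm q.B.D_bop] by (simp_all add: U1_def)
      then show ?thesis using proj_split(1)[OF imag_unit_i(2) U12_mem[OF x(1) csub_0[OF N'p]]] by (simp add: \<phi>_def)
    qed
    have "cinner ((\<phi> - U \<phi>) - h) k = 0" if k: "k \<in> LL" for k
    proof -
      have "cinner (U \<phi> - \<phi>) k = cinner (proj L (U \<phi>) - V \<i> (proj (Lz \<i>) \<phi>)) (proj (N (-\<i>)) k)"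
        by (rule H0_diff_eq[OF imag_unit_i(1) p U_mem[OF p] k])
      also have "proj L (U \<phi>) - V \<i> (proj (Lz \<i>) \<phi>) = - w"
        using pU x VVm[OF x(1)] proj_id[OF Lp l] by (auto simp: \<phi>_def)
      finally have "cinner (U \<phi> - \<phi>) k = - cinner h k" by (simp add: wc[OF k])
      then show ?thesis unfolding cinner_diff_left by (simp add: algebra_simps)
    qed
    then have "(\<phi> - U \<phi>) - h \<in> H0" by (rule H0_I)
    then show ?thesis using p n by blast
  qed
  then show ?thesis using c(1) d(1) by (intro exI[of _ "1 / (d * c)"]) auto
qed

text \<open>The \<LL>-component of F' is bounded by |F| and the \<open>H0\<close>-component of F'.
  So convergence of the latter two along a sequence forces convergence of F', and the extension is
  closed, being self-adjoint.\<close>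

lemma regular_if_full:
  assumes full: "ImY ` L = L" shows "regular_extension S St"
proof -
  obtain C where C: "C > 0" "\<And>h. h \<in> LL \<Longrightarrow> \<exists>\<phi>\<in>N \<i>. norm \<phi> \<le> C * norm h \<and> (\<phi> - U \<phi>) - h \<in> H0"
    using lift_LL[OF full] by blast
  have LLd: "F' - proj H0 F' \<in> LL" for F'
    by (rule LL_I) (rule proj_orth[OF H0 Domain_H0])
  \<comment> \<open>2 C bounds |k| and |k'| relative to |h|; the 1 is for h in k - h.\<close>
  define K where "K = 2 * C + 1"
  have est: "norm (F' - proj H0 F') \<le> K * (norm F + norm (proj H0 F'))" if F: "(F, F') \<in> St" for F F'
  proof -
    define h where "h = F' - proj H0 F'"
    have h: "h \<in> LL" unfolding h_def by (rule LLd)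
    obtain \<phi> where p: "\<phi> \<in> N \<i>" "norm \<phi> \<le> C * norm h" "(\<phi> - U \<phi>) - h \<in> H0" using C(2)[OF h] by blast
    define k k' where "k = \<phi> - U \<phi>" and "k' = \<i> *\<^sub>C (\<phi> + U \<phi>)"
    have "(0 + (\<phi> - U \<phi>), 0 + \<i> *\<^sub>C (\<phi> + U \<phi>)) \<in> St" by (rule St_I[OF lop_0[OF lS] p(1)])
    then have k: "(k, k') \<in> St" by (simp add: k_def k'_def)
    have kn: "norm k \<le> 2 * C * norm h"
      using norm_triangle_ineq4[of \<phi> "U \<phi>"] U_norm[OF p(1)] p(2) unfolding k_def by linarith
    have kn': "norm k' \<le> 2 * C * norm h"
      using norm_triangle_ineq[of \<phi> "U \<phi>"] U_norm[OF p(1)] p(2) unfolding k'_def norm_scaleC by simp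
    \<comment> \<open>In (F', h) the vector h is replaced by k from the domain: symmetry turns (F',
      k) into (F, k'), and k - h \<in> \<open>H0\<close> sees only the projection of F'.\<close>
    have "cinner h h = cinner F' h - cinner (proj H0 F') h" by (simp add: h_def cinner_diff_left)
    also have "cinner (proj H0 F') h = 0" using LL_orth[OF h proj_mem[OF H0]] cinner_eq_sym by blast
    also have "cinner F' h = cinner F' k - cinner F' (k - h)" by (simp add: cinner_diff_right)
    also have "cinner F' k = cinner F k'" by (rule sym_cinner[OF St_sym F k])
    also have "cinner F' (k - h) = cinner (proj H0 F') (k - h)"
      using proj_cinner[OF H0 p(3), of F'] by (simp add: k_def)
    finally have "(norm h)\<^sup>2 = Re (cinner F k') - Re (cinner (proj H0 F') (k - h))"
      by (simp add: norm_sq_cinner)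
    also have "\<dots> \<le> norm F * norm k' + norm (proj H0 F') * norm (k - h)"
      using cinner_CS[of F k'] cinner_CS[of "proj H0 F'" "k - h"]
        complex_Re_le_cmod[of "cinner F k'"] abs_Re_le_cmod[of "cinner (proj H0 F') (k - h)"] by linarith
    also have "\<dots> \<le> norm F * (K * norm h) + norm (proj H0 F') * (K * norm h)"
    proof (intro add_mono mult_left_mono)
      show "norm k' \<le> K * norm h" using kn' norm_ge_zero[of h] unfolding K_def distrib_right by linarith
      show "norm (k - h) \<le> K * norm h"
        using norm_triangle_ineq4[of k h] kn unfolding K_def distrib_right by linarith
    qed auto
    finally have "norm h * norm h \<le> (K * (norm F + norm (proj H0 F'))) * norm h"
      by (simp add: power2_eq_square algebra_simps)
    then have "norm h \<le> K * (norm F + norm (proj H0 F')) \<or> h = 0" by auto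
    moreover have "0 \<le> K * (norm F + norm (proj H0 F'))" using C(1) by (simp add: K_def)
    ultimately show ?thesis unfolding h_def[symmetric] by auto
  qed
  have clSt: "closed St"
    using adjoint_closed[OF csub_UNIV, of St] St_selfadjoint by (simp add: selfadjoint_in_def)
  show ?thesis
    unfolding regular_extension_def closed_sequential_limits
  proof (intro allI impI)
    fix w l assume w: "(\<forall>n. w n \<in> proj_operator H0 St) \<and> w \<longlonglongrightarrow> l"
    then have "\<forall>n. \<exists>F F'. (F, F') \<in> St \<and> w n = (F, proj H0 F')" unfolding proj_operator_def by blast
    then obtain F F' where F: "\<And>n. (F n, F' n) \<in> St" "\<And>n. w n = (F n, proj H0 (F' n))" by metis
    have wF: "w = (\<lambda>n. (F n, proj H0 (F' n)))" using F(2) by (rule ext)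
    have lF: "F \<longlonglongrightarrow> fst l" "(\<lambda>n. proj H0 (F' n)) \<longlonglongrightarrow> snd l"
      using tendsto_fst[of w l] tendsto_snd[of w l] w unfolding wF by simp_all
    define h where "h n = F' n - proj H0 (F' n)" for n
    have d: "dist (h i) (h j) \<le> K * (dist (F i) (F j) + dist (proj H0 (F' i)) (proj H0 (F' j)))" for i j
      using est[OF lop_diff[OF St_linear F(1)[of i] F(1)[of j]]]
      by (simp add: h_def dist_norm proj_diff[OF H0] algebra_simps)
    have K: "K > 0" using C(1) by (simp add: K_def)
    have "Cauchy h"
    proof (rule metric_CauchyI)
      fix e :: real assume e: "e > 0"
      define e' where "e' = e / (2 * K)"
      have e': "e' > 0" using e K by (simp add: e'_def)
      obtain A where A: "\<And>i j. i \<ge> A \<Longrightarrow> j \<ge> A \<Longrightarrow> dist (F i) (F j) < e'"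
        using metric_CauchyD[OF LIMSEQ_imp_Cauchy[OF lF(1)] e'] by blast
      obtain B where B: "\<And>i j. i \<ge> B \<Longrightarrow> j \<ge> B \<Longrightarrow> dist (proj H0 (F' i)) (proj H0 (F' j)) < e'"
        using metric_CauchyD[OF LIMSEQ_imp_Cauchy[OF lF(2)] e'] by blast
      have "dist (h i) (h j) < e" if "i \<ge> max A B" "j \<ge> max A B" for i j
      proof -
        have "dist (F i) (F j) + dist (proj H0 (F' i)) (proj H0 (F' j)) < 2 * e'"
          using A[of i j] B[of i j] that by simp
        then have "K * (dist (F i) (F j) + dist (proj H0 (F' i)) (proj H0 (F' j))) < K * (2 * e')"
          using K by simp
        also have "K * (2 * e') = e" using K by (simp add: e'_def)
        finally show ?thesis using d[of i j] by linarith
      qed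
      then show "\<exists>M. \<forall>i\<ge>M. \<forall>j\<ge>M. dist (h i) (h j) < e" by blast
    qed
    then obtain k where "h \<longlonglongrightarrow> k" using Cauchy_convergent_iff convergent_def by blast
    then have "(\<lambda>n. h n + proj H0 (F' n)) \<longlonglongrightarrow> k + snd l" by (intro tendsto_add lF(2))
    then have F'l: "F' \<longlonglongrightarrow> k + snd l" by (simp add: h_def)
    have "(fst l, k + snd l) \<in> St" by (rule closed_sequentially[OF clSt F(1) tendsto_Pair[OF lF(1) F'l]])
    moreover have "snd l = proj H0 (k + snd l)"
      using LIMSEQ_unique[OF lF(2) bounded_linear.tendsto[OF bounded_linear_proj[OF H0] F'l]] .
    ultimately show "l \<in> proj_operator H0 St" unfolding proj_operator_def by (metis (mono_tags, lifting) mem_Collect_eq prod.collapse)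
  qed
qed

text \<open>Closedness of the projected graph bounds it from below, and with self-adjointness every
  h \<in> \<LL> becomes the \<LL>-component of a vector in the domain. Read in \<LL>_-i, this says
  that ran (I - Y) and the range of \<open>DYs\<close> together span it, i.e. that R is
  onto.\<close>

lemma full_if_regular:
  assumes reg: "regular_extension S St" shows "ImY ` L = L"
proof -
  have clSt: "closed St"
    using adjoint_closed[OF csub_UNIV, of St] St_selfadjoint by (simp add: selfadjoint_in_def)
  have sSt: "subspace St"
    unfolding subspace_def
  proof (intro conjI ballI allI)
    show "0 \<in> St" using lop_0[OF St_linear] by (simp add: zero_prod_def)
    show "x + y \<in> St" if "x \<in> St" "y \<in> St" for x y
      using lop_add[OF St_linear, of "fst x" "snd x" "fst y" "snd y"] that by (simp add: plus_prod_def)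
    show "c *\<^sub>R x \<in> St" if "x \<in> St" for c x
      using lop_scaleC[OF St_linear, of "fst x" "snd x" "of_real c"] that by (simp add: scaleR_prod_def scaleR_eq_scaleC)
  qed
  define T where "T z = (fst z, proj H0 (snd z))" for z :: "'a \<times> 'a"
  have Tim: "T ` St = proj_operator H0 St" unfolding proj_operator_def T_def by force
  have clT: "closed (T ` St)" using reg unfolding Tim regular_extension_def .
  have Tadd: "T (x + y) = T x + T y" for x y by (simp add: T_def proj_add[OF H0])
  have Tsc: "T (c *\<^sub>R x) = c *\<^sub>R T x" for c x by (simp add: T_def scaleR_eq_scaleC proj_scaleC[OF H0])
  have Tn: "norm (T x) \<le> 1 * norm x" for x
    unfolding T_def norm_Pair norm_prod_def using proj_norm_le[OF H0] by (simp add: power_mono)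
  have Tinj: "x = 0" if x: "x \<in> St" "T x = 0" for x
  proof -
    have "fst x = 0" using x(2) by (simp add: T_def zero_prod_def)
    moreover from this have "snd x = 0"
      using lop_unique[OF St_linear _ lop_0[OF St_linear], of "snd x"] x(1) by (metis prod.collapse)
    ultimately show ?thesis by (simp add: prod_eq_iff)
  qed
  have "\<exists>c>0. \<forall>x\<in>St. c * norm x \<le> norm (T x)"
    by (rule bounded_below_if_closed_range[OF sSt clSt Tadd Tsc Tn Tinj clT])
  then obtain c where c: "c > 0" "\<And>x. x \<in> St \<Longrightarrow> c * norm x \<le> norm (T x)" by blast
  have lift: "\<exists>m. m \<in> Domain St \<and> m - h \<in> H0" if h: "h \<in> LL" for h
  proof -
    have "\<exists>w\<in>closure (T ` St). \<forall>z\<in>St. inner (snd z) h = inner (T z) w"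
    proof (rule riesz_general[OF sSt, where b="norm h / c"])
      fix z assume z: "z \<in> St"
      have "\<bar>inner (snd z) h\<bar> \<le> norm (snd z) * norm h" by (rule Cauchy_Schwarz_ineq2)
      also have "\<dots> \<le> norm z * norm h" by (intro mult_right_mono) (auto simp: norm_prod_def)
      also have "\<dots> \<le> (norm (T z) / c) * norm h"
        using c(2)[OF z] c(1) by (intro mult_right_mono) (auto simp: pos_le_divide_eq mult.commute)
      finally show "\<bar>inner (snd z) h\<bar> \<le> norm h / c * norm (T z)" by (simp add: mult.commute)
    qed (simp_all add: Tadd Tsc inner_simps)
    then obtain w where w: "w \<in> T ` St" "\<And>z. z \<in> St \<Longrightarrow> inner (snd z) h = inner (T z) w"
      unfolding closure_closed[OF clT] by blast
    then obtain k k' where k: "(k, k') \<in> St" "w = (k, proj H0 k')" unfolding T_def by auto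
    \<comment> \<open>The Riesz identity will say that (m, k) belongs to the adjoint graph, which is
      the graph of the extension itself.\<close>
    define m where "m = h - proj H0 k'"
    have re: "Re (cinner F' m) = Re (cinner F k)" if F: "(F, F') \<in> St" for F F'
    proof -
      have "inner F' h = inner F k + inner (proj H0 F') (proj H0 k')" using w(2)[OF F] k(2) by (simp add: T_def)
      moreover have "cinner (proj H0 F') (proj H0 k') = cinner F' (proj H0 k')"
        by (rule proj_cinner[OF H0 proj_mem[OF H0]])
      ultimately show ?thesis by (simp add: m_def inner_eq_Re_cinner cinner_diff_right)
    qed
    have "cinner F' m = cinner F k" if F: "(F, F') \<in> St" for F F'
      using re[OF F] re[OF lop_scaleC[OF St_linear F, of \<i>]] by (simp add: complex_eq_iff cinner_lin)
    then have "(m, k) \<in> adjoint_in UNIV St" unfolding adjoint_in_def by blast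
    then have "(m, k) \<in> St" using St_selfadjoint by (simp add: selfadjoint_in_def)
    moreover have "m - h \<in> H0" using csub_neg[OF H0 proj_mem[OF H0, of k']] by (simp add: m_def)
    ultimately show ?thesis by blast
  qed
  have "q.R ` L = L"
  proof
    show "q.R ` L \<subseteq> L" using bop_mem[OF q.R_bop] by blast
    show "L \<subseteq> q.R ` L"
    proof
      fix y assume y: "y \<in> L"
      define h where "h = proj LL y"
      have h: "h \<in> LL" unfolding h_def by (rule proj_mem[OF LL])
      obtain m m' where m: "(m, m') \<in> St" "m - h \<in> H0" using lift[OF h] by blast
      obtain f f' \<phi> where o: "(f, f') \<in> S" "\<phi> \<in> N \<i>" "m = f + (\<phi> - U \<phi>)" using m(1) by (rule St_E)
      define x p where "x = V \<i> (proj (Lz \<i>) \<phi>)" and "p = \<phi> - proj (Lz \<i>) \<phi>"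
      have pl: "proj (Lz \<i>) \<phi> \<in> Lz \<i>" by (rule proj_mem[OF Lp])
      have x: "x \<in> L" unfolding x_def by (rule V_mem[OF pl])
      have p: "p \<in> N' \<i>" unfolding p_def by (rule N_split[OF imag_unit_i(1) o(2)])
      have vz: "\<phi> = Vm x + p" unfolding x_def VmV[OF pl] p_def by simp
      \<comment> \<open>The vector that represents \<phi> - U \<phi> on \<LL> according to
        \<open>H0_diff_eq\<close>, written in the form required by \<open>R_range\<close>.\<close>
      define z where "z = ImY x + DYs (- M p)"
      note mm = mems[OF x p]
      have mp: "- M p \<in> L" by (rule csub_neg[OF Lm mm(2)])
      have zR: "z \<in> q.R ` L" unfolding q.R_range z_def using x mp by blast
      have zL: "z \<in> L" using zR bop_mem[OF q.R_bop] by blast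
      have "proj L (U \<phi>) = U1 x p"
        using proj_split(1)[OF imag_unit_i(2) U12_mem[OF x p]] U_block[OF x p] vz by simp
      then have pz: "proj L (U \<phi>) - V \<i> (proj (Lz \<i>) \<phi>) = - z"
        unfolding z_def U1_def x_def[symmetric] by (simp add: bop_minus[OF q.B.D_bop mm(2)])
      have "cinner (z - y) t = 0" if t: "t \<in> L" for t
      proof -
        obtain k where k: "k \<in> LL" "t = proj (N (-\<i>)) k" using t by (rule Lz_E)
        have "cinner z t = - cinner (U \<phi> - \<phi>) k"
          using H0_diff_eq[OF imag_unit_i(1) o(2) U_mem[OF o(2)] k(1)] pz k(2) by simp
        also have "\<dots> = cinner (m - f) k" by (simp add: o(3) cinner_lin)
        also have "\<dots> = cinner m k"
          using LL_orth[OF k(1) Domain_H0[OF o(1)]] cinner_eq_sym[of f k] by (simp add: cinner_diff_left)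
        also have "\<dots> = cinner h k"
          using LL_orth[OF k(1) m(2)] cinner_eq_sym[of "m - h" k] by (simp add: cinner_diff_left)
        also have "\<dots> = cinner y k" unfolding h_def by (rule proj_cinner[OF LL k(1)])
        also have "\<dots> = cinner y t"
          unfolding k(2) by (rule proj_cinner'[OF Nm Lz_N[OF imag_unit_i(2) y], symmetric])
        finally show ?thesis by (simp add: cinner_diff_left)
      qed
      from this[OF csub_diff[OF Lm zL y]] have "z = y" by simp
      then show "y \<in> q.R ` L" using zR by simp
    qed
  qed
  then show ?thesis by (rule q.full_if_R_full)
qed

lemma regular_iff: "regular_extension S St \<longleftrightarrow> ImY ` L = L"
  using regular_if_full full_if_regular by blast

text \<open>Surjectivity passes to the adjoint of I - Y, and then both range inclusions are
  trivial.\<close>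

lemma full_selfadjoint: assumes f: "ImY ` L = L" shows "selfadjoint_in H0 St0"
proof -
  have "DYs ` L \<subseteq> ImY ` L" by (rule q.R_full_if_full[OF f])
  moreover have "DY ` L \<subseteq> ImYs ` L" unfolding q.full_dual[OF f] using q.A.D_mem by blast
  ultimately show ?thesis unfolding St0_selfadjoint_iff domW_full by blast
qed

section \<open>Deficiency spaces and the minimal, maximal and self-adjoint cases\<close>

lemma deficiency_forms:
  "deficiency_sp H0 St0 \<i> = N' \<i> \<ominus> {\<phi> \<in> N' \<i>. M \<phi> \<in> inv_into KYs DYs ` (ImY ` L \<inter> DYs ` L)}"
  "deficiency_sp H0 St0 (-\<i>) = N' (-\<i>) \<ominus> {\<phi> \<in> N' (-\<i>). Gs \<phi> \<in> inv_into KY DY ` (ImYs ` L \<inter> DY ` L)}"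
proof -
  have "domW \<i> = {\<phi> \<in> N' \<i>. M \<phi> \<in> inv_into KYs DYs ` (ImY ` L \<inter> DYs ` L)}"
    unfolding domW_simps Domain_U0 using P.pinv_iff by blast
  then show "deficiency_sp H0 St0 \<i> = N' \<i> \<ominus> {\<phi> \<in> N' \<i>. M \<phi> \<in> inv_into KYs DYs ` (ImY ` L \<inter> DYs ` L)}"
    using deficiency_St0[OF imag_unit_i(1)] by simp
  have "domW (-\<i>) = {\<phi> \<in> N' (-\<i>). Gs \<phi> \<in> inv_into KY DY ` (ImYs ` L \<inter> DY ` L)}"
    unfolding domW_simps Range_U0 using Q.pinv_iff by blast
  then show "deficiency_sp H0 St0 (-\<i>) = N' (-\<i>) \<ominus> {\<phi> \<in> N' (-\<i>). Gs \<phi> \<in> inv_into KY DY ` (ImYs ` L \<inter> DY ` L)}"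
    using deficiency_St0[OF imag_unit_i(2)] by simp
qed

lemma compression_minimal_iff:
  "St0 = S0 \<longleftrightarrow> {\<phi> \<in> N' \<i>. M \<phi> = 0} = {0} \<and> ImY ` L \<inter> DYs ` L = {0}"
  "St0 = S0 \<longleftrightarrow> {\<phi> \<in> N' (-\<i>). Gs \<phi> = 0} = {0} \<and> ImYs ` L \<inter> DY ` L = {0}"
proof -
  show "St0 = S0 \<longleftrightarrow> {\<phi> \<in> N' \<i>. M \<phi> = 0} = {0} \<and> ImY ` L \<inter> DYs ` L = {0}"
    unfolding St0_eq_S0_iff[OF imag_unit_i(1)] domW_simps Domain_U0 by (rule P.zero_iff)
  show "St0 = S0 \<longleftrightarrow> {\<phi> \<in> N' (-\<i>). Gs \<phi> = 0} = {0} \<and> ImYs ` L \<inter> DY ` L = {0}"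
    unfolding St0_eq_S0_iff[OF imag_unit_i(2)] domW_simps Range_U0 by (rule Q.zero_iff)
qed

lemma maximal_plus:
  "maximal_symmetric_in H0 St0 \<and> hdim (deficiency_sp H0 St0 \<i>) = 0 \<and> hdim (deficiency_sp H0 St0 (-\<i>)) > 0
    \<longleftrightarrow> DYs ` L \<subseteq> ImY ` L \<and> \<not> DY ` L \<subseteq> ImYs ` L"
  unfolding maximal_iff[OF imag_unit_i(1)] domW_full ..

lemma maximal_minus:
  "maximal_symmetric_in H0 St0 \<and> hdim (deficiency_sp H0 St0 \<i>) > 0 \<and> hdim (deficiency_sp H0 St0 (-\<i>)) = 0
    \<longleftrightarrow> DY ` L \<subseteq> ImYs ` L \<and> \<not> DYs ` L \<subseteq> ImY ` L"
  using maximal_iff[OF imag_unit_i(2)] unfolding minus_minus domW_full by blast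

lemma kernel_equalities:
  "U ` {\<phi> \<in> N \<i>. U \<phi> - \<phi> \<in> H0} = kerPi"
  "csubspace {\<phi> \<in> N \<i>. U \<phi> - \<phi> \<in> H0}" "closed {\<phi> \<in> N \<i>. U \<phi> - \<phi> \<in> H0}"
  "csubspace (U ` {\<phi> \<in> N \<i>. U \<phi> - \<phi> \<in> H0})" "closed (U ` {\<phi> \<in> N \<i>. U \<phi> - \<phi> \<in> H0})"
  using U_Nt Nt_kerPi Nt_csub U_Nt_csub by (simp_all add: csub_def)

lemma U0_parts:
  "Domain U0 \<subseteq> N' \<i>" "Range U0 \<subseteq> N' (-\<i>)"
  "is_direct_sum (Domain St0) (Domain S0) {\<phi> - \<phi>' | \<phi> \<phi>'. (\<phi>, \<phi>') \<in> U0}"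
  "is_direct_sum (Domain St0) (Domain S) {\<phi> - \<phi>' | \<phi> \<phi>'. (\<phi>, \<phi>') \<in> U0\<inverse>}"
  "Domain (U0\<inverse>) = {\<phi> \<in> N' (-\<i>). DY (Gs \<phi>) \<in> ImYs ` L \<inter> DY ` L}"
  "\<forall>\<phi>\<in>Domain U0. (\<phi>, G (- Ys (M \<phi>) + DY (inv_into L ImY (DYs (M \<phi>)))) + DGs (X (DM \<phi>))) \<in> U0"
  "\<forall>\<phi>\<in>Domain (U0\<inverse>). (\<phi>, Ms (- Y (Gs \<phi>) + DYs (inv_into L ImYs (DY (Gs \<phi>)))) + DM (Xs (DGs \<phi>))) \<in> U0\<inverse>"
proof -
  show "Domain U0 \<subseteq> N' \<i>" "Range U0 \<subseteq> N' (-\<i>)" using U0_mem by blast+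
  show "is_direct_sum (Domain St0) (Domain S0) {\<phi> - \<phi>' | \<phi> \<phi>'. (\<phi>, \<phi>') \<in> U0}"
    unfolding S0_Domain by (rule St0_direct)
  show "is_direct_sum (Domain St0) (Domain S) {\<phi> - \<phi>' | \<phi> \<phi>'. (\<phi>, \<phi>') \<in> U0\<inverse>}"
    unfolding U0_converse_diff by (rule St0_direct)
  show "Domain (U0\<inverse>) = {\<phi> \<in> N' (-\<i>). DY (Gs \<phi>) \<in> ImYs ` L \<inter> DY ` L}"
    unfolding Domain_converse by (rule Range_U0)
  show "\<forall>\<phi>\<in>Domain U0. (\<phi>, G (- Ys (M \<phi>) + DY (inv_into L ImY (DYs (M \<phi>)))) + DGs (X (DM \<phi>))) \<in> U0"
    by (intro ballI U0_formula)
  show "\<forall>\<phi>\<in>Domain (U0\<inverse>). (\<phi>, Ms (- Y (Gs \<phi>) + DYs (inv_into L ImYs (DY (Gs \<phi>)))) + DM (Xs (DGs \<phi>))) \<in> U0\<inverse>"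
    unfolding Domain_converse converse_iff by (intro ballI U0_formula')
qed

lemma maximal_parts:
  "maximal_symmetric_in H0 St0 \<and> hdim (deficiency_sp H0 St0 \<i>) = 0 \<and> hdim (deficiency_sp H0 St0 (-\<i>)) > 0
    \<longleftrightarrow> ImY ` L = q.R ` L \<and> ImYs ` L \<noteq> q.R ` L"
  "isometry_op L L Ys \<and> \<not> unitary_op L L Y \<longrightarrow> maximal_symmetric_in H0 St0 \<and>
    hdim (deficiency_sp H0 St0 \<i>) = 0 \<and> hdim (deficiency_sp H0 St0 (-\<i>)) > 0"
  "maximal_symmetric_in H0 St0 \<and> hdim (deficiency_sp H0 St0 \<i>) > 0 \<and> hdim (deficiency_sp H0 St0 (-\<i>)) = 0
    \<longleftrightarrow> ImYs ` L = q.R ` L \<and> ImY ` L \<noteq> q.R ` L"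
  "isometry_op L L Y \<and> \<not> unitary_op L L Y \<longrightarrow> maximal_symmetric_in H0 St0 \<and>
    hdim (deficiency_sp H0 St0 \<i>) > 0 \<and> hdim (deficiency_sp H0 St0 (-\<i>)) = 0"
  unfolding maximal_plus maximal_minus q.ran_eq_iff q.ran_eq_iff'
  using q.coisometry_range q.coisometry_not_range q.isometry_range q.isometry_not_range by blast+

lemma selfadjoint_parts:
  "selfadjoint_in H0 St0 \<longleftrightarrow> DYs ` L \<subseteq> ImY ` L \<and> DY ` L \<subseteq> ImYs ` L"
  "selfadjoint_in H0 St0 \<longleftrightarrow> ImYs ` L = ImY ` L \<and> ImY ` L = q.R ` L"
  "regular_extension S St \<longrightarrow> selfadjoint_in H0 St0"
  "unitary_op L L Y \<longrightarrow> selfadjoint_in H0 St0"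
proof -
  show 1: "selfadjoint_in H0 St0 \<longleftrightarrow> DYs ` L \<subseteq> ImY ` L \<and> DY ` L \<subseteq> ImYs ` L"
    unfolding St0_selfadjoint_iff domW_full ..
  show "selfadjoint_in H0 St0 \<longleftrightarrow> ImYs ` L = ImY ` L \<and> ImY ` L = q.R ` L"
    unfolding 1 using q.ran_eq_iff q.ran_eq_iff' by argo
  show "regular_extension S St \<longrightarrow> selfadjoint_in H0 St0" unfolding regular_iff using full_selfadjoint by blast
  show "unitary_op L L Y \<longrightarrow> selfadjoint_in H0 St0" 
    unfolding 1 using q.isometry_range q.coisometry_range adj_unitary[OF Lm Lm]
    by (auto simp: unitary_op_def)
qed

end

theorem theorem6p2:
  fixes S :: "('a::complex_hilbert_space \<times> 'a) set" and U :: "'a \<Rightarrow> 'a"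
  assumes "separable_space (euclidean :: 'a topology)"
    and "hdim (UNIV :: 'a set) = \<infinity>"
    and "symmetric_operator S" and "closed S"
    and "dom_closure S \<noteq> UNIV"
    and "hdim (dom_orth S) = \<infinity>"
    and "hdim (N'_sp S \<i>) \<noteq> 0" and "hdim (N'_sp S (-\<i>)) \<noteq> 0"
    and "regular_extension S S"
    and "unitary_op (N_sp S \<i>) (N_sp S (-\<i>)) U"
    and "\<forall>f \<in> L_sp S \<i> - {0}. U f - V_op S \<i> f \<noteq> 0"
  shows "(\<exists>Y M G X. block_representation S U Y M G X) \<and>
    (\<forall>Y M G X. block_representation S U Y M G X \<longrightarrow>
      (let
         H0 = dom_closure S;
         N\<^sub>i = N_sp S \<i>; N\<^sub>m = N_sp S (-\<i>);
         L\<^sub>i = L_sp S \<i>; L = L_sp S (-\<i>);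
         N'\<^sub>i = N'_sp S \<i>; N'\<^sub>m = N'_sp S (-\<i>);
         V\<^sub>i = V_op S \<i>; V\<^sub>m = V_op S (-\<i>);
         Ui = inv_into N\<^sub>i U;
         Ys = adj L L Y;
         DY = defect_op L L Y; KY = defect_sp L L Y;
         DYs = defect_op L L Ys; KYs = defect_sp L L Ys;
         Ms = adj N'\<^sub>i KYs M; Gs = adj KY N'\<^sub>m G;
         DM = defect_op N'\<^sub>i KYs M; KM = defect_sp N'\<^sub>i KYs M;
         DGs = defect_op N'\<^sub>m KY Gs; KGs = defect_sp N'\<^sub>m KY Gs;
         Xs = adj KM KGs X;
         pinvDY = inv_into KY DY; pinvDYs = inv_into KYs DYs;
         ImY = (\<lambda>x. x - Y x); ImYs = (\<lambda>x. x - Ys x);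
         invImY = inv_into L ImY; invImYs = inv_into L ImYs;
         ranR = sqrt_op L (\<lambda>x. x - (1/2) *\<^sub>R (Y x + Ys x)) ` L;
         \<Omega> = ImY ` L \<inter> DYs ` L;
         \<Omega>s = ImYs ` L \<inter> DY ` L;
         St = vN_extension S U;
         S0 = proj_operator H0 S;
         St0 = compression H0 St;
         Nt\<^sub>i = {\<phi> \<in> N\<^sub>i. U \<phi> - \<phi> \<in> H0};
         kerP = {\<phi> \<in> N\<^sub>i. proj L (U \<phi>) - V\<^sub>i (proj L\<^sub>i \<phi>) = 0};
         kerPi = {\<phi> \<in> N\<^sub>m. proj L\<^sub>i (Ui \<phi>) - V\<^sub>m (proj L \<phi>) = 0};
         kerM = {\<phi> \<in> N'\<^sub>i. M \<phi> = 0};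
         kerGs = {\<phi> \<in> N'\<^sub>m. Gs \<phi> = 0};
         U0 = {(proj N'\<^sub>i \<phi>, proj N'\<^sub>m (U \<phi>)) | \<phi>. \<phi> \<in> kerP};
         n_plus = hdim (deficiency_sp H0 St0 \<i>);
         n_minus = hdim (deficiency_sp H0 St0 (-\<i>))
       in
         \<comment> \<open>the extension\<close>
         is_direct_sum (Domain St) (Domain S) ((\<lambda>\<phi>. \<phi> - U \<phi>) ` N\<^sub>i) \<and>
         S \<subseteq> St \<and> selfadjoint_in UNIV St \<and>
         \<comment> \<open>(1)\<close>
         complex_vector.subspace Nt\<^sub>i \<and> closed Nt\<^sub>i \<and>
         complex_vector.subspace (U ` Nt\<^sub>i) \<and> closed (U ` Nt\<^sub>i) \<and>
         U ` Nt\<^sub>i = {\<phi> \<in> N\<^sub>m. Ui \<phi> - \<phi> \<in> H0} \<and>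
         Nt\<^sub>i = kerP \<and>
         kerP = {V\<^sub>m (invImY h) + (\<psi> + Ms (pinvDYs h)) | h \<psi>. h \<in> \<Omega> \<and> \<psi> \<in> kerM} \<and>
         U ` Nt\<^sub>i = kerPi \<and>
         kerPi = {invImYs g + (\<psi> + G (pinvDY g)) | g \<psi>. g \<in> \<Omega>s \<and> \<psi> \<in> kerGs} \<and>
         \<comment> \<open>(2)\<close>
         isometric_operator U0 \<and> Domain U0 \<subseteq> N'\<^sub>i \<and> Range U0 \<subseteq> N'\<^sub>m \<and>
         is_direct_sum (Domain St0) (Domain S0) {\<phi> - \<phi>' | \<phi> \<phi>'. (\<phi>, \<phi>') \<in> U0} \<and>
         is_direct_sum (Domain St0) (Domain S) {\<phi> - \<phi>' | \<phi> \<phi>'. (\<phi>, \<phi>') \<in> U0\<inverse>} \<and>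
         Domain U0 = {\<phi> \<in> N'\<^sub>i. DYs (M \<phi>) \<in> \<Omega>} \<and>
         (\<forall>\<phi> \<in> Domain U0.
            (\<phi>, G (- Ys (M \<phi>) + DY (invImY (DYs (M \<phi>)))) + DGs (X (DM \<phi>))) \<in> U0) \<and>
         Domain (U0\<inverse>) = {\<phi> \<in> N'\<^sub>m. DY (Gs \<phi>) \<in> \<Omega>s} \<and>
         (\<forall>\<phi> \<in> Domain (U0\<inverse>).
            (\<phi>, Ms (- Y (Gs \<phi>) + DYs (invImYs (DY (Gs \<phi>)))) + DM (Xs (DGs \<phi>))) \<in> U0\<inverse>) \<and>
         \<comment> \<open>(3)\<close>
         deficiency_sp H0 St0 \<i> = N'\<^sub>i \<ominus> {\<phi> \<in> N'\<^sub>i. M \<phi> \<in> pinvDYs ` \<Omega>} \<and>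
         deficiency_sp H0 St0 (-\<i>) = N'\<^sub>m \<ominus> {\<phi> \<in> N'\<^sub>m. Gs \<phi> \<in> pinvDY ` \<Omega>s} \<and>
         \<comment> \<open>(I)\<close>
         (St0 = S0 \<longleftrightarrow> kerM = {0} \<and> \<Omega> = {0}) \<and>
         (St0 = S0 \<longleftrightarrow> kerGs = {0} \<and> \<Omega>s = {0}) \<and>
         \<comment> \<open>(II)\<close>
         (maximal_symmetric_in H0 St0 \<and> n_plus = 0 \<and> n_minus > 0 \<longleftrightarrow>
            ImY ` L = ranR \<and> ImYs ` L \<noteq> ranR) \<and>
         (isometry_op L L Ys \<and> \<not> unitary_op L L Y \<longrightarrow>
            maximal_symmetric_in H0 St0 \<and> n_plus = 0 \<and> n_minus > 0) \<and>
         \<comment> \<open>(III)\<close>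
         (maximal_symmetric_in H0 St0 \<and> n_plus > 0 \<and> n_minus = 0 \<longleftrightarrow>
            ImYs ` L = ranR \<and> ImY ` L \<noteq> ranR) \<and>
         (isometry_op L L Y \<and> \<not> unitary_op L L Y \<longrightarrow>
            maximal_symmetric_in H0 St0 \<and> n_plus > 0 \<and> n_minus = 0) \<and>
         \<comment> \<open>(IV)\<close>
         (hdim N'\<^sub>i = hdim N'\<^sub>m \<longrightarrow>
            (selfadjoint_in H0 St0 \<longleftrightarrow> DYs ` L \<subseteq> ImY ` L \<and> DY ` L \<subseteq> ImYs ` L) \<and>
            (selfadjoint_in H0 St0 \<longleftrightarrow> ImYs ` L = ImY ` L \<and> ImY ` L = ranR)) \<and>
         (regular_extension S St \<longleftrightarrow> ImY ` L = L) \<and>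
         (regular_extension S St \<longrightarrow> selfadjoint_in H0 St0) \<and>
         (unitary_op L L Y \<longrightarrow> selfadjoint_in H0 St0)))"
proof -
  interpret e: vN_ext S U by unfold_locales (rule assms(3,4,9,10,11))+
  show ?thesis
  proof (rule conjI[OF e.ex_block_representation], (rule allI)+, rule impI, goal_cases)
    case (1 Y M G X)
    then interpret b: block S U Y M G X by unfold_locales
    show ?case
      unfolding Let_def e.U0_def[symmetric]
      by (intro conjI impI[of "hdim _ = hdim _"])
        (rule e.St_direct e.S_St e.St_selfadjoint b.kernel_equalities e.U_Nt e.Nt_kerP b.kerP_form
          b.kerPi_form e.U0_isometric b.U0_parts b.Domain_U0 b.deficiency_forms
          b.compression_minimal_iff b.maximal_parts b.selfadjoint_parts b.regular_iff)+
  qed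
qed

end
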